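(* Let $(\Omega,\mathcal F,\mathbf P)$, $\mathcal M$, $\boldsymbol\xi$, $U$, $(\Phi_{s,t})$, $r$, $E$, $\tau$ and $(A_t^{(s)})$ be an abstract flow system, as defined in the context, and let $\mathfrak P$ be the Markov operator on $\bar U$ given by $\mathfrak P\Psi(u)=\mathbf E\,\Psi(\Phi(u,\boldsymbol\xi(\omega)))$ for bounded measurable $\Psi:\bar U\to\mathbf R$. Then $\mathfrak P$ satisfies the strong Feller property, i.e. $\mathfrak P\Psi:\bar U\to\mathbf R$ is continuous for every bounded measurable $\Psi:\bar U\to\mathbf R$.
   Context: **Probability space.** $\Omega$ is a separable Banach space carrying a Gaussian measure $\mathbf P$ whose Cameron–Martin space is $\mathcal H=L^2(\mathbf R,H_0)\subset\Omega$ for some Hilbert space $H_0$. For $h\in\mathcal H$, $h^*$ denotes the associated measurable linear functional on $\Omega$. Set $\mathcal F_{s,t}=\sigma\{h^*(\omega): h\in L^2([s,t],H_0)\}$ and $\mathcal F_t=\mathcal F_{-\infty,t}$. $\mathcal M$ is a complete separable metric space and $\boldsymbol\xi:\Omega\to\mathcal M$ is a random variable; $\xi$ denotes a generic element of $\mathcal M$. For a measurable map $X$ on $\Omega$ and $h\in\mathcal H$, $X(\omega+h)$ is the random variable obtained by composing $X$ with the shift $\omega\mapsto\omega+h$; it is well defined up to null sets and satisfies $\mathbf E F(X(\omega+h))=\mathbf E F(X(\omega))\exp(h^*(\omega)-\|h\|_{\mathcal H}^2/2)$ for bounded measurable $F$. **Flow.** $U$ is a separable Banach space and $\bar U=U\cup\{\dagger\}$,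 where $\dagger$ is a "death state"; $\bar U$ is metrized by the norm distance on $U$ and $d(\dagger,u)^2=1+\|u\|^2$. For $0\le s\le t\le1$ we are given $\Phi_{s,t}:\bar U\times\mathcal M\to\bar U$ with $\Phi_{t,r}(\Phi_{s,t}(u,\xi),\xi)=\Phi_{s,r}(u,\xi)$ for $s\le t\le r$ and $\Phi_{s,t}(\dagger,\xi)=\dagger$. Write $\Phi_t=\Phi_{0,t}$, $\Phi=\Phi_{0,1}$, $\mathcal N_t=\{(u,\xi)\in U\times\mathcal M:\Phi_t(u,\xi)\ne\dagger\}$, $\mathcal N=\mathcal N_1$. **Shift space.** $E=L^p([0,1],X_0)\subset\mathcal H$, where $X_0$ is a separable Banach space continuously included in $H_0$ and $p\in(2,\infty)$ is fixed. $E_s=L^p([0,s],X_0)$ for $s\in(0,1]$, viewed as a subspace of $E$ by extension by $0$. "Locally Lipschitz" means that each point of the domain has a neighbourhood on which the map is Lipschitz. **Abstract flow system.** The data form an abstract flow system if the following five conditions hold. (Continuity) The preimage of $U$ under $(s,t,u,\xi)\mapsto\Phi_{s,t}(u,\xi)$ is open and this map is jointly continuous on that preimage. Furthermore it is Fréchet differentiable in $u$ at every point of the preimage. The Fréchet derivative of $\Phi_t$ in direction $v\in U$ is $D\Phi_t(u,\xi)v$, defined on $\mathcal N_t$. (Explosion) We are given a lower semicontinuous map $r:[0,1]\times U\times\mathcal M\to[0,\infty]$ such that: (a) for all $u\in U$, $t\in[0,1]$, $\omega\mapsto r_t(u,\boldsymbol\xi(\omega))$ is $\mathcal F_t$-measurable;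 (b) for every $(u,\xi)\in U\times\mathcal M$, $r_0(u,\xi)<\infty$ and $t\mapsto r_t(u,\xi)$ is continuous and increasing; (c) $\{(u,\xi):\Phi_t(u,\xi)=\dagger\}=\{(u,\xi):r_t(u,\xi)=\infty\}$; (d) for every $t\in(0,1]$, $r_t$ is locally Lipschitz continuous on $\mathcal N_t$. (Action) We are given a continuous action $\tau:E\times\mathcal M\to\mathcal M$ such that for every $\xi$ the map $h\mapsto\tau(h,\xi)$ is locally Lipschitz and such that, for every $h\in E$, $\boldsymbol\xi(\omega+h)=\tau(h,\boldsymbol\xi(\omega))$ $\mathbf P$-almost surely. Furthermore, if $h(r)=0$ for $r\in[s,t]$, then $\Phi_{s,t}(u,\tau(h,\xi))=\Phi_{s,t}(u,\xi)$ for every $u\in\bar U$. (Noise differentiability) For every $(u,\xi)\in\mathcal N_t$, the map $h\mapsto\Phi_t(u,\tau(h,\xi))$ is Fréchet differentiable (from $E$ to $U$) at $h=0$; its derivative is denoted $\mathcal D\Phi_t(u,\xi)$. (Compensation) For every $s\le t$ with $t\in(0,1]$ we are given $A_t^{(s)}:\mathcal N_s\to L(U,E_s)$ (bounded linear operators) such that for $0<s<r\le t$, $(u,\xi)\in\mathcal N_r$, $v\in U$, the restriction of $A_t^{(r)}(u,\xi)v$ to $[0,s]$ equals $A_t^{(s)}(u,\xi)v$. For every $u\in U$ and $s\le t$, $\omega\mapsto A_t^{(s)}(u,\boldsymbol\xi(\omega))$ is $\mathcal F_s$-measurable, and $$D\Phi_t(u,\xi)v+\mathcal D\Phi_t(u,\xi)(A_t^{(t)}(u,\xi)v)=0$$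 for all $v\in U$, $(u,\xi)\in\mathcal N_t$. For $0<s\le t\le1$, $A_t^{(s)}$ is locally Lipschitz from $\mathcal N_s$ to $L(U,E_s)$ and bounded on every set $\{(u,\xi):r_s(u,\xi)\le R\}$, $R>0$. *)

theory Defs
  imports "HOL-Probability.Probability"
begin

datatype 'u with_death = Alive (state: 'u) | Dead
  where "state Dead = undefined"

instantiation with_death :: (real_normed_vector) metric_space
begin

fun dist_with_death :: "'a with_death \<Rightarrow> 'a with_death \<Rightarrow> real" where
  "dist_with_death (Alive u) (Alive v) = norm (u - v)"
| "dist_with_death (Alive u) Dead = sqrt (1 + (norm u)\<^sup>2)"
| "dist_with_death Dead (Alive u) = sqrt (1 + (norm u)\<^sup>2)"
| "dist_with_death Dead Dead = 0"

definition uniformity_with_death :: "('a with_death \<times> 'a with_death) filter" where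
  "uniformity_with_death = (INF e\<in>{0 <..}. principal {(x, y). dist x y < e})"

definition open_with_death :: "'a with_death set \<Rightarrow> bool" where
  "open_with_death S \<longleftrightarrow> (\<forall>x\<in>S. \<forall>\<^sub>F (x', y) in uniformity. x' = x \<longrightarrow> y \<in> S)"

instance
proof
  define emb :: "'a with_death \<Rightarrow> 'a \<times> real"
    where "emb = (\<lambda>x. case x of Alive u \<Rightarrow> (u, 0) | Dead \<Rightarrow> (0, 1))"
  have dist_emb: "dist x y = dist (emb x) (emb y)" for x y :: "'a with_death"
    by (cases x; cases y) (simp_all add: emb_def dist_prod_def dist_norm add.commute)
  have inj: "emb x = emb y \<longleftrightarrow> x = y" for x y :: "'a with_death"
    by (cases x; cases y) (simp_all add: emb_def)
  show "dist x y = 0 \<longleftrightarrow> x = y" for x y :: "'a with_death"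
    by (simp add: dist_emb inj)
  show "dist x y \<le> dist x z + dist y z" for x y z :: "'a with_death"
    unfolding dist_emb by (rule dist_triangle2)
qed (simp_all add: uniformity_with_death_def open_with_death_def)

end

definition Lp_norm :: "'a measure \<Rightarrow> real \<Rightarrow> ('a \<Rightarrow> 'b::real_normed_vector) \<Rightarrow> real" where
  "Lp_norm M p f = (\<integral>x. norm (f x) powr p \<partial>M) powr (1 / p)"

text \<open>Representatives of the elements of \<open>L\<^sup>p(S, X)\<close>, extended by \<open>0\<close> outside \<open>S\<close>.\<close>

definition Lp_on :: "real \<Rightarrow> real set \<Rightarrow> (real \<Rightarrow> 'b::{banach,second_countable_topology}) set" where
  "Lp_on p S = {f \<in> borel_measurable borel.
     integrable lborel (\<lambda>x. norm (f x) powr p) \<and> (\<forall>x. x \<notin> S \<longrightarrow> f x = 0)}"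

text \<open>
  Since a type cannot depend on the exponent, the Banach space \<open>L\<^sup>p(S, X)\<close> of classes modulo
  almost everywhere equality is an arbitrary Banach space type \<open>'e\<close> together with a map \<open>rep\<close>
  selecting a representative of every class, such that \<open>rep\<close> induces an isometric linear
  isomorphism onto the space of classes (injectivity being a consequence of isometry).
\<close>

definition is_Lp_space ::
  "real \<Rightarrow> real set \<Rightarrow> ('e::banach \<Rightarrow> real \<Rightarrow> 'b::{banach,second_countable_topology}) \<Rightarrow> bool" where
  "is_Lp_space p S rep \<longleftrightarrow>
     (\<forall>h. rep h \<in> Lp_on p S) \<and>
     (\<forall>f\<in>Lp_on p S. \<exists>h. AE x in lborel. rep h x = f x) \<and>
     (\<forall>h k. AE x in lborel. rep (h + k) x = rep h x + rep k x) \<and>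
     (\<forall>c h. AE x in lborel. rep (c *\<^sub>R h) x = c *\<^sub>R rep h x) \<and>
     (\<forall>h. norm h = Lp_norm lborel p (rep h))"

definition centred_gaussian :: "'w::real_normed_vector measure \<Rightarrow> bool" where
  "centred_gaussian P \<longleftrightarrow> prob_space P \<and> sets P = sets borel \<and>
     (\<forall>l::'w \<Rightarrow> real. bounded_linear l \<longrightarrow>
        (\<exists>\<sigma>\<ge>0. distr P borel l =
           (if \<sigma> = 0 then return borel 0 else density lborel (normal_density 0 \<sigma>))))"

text \<open>
  \<open>is_star P h g\<close>: the random variable \<open>g\<close> is a version of the measurable linear functional
  \<open>h\<^sup>*\<close>, i.e. it belongs to the closure of the topological dual in \<open>L\<^sup>2(P)\<close> and
  \<open>E(l g) = l(h)\<close> for every continuous linear functional \<open>l\<close>. The Cameron--Martin space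
  consists of those \<open>h\<close> that admit such a \<open>g\<close>, and its norm is the norm of \<open>g\<close> in \<open>L\<^sup>2(P)\<close>.
\<close>

definition is_star :: "'w::real_normed_vector measure \<Rightarrow> 'w \<Rightarrow> ('w \<Rightarrow> real) \<Rightarrow> bool" where
  "is_star P h g \<longleftrightarrow> g \<in> borel_measurable (completion P) \<and>
     (\<exists>l::nat \<Rightarrow> 'w \<Rightarrow> real. (\<forall>n. bounded_linear (l n)) \<and>
        (\<lambda>n. \<integral>\<^sup>+\<omega>. ennreal ((l n \<omega> - g \<omega>)\<^sup>2) \<partial>completion P) \<longlonglongrightarrow> 0) \<and>
     (\<forall>l::'w \<Rightarrow> real. bounded_linear l \<longrightarrow> (\<integral>\<omega>. l \<omega> * g \<omega> \<partial>completion P) = l h)"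

definition cameron_martin_space :: "'w::real_normed_vector measure \<Rightarrow> 'w set" where
  "cameron_martin_space P = {h. \<exists>g. is_star P h g}"

definition cameron_martin_norm :: "'w::real_normed_vector measure \<Rightarrow> 'w \<Rightarrow> real" where
  "cameron_martin_norm P h = Lp_norm (completion P) 2 (SOME g. is_star P h g)"

text \<open>
  The inclusion of \<open>L\<^sup>2(\<real>, H\<^sub>0)\<close> in the Banach space \<open>'w\<close> is the map \<open>inc\<close>, defined on
  representatives; it is well defined and injective on classes because it is linear and isometric
  for the Cameron--Martin norm. Separability of \<open>H\<^sub>0\<close> is no restriction: the Cameron--Martin
  space of a Gaussian measure on a separable Banach space is separable.
\<close>

locale gaussian_noise =
  fixes P :: "'w::{banach,second_countable_topology} measure"
    and inc :: "(real \<Rightarrow> 'h::{real_inner,banach,second_countable_topology}) \<Rightarrow> 'w"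
  assumes gaussian: "centred_gaussian P"
    and inc_add: "\<lbrakk>f \<in> Lp_on 2 UNIV; g \<in> Lp_on 2 UNIV\<rbrakk> \<Longrightarrow> inc (\<lambda>x. f x + g x) = inc f + inc g"
    and inc_scaleR: "f \<in> Lp_on 2 UNIV \<Longrightarrow> inc (\<lambda>x. c *\<^sub>R f x) = c *\<^sub>R inc f"
    and inc_image: "inc ` Lp_on 2 UNIV = cameron_martin_space P"
    and inc_isometry: "f \<in> Lp_on 2 UNIV \<Longrightarrow> cameron_martin_norm P (inc f) = Lp_norm lborel 2 f"

text \<open>
  The \<open>\<sigma>\<close>-algebra generated by all \<open>h\<^sup>*\<close> with \<open>h \<in> L\<^sup>2(S, H\<^sub>0)\<close>. As \<open>h\<^sup>*\<close> is only defined up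
  to null sets, all its versions are used, so that every null set is included.
\<close>

definition noise_sigma ::
  "'w::{banach,second_countable_topology} measure \<Rightarrow>
   ((real \<Rightarrow> 'h::{real_inner,banach,second_countable_topology}) \<Rightarrow> 'w) \<Rightarrow> real set \<Rightarrow> 'w measure" where
  "noise_sigma P inc S =
     sigma UNIV {g -` B | f g B. f \<in> Lp_on 2 S \<and> is_star P (inc f) g \<and> B \<in> sets borel}"

definition locally_lipschitz_on :: "'a::metric_space set \<Rightarrow> ('a \<Rightarrow> 'b::metric_space) \<Rightarrow> bool" where
  "locally_lipschitz_on X f \<longleftrightarrow>
     (\<forall>x\<in>X. \<exists>V L. open V \<and> x \<in> V \<and> L-lipschitz_on (V \<inter> X) f)"

definition survival :: "(real \<Rightarrow> real \<Rightarrow> 'u with_death \<Rightarrow> 'm \<Rightarrow> 'u with_death) \<Rightarrow> real \<Rightarrow> ('u \<times> 'm) set" where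
  "survival \<Phi> t = {(u, \<xi>). \<Phi> 0 t (Alive u) \<xi> \<noteq> Dead}"

definition markov_operator ::
  "'w measure \<Rightarrow> ('w \<Rightarrow> 'm) \<Rightarrow> (real \<Rightarrow> real \<Rightarrow> 'u with_death \<Rightarrow> 'm \<Rightarrow> 'u with_death) \<Rightarrow>
   ('u with_death \<Rightarrow> real) \<Rightarrow> 'u with_death \<Rightarrow> real" where
  "markov_operator P \<Xi> \<Phi> \<Psi> u = (\<integral>\<omega>. \<Psi> (\<Phi> 0 1 u (\<Xi> \<omega>)) \<partial>completion P)"

text \<open>
  \<open>\<Xi>\<close> is the random variable whose generic values are denoted \<open>\<xi>\<close>, \<open>j\<close> is the inclusion of
  \<open>X\<^sub>0\<close> in \<open>H\<^sub>0\<close>, and \<open>'e\<close> is \<open>E = L\<^sup>p([0,1], X\<^sub>0)\<close> via \<open>rep\<close>. Values of maps are irrelevant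
  outside the ranges of parameters appearing below; in particular \<open>A t s\<close>, which stands for
  \<open>A\<^sub>t\<^bsup>(s)\<^esup>\<close>, matters only on \<open>survival \<Phi> s\<close>. There it takes values in the operators from \<open>U\<close> to
  \<open>E\<^sub>s\<close>, viewed as a closed subspace of those from \<open>U\<close> to \<open>E\<close>.
\<close>

locale abstract_flow_system = gaussian_noise P inc
  for P :: "'w::{banach,second_countable_topology} measure"
    and inc :: "(real \<Rightarrow> 'h::{real_inner,banach,second_countable_topology}) \<Rightarrow> 'w" +
  fixes j :: "'x::{banach,second_countable_topology} \<Rightarrow> 'h"
    and p :: real
    and rep :: "'e::{banach,second_countable_topology} \<Rightarrow> real \<Rightarrow> 'x"
    and \<Xi> :: "'w \<Rightarrow> 'm::polish_space"
    and \<Phi> :: "real \<Rightarrow> real \<Rightarrow> 'u::{banach,second_countable_topology} with_death \<Rightarrow> 'm \<Rightarrow> 'u with_death"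
    and r :: "real \<Rightarrow> 'u \<Rightarrow> 'm \<Rightarrow> ennreal"
    and \<tau> :: "'e \<Rightarrow> 'm \<Rightarrow> 'm"
    and A :: "real \<Rightarrow> real \<Rightarrow> 'u \<Rightarrow> 'm \<Rightarrow> 'u \<Rightarrow>\<^sub>L 'e"
  assumes j_inclusion: "bounded_linear j" "inj j"
    and p_gt_2: "2 < p"
    and E_is_Lp: "is_Lp_space p {0..1} rep"
    and \<Xi>_measurable: "\<Xi> \<in> measurable (completion P) borel"
    and flow: "\<lbrakk>0 \<le> s; s \<le> t; t \<le> q; q \<le> 1\<rbrakk> \<Longrightarrow> \<Phi> t q (\<Phi> s t z \<xi>) \<xi> = \<Phi> s q z \<xi>"
    and flow_Dead: "\<lbrakk>0 \<le> s; s \<le> t; t \<le> 1\<rbrakk> \<Longrightarrow> \<Phi> s t Dead \<xi> = Dead"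
    and alive_open:
      "openin (top_of_set {(s, t, z, \<xi>). 0 \<le> s \<and> s \<le> t \<and> t \<le> 1})
         {(s, t, z, \<xi>). 0 \<le> s \<and> s \<le> t \<and> t \<le> 1 \<and> \<Phi> s t z \<xi> \<noteq> Dead}"
    and alive_continuous:
      "continuous_on {(s, t, z, \<xi>). 0 \<le> s \<and> s \<le> t \<and> t \<le> 1 \<and> \<Phi> s t z \<xi> \<noteq> Dead}
         (\<lambda>(s, t, z, \<xi>). \<Phi> s t z \<xi>)"
    and alive_differentiable:
      "\<lbrakk>0 \<le> s; s \<le> t; t \<le> 1; \<Phi> s t (Alive u) \<xi> \<noteq> Dead\<rbrakk>
         \<Longrightarrow> (\<lambda>u'. state (\<Phi> s t (Alive u') \<xi>)) differentiable (at u)"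
    and r_lower_semicontinuous:
      "openin (top_of_set ({0..1} \<times> UNIV)) {(t, u, \<xi>). t \<in> {0..1} \<and> c < r t u \<xi>}"
    and r_adapted:
      "t \<in> {0..1} \<Longrightarrow> (\<lambda>\<omega>. r t u (\<Xi> \<omega>)) \<in> borel_measurable (noise_sigma P inc {..t})"
    and r_0: "r 0 u \<xi> < \<infinity>"
    and r_continuous: "continuous_on {0..1} (\<lambda>t. r t u \<xi>)"
    and r_mono: "mono_on {0..1} (\<lambda>t. r t u \<xi>)"
    and r_explosion: "t \<in> {0..1} \<Longrightarrow> \<Phi> 0 t (Alive u) \<xi> = Dead \<longleftrightarrow> r t u \<xi> = \<infinity>"
    and r_lipschitz:
      "t \<in> {0<..1} \<Longrightarrow> locally_lipschitz_on (survival \<Phi> t) (\<lambda>(u, \<xi>). enn2real (r t u \<xi>))"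
    and \<tau>_zero: "\<tau> 0 \<xi> = \<xi>"
    and \<tau>_add: "\<tau> (h + k) \<xi> = \<tau> h (\<tau> k \<xi>)"
    and \<tau>_continuous: "continuous_on UNIV (\<lambda>(h, \<xi>). \<tau> h \<xi>)"
    and \<tau>_lipschitz: "locally_lipschitz_on UNIV (\<lambda>h. \<tau> h \<xi>)"
    and \<tau>_shift: "AE \<omega> in completion P. \<Xi> (\<omega> + inc (\<lambda>x. j (rep h x))) = \<tau> h (\<Xi> \<omega>)"
    and \<tau>_local:
      "\<lbrakk>0 \<le> s; s \<le> t; t \<le> 1; AE x in lborel. x \<in> {s..t} \<longrightarrow> rep h x = 0\<rbrakk>
         \<Longrightarrow> \<Phi> s t z (\<tau> h \<xi>) = \<Phi> s t z \<xi>"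
    and noise_differentiable:
      "\<lbrakk>t \<in> {0..1}; (u, \<xi>) \<in> survival \<Phi> t\<rbrakk>
         \<Longrightarrow> (\<lambda>h. state (\<Phi> 0 t (Alive u) (\<tau> h \<xi>))) differentiable (at 0)"
    and A_range:
      "\<lbrakk>0 < s; s \<le> t; t \<le> 1; (u, \<xi>) \<in> survival \<Phi> s\<rbrakk>
         \<Longrightarrow> AE x in lborel. x \<notin> {0..s} \<longrightarrow> rep (blinfun_apply (A t s u \<xi>) v) x = 0"
    and A_restrict:
      "\<lbrakk>0 < s; s < q; q \<le> t; t \<le> 1; (u, \<xi>) \<in> survival \<Phi> q\<rbrakk>
         \<Longrightarrow> AE x in lborel. x \<in> {0..s} \<longrightarrow>
               rep (blinfun_apply (A t q u \<xi>) v) x = rep (blinfun_apply (A t s u \<xi>) v) x"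
    and A_adapted:
      "\<lbrakk>0 < s; s \<le> t; t \<le> 1\<rbrakk> \<Longrightarrow>
         (\<lambda>\<omega>. A t s u (\<Xi> \<omega>)) \<in> borel_measurable
           (restrict_space (noise_sigma P inc {..s}) {\<omega>. (u, \<Xi> \<omega>) \<in> survival \<Phi> s})"
    and A_compensates:
      "\<lbrakk>t \<in> {0<..1}; (u, \<xi>) \<in> survival \<Phi> t\<rbrakk> \<Longrightarrow>
         frechet_derivative (\<lambda>u'. state (\<Phi> 0 t (Alive u') \<xi>)) (at u) v
         + frechet_derivative (\<lambda>h. state (\<Phi> 0 t (Alive u) (\<tau> h \<xi>))) (at 0)
             (blinfun_apply (A t t u \<xi>) v) = 0"
    and A_lipschitz:
      "\<lbrakk>0 < s; s \<le> t; t \<le> 1\<rbrakk> \<Longrightarrow> locally_lipschitz_on (survival \<Phi> s) (\<lambda>(u, \<xi>). A t s u \<xi>)"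
    and A_bounded:
      "\<lbrakk>0 < s; s \<le> t; t \<le> 1; 0 < R\<rbrakk> \<Longrightarrow>
         bounded ((\<lambda>(u, \<xi>). A t s u \<xi>) ` {(u, \<xi>). r s u \<xi> \<le> ennreal R})"

end

theory Submission
  imports Defs
begin

text \<open>
  Two laws \<open>\<Phi>\<^sub>1(u\<^sub>0, \<Xi>)\<close> and \<open>\<Phi>\<^sub>1(u\<^sub>0 + v, \<Xi>)\<close> are compared by moving the noise: a random
  shift \<open>h\<close>, the control, is constructed such that the trajectory started from \<open>u\<^sub>0 + v\<close> and driven by
  \<open>\<tau> h \<Xi>\<close> meets the trajectory started from \<open>u\<^sub>0\<close> and driven by \<open>\<Xi>\<close>, while the law of
  \<open>\<tau> h \<Xi>\<close> is close to that of \<open>\<Xi>\<close> when \<open>v\<close> is small.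

  The control steers along the segment from \<open>u\<^sub>0\<close> to \<open>u\<^sub>0 + v\<close>. For a small time \<open>t\<close> it is the value at
  \<open>\<theta> = 1\<close> of the solution of
  \<open>dh/d\<theta> = A t t (u\<^sub>0 + \<theta> v) (\<tau> h \<xi>) v\<close>, \<open>h 0 = 0\<close>.
  By the compensation identity the derivatives of \<open>\<Phi>\<^sub>t\<close> along the two arguments cancel, so
  \<open>\<Phi>\<^sub>t(u\<^sub>0 + \<theta> v, \<tau> (h \<theta>) \<xi>)\<close> does not depend on \<open>\<theta>\<close> (\<open>constant_on_diagonal\<close>,
  \<open>control_couples\<close>). After time \<open>t\<close> the control vanishes, so that the two trajectories stay together.
  The equation is solved by Picard iteration on the closed set of tame configurations \<open>\<xi>\<close>, on which
  \<open>A\<close> is bounded and Lipschitz with fixed constants near \<open>(u\<^sub>0, \<xi>)\<close>. Explosion happens at positive times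
  only, so the probability that \<open>\<Xi>\<close> is not tame is as small as desired when \<open>t\<close> is small and the
  constants are large (\<open>eventually_tame\<close>).

  The law of \<open>\<tau> h \<Xi>\<close> is controlled by Girsanov's theorem. As the operators \<open>A t s\<close> are adapted and
  compatible with restriction, the control on \<open>[0, s]\<close> can be computed at time \<open>s\<close>, and it exists there on
  a set of configurations that decreases in \<open>s\<close>. Delaying it by one step of a fine grid and
  rounding it to a countable dense set gives a step process to which an elementary form
  of Girsanov's theorem applies: it is proved block by block from the Cameron--Martin theorem, since a
  choice made before a block is unaffected by a shift inside that block (\<open>step_shift_prob_le\<close>). The
  density has second moment at most \<open>exp K\<close> when the energy is bounded by \<open>K\<close>, so the probability of any
  event increases by at most \<open>sqrt (exp K - 1)\<close>. In the limit of fine grids the delayed controls converge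
  to the control (\<open>approx_tendsto\<close>), and the bound passes to open events by Fatou's lemma and to Borel
  events by regularity (\<open>control_law_le\<close>). Since \<open>p > 2\<close>, the space
  \<open>E\<close> embeds in \<open>L\<^sup>2\<close>, so that elements of \<open>E\<close> are shifts in the Cameron--Martin space.

  Together these give, for every Borel set \<open>D\<close>, an estimate of \<open>P(\<Phi>\<^sub>1(u\<^sub>0, \<Xi>) \<in> D)\<close> by
  \<open>P(\<Phi>\<^sub>1(u\<^sub>0 + v, \<Xi>) \<in> D)\<close> plus a small error that does not depend on \<open>D\<close>, which is the strong Feller
  property at \<open>u\<^sub>0\<close>. The death state is an isolated point.
\<close>

section \<open>Norming functionals and the Borel sets of a separable normed space\<close>

text \<open>
  The Hahn--Banach theorem, for the extension of \<open>c x \<mapsto> c \<parallel>x\<parallel>\<close> from the line through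
  \<open>x\<close>. Partial functionals dominated by the norm are represented by their graphs, which are subspaces of
  \<open>'a \<times> real\<close>; Zorn's lemma gives a maximal graph, and maximality forces its domain to be everything.
\<close>

lemma norming_functional_exists:
  fixes x :: "'a::real_normed_vector"
  obtains l :: "'a \<Rightarrow> real" where "bounded_linear l" "\<And>y. \<bar>l y\<bar> \<le> norm y" "l x = norm x"
proof -
  define \<A> where "\<A> = {g :: ('a \<times> real) set. subspace g \<and> (x, norm x) \<in> g \<and> (\<forall>(y, a)\<in>g. a \<le> norm y)}"
  have "span {(x, norm x)} \<in> \<A>"
  proof -
    have "a \<le> norm y" if "(y, a) \<in> span {(x, norm x)}" for y a
    proof -
      from that obtain c where "y = c *\<^sub>R x" "a = c * norm x"
        by (auto simp: span_singleton)
      then show ?thesis by (simp add: mult_right_mono)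
    qed
    then show ?thesis
      unfolding \<A>_def by (auto intro: span_base)
  qed
  moreover have "\<Union>\<C> \<in> \<A>" if ne: "\<C> \<noteq> {}" and ch: "subset.chain \<A> \<C>" for \<C>
  proof -
    have sub: "g \<in> \<A>" if "g \<in> \<C>" for g
      using ch that by (auto simp: subset_chain_def)
    have tot: "g \<subseteq> g' \<or> g' \<subseteq> g" if "g \<in> \<C>" "g' \<in> \<C>" for g g'
      using ch that by (auto simp: subset_chain_def)
    have subs: "subspace g" if "g \<in> \<C>" for g
      using sub[OF that] by (simp add: \<A>_def)
    have "subspace (\<Union>\<C>)"
      unfolding subspace_def
    proof (intro conjI ballI allI)
      show "0 \<in> \<Union>\<C>" using ne subs subspace_0 by blast
    next
      fix p q assume "p \<in> \<Union>\<C>" "q \<in> \<Union>\<C>"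
      then obtain g g' where "g \<in> \<C>" "g' \<in> \<C>" "p \<in> g" "q \<in> g'" by blast
      with tot[of g g'] obtain g'' where "g'' \<in> \<C>" "p \<in> g''" "q \<in> g''" by blast
      then show "p + q \<in> \<Union>\<C>" using subs subspace_add by blast
    next
      fix c :: real and p assume "p \<in> \<Union>\<C>"
      then show "c *\<^sub>R p \<in> \<Union>\<C>" using subs subspace_scale by blast
    qed
    moreover have "(x, norm x) \<in> \<Union>\<C>"
      using ne sub by (auto simp: \<A>_def)
    ultimately show ?thesis
      using sub unfolding \<A>_def by blast
  qed
  ultimately obtain g where g: "g \<in> \<A>" and max: "\<And>g'. g' \<in> \<A> \<Longrightarrow> g \<subseteq> g' \<Longrightarrow> g' = g"
    using subset_Zorn_nonempty[of \<A>] by blast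
  have sg: "subspace g" and xg: "(x, norm x) \<in> g" and le: "\<And>y a. (y, a) \<in> g \<Longrightarrow> a \<le> norm y"
    using g by (auto simp: \<A>_def)
  have total: "\<exists>a. (z, a) \<in> g" for z
  proof -
    define c where "c = Sup ((\<lambda>(y, a). a - norm (y - z)) ` g)"
    have key: "a - norm (y - z) \<le> norm (y' + z) - a'" if "(y, a) \<in> g" "(y', a') \<in> g" for y a y' a'
    proof -
      have "a + a' \<le> norm (y + y')" using le subspace_add[OF sg that] by simp
      also have "\<dots> \<le> norm (y - z) + norm (y' + z)"
        using norm_triangle_ineq[of "y - z" "y' + z"] by simp
      finally show ?thesis by simp
    qed
    have c_upper: "c \<le> norm (y' + z) - a'" if "(y', a') \<in> g" for y' a'
      unfolding c_def using xg key[OF _ that] by (intro cSup_least) auto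
    have c_lower: "a - norm (y - z) \<le> c" if "(y, a) \<in> g" for y a
      unfolding c_def using that key[OF _ xg]
      by (intro cSup_upper2[where x = "a - norm (y - z)"] bdd_aboveI[of _ "norm (x + z) - norm x"]) force+
    define g' where "g' = span (insert (z, c) g)"
    have "g' \<in> \<A>"
    proof -
      have "a \<le> norm y" if "(y, a) \<in> g'" for y a
      proof -
        obtain s where s: "(y, a) - s *\<^sub>R (z, c) \<in> g"
          using \<open>(y, a) \<in> g'\<close> unfolding g'_def by (auto simp: span_breakdown_eq span_eq_iff[THEN iffD2, OF sg])
        then have w: "(t *\<^sub>R (y - s *\<^sub>R z), t * (a - s * c)) \<in> g" for t
          using subspace_scale[OF sg s, of t] by simp
        consider "s = 0" | "s > 0" | "s < 0" by linarith
        then show ?thesis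
        proof cases
          case 1 then show ?thesis using w[of 1] le by simp
        next
          case 2
          have "c \<le> norm (y /\<^sub>R s) - (a - s * c) / s"
            using c_upper[OF w[of "inverse s"]] 2 by (simp add: algebra_simps divide_inverse)
          then show ?thesis using 2 by (simp add: field_simps)
        next
          case 3
          have *: "inverse (- s) *\<^sub>R (y - s *\<^sub>R z) - z = y /\<^sub>R (- s)"
            using 3 by (simp add: algebra_simps)
          have "(a - s * c) / (- s) - norm (y /\<^sub>R (- s)) \<le> c"
            using c_lower[OF w[of "inverse (- s)"]] unfolding * by (simp add: divide_inverse mult.commute)
          then show ?thesis using 3 by (simp add: field_simps)
        qed
      qed
      then show ?thesis using xg unfolding \<A>_def g'_def by (auto simp: span_base)
    qed
    moreover have "g \<subseteq> g'" unfolding g'_def using span_superset[of "insert (z, c) g"] by simp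
    ultimately have "g' = g" by (rule max)
    moreover have "(z, c) \<in> g'" unfolding g'_def by (simp add: span_base)
    ultimately show ?thesis by blast
  qed
  have unique: "a = b" if "(y, a) \<in> g" "(y, b) \<in> g" for y a b
    using le[of 0 "a - b"] le[of 0 "b - a"] subspace_diff[OF sg that] subspace_diff[OF sg that(2,1)] by simp
  define l where "l y = (THE a. (y, a) \<in> g)" for y
  have l: "(y, l y) \<in> g" for y
    unfolding l_def using total unique by (metis theI)
  have l_eq: "l y = a" if "(y, a) \<in> g" for y a
    using l unique that by blast
  have ab: "\<bar>l y\<bar> \<le> norm y" for y
    using le[OF l[of y]] le[of "- y" "- l y"] subspace_neg[OF sg l[of y]] by (simp add: abs_le_iff)
  have "bounded_linear l"
  proof (rule bounded_linear_intro[where K = 1])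
    show "l (y + z) = l y + l z" for y z
      using subspace_add[OF sg l l, of y z] by (intro l_eq) simp
    show "l (c *\<^sub>R y) = c *\<^sub>R l y" for c y
      using subspace_scale[OF sg l, of c y] by (intro l_eq) simp
    show "norm (l y) \<le> norm y * 1" for y using ab by simp
  qed
  then show thesis using ab l_eq[OF xg] by (rule that)
qed

lemma functionals_separate_points:
  fixes x :: "'a::real_normed_vector"
  assumes "\<And>l::'a \<Rightarrow> real. bounded_linear l \<Longrightarrow> l x = 0"
  shows "x = 0"
proof (rule norming_functional_exists[of x])
  fix l :: "'a \<Rightarrow> real"
  assume "bounded_linear l" "l x = norm x"
  then have "norm x = 0" using assms[OF \<open>bounded_linear l\<close>] by linarith
  then show "x = 0" by simp
qed

text \<open>
  On a separable space the norm is the supremum of the functionals that norm the points of a countable dense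
  set. Hence closed balls are cut out by countably many functionals, and open sets are countable unions of
  balls.
\<close>

lemma borel_eq_sigma_functionals:
  "sets (borel :: 'a::{real_normed_vector,second_countable_topology} measure)
     = sigma_sets UNIV {l -` B | l B. bounded_linear (l :: 'a \<Rightarrow> real) \<and> B \<in> sets borel}"
    (is "_ = sigma_sets UNIV ?G")
proof
  obtain D :: "'a set" where D: "countable D" "\<And>X. open X \<Longrightarrow> X \<noteq> {} \<Longrightarrow> \<exists>d\<in>D. d \<in> X"
    by (erule countable_dense_setE)
  have "\<exists>l :: 'a \<Rightarrow> real. bounded_linear l \<and> (\<forall>y. \<bar>l y\<bar> \<le> norm y) \<and> l d = norm d" for d
    by (rule norming_functional_exists[of d]) blast
  then obtain f :: "'a \<Rightarrow> 'a \<Rightarrow> real"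
    where f: "\<And>d. bounded_linear (f d)" "\<And>d y. \<bar>f d y\<bar> \<le> norm y" "\<And>d. f d d = norm d"
    by metis
  have norm_le: "norm y \<le> c" if "\<And>d. d \<in> D \<Longrightarrow> f d y \<le> c" for y c
  proof (rule field_le_epsilon)
    fix e :: real assume "e > 0"
    then obtain d where d: "d \<in> D" "d \<in> ball y (e/2)"
      using D(2)[of "ball y (e/2)"] by auto
    have "norm y \<le> norm d + norm (y - d)" by (metis norm_triangle_sub add.commute)
    also have "norm d = f d y + f d (d - y)"
      using f(1)[of d] f(3)[of d] by (simp add: linear_simps)
    also have "f d (d - y) \<le> norm (y - d)" using f(2)[of d "d - y"] by (simp add: norm_minus_commute)
    finally show "norm y \<le> c + e" using that[OF d(1)] d(2) by (simp add: dist_norm)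
  qed
  define \<Sigma> where "\<Sigma> = sigma UNIV ?G"
  have \<Sigma>: "sets \<Sigma> = sigma_sets UNIV ?G" by (simp add: \<Sigma>_def)
  have cball: "cball a c \<in> sets \<Sigma>" for a c
  proof -
    have "f d (y - a) = f d y - f d a" for d y using f(1)[of d] by (simp add: linear_simps)
    then have "cball a c = (\<Inter>d\<in>D. f d -` {.. c + f d a})"
    proof -
      have "dist a y \<le> c \<longleftrightarrow> (\<forall>d\<in>D. f d y \<le> c + f d a)" for y
      proof
        assume "dist a y \<le> c"
        then have "f d (y - a) \<le> c" for d
          using f(2)[of d "y - a"] by (simp add: dist_norm norm_minus_commute)
        then show "\<forall>d\<in>D. f d y \<le> c + f d a"
          using f(1) by (simp add: linear_simps algebra_simps)
      next
        assume "\<forall>d\<in>D. f d y \<le> c + f d a"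
        then have "norm (y - a) \<le> c" using f(1) by (intro norm_le) (auto simp: linear_simps)
        then show "dist a y \<le> c" by (simp add: dist_norm norm_minus_commute)
      qed
      then show ?thesis by auto
    qed
    moreover have "f d -` {.. c + f d a} \<in> sets \<Sigma>" for d
      unfolding \<Sigma>
      by (rule sigma_sets.Basic, rule CollectI, rule exI[of _ "f d"], rule exI[of _ "{.. c + f d a}"]) (simp add: f(1))
    moreover have "D \<noteq> {}" using D(2)[of UNIV] by auto
    ultimately show ?thesis using D(1) by (simp only:) (rule sets.countable_INT', auto)
  qed
  have ball: "ball a c \<in> sets \<Sigma>" for a c
  proof -
    have "ball a c = (\<Union>n. cball a (c - inverse (real (Suc n))))"
    proof -
      have "x < c \<longleftrightarrow> (\<exists>n. x \<le> c - inverse (real (Suc n)))" for x :: real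
      proof
        assume "x < c"
        then obtain n where "inverse (real (Suc n)) < c - x"
          using reals_Archimedean[of "c - x"] by auto
        then have "x \<le> c - inverse (real (Suc n))" by linarith
        then show "\<exists>n. x \<le> c - inverse (real (Suc n))" ..
      next
        assume "\<exists>n. x \<le> c - inverse (real (Suc n))"
        then obtain n where "x \<le> c - inverse (real (Suc n))" ..
        moreover have "0 < inverse (real (Suc n))" by simp
        ultimately show "x < c" by linarith
      qed
      then show ?thesis by (simp add: set_eq_iff del: of_nat_Suc)
    qed
    then show ?thesis using cball by (simp only:) (rule sets.countable_UN, blast)
  qed
  have "S \<in> sets \<Sigma>" if "open S" for S :: "'a set"
  proof -
    define I where "I = {(d, q). d \<in> D \<and> q \<in> \<rat> \<and> ball d q \<subseteq> S}"
    have "countable I"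
      by (rule countable_subset[of _ "D \<times> \<rat>"]) (auto simp: I_def D(1) countable_rat)
    moreover have "S = (\<Union>(d, q)\<in>I. ball d q)"
    proof (intro equalityI subsetI)
      fix x assume "x \<in> S"
      then obtain e where e: "e > 0" "ball x e \<subseteq> S" using \<open>open S\<close> by (auto simp: open_contains_ball)
      obtain q where q: "q \<in> \<rat>" "0 < q" "q < e / 2" using Rats_dense_in_real[of 0 "e/2"] e by auto
      obtain d where d: "d \<in> D" "dist x d < q" using D(2)[of "ball x q"] q by auto
      have "ball d q \<subseteq> ball x e"
      proof
        fix y assume "y \<in> ball d q"
        then show "y \<in> ball x e" using d q dist_triangle[of x y d] by simp
      qed
      then have "(d, q) \<in> I" using d q e by (auto simp: I_def)
      moreover have "x \<in> ball d q" using d by (simp add: dist_commute)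
      ultimately show "x \<in> (\<Union>(d, q)\<in>I. ball d q)" by blast
    qed (auto simp: I_def)
    moreover have "(\<Union>(d, q)\<in>I. ball d q) \<in> sets \<Sigma>"
      using \<open>countable I\<close> ball by (intro sets.countable_UN') auto
    ultimately show ?thesis by simp
  qed
  then have "sigma_sets UNIV {S :: 'a set. open S} \<subseteq> sets \<Sigma>"
    by (intro sets.sigma_sets_subset[of _ \<Sigma>, simplified \<Sigma>_def space_measure_of_conv, folded \<Sigma>_def]) auto
  moreover have "sets (borel :: 'a measure) = sigma_sets UNIV {S. open S}"
    by (simp add: borel_def)
  ultimately show "sets (borel :: 'a measure) \<subseteq> sigma_sets UNIV ?G"
    using \<Sigma> by simp
next
  have "l -` B \<in> sets borel" if "bounded_linear l" "B \<in> sets borel" for l :: "'a \<Rightarrow> real" and B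
    using measurable_sets[OF borel_measurable_continuous_onI[OF linear_continuous_on[OF that(1)]] that(2)]
    by simp
  then show "sigma_sets UNIV ?G \<subseteq> sets (borel :: 'a measure)"
    by (intro sets.sigma_sets_subset[of _ borel, simplified]) auto
qed

section \<open>Square integrable random variables and characteristic functionals\<close>

definition square_integrable :: "'a measure \<Rightarrow> ('a \<Rightarrow> real) \<Rightarrow> bool" where
  "square_integrable M X \<longleftrightarrow> X \<in> borel_measurable M \<and> integrable M (\<lambda>x. (X x)\<^sup>2)"

lemma square_integrable_measurable [measurable_dest]:
  "square_integrable M X \<Longrightarrow> X \<in> borel_measurable M"
  by (simp add: square_integrable_def)

lemma square_integrable_mult:
  assumes "square_integrable M X" "square_integrable M Y"
  shows "integrable M (\<lambda>x. X x * Y x)"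
proof (rule Bochner_Integration.integrable_bound[of M "\<lambda>x. (X x)\<^sup>2 + (Y x)\<^sup>2"])
  have "2 * (\<bar>a\<bar> * \<bar>b\<bar>) \<le> a\<^sup>2 + b\<^sup>2" for a b :: real
    using sum_squares_bound[of "\<bar>a\<bar>" "\<bar>b\<bar>"] by simp
  moreover have "0 \<le> \<bar>a\<bar> * \<bar>b\<bar>" for a b :: real by simp
  ultimately have "\<bar>a\<bar> * \<bar>b\<bar> \<le> a\<^sup>2 + b\<^sup>2" for a b :: real by (smt (verit))
  then show "AE x in M. norm (X x * Y x) \<le> norm ((X x)\<^sup>2 + (Y x)\<^sup>2)"
    by (auto simp: abs_mult)
qed (use assms in \<open>auto simp: square_integrable_def\<close>)

lemma square_integrable_add:
  assumes "square_integrable M X" "square_integrable M Y"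
  shows "square_integrable M (\<lambda>x. X x + Y x)"
  using assms square_integrable_mult[OF assms]
  by (auto simp: square_integrable_def power2_sum mult.assoc)

lemma square_integrable_scale:
  "square_integrable M X \<Longrightarrow> square_integrable M (\<lambda>x. c * X x)"
  by (auto simp: square_integrable_def power_mult_distrib)

lemma square_integrable_diff:
  "square_integrable M X \<Longrightarrow> square_integrable M Y \<Longrightarrow> square_integrable M (\<lambda>x. X x - Y x)"
  using square_integrable_add[of M X "\<lambda>x. (- 1) * Y x"] square_integrable_scale[of M Y "-1"] by simp

lemma Cauchy_Schwarz_integral:
  assumes "square_integrable M X" "square_integrable M Y"
  shows "(\<integral>x. X x * Y x \<partial>M)\<^sup>2 \<le> (\<integral>x. (X x)\<^sup>2 \<partial>M) * (\<integral>x. (Y x)\<^sup>2 \<partial>M)"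
proof -
  define a b c where "a = (\<integral>x. (X x)\<^sup>2 \<partial>M)" and "b = (\<integral>x. X x * Y x \<partial>M)" and "c = (\<integral>x. (Y x)\<^sup>2 \<partial>M)"
  have q: "0 \<le> a - 2 * t * b + t\<^sup>2 * c" for t
  proof -
    have "0 \<le> (\<integral>x. (X x - t * Y x)\<^sup>2 \<partial>M)" by simp
    also have "\<dots> = (\<integral>x. (X x)\<^sup>2 - (2 * t) * (X x * Y x) + t\<^sup>2 * (Y x)\<^sup>2 \<partial>M)"
      by (intro Bochner_Integration.integral_cong) (auto simp: power2_eq_square algebra_simps)
    also have "\<dots> = a - 2 * t * b + t\<^sup>2 * c"
      using assms square_integrable_mult[OF assms]
      by (simp add: a_def b_def c_def square_integrable_def)
    finally show ?thesis .
  qed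
  have "c \<ge> 0" by (simp add: c_def)
  have "b\<^sup>2 \<le> a * c"
  proof (cases "c = 0")
    case True
    have "b = 0"
    proof (rule ccontr)
      assume "b \<noteq> 0"
      then show False using q[of "(a + 1) / (2 * b)"] True by simp
    qed
    then show ?thesis using True by simp
  next
    case False
    then show ?thesis using q[of "b / c"] \<open>c \<ge> 0\<close>
      by (simp add: power2_eq_square field_simps)
  qed
  then show ?thesis by (simp add: a_def b_def c_def)
qed

context prob_space
begin

definition msq_limit :: "(nat \<Rightarrow> 'a \<Rightarrow> real) \<Rightarrow> ('a \<Rightarrow> real) \<Rightarrow> bool" where
  "msq_limit Y X \<longleftrightarrow> (\<forall>n. square_integrable M (Y n)) \<and> square_integrable M X \<and>
     (\<lambda>n. expectation (\<lambda>x. (Y n x - X x)\<^sup>2)) \<longlonglongrightarrow> 0"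

lemma square_integrable_const: "square_integrable M (\<lambda>x. c)"
  by (simp add: square_integrable_def)

lemma square_integrable_imp_integrable: "square_integrable M X \<Longrightarrow> integrable M X"
  using square_integrable_mult[OF _ square_integrable_const[of 1]] by simp

lemma msq_limit_mult:
  assumes "msq_limit Y X" "square_integrable M Z"
  shows "(\<lambda>n. expectation (\<lambda>x. Y n x * Z x)) \<longlonglongrightarrow> expectation (\<lambda>x. X x * Z x)"
proof -
  have sq: "square_integrable M (Y n)" "square_integrable M X" "square_integrable M (\<lambda>x. Y n x - X x)" for n
    using assms by (auto simp: msq_limit_def intro: square_integrable_diff)
  have "(\<lambda>n. expectation (\<lambda>x. (Y n x - X x) * Z x)) \<longlonglongrightarrow> 0"
  proof (rule Lim_null_comparison)
    show "\<forall>\<^sub>F n in sequentially. norm (expectation (\<lambda>x. (Y n x - X x) * Z x))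
        \<le> sqrt (expectation (\<lambda>x. (Y n x - X x)\<^sup>2) * expectation (\<lambda>x. (Z x)\<^sup>2))"
      using Cauchy_Schwarz_integral[OF sq(3) assms(2)]
      by (auto intro!: real_le_rsqrt always_eventually simp: power2_abs)
    have "(\<lambda>n. expectation (\<lambda>x. (Y n x - X x)\<^sup>2)) \<longlonglongrightarrow> 0" using assms by (simp add: msq_limit_def)
    then show "(\<lambda>n. sqrt (expectation (\<lambda>x. (Y n x - X x)\<^sup>2) * expectation (\<lambda>x. (Z x)\<^sup>2))) \<longlonglongrightarrow> 0"
      by (auto intro!: tendsto_eq_intros)
  qed
  moreover have "expectation (\<lambda>x. (Y n x - X x) * Z x)
      = expectation (\<lambda>x. Y n x * Z x) - expectation (\<lambda>x. X x * Z x)" for n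
    using square_integrable_mult[OF sq(1) assms(2)] square_integrable_mult[OF sq(2) assms(2)]
    by (simp add: left_diff_distrib)
  ultimately show ?thesis by (simp add: LIM_zero_iff)
qed

lemma msq_limit_square:
  assumes "msq_limit Y X"
  shows "(\<lambda>n. expectation (\<lambda>x. (Y n x)\<^sup>2)) \<longlonglongrightarrow> expectation (\<lambda>x. (X x)\<^sup>2)"
proof -
  have sq: "square_integrable M (Y n)" "square_integrable M X" "square_integrable M (\<lambda>x. Y n x - X x)" for n
    using assms by (auto simp: msq_limit_def intro: square_integrable_diff)
  have eq: "expectation (\<lambda>x. (Y n x)\<^sup>2) = expectation (\<lambda>x. (Y n x - X x)\<^sup>2)
       + 2 * expectation (\<lambda>x. Y n x * X x) - expectation (\<lambda>x. (X x)\<^sup>2)" for n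
  proof -
    have "expectation (\<lambda>x. (Y n x)\<^sup>2) = expectation (\<lambda>x. (Y n x - X x)\<^sup>2 + 2 * (Y n x * X x) - (X x)\<^sup>2)"
      by (intro Bochner_Integration.integral_cong) (auto simp: power2_eq_square algebra_simps)
    then show ?thesis
      using sq square_integrable_mult[OF sq(1) sq(2)] by (simp add: square_integrable_def)
  qed
  have "(\<lambda>n. expectation (\<lambda>x. (Y n x - X x)\<^sup>2)) \<longlonglongrightarrow> 0" using assms by (simp add: msq_limit_def)
  from tendsto_diff[OF tendsto_add[OF this tendsto_mult[OF tendsto_const[of 2] msq_limit_mult[OF assms sq(2)]]]
      tendsto_const[of "expectation (\<lambda>x. (X x)\<^sup>2)"]]
  show ?thesis unfolding eq by (simp add: power2_eq_square)
qed

lemma msq_limit_iexp: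
  assumes "msq_limit Y X"
  shows "(\<lambda>n. expectation (\<lambda>x. iexp (Y n x))) \<longlonglongrightarrow> expectation (\<lambda>x. iexp (X x))"
proof -
  have sq: "square_integrable M (Y n)" "square_integrable M X" "square_integrable M (\<lambda>x. Y n x - X x)" for n
    using assms by (auto simp: msq_limit_def intro: square_integrable_diff)
  have [measurable]: "Y n \<in> borel_measurable M" "X \<in> borel_measurable M" for n
    using sq by (auto simp: square_integrable_def)
  have int: "integrable M (\<lambda>x. iexp (Y n x))" "integrable M (\<lambda>x. iexp (X x))" for n
    by (auto intro!: integrable_const_bound[of _ 1])
  have "(\<lambda>n. expectation (\<lambda>x. iexp (Y n x)) - expectation (\<lambda>x. iexp (X x))) \<longlonglongrightarrow> 0"
  proof (rule Lim_null_comparison)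
    have "norm (expectation (\<lambda>x. iexp (Y n x)) - expectation (\<lambda>x. iexp (X x)))
        \<le> sqrt (expectation (\<lambda>x. (Y n x - X x)\<^sup>2))" for n
    proof -
      have lip: "norm (iexp a - iexp b) \<le> \<bar>a - b\<bar>" for a b
      proof -
        have "iexp a - iexp b = iexp b * (iexp (a - b) - 1)"
          by (simp add: right_diff_distrib exp_add[symmetric] algebra_simps)
        then have "norm (iexp a - iexp b) = norm (iexp (a - b) - 1)"
          by (simp add: norm_mult)
        also have "\<dots> \<le> \<bar>a - b\<bar>" using iexp_approx1[of "a - b" 0] by simp
        finally show ?thesis .
      qed
      have "norm (expectation (\<lambda>x. iexp (Y n x)) - expectation (\<lambda>x. iexp (X x)))
          = norm (expectation (\<lambda>x. iexp (Y n x) - iexp (X x)))"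
        using int by simp
      also have "\<dots> \<le> expectation (\<lambda>x. norm (iexp (Y n x) - iexp (X x)))" by simp
      also have "\<dots> \<le> expectation (\<lambda>x. \<bar>Y n x - X x\<bar> * 1)"
        using int square_integrable_imp_integrable[OF sq(3)] lip
        by (intro integral_mono) auto
      also have "\<dots> \<le> sqrt (expectation (\<lambda>x. (Y n x - X x)\<^sup>2))"
      proof (rule real_le_rsqrt)
        have "square_integrable M (\<lambda>x. \<bar>Y n x - X x\<bar>)" using sq(3) by (auto simp: square_integrable_def)
        from Cauchy_Schwarz_integral[OF this square_integrable_const[of 1]]
        show "(expectation (\<lambda>x. \<bar>Y n x - X x\<bar> * 1))\<^sup>2 \<le> expectation (\<lambda>x. (Y n x - X x)\<^sup>2)"
          by (simp add: prob_space)
      qed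
      finally show ?thesis .
    qed
    then show "\<forall>\<^sub>F n in sequentially. norm (expectation (\<lambda>x. iexp (Y n x)) - expectation (\<lambda>x. iexp (X x)))
        \<le> sqrt (expectation (\<lambda>x. (Y n x - X x)\<^sup>2))" by simp
    have "(\<lambda>n. expectation (\<lambda>x. (Y n x - X x)\<^sup>2)) \<longlonglongrightarrow> 0" using assms by (simp add: msq_limit_def)
    then show "(\<lambda>n. sqrt (expectation (\<lambda>x. (Y n x - X x)\<^sup>2))) \<longlonglongrightarrow> 0"
      by (auto intro!: tendsto_eq_intros)
  qed
  then show ?thesis by (simp add: LIM_zero_iff)
qed

lemma msq_limit_lincomb:
  assumes "msq_limit Y X" "msq_limit Y' X'"
  shows "msq_limit (\<lambda>n x. a * Y n x + b * Y' n x) (\<lambda>x. a * X x + b * X' x)"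
  unfolding msq_limit_def
proof (intro conjI allI)
  have sq: "square_integrable M (Y n)" "square_integrable M X" "square_integrable M (\<lambda>x. Y n x - X x)"
     "square_integrable M (Y' n)" "square_integrable M X'" "square_integrable M (\<lambda>x. Y' n x - X' x)" for n
    using assms by (auto simp: msq_limit_def intro: square_integrable_diff)
  show "square_integrable M (\<lambda>x. a * Y n x + b * Y' n x)" for n
    using sq by (intro square_integrable_add square_integrable_scale)
  show "square_integrable M (\<lambda>x. a * X x + b * X' x)"
    using sq by (intro square_integrable_add square_integrable_scale)
  show "(\<lambda>n. expectation (\<lambda>x. (a * Y n x + b * Y' n x - (a * X x + b * X' x))\<^sup>2)) \<longlonglongrightarrow> 0"
  proof (rule Lim_null_comparison)
    have "expectation (\<lambda>x. (a * Y n x + b * Y' n x - (a * X x + b * X' x))\<^sup>2)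
       \<le> 2 * a\<^sup>2 * expectation (\<lambda>x. (Y n x - X x)\<^sup>2) + 2 * b\<^sup>2 * expectation (\<lambda>x. (Y' n x - X' x)\<^sup>2)" for n
    proof -
      have "(a * y + b * y' - (a * u + b * u'))\<^sup>2 \<le> 2 * a\<^sup>2 * (y - u)\<^sup>2 + 2 * b\<^sup>2 * (y' - u')\<^sup>2" for y y' u u'
        using sum_squares_bound[of "a * (y - u)" "b * (y' - u')"]
        by (simp add: power2_eq_square algebra_simps)
      then have "expectation (\<lambda>x. (a * Y n x + b * Y' n x - (a * X x + b * X' x))\<^sup>2)
        \<le> expectation (\<lambda>x. 2 * a\<^sup>2 * (Y n x - X x)\<^sup>2 + 2 * b\<^sup>2 * (Y' n x - X' x)\<^sup>2)"
        using sq(3,6)[of n] by (intro integral_mono') (auto simp: square_integrable_def)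
      then show ?thesis using sq(3,6)[of n] by (simp add: square_integrable_def)
    qed
    then show "\<forall>\<^sub>F n in sequentially. norm (expectation (\<lambda>x. (a * Y n x + b * Y' n x - (a * X x + b * X' x))\<^sup>2))
       \<le> 2 * a\<^sup>2 * expectation (\<lambda>x. (Y n x - X x)\<^sup>2) + 2 * b\<^sup>2 * expectation (\<lambda>x. (Y' n x - X' x)\<^sup>2)"
      by simp
    show "(\<lambda>n. 2 * a\<^sup>2 * expectation (\<lambda>x. (Y n x - X x)\<^sup>2) + 2 * b\<^sup>2 * expectation (\<lambda>x. (Y' n x - X' x)\<^sup>2)) \<longlonglongrightarrow> 0"
      using assms by (auto simp: msq_limit_def intro!: tendsto_eq_intros)
  qed
qed

end

text \<open>
  Levy's uniqueness theorem concerns probability measures; the value of the characteristic function at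
  \<open>0\<close> is the total mass, by which both measures are divided.
\<close>

lemma finite_measure_eqI_char:
  fixes M N :: "real measure"
  assumes "finite_measure M" "finite_measure N" and sets [measurable_cong]: "sets M = sets borel" "sets N = sets borel"
    and char: "\<And>t. (CLINT x|M. iexp (t * x)) = (CLINT x|N. iexp (t * x))"
  shows "M = N"
proof -
  interpret M: finite_measure M by fact
  interpret N: finite_measure N by fact
  have sp: "space M = UNIV" "space N = UNIV" using sets by (auto dest: sets_eq_imp_space_eq)
  have meas: "measure M UNIV = measure N UNIV"
    using char[of 0] sp by simp
  define m where "m = measure M UNIV"
  show ?thesis
  proof (cases "m = 0")
    case True
    then have "emeasure M UNIV = 0" "emeasure N UNIV = 0"
      using meas by (simp_all add: m_def M.emeasure_eq_measure N.emeasure_eq_measure)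
    then have "emeasure M A = 0" "emeasure N A = 0" for A
      using emeasure_mono[of A UNIV M] emeasure_mono[of A UNIV N] sets by auto
    then show ?thesis using sets by (intro measure_eqI) auto
  next
    case False
    then have m: "m > 0" by (simp add: m_def less_le)
    have real: "real_distribution (density K (\<lambda>x. ennreal (1 / m)))"
      if "sets K = sets borel" "finite_measure K" "measure K UNIV = m" for K :: "real measure"
    proof -
      interpret K: finite_measure K by fact
      have sp: "space K = UNIV" using sets_eq_imp_space_eq[OF that(1)] by simp
      then have "emeasure (density K (\<lambda>x. ennreal (1 / m))) (space K) = 1"
        using m that by (simp add: emeasure_density_const K.emeasure_eq_measure ennreal_mult'[symmetric])
      then have "prob_space (density K (\<lambda>x. ennreal (1 / m)))"
        by (intro prob_spaceI) simp
      then show ?thesis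
        using that(1) sp by (simp add: real_distribution_def real_distribution_axioms_def)
    qed
    have "density M (\<lambda>x. ennreal (1 / m)) = density N (\<lambda>x. ennreal (1 / m))"
    proof (rule Levy_uniqueness)
      show "char (density M (\<lambda>x. ennreal (1 / m))) = char (density N (\<lambda>x. ennreal (1 / m)))"
        using char m by (auto simp: char_def fun_eq_iff integral_density)
    qed (use real[OF sets(1) assms(1)] real[OF sets(2) assms(2)] meas in \<open>simp_all add: m_def\<close>)
    then have eq: "emeasure (density M (\<lambda>x. ennreal (1 / m))) A = emeasure (density N (\<lambda>x. ennreal (1 / m))) A" for A
      by simp
    show ?thesis
    proof (rule measure_eqI)
      fix A assume A: "A \<in> sets M"
      have "ennreal (1 / m) * emeasure M A = ennreal (1 / m) * emeasure N A"
        using eq[of A] A sets by (simp add: emeasure_density_const)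
      then show "emeasure M A = emeasure N A" using m by (simp add: ennreal_mult_cancel_left)
    qed (simp add: sets)
  qed
qed

text \<open>
  The previous lemma in the form in which it is used: the finite measures are laws of random variables under
  densities.
\<close>

lemma weighted_law_eqI_char:
  fixes M :: "'a measure" and N :: "'b measure"
  assumes u [measurable]: "integrable M u" "\<And>x. 0 \<le> u x" and v [measurable]: "integrable N v" "\<And>x. 0 \<le> v x"
    and [measurable]: "f \<in> borel_measurable M" "g \<in> borel_measurable N"
    and char: "\<And>t. (CLINT x|M. of_real (u x) * iexp (t * f x)) = (CLINT x|N. of_real (v x) * iexp (t * g x))"
  shows "distr (density M u) borel f = distr (density N v) borel g"
proof (rule finite_measure_eqI_char)
  have "finite_measure (density K w)" if "integrable K w" "\<And>x. 0 \<le> w x" for K and w :: "_ \<Rightarrow> real"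
    using that by (intro finite_measureI) (auto simp: emeasure_density integrable_iff_bounded cong: nn_integral_cong)
  then show "finite_measure (distr (density M u) borel f)" "finite_measure (distr (density N v) borel g)"
    using u v by (auto intro!: finite_measure.finite_measure_distr)
  show "(CLINT x|distr (density M u) borel f. iexp (t * x)) = (CLINT x|distr (density N v) borel g. iexp (t * x))" for t
    using char[of t] u(2) v(2) by (simp add: integral_distr integral_density scaleR_conv_of_real)
qed auto

text \<open>
  The events that finitely many functionals take values in given Borel sets form a
  \<open>\<inter>\<close>-stable generator of the Borel sets. Equality on these events follows by induction on the number of
  functionals: one more functional \<open>l'\<close> is added by applying uniqueness of one-dimensional characteristic
  functions to the law of \<open>l'\<close> under a weighted measure.
\<close>

lemma finite_measure_eqI_char_functional:
  fixes M N :: "'a::{real_normed_vector,second_countable_topology} measure"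
  assumes "finite_measure M" "finite_measure N" and sets [measurable_cong]: "sets M = sets borel" "sets N = sets borel"
    and char: "\<And>l :: 'a \<Rightarrow> real. bounded_linear l \<Longrightarrow> (CLINT x|M. iexp (l x)) = (CLINT x|N. iexp (l x))"
  shows "M = N"
proof -
  interpret M: finite_measure M by fact
  interpret N: finite_measure N by fact
  define cyl where "cyl ls = {x :: 'a. \<forall>(l, B)\<in>set ls. l x \<in> B}" for ls :: "(('a \<Rightarrow> real) \<times> real set) list"
  define ok where "ok ls \<longleftrightarrow> (\<forall>(l, B)\<in>set ls. bounded_linear l \<and> B \<in> sets borel)" for ls :: "(('a \<Rightarrow> real) \<times> real set) list"
  have lin: "l \<in> borel_measurable borel" if "bounded_linear l" for l :: "'a \<Rightarrow> real"
    by (rule borel_measurable_continuous_onI[OF linear_continuous_on[OF that]])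
  have cyl_Cons: "cyl ((l, B) # ls) = cyl ls \<inter> l -` B" for l B ls
    by (auto simp: cyl_def)
  have cyl_meas: "cyl ls \<in> sets borel" if "ok ls" for ls
    using that
  proof (induction ls)
    case (Cons p ls)
    obtain l B where p: "p = (l, B)" by fastforce
    have "l -` B \<in> sets borel"
      using measurable_sets[OF lin[of l], of B] Cons.prems by (simp add: p ok_def)
    then show ?case using Cons by (simp add: p cyl_Cons ok_def)
  qed (simp add: cyl_def)
  have key: "(CLINT x|M. of_real (indicator (cyl ls) x) * iexp (l x)) = (CLINT x|N. of_real (indicator (cyl ls) x) * iexp (l x))"
    if "ok ls" "bounded_linear l" for ls l
    using that
  proof (induction ls arbitrary: l)
    case Nil
    then show ?case using char by (simp add: cyl_def)
  next
    case (Cons p ls)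
    obtain l' B where p: "p = (l', B)" by fastforce
    have l': "bounded_linear l'" and B [measurable]: "B \<in> sets borel" and ok: "ok ls"
      using Cons.prems by (auto simp: ok_def p)
    note [measurable] = lin[OF l'] lin[OF \<open>bounded_linear l\<close>] cyl_meas[OF ok]
    have IH: "(CLINT x|M. of_real (indicator (cyl ls) x) * iexp (a * l x + t * l' x))
        = (CLINT x|N. of_real (indicator (cyl ls) x) * iexp (a * l x + t * l' x))" for a t
      using Cons.IH[OF ok, of "\<lambda>x. a * l x + t * l' x"] l' \<open>bounded_linear l\<close>
      by (simp add: bounded_linear_add bounded_linear_const_mult)
    have int: "integrable M (\<lambda>x. of_real (indicator (cyl ls) x) * iexp (f x))"
         "integrable N (\<lambda>x. of_real (indicator (cyl ls) x) * iexp (f x))"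
      if [measurable]: "f \<in> borel_measurable borel" for f
      by (auto intro!: M.integrable_const_bound[of _ 1] N.integrable_const_bound[of _ 1]
           simp: norm_mult split: split_indicator)
    \<comment> \<open>Uniqueness needs nonnegative weights, and \<open>iexp (l x)\<close> is complex. The constant \<open>2\<close> makes the
      weight \<open>2 + Re (c * iexp (l x))\<close> nonnegative, and the choices \<open>c = 0, 1, - \<i>\<close> recover \<open>iexp (l x)\<close>.\<close>
    have law: "(\<integral>x. indicator (cyl ls) x * (2 + w x) * indicator B (l' x) \<partial>M)
         = (\<integral>x. indicator (cyl ls) x * (2 + w x) * indicator B (l' x) \<partial>N)"
      if w: "w = (\<lambda>x. Re (c * iexp (l x)))" and c: "norm c \<le> 1" for w c
    proof -
      have wb: "\<bar>w x\<bar> \<le> 1" for x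
        using abs_Re_le_cmod[of "c * iexp (l x)"] c by (simp add: w norm_mult)
      have [measurable]: "w \<in> borel_measurable borel" unfolding w by measurable
      have nn: "0 \<le> indicator (cyl ls) x * (2 + w x)" for x
        using wb[of x] by (auto split: split_indicator simp: abs_le_iff)
      have "distr (density M (\<lambda>x. indicator (cyl ls) x * (2 + w x))) borel l'
          = distr (density N (\<lambda>x. indicator (cyl ls) x * (2 + w x))) borel l'"
      proof (rule weighted_law_eqI_char)
        fix t
        define F where "F a x = of_real (indicator (cyl ls) x) * iexp (a * l x + t * l' x)" for a x
        have F: "integrable M (F a)" "integrable N (F a)" "(CLINT x|M. F a x) = (CLINT x|N. F a x)" for a
          unfolding F_def using int[of "\<lambda>x. a * l x + t * l' x"] IH[of a t] by simp_all
        have dec: "of_real (indicator (cyl ls) x * (2 + w x)) * iexp (t * l' x)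
           = 2 * F 0 x + (c / 2) * F 1 x + (cnj c / 2) * F (- 1) x" for x
        proof -
          have 1: "of_real (w x) = (c * iexp (l x) + cnj c * iexp (- l x)) / 2"
            unfolding w by (simp add: complex_eq_iff Re_exp Im_exp)
          have 2: "F 0 x = of_real (indicator (cyl ls) x) * iexp (t * l' x)"
            "F 1 x = of_real (indicator (cyl ls) x) * (iexp (l x) * iexp (t * l' x))"
            "F (- 1) x = of_real (indicator (cyl ls) x) * (iexp (- l x) * iexp (t * l' x))"
            by (simp_all add: F_def exp_add[symmetric] algebra_simps)
          show ?thesis unfolding 2 of_real_mult of_real_add 1 by (simp add: field_simps)
        qed
        show "(CLINT x|M. of_real (indicator (cyl ls) x * (2 + w x)) * iexp (t * l' x))
            = (CLINT x|N. of_real (indicator (cyl ls) x * (2 + w x)) * iexp (t * l' x))"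
          unfolding dec using F by simp
      next
        have b: "\<bar>indicator (cyl ls) x * (2 + w x)\<bar> \<le> 3" for x
          using wb[of x] by (auto split: split_indicator simp: abs_le_iff)
        then show "integrable M (\<lambda>x. indicator (cyl ls) x * (2 + w x))"
            "integrable N (\<lambda>x. indicator (cyl ls) x * (2 + w x))"
          by (auto intro!: M.integrable_const_bound[of _ 3] N.integrable_const_bound[of _ 3])
      qed (use nn in auto)
      moreover have K: "(\<integral>y. indicator B y \<partial>distr (density K (\<lambda>x. indicator (cyl ls) x * (2 + w x))) borel l')
          = (\<integral>x. indicator (cyl ls) x * (2 + w x) * indicator B (l' x) \<partial>K)"
        if [measurable_cong]: "sets K = sets borel" for K
        using nn by (subst integral_distr, measurable, subst integral_real_density) auto
      ultimately show ?thesis using K[OF sets(1)] K[OF sets(2)] by (simp only:)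
    qed
    have intR: "integrable M (\<lambda>x. indicator (cyl ls) x * Re (c * iexp (l x)) * indicator B (l' x))"
         "integrable N (\<lambda>x. indicator (cyl ls) x * Re (c * iexp (l x)) * indicator B (l' x))" for c
    proof -
      have b: "\<bar>indicator (cyl ls) x * Re (c * iexp (l x)) * indicator B (l' x)\<bar> \<le> norm c" for x
        using abs_Re_le_cmod[of "c * iexp (l x)"] by (auto split: split_indicator simp: norm_mult)
      then show "integrable M (\<lambda>x. indicator (cyl ls) x * Re (c * iexp (l x)) * indicator B (l' x))"
         "integrable N (\<lambda>x. indicator (cyl ls) x * Re (c * iexp (l x)) * indicator B (l' x))"
        by (auto intro!: M.integrable_const_bound[of _ "norm c"] N.integrable_const_bound[of _ "norm c"])
    qed
    have int0: "integrable M (\<lambda>x. indicator (cyl ls) x * indicator B (l' x) :: real)"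
         "integrable N (\<lambda>x. indicator (cyl ls) x * indicator B (l' x) :: real)"
      by (auto intro!: M.integrable_const_bound[of _ 1] N.integrable_const_bound[of _ 1] split: split_indicator)
    have re: "(\<integral>x. indicator (cyl ls) x * Re (c * iexp (l x)) * indicator B (l' x) \<partial>M)
         = (\<integral>x. indicator (cyl ls) x * Re (c * iexp (l x)) * indicator B (l' x) \<partial>N)" if "norm c \<le> 1" for c
    proof -
      have "indicator (cyl ls) x * (2 + Re (d * iexp (l x))) * indicator B (l' x)
          = 2 * (indicator (cyl ls) x * indicator B (l' x)) + indicator (cyl ls) x * Re (d * iexp (l x)) * indicator B (l' x)" for x d
        by (simp add: algebra_simps)
      note eq = this
      have "(\<integral>x. 2 * (indicator (cyl ls) x * indicator B (l' x)) \<partial>M)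
          = (\<integral>x. 2 * (indicator (cyl ls) x * indicator B (l' x)) \<partial>N :: real)"
        using law[OF refl, of 0] unfolding eq by simp
      then have "(\<integral>x. indicator (cyl ls) x * indicator B (l' x) \<partial>M)
          = (\<integral>x. indicator (cyl ls) x * indicator B (l' x) \<partial>N :: real)"
        by simp
      then show ?thesis
        using law[OF refl that] int0 intR[of c] unfolding eq
        by (simp del: times_complex.sel)
    qed
    define h where "h x = of_real (indicator (cyl (p # ls)) x) * iexp (l x)" for x
    have Re_h: "Re (h x) = indicator (cyl ls) x * Re (1 * iexp (l x)) * indicator B (l' x)"
       and Im_h: "Im (h x) = indicator (cyl ls) x * Re ((- \<i>) * iexp (l x)) * indicator B (l' x)" for x
      by (auto simp: h_def p cyl_Cons split: split_indicator)
    have hm [measurable]: "h \<in> borel_measurable borel"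
      using cyl_meas[OF Cons.prems(1)] unfolding h_def by measurable
    have inth: "integrable M h" "integrable N h"
      by (auto intro!: M.integrable_const_bound[of _ 1] N.integrable_const_bound[of _ 1]
           simp: h_def norm_mult split: split_indicator)
    have "(CLINT x|M. h x) = (CLINT x|N. h x)"
      by (rule complex_eqI) (use re[of 1] re[of "-\<i>"] inth in \<open>simp_all add: Re_h Im_h flip: integral_Re integral_Im\<close>)
    then show ?case by (simp add: h_def)
  qed
  have eq: "emeasure M (cyl ls) = emeasure N (cyl ls)" if "ok ls" for ls
  proof -
    note [measurable] = cyl_meas[OF that]
    have "complex_of_real (measure M (cyl ls)) = complex_of_real (measure N (cyl ls))"
      using key[OF that bounded_linear_zero] sets_eq_imp_space_eq[OF sets(1)] sets_eq_imp_space_eq[OF sets(2)] by simp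
    then show ?thesis by (simp add: M.emeasure_eq_measure N.emeasure_eq_measure)
  qed
  show ?thesis
  proof (rule measure_eqI_generator_eq[where E = "{cyl ls | ls. ok ls}" and \<Omega> = UNIV and A = "\<lambda>_. UNIV"])
    show "Int_stable {cyl ls | ls. ok ls}"
    proof (rule Int_stableI)
      fix a b assume "a \<in> {cyl ls | ls. ok ls}" "b \<in> {cyl ls | ls. ok ls}"
      then obtain ls ms where *: "a = cyl ls" "b = cyl ms" "ok ls" "ok ms"
        by (elim CollectE exE conjE)
      then have "a \<inter> b = cyl (ls @ ms)" "ok (ls @ ms)" by (auto simp: cyl_def ok_def)
      then show "a \<inter> b \<in> {cyl ls | ls. ok ls}" by (intro CollectI exI[of _ "ls @ ms"] conjI)
    qed
    have gen: "sets (borel :: 'a measure) = sigma_sets UNIV {cyl ls | ls. ok ls}"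
    proof
      have "{l -` B | l B. bounded_linear (l :: 'a \<Rightarrow> real) \<and> B \<in> sets borel} \<subseteq> {cyl ls | ls. ok ls}"
      proof clarify
        fix l :: "'a \<Rightarrow> real" and B :: "real set" assume "bounded_linear l" "B \<in> sets borel"
        then have "l -` B = cyl [(l, B)]" "ok [(l, B)]" by (auto simp: cyl_def ok_def)
        then show "\<exists>ls. l -` B = cyl ls \<and> ok ls" by (intro exI[of _ "[(l, B)]"] conjI)
      qed
      then show "sets (borel :: 'a measure) \<subseteq> sigma_sets UNIV {cyl ls | ls. ok ls}"
        by (rule ord_eq_le_trans[OF borel_eq_sigma_functionals sigma_sets_mono'])
      show "sigma_sets UNIV {cyl ls | ls. ok ls} \<subseteq> sets (borel :: 'a measure)"
        using cyl_meas by (intro sets.sigma_sets_subset[of _ borel, simplified]) auto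
    qed
    show "sets M = sigma_sets UNIV {cyl ls | ls. ok ls}" "sets N = sigma_sets UNIV {cyl ls | ls. ok ls}"
      using sets gen by auto
    have "cyl [] \<in> {cyl ls | ls. ok ls}" by (rule CollectI, rule exI[of _ "[]"]) (simp add: ok_def)
    then have "UNIV \<in> {cyl ls | ls. ok ls}" by (simp add: cyl_def)
    then show "range (\<lambda>_. UNIV) \<subseteq> {cyl ls | ls. ok ls}" by (simp add: image_subset_iff)
    fix X assume "X \<in> {cyl ls | ls. ok ls}"
    then obtain ls where "X = cyl ls" "ok ls" by (elim CollectE exE conjE)
    then show "emeasure M X = emeasure N X" using eq[of ls] by simp
  next
    show "{cyl ls | ls. ok ls} \<subseteq> Pow UNIV" by (simp only: Pow_UNIV subset_UNIV)
    show "(\<Union>i :: nat. UNIV :: 'a set) = UNIV" by simp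
    show "emeasure M UNIV \<noteq> \<infinity>" by (simp only: M.emeasure_eq_measure) simp
  qed
qed

section \<open>Gaussian measures on separable Banach spaces\<close>

lemma char_centred_normal:
  assumes "0 < \<sigma>"
  shows "(CLINT x|density lborel (normal_density 0 \<sigma>). iexp (t * x)) = exp (- (\<sigma>\<^sup>2 * t\<^sup>2 / 2))"
proof -
  have "(CLINT x|density lborel (normal_density 0 \<sigma>). iexp (t * x))
      = (\<integral>x. normal_density 0 \<sigma> x *\<^sub>R iexp (t * x) \<partial>lborel)"
    by (subst integral_density) auto
  also have "\<dots> = \<bar>\<sigma>\<bar> *\<^sub>R (\<integral>x. normal_density 0 \<sigma> (0 + \<sigma> * x) *\<^sub>R iexp (t * (0 + \<sigma> * x)) \<partial>lborel)"
    using assms by (intro lborel_integral_real_affine) simp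
  also have "\<dots> = (\<integral>x. \<sigma> *\<^sub>R normal_density 0 \<sigma> (\<sigma> * x) *\<^sub>R iexp (t * (\<sigma> * x)) \<partial>lborel)"
    using assms by (simp flip: integral_scaleR_right)
  also have "\<dots> = (\<integral>x. std_normal_density x *\<^sub>R iexp ((\<sigma> * t) * x) \<partial>lborel)"
    using assms
    by (intro Bochner_Integration.integral_cong)
       (auto simp: normal_density_def power_mult_distrib real_sqrt_mult mult_ac)
  also have "\<dots> = char std_normal_distribution (\<sigma> * t)"
    unfolding char_def by (subst integral_density) auto
  also have "\<dots> = exp (- (\<sigma>\<^sup>2 * t\<^sup>2 / 2))"
    by (simp add: char_std_normal_distribution power_mult_distrib)
  finally show ?thesis .
qed

text \<open>The one-dimensional Cameron--Martin formula.\<close>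

lemma normal_density_exponential_tilt:
  assumes "0 < \<sigma>"
  shows "normal_density 0 \<sigma> y * exp (y - \<sigma>\<^sup>2 / 2) = normal_density (\<sigma>\<^sup>2) \<sigma> y"
proof -
  have "- (y - 0)\<^sup>2 / (2 * \<sigma>\<^sup>2) + (y - \<sigma>\<^sup>2 / 2) = - (y - \<sigma>\<^sup>2)\<^sup>2 / (2 * \<sigma>\<^sup>2)"
    using assms by (simp add: field_simps power2_eq_square)
  then show ?thesis unfolding normal_density_def
    by (simp add: exp_add[symmetric])
qed

locale gaussian_measure =
  fixes P :: "'w::{banach,second_countable_topology} measure"
  assumes gaussian: "centred_gaussian P"
begin

abbreviation "Q \<equiv> completion P"

sublocale base: prob_space P
  using gaussian by (simp add: centred_gaussian_def)

sublocale prob_space Q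
  by (intro prob_spaceI) (simp add: base.emeasure_space_1)

lemma sets_P [measurable_cong]: "sets P = sets borel"
  using gaussian by (simp add: centred_gaussian_def)

lemma space_P [simp]: "space P = UNIV"
  using sets_eq_imp_space_eq[OF sets_P] by simp

lemma prob_UNIV [simp]: "measure P UNIV = 1"
  using base.prob_space by simp

lemma borel_imp_Q_measurable: "f \<in> measurable borel N \<Longrightarrow> f \<in> measurable Q N"
  by (rule measurable_completion) (simp add: measurable_cong_sets[OF sets_P refl])

lemma functional_borel: "bounded_linear l \<Longrightarrow> l \<in> borel_measurable borel" for l :: "'w \<Rightarrow> real"
  by (rule borel_measurable_continuous_onI[OF linear_continuous_on])

lemma functional_law:
  fixes l :: "'w \<Rightarrow> real"
  assumes l: "bounded_linear l"
  shows "square_integrable Q l" (is ?A)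
    and "(CLINT \<omega>|Q. iexp (l \<omega>)) = exp (- (expectation (\<lambda>\<omega>. (l \<omega>)\<^sup>2) / 2))" (is ?B)
proof -
  note [measurable] = functional_borel[OF l]
  have lP [measurable]: "l \<in> borel_measurable P" by measurable
  have lQ [measurable]: "l \<in> borel_measurable Q" by (rule measurable_completion) measurable
  obtain \<sigma> where \<sigma>: "\<sigma> \<ge> 0" "distr P borel l =
           (if \<sigma> = 0 then return borel 0 else density lborel (normal_density 0 \<sigma>))"
    using gaussian l by (auto simp: centred_gaussian_def)
  let ?D = "distr Q borel l"
  have D: "?D = (if \<sigma> = 0 then return borel 0 else density lborel (normal_density 0 \<sigma>))"
    using \<sigma>(2) distr_completion[OF lP] by simp
  have "integrable ?D (\<lambda>x. x\<^sup>2) \<and> (\<integral>x. x\<^sup>2 \<partial>?D) = \<sigma>\<^sup>2 \<and> (CLINT x|?D. iexp (1 * x)) = exp (- (\<sigma>\<^sup>2 / 2))"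
  proof (cases "\<sigma> = 0")
    case True
    interpret R: prob_space "return borel (0::real)" by (rule prob_space_return) simp
    have "AE x in return borel (0::real). x\<^sup>2 = 0" by (simp add: AE_return)
    then have "integrable (return borel (0::real)) (\<lambda>x. x\<^sup>2)"
      by (intro R.integrable_const_bound[of _ 0]) auto
    then show ?thesis using True by (simp add: D integral_return)
  next
    case False
    then have "\<sigma> > 0" using \<sigma>(1) by simp
    have "has_bochner_integral lborel (\<lambda>x. normal_density 0 \<sigma> x * x\<^sup>2) (\<sigma>\<^sup>2)"
      using normal_moment_even[OF \<open>\<sigma> > 0\<close>, of 0 1] \<open>\<sigma> > 0\<close> by (simp add: fact_numeral)
    then have "has_bochner_integral (density lborel (normal_density 0 \<sigma>)) (\<lambda>x. x\<^sup>2) (\<sigma>\<^sup>2)"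
      by (intro has_bochner_integral_density) auto
    then show ?thesis using False char_centred_normal[OF \<open>\<sigma> > 0\<close>, of 1]
      by (simp add: D has_bochner_integral_iff)
  qed
  then have *: "integrable Q (\<lambda>\<omega>. (l \<omega>)\<^sup>2)" "expectation (\<lambda>\<omega>. (l \<omega>)\<^sup>2) = \<sigma>\<^sup>2"
      "(CLINT \<omega>|Q. iexp (l \<omega>)) = exp (- (\<sigma>\<^sup>2 / 2))"
    by (simp_all add: integrable_distr_eq integral_distr)
  then show ?A ?B by (auto simp: square_integrable_def)
qed

text \<open>The closure of the dual of \<open>'w\<close> in \<open>L\<^sup>2\<close>: a linear space of Gaussian random variables.\<close>

definition gaussian_space :: "('w \<Rightarrow> real) set" where
  "gaussian_space = {X. \<exists>l. (\<forall>n. bounded_linear (l n)) \<and> msq_limit l X}"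

lemma gaussian_space_square_integrable: "X \<in> gaussian_space \<Longrightarrow> square_integrable Q X"
  by (auto simp: gaussian_space_def msq_limit_def)

lemma functional_in_gaussian_space: "bounded_linear l \<Longrightarrow> l \<in> gaussian_space"
  unfolding gaussian_space_def
  by (rule CollectI, rule exI[of _ "\<lambda>_. l"]) (simp add: msq_limit_def functional_law(1))

lemma gaussian_spaceE:
  assumes "X \<in> gaussian_space"
  obtains l where "\<And>n. bounded_linear (l n)" "msq_limit l X"
  using assms unfolding gaussian_space_def by auto

lemma gaussian_space_lincomb:
  assumes "X \<in> gaussian_space" "Y \<in> gaussian_space"
  shows "(\<lambda>\<omega>. a * X \<omega> + b * Y \<omega>) \<in> gaussian_space"
proof -
  obtain l where l: "\<And>n. bounded_linear (l n)" "msq_limit l X"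
    using gaussian_spaceE[OF assms(1)] by metis
  obtain k where k: "\<And>n. bounded_linear (k n)" "msq_limit k Y"
    using gaussian_spaceE[OF assms(2)] by metis
  have "bounded_linear (\<lambda>\<omega>. a * l n \<omega> + b * k n \<omega>)" for n
    using l(1) k(1) by (intro bounded_linear_add bounded_linear_const_mult)
  with msq_limit_lincomb[OF l(2) k(2), of a b] show ?thesis
    unfolding gaussian_space_def by (intro CollectI exI[of _ "\<lambda>n \<omega>. a * l n \<omega> + b * k n \<omega>"]) simp
qed

text \<open>Characteristic functions of functionals are known, and mean square limits carry them over.\<close>

lemma gaussian_space_char:
  assumes "X \<in> gaussian_space"
  shows "(CLINT \<omega>|Q. iexp (X \<omega>)) = exp (- (expectation (\<lambda>\<omega>. (X \<omega>)\<^sup>2) / 2))"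
proof -
  obtain l where l: "\<And>n. bounded_linear (l n)" "msq_limit l X"
    using gaussian_spaceE[OF assms] by metis
  have "(\<lambda>n. CLINT \<omega>|Q. iexp (l n \<omega>)) \<longlonglongrightarrow> exp (- (expectation (\<lambda>\<omega>. (X \<omega>)\<^sup>2) / 2))"
    unfolding functional_law(2)[OF l(1)]
    by (intro tendsto_intros tendsto_of_real msq_limit_square l) auto
  then show ?thesis using msq_limit_iexp[OF l(2)] LIMSEQ_unique by blast
qed

lemma gaussian_space_law:
  assumes X: "X \<in> gaussian_space" and \<sigma>: "0 < \<sigma>" "expectation (\<lambda>\<omega>. (X \<omega>)\<^sup>2) = \<sigma>\<^sup>2"
  shows "distr Q borel X = density lborel (normal_density 0 \<sigma>)"
proof (rule finite_measure_eqI_char)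
  have [measurable]: "X \<in> borel_measurable Q"
    using gaussian_space_square_integrable[OF X] by (simp add: square_integrable_def)
  show "finite_measure (distr Q borel X)" by (rule finite_measure_distr) measurable
  interpret N: prob_space "density lborel (normal_density 0 \<sigma>)"
    by (rule prob_space_normal_density[OF \<sigma>(1)])
  show "finite_measure (density lborel (normal_density 0 \<sigma>))" by (rule N.finite_measure_axioms)
  fix t
  have "(\<lambda>\<omega>. t * X \<omega> + 0 * X \<omega>) \<in> gaussian_space" by (rule gaussian_space_lincomb[OF X X])
  from gaussian_space_char[OF this]
  show "(CLINT x|distr Q borel X. iexp (t * x)) = (CLINT x|density lborel (normal_density 0 \<sigma>). iexp (t * x))"
    using \<sigma> char_centred_normal[OF \<sigma>(1), of t] by (simp add: integral_distr power_mult_distrib mult_ac)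
qed auto

text \<open>
  Uncorrelated elements of a Gaussian space are independent, because the characteristic function of their
  joint law factorises. The form stated here, with a function of \<open>Y\<close> that need not be bounded, is
  the one to which exponential densities can be applied.
\<close>

lemma gaussian_space_independent:
  assumes X: "X \<in> gaussian_space" and Y: "Y \<in> gaussian_space"
    and orth: "expectation (\<lambda>\<omega>. X \<omega> * Y \<omega>) = 0"
    and \<psi> [measurable]: "\<psi> \<in> borel_measurable borel" and int: "integrable Q (\<lambda>\<omega>. \<psi> (Y \<omega>))"
  shows "(CLINT \<omega>|Q. iexp (X \<omega>) * \<psi> (Y \<omega>)) = (CLINT \<omega>|Q. iexp (X \<omega>)) * (CLINT \<omega>|Q. \<psi> (Y \<omega>))"
proof -
  note sq = gaussian_space_square_integrable[OF X] gaussian_space_square_integrable[OF Y]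
  have [measurable]: "X \<in> borel_measurable Q" "Y \<in> borel_measurable Q"
    using sq by (auto simp: square_integrable_def)
  define e where "e = exp (- (expectation (\<lambda>\<omega>. (X \<omega>)\<^sup>2) / 2))"
  have char: "(CLINT \<omega>|Q. iexp (a * X \<omega> + t * Y \<omega>)) = of_real e * (CLINT \<omega>|Q. iexp (t * Y \<omega>))" if "\<bar>a\<bar> = 1" for a t
  proof -
    have a2: "a\<^sup>2 = 1" using that by (metis power2_abs power_one)
    have "expectation (\<lambda>\<omega>. (a * X \<omega> + t * Y \<omega>)\<^sup>2)
       = expectation (\<lambda>\<omega>. (X \<omega>)\<^sup>2 + (2 * a * t) * (X \<omega> * Y \<omega>) + t\<^sup>2 * (Y \<omega>)\<^sup>2)"
      using a2 by (intro Bochner_Integration.integral_cong) (auto simp: power2_sum power_mult_distrib mult_ac)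
    also have "\<dots> = expectation (\<lambda>\<omega>. (X \<omega>)\<^sup>2) + t\<^sup>2 * expectation (\<lambda>\<omega>. (Y \<omega>)\<^sup>2)"
      using sq square_integrable_mult[OF sq] orth by (simp add: square_integrable_def)
    finally have 1: "expectation (\<lambda>\<omega>. (a * X \<omega> + t * Y \<omega>)\<^sup>2)
       = expectation (\<lambda>\<omega>. (X \<omega>)\<^sup>2) + t\<^sup>2 * expectation (\<lambda>\<omega>. (Y \<omega>)\<^sup>2)" .
    have 2: "(CLINT \<omega>|Q. iexp (t * Y \<omega>)) = exp (- (t\<^sup>2 * expectation (\<lambda>\<omega>. (Y \<omega>)\<^sup>2) / 2))"
      using gaussian_space_char[OF gaussian_space_lincomb[OF Y Y, of t 0]] by (simp add: power_mult_distrib)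
    show ?thesis
      unfolding 2 gaussian_space_char[OF gaussian_space_lincomb[OF X Y, of a t]] 1 e_def
      by (simp only: of_real_mult[symmetric] exp_add[symmetric]) (simp add: add_divide_distrib)
  qed
  have eX: "(CLINT \<omega>|Q. iexp (X \<omega>)) = of_real e" using char[of 1 0] by (simp add: prob_space)
  \<comment> \<open>As above, \<open>2 + Re (c * iexp X)\<close> is a nonnegative weight from which \<open>iexp X\<close> is recovered.\<close>
  have law: "(CLINT \<omega>|Q. of_real (2 + Re (c * iexp (X \<omega>))) * \<psi> (Y \<omega>)) = of_real (2 + Re c * e) * (CLINT \<omega>|Q. \<psi> (Y \<omega>))"
    if c: "norm c \<le> 1" for c
  proof -
    define w where "w \<omega> = Re (c * iexp (X \<omega>))" for \<omega>
    have wb: "\<bar>w x\<bar> \<le> 1" for x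
      using abs_Re_le_cmod[of "c * iexp (X x)"] c by (simp add: w_def norm_mult)
    have [measurable]: "w \<in> borel_measurable Q" unfolding w_def by measurable
    have e: "0 < e" "e \<le> 1" by (auto simp: e_def)
    have m: "2 + Re c * e \<ge> 0"
    proof -
      have "\<bar>Re c * e\<bar> \<le> 1" using e abs_Re_le_cmod[of c] c by (simp add: abs_mult mult_le_one)
      then show ?thesis by linarith
    qed
    have nn: "0 \<le> 2 + w \<omega>" for \<omega> using wb[of \<omega>] by linarith
    have eq: "distr (density Q (\<lambda>\<omega>. 2 + w \<omega>)) borel Y = distr (density Q (\<lambda>\<omega>. 2 + Re c * e)) borel Y"
    proof (rule weighted_law_eqI_char)
      fix t
      define F where "F a \<omega> = iexp (a * X \<omega> + t * Y \<omega>)" for a \<omega>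
      have F: "integrable Q (F a)" for a
        unfolding F_def by (auto intro!: integrable_const_bound[of _ 1])
      have F': "(CLINT \<omega>|Q. F 1 \<omega>) = of_real e * (CLINT \<omega>|Q. F 0 \<omega>)" "(CLINT \<omega>|Q. F (- 1) \<omega>) = of_real e * (CLINT \<omega>|Q. F 0 \<omega>)"
        unfolding F_def using char[of 1 t] char[of "-1" t] by simp_all
      have dec: "of_real (2 + w \<omega>) * iexp (t * Y \<omega>) = 2 * F 0 \<omega> + (c / 2) * F 1 \<omega> + (cnj c / 2) * F (- 1) \<omega>" for \<omega>
      proof -
        have 1: "of_real (w \<omega>) = (c * iexp (X \<omega>) + cnj c * iexp (- X \<omega>)) / 2"
          unfolding w_def by (simp add: complex_eq_iff Re_exp Im_exp)
        have 2: "F 0 \<omega> = iexp (t * Y \<omega>)" "F 1 \<omega> = iexp (X \<omega>) * iexp (t * Y \<omega>)"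
          "F (- 1) \<omega> = iexp (- X \<omega>) * iexp (t * Y \<omega>)"
          by (simp_all add: F_def exp_add[symmetric] algebra_simps)
        show ?thesis unfolding 2 of_real_mult of_real_add 1 by (simp add: field_simps)
      qed
      have cc: "c + cnj c = 2 * of_real (Re c)" by (simp add: complex_eq_iff)
      have "(CLINT \<omega>|Q. of_real (2 + w \<omega>) * iexp (t * Y \<omega>)) = (2 + (c + cnj c) / 2 * of_real e) * (CLINT \<omega>|Q. F 0 \<omega>)"
        unfolding dec using F by (simp add: F' algebra_simps add_divide_distrib)
      also have "\<dots> = of_real (2 + Re c * e) * (CLINT \<omega>|Q. F 0 \<omega>)"
        unfolding cc by simp
      also have "\<dots> = (CLINT \<omega>|Q. of_real (2 + Re c * e) * iexp (t * Y \<omega>))" by (simp add: F_def)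
      finally show "(CLINT \<omega>|Q. of_real (2 + w \<omega>) * iexp (t * Y \<omega>)) = (CLINT \<omega>|Q. of_real (2 + Re c * e) * iexp (t * Y \<omega>))" .
    next
      have "\<bar>2 + w \<omega>\<bar> \<le> 3" for \<omega> using wb[of \<omega>] by linarith
      then show "integrable Q (\<lambda>\<omega>. 2 + w \<omega>)" by (intro integrable_const_bound[of _ 3]) auto
    qed (use nn m in auto)
    have "(CLINT \<omega>|Q. of_real (2 + w \<omega>) * \<psi> (Y \<omega>)) = (CLINT y|distr (density Q (\<lambda>\<omega>. 2 + w \<omega>)) borel Y. \<psi> y)"
      using nn by (subst integral_distr, measurable, subst integral_density) (auto simp: scaleR_conv_of_real)
    also have "\<dots> = of_real (2 + Re c * e) * (CLINT \<omega>|Q. \<psi> (Y \<omega>))"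
      unfolding eq using m by (subst integral_distr, measurable, subst integral_density) (auto simp: scaleR_conv_of_real)
    finally show ?thesis by (simp add: w_def)
  qed
  have intw: "integrable Q (\<lambda>\<omega>. of_real (Re (c * iexp (X \<omega>))) * \<psi> (Y \<omega>))" if "norm c \<le> 1" for c
  proof (rule Bochner_Integration.integrable_bound[OF int])
    have "\<bar>Re (c * iexp (X x))\<bar> \<le> 1" for x
      using abs_Re_le_cmod[of "c * iexp (X x)"] that by (simp add: norm_mult)
    then show "AE \<omega> in Q. norm (complex_of_real (Re (c * iexp (X \<omega>))) * \<psi> (Y \<omega>)) \<le> norm (\<psi> (Y \<omega>))"
      by (intro always_eventually allI) (simp add: norm_mult mult_left_le_one_le del: times_complex.sel)
  qed measurable
  have re: "(CLINT \<omega>|Q. of_real (Re (c * iexp (X \<omega>))) * \<psi> (Y \<omega>)) = of_real (Re c * e) * (CLINT \<omega>|Q. \<psi> (Y \<omega>))"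
    if "norm c \<le> 1" for c
  proof -
    define w where "w \<omega> = complex_of_real (Re (c * iexp (X \<omega>)))" for \<omega>
    define I where "I = (CLINT \<omega>|Q. \<psi> (Y \<omega>))"
    have "(CLINT \<omega>|Q. (2 + w \<omega>) * \<psi> (Y \<omega>)) = (2 + of_real (Re c * e)) * I"
      using law[OF that] unfolding w_def I_def by (simp only: of_real_add of_real_numeral)
    moreover have "(CLINT \<omega>|Q. (2 + w \<omega>) * \<psi> (Y \<omega>)) = 2 * I + (CLINT \<omega>|Q. w \<omega> * \<psi> (Y \<omega>))"
      using int intw[OF that, folded w_def] by (simp add: distrib_right I_def)
    ultimately show ?thesis unfolding w_def[symmetric] I_def[symmetric] by (simp add: distrib_right)
  qed
  have "iexp (X \<omega>) * \<psi> (Y \<omega>) = of_real (Re (1 * iexp (X \<omega>))) * \<psi> (Y \<omega>) + \<i> * (of_real (Re ((- \<i>) * iexp (X \<omega>))) * \<psi> (Y \<omega>))" for \<omega>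
  proof -
    have "iexp (X \<omega>) = of_real (Re (1 * iexp (X \<omega>))) + \<i> * of_real (Re ((- \<i>) * iexp (X \<omega>)))"
      by (simp add: complex_eq_iff)
    from arg_cong[OF this, of "\<lambda>z. z * \<psi> (Y \<omega>)"] show ?thesis
      by (simp only: distrib_right mult.assoc)
  qed
  note split = this
  define G where "G c \<omega> = of_real (Re (c * iexp (X \<omega>))) * \<psi> (Y \<omega>)" for c \<omega>
  have G: "integrable Q (G 1)" "integrable Q (G (- \<i>))"
    unfolding G_def using intw[of 1] intw[of "- \<i>"] by (simp_all only: norm_one norm_minus_cancel norm_ii order_refl simp_thms)
  have G1: "(CLINT \<omega>|Q. iexp (X \<omega>) * \<psi> (Y \<omega>)) = (CLINT \<omega>|Q. G 1 \<omega> + \<i> * G (- \<i>) \<omega>)"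
    by (rule Bochner_Integration.integral_cong[OF refl]) (unfold G_def, rule split)
  have G2: "(CLINT \<omega>|Q. G 1 \<omega>) = of_real (Re 1 * e) * (CLINT \<omega>|Q. \<psi> (Y \<omega>))"
    unfolding G_def by (rule re) simp
  have G3: "(CLINT \<omega>|Q. G (- \<i>) \<omega>) = of_real (Re (- \<i>) * e) * (CLINT \<omega>|Q. \<psi> (Y \<omega>))"
    unfolding G_def by (rule re) simp
  show ?thesis
    unfolding G1 eX using G by (simp add: G2 G3)
qed

end

section \<open>The Cameron--Martin theorem\<close>

context gaussian_measure
begin

lemma is_star_iff:
  "is_star P h g \<longleftrightarrow> g \<in> gaussian_space \<and> (\<forall>l::'w \<Rightarrow> real. bounded_linear l \<longrightarrow> expectation (\<lambda>\<omega>. l \<omega> * g \<omega>) = l h)"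
proof -
  have "(\<forall>n. bounded_linear (l n)) \<and> (\<lambda>n. \<integral>\<^sup>+\<omega>. ennreal ((l n \<omega> - g \<omega>)\<^sup>2) \<partial>Q) \<longlonglongrightarrow> 0
      \<longleftrightarrow> (\<forall>n. bounded_linear (l n)) \<and> msq_limit l g"
    if [measurable]: "g \<in> borel_measurable Q" for l :: "nat \<Rightarrow> 'w \<Rightarrow> real"
  proof (rule conj_cong[OF refl])
    assume l: "\<forall>n. bounded_linear (l n)"
    then have sl: "square_integrable Q (l n)" for n by (simp add: functional_law(1))
    then have [measurable]: "l n \<in> borel_measurable Q" for n by (simp add: square_integrable_def)
    have eq: "(\<integral>\<^sup>+\<omega>. ennreal ((l n \<omega> - g \<omega>)\<^sup>2) \<partial>Q) = ennreal (expectation (\<lambda>\<omega>. (l n \<omega> - g \<omega>)\<^sup>2))"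
      if "square_integrable Q g" for n
      using square_integrable_diff[OF sl that] by (intro nn_integral_eq_integral) (auto simp: square_integrable_def)
    show "(\<lambda>n. \<integral>\<^sup>+\<omega>. ennreal ((l n \<omega> - g \<omega>)\<^sup>2) \<partial>Q) \<longlonglongrightarrow> 0 \<longleftrightarrow> msq_limit l g"
    proof
      assume lim: "(\<lambda>n. \<integral>\<^sup>+\<omega>. ennreal ((l n \<omega> - g \<omega>)\<^sup>2) \<partial>Q) \<longlonglongrightarrow> 0"
      then have "\<forall>\<^sub>F n in sequentially. (\<integral>\<^sup>+\<omega>. ennreal ((l n \<omega> - g \<omega>)\<^sup>2) \<partial>Q) < 1"
        by (rule order_tendstoD) simp
      then obtain n where n: "(\<integral>\<^sup>+\<omega>. ennreal ((l n \<omega> - g \<omega>)\<^sup>2) \<partial>Q) < 1"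
        by (auto simp: eventually_sequentially)
      have "square_integrable Q (\<lambda>\<omega>. l n \<omega> - g \<omega>)"
        using order_less_trans[OF n ennreal_one_less_top]
        unfolding square_integrable_def by (auto intro!: integrableI_bounded)
      from square_integrable_diff[OF sl[of n] this] have g: "square_integrable Q g" by simp
      have "(\<lambda>n. ennreal (expectation (\<lambda>\<omega>. (l n \<omega> - g \<omega>)\<^sup>2))) \<longlonglongrightarrow> ennreal 0"
        using lim unfolding eq[OF g] by simp
      then have "(\<lambda>n. expectation (\<lambda>\<omega>. (l n \<omega> - g \<omega>)\<^sup>2)) \<longlonglongrightarrow> 0"
        by (subst (asm) tendsto_ennreal_iff) auto
      then show "msq_limit l g" using sl g by (simp add: msq_limit_def)
    next
      assume "msq_limit l g"
      then have g: "square_integrable Q g" and "(\<lambda>n. expectation (\<lambda>\<omega>. (l n \<omega> - g \<omega>)\<^sup>2)) \<longlonglongrightarrow> 0"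
        by (auto simp: msq_limit_def)
      from tendsto_ennrealI[OF this(2)] show "(\<lambda>n. \<integral>\<^sup>+\<omega>. ennreal ((l n \<omega> - g \<omega>)\<^sup>2) \<partial>Q) \<longlonglongrightarrow> 0"
        unfolding eq[OF g] by simp
    qed
  qed
  moreover have "g \<in> borel_measurable Q" if "msq_limit l g" for l
    using that by (auto simp: msq_limit_def square_integrable_def)
  ultimately have "(g \<in> borel_measurable Q \<and> (\<exists>l. (\<forall>n. bounded_linear (l n)) \<and>
        (\<lambda>n. \<integral>\<^sup>+\<omega>. ennreal ((l n \<omega> - g \<omega>)\<^sup>2) \<partial>Q) \<longlonglongrightarrow> 0)) \<longleftrightarrow> g \<in> gaussian_space"
    unfolding gaussian_space_def by auto
  from this[symmetric] show ?thesis by (simp only: is_star_def conj_assoc)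
qed

lemma is_starD:
  assumes "is_star P h g"
  shows "g \<in> gaussian_space" "square_integrable Q g" "g \<in> borel_measurable Q"
    "\<And>l::'w \<Rightarrow> real. bounded_linear l \<Longrightarrow> expectation (\<lambda>\<omega>. l \<omega> * g \<omega>) = l h"
  using assms gaussian_space_square_integrable[of g] by (auto simp: is_star_iff square_integrable_def)

lemma is_star_lincomb:
  assumes "is_star P h g" "is_star P k f"
  shows "is_star P (a *\<^sub>R h + b *\<^sub>R k) (\<lambda>\<omega>. a * g \<omega> + b * f \<omega>)"
  unfolding is_star_iff
proof (intro conjI allI impI)
  show "(\<lambda>\<omega>. a * g \<omega> + b * f \<omega>) \<in> gaussian_space"
    using assms by (intro gaussian_space_lincomb is_starD)
  fix l :: "'w \<Rightarrow> real" assume l: "bounded_linear l"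
  have "expectation (\<lambda>\<omega>. l \<omega> * (a * g \<omega> + b * f \<omega>)) = expectation (\<lambda>\<omega>. a * (l \<omega> * g \<omega>) + b * (l \<omega> * f \<omega>))"
    by (intro Bochner_Integration.integral_cong) (auto simp: algebra_simps)
  also have "\<dots> = a * l h + b * l k"
    using square_integrable_mult[OF functional_law(1)[OF l] is_starD(2)[OF assms(1)]]
      square_integrable_mult[OF functional_law(1)[OF l] is_starD(2)[OF assms(2)]]
      is_starD(4)[OF assms(1) l] is_starD(4)[OF assms(2) l]
    by simp
  finally show "expectation (\<lambda>\<omega>. l \<omega> * (a * g \<omega> + b * f \<omega>)) = l (a *\<^sub>R h + b *\<^sub>R k)"
    using l by (simp add: linear_simps)
qed

text \<open>An element of the closure of the dual that is orthogonal to the dual is orthogonal to itself.\<close>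

lemma gaussian_space_orthogonal_dual_eq_0:
  assumes d: "d \<in> gaussian_space" and orth: "\<And>l::'w \<Rightarrow> real. bounded_linear l \<Longrightarrow> expectation (\<lambda>\<omega>. l \<omega> * d \<omega>) = 0"
  shows "AE \<omega> in Q. d \<omega> = 0"
proof -
  obtain k where k: "\<And>n. bounded_linear (k n)" "msq_limit k d"
    using gaussian_spaceE[OF d] by metis
  note sq = gaussian_space_square_integrable[OF d]
  have "(\<lambda>n. expectation (\<lambda>\<omega>. k n \<omega> * d \<omega>)) \<longlonglongrightarrow> expectation (\<lambda>\<omega>. d \<omega> * d \<omega>)"
    by (rule msq_limit_mult[OF k(2) sq])
  then have "expectation (\<lambda>\<omega>. d \<omega> * d \<omega>) = 0"
    using orth[OF k(1)] by (simp add: LIMSEQ_const_iff)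
  then have "AE \<omega> in Q. d \<omega> * d \<omega> = 0"
    using square_integrable_mult[OF sq sq] by (subst (asm) integral_nonneg_eq_0_iff_AE) auto
  then show ?thesis by simp
qed

lemma is_star_unique:
  assumes "is_star P h g" "is_star P h f"
  shows "AE \<omega> in Q. g \<omega> = f \<omega>"
proof -
  have "is_star P (1 *\<^sub>R h + (-1) *\<^sub>R h) (\<lambda>\<omega>. 1 * g \<omega> + (-1) * f \<omega>)"
    by (rule is_star_lincomb[OF assms])
  then have "is_star P 0 (\<lambda>\<omega>. g \<omega> - f \<omega>)" by simp
  then have "AE \<omega> in Q. g \<omega> - f \<omega> = 0"
    by (intro gaussian_space_orthogonal_dual_eq_0) (auto dest: is_starD simp: linear_simps)
  then show ?thesis by simp
qed

text \<open>
  Both sides are finite measures, so that it suffices to compare their characteristic functionals at a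
  functional \<open>l\<close>. Unless \<open>g = 0\<close>, write \<open>l = l' + c g\<close> with \<open>l'\<close> uncorrelated to \<open>g\<close>. By
  independence only the law of \<open>g\<close> is affected by the density, which moves the mean of
  \<open>g\<close> from \<open>0\<close> to \<open>E (g\<^sup>2)\<close>; this turns \<open>iexp l\<close> into \<open>iexp (l + l h)\<close> on average, since
  \<open>c E (g\<^sup>2) = E (l g) = l h\<close>.
\<close>

theorem cameron_martin:
  assumes star: "is_star P h g"
  shows "distr Q borel (\<lambda>\<omega>. \<omega> + h)
       = distr (density Q (\<lambda>\<omega>. exp (g \<omega> - expectation (\<lambda>\<omega>. (g \<omega>)\<^sup>2) / 2))) borel (\<lambda>\<omega>. \<omega>)"
proof -
  note gs = is_starD(1)[OF star] and sq = is_starD(2)[OF star]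
  have [measurable]: "g \<in> borel_measurable Q" by (rule is_starD(3)[OF star])
  have [measurable]: "(\<lambda>\<omega>. \<omega>) \<in> measurable Q borel" "(\<lambda>\<omega>. \<omega> + h) \<in> measurable Q borel"
    by (rule borel_imp_Q_measurable, measurable)+
  define s2 where "s2 = expectation (\<lambda>\<omega>. (g \<omega>)\<^sup>2)"
  have "s2 \<ge> 0" by (simp add: s2_def)
  have key: "integrable Q (\<lambda>\<omega>. exp (g \<omega> - s2 / 2)) \<and>
     (CLINT \<omega>|Q. of_real (exp (g \<omega> - s2 / 2)) * iexp (l \<omega>)) = iexp (l h) * (CLINT \<omega>|Q. iexp (l \<omega>))"
    if l: "bounded_linear l" for l :: "'w \<Rightarrow> real"
  proof (cases "s2 = 0")
    case True
    have "AE \<omega> in Q. (g \<omega>)\<^sup>2 = 0"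
      using True sq by (subst integral_nonneg_eq_0_iff_AE[symmetric]) (auto simp: s2_def square_integrable_def)
    then have g0: "AE \<omega> in Q. g \<omega> = 0" by simp
    have [measurable]: "l \<in> borel_measurable Q" using functional_law(1)[OF l] by (simp add: square_integrable_def)
    have "l h = expectation (\<lambda>\<omega>. l \<omega> * g \<omega>)" using is_starD(4)[OF star l] by simp
    also have "\<dots> = expectation (\<lambda>\<omega>. 0)" by (rule integral_cong_AE) (use g0 in auto)
    finally have lh: "l h = 0" by simp
    have e1: "AE \<omega> in Q. exp (g \<omega> - s2 / 2) = 1" using g0 True by auto
    have "integrable Q (\<lambda>\<omega>. exp (g \<omega> - s2 / 2)) = integrable Q (\<lambda>\<omega>. 1 :: real)"
      using e1 by (intro integrable_cong_AE) auto
    moreover have "(CLINT \<omega>|Q. of_real (exp (g \<omega> - s2 / 2)) * iexp (l \<omega>)) = (CLINT \<omega>|Q. iexp (l \<omega>))"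
      using e1 by (intro integral_cong_AE) auto
    ultimately show ?thesis using lh by simp
  next
    case False
    define \<sigma> where "\<sigma> = sqrt s2"
    have \<sigma>: "0 < \<sigma>" "\<sigma>\<^sup>2 = s2" using False \<open>s2 \<ge> 0\<close> by (auto simp: \<sigma>_def)
    define c where "c = l h / s2"
    define X where "X \<omega> = 1 * l \<omega> + (- c) * g \<omega>" for \<omega>
    have X: "X \<in> gaussian_space"
      unfolding X_def by (rule gaussian_space_lincomb[OF functional_in_gaussian_space[OF l] gs])
    have "expectation (\<lambda>\<omega>. X \<omega> * g \<omega>) = expectation (\<lambda>\<omega>. l \<omega> * g \<omega> - c * (g \<omega>)\<^sup>2)"
      by (intro Bochner_Integration.integral_cong) (auto simp: X_def algebra_simps power2_eq_square)
    also have "\<dots> = l h - c * s2"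
      using is_starD(4)[OF star l] square_integrable_mult[OF functional_law(1)[OF l] sq] sq
      by (simp add: s2_def square_integrable_def)
    finally have orth: "expectation (\<lambda>\<omega>. X \<omega> * g \<omega>) = 0" using False by (simp add: c_def)
    define \<psi> where "\<psi> y = of_real (exp (y - s2 / 2)) * iexp (c * y)" for y
    have [measurable]: "\<psi> \<in> borel_measurable borel" unfolding \<psi>_def by measurable
    have law: "distr Q borel g = density lborel (normal_density 0 \<sigma>)"
      using gaussian_space_law[OF gs \<sigma>(1)] \<sigma>(2) by (simp add: s2_def)
    have tilt: "normal_density 0 \<sigma> y *\<^sub>R \<psi> y = normal_density s2 \<sigma> y *\<^sub>R iexp (c * y)" for y
      using normal_density_exponential_tilt[OF \<sigma>(1), of y] \<sigma>(2)
      by (simp add: \<psi>_def scaleR_conv_of_real mult.assoc[symmetric] flip: of_real_mult)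
    have "integrable lborel (\<lambda>y. normal_density s2 \<sigma> y *\<^sub>R iexp (c * y))"
      by (rule Bochner_Integration.integrable_bound[OF integrable_normal_density[OF \<sigma>(1), of s2]]) auto
    then have "integrable (distr Q borel g) \<psi>"
      unfolding law using tilt by (simp add: integrable_density)
    then have int: "integrable Q (\<lambda>\<omega>. \<psi> (g \<omega>))" by (simp add: integrable_distr_eq)
    have "(CLINT \<omega>|Q. \<psi> (g \<omega>)) = (CLINT y|distr Q borel g. \<psi> y)" by (simp add: integral_distr)
    also have "\<dots> = (CLINT y|lborel. normal_density s2 \<sigma> y *\<^sub>R iexp (c * y))"
      unfolding law using tilt by (simp add: integral_density)
    also have "\<dots> = \<bar>1\<bar> *\<^sub>R (CLINT y|lborel. normal_density s2 \<sigma> (s2 + 1 * y) *\<^sub>R iexp (c * (s2 + 1 * y)))"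
      by (rule lborel_integral_real_affine) simp
    also have "\<dots> = (CLINT y|lborel. iexp (l h) * (normal_density 0 \<sigma> y *\<^sub>R iexp (c * y)))"
    proof -
      have "normal_density s2 \<sigma> (s2 + y) = normal_density 0 \<sigma> y" for y by (simp add: normal_density_def)
      moreover have "iexp (c * (s2 + y)) = iexp (l h) * iexp (c * y)" for y
        using False by (simp add: c_def exp_add[symmetric] field_simps)
      ultimately have "normal_density s2 \<sigma> (s2 + 1 * y) *\<^sub>R iexp (c * (s2 + 1 * y))
          = iexp (l h) * (normal_density 0 \<sigma> y *\<^sub>R iexp (c * y))" for y
        by (simp only: mult_1 mult_scaleR_right)
      then show ?thesis by (simp only: abs_one scaleR_one)
    qed
    also have "\<dots> = iexp (l h) * (CLINT y|lborel. normal_density 0 \<sigma> y *\<^sub>R iexp (c * y))"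
      by (rule integral_mult_right_zero)
    also have "(CLINT y|lborel. normal_density 0 \<sigma> y *\<^sub>R iexp (c * y)) = (CLINT \<omega>|Q. iexp (c * g \<omega>))"
    proof -
      have "(CLINT \<omega>|Q. iexp (c * g \<omega>)) = (CLINT y|distr Q borel g. iexp (c * y))"
        by (subst integral_distr) auto
      also have "\<dots> = (CLINT y|lborel. normal_density 0 \<sigma> y *\<^sub>R iexp (c * y))"
        unfolding law by (subst integral_density) auto
      finally show ?thesis by simp
    qed
    finally have E\<psi>: "(CLINT \<omega>|Q. \<psi> (g \<omega>)) = iexp (l h) * (CLINT \<omega>|Q. iexp (c * g \<omega>))" .
    have lX: "iexp (l \<omega>) = iexp (X \<omega>) * iexp (c * g \<omega>)" for \<omega>
      by (simp add: X_def exp_add[symmetric] algebra_simps)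
    have "(CLINT \<omega>|Q. of_real (exp (g \<omega> - s2 / 2)) * iexp (l \<omega>)) = (CLINT \<omega>|Q. iexp (X \<omega>) * \<psi> (g \<omega>))"
      unfolding lX \<psi>_def by (simp add: mult_ac)
    also have "\<dots> = (CLINT \<omega>|Q. iexp (X \<omega>)) * (CLINT \<omega>|Q. \<psi> (g \<omega>))"
      by (rule gaussian_space_independent[OF X gs orth]) (use int in auto)
    also have "\<dots> = iexp (l h) * ((CLINT \<omega>|Q. iexp (X \<omega>)) * (CLINT \<omega>|Q. iexp (c * g \<omega>)))"
      unfolding E\<psi> by (simp add: mult_ac)
    also have "(CLINT \<omega>|Q. iexp (X \<omega>)) * (CLINT \<omega>|Q. iexp (c * g \<omega>)) = (CLINT \<omega>|Q. iexp (l \<omega>))"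
      unfolding lX by (rule gaussian_space_independent[OF X gs orth, symmetric])
        (auto intro!: integrable_const_bound[of _ 1])
    finally have 1: "(CLINT \<omega>|Q. of_real (exp (g \<omega> - s2 / 2)) * iexp (l \<omega>)) = iexp (l h) * (CLINT \<omega>|Q. iexp (l \<omega>))" .
    have "integrable Q (\<lambda>\<omega>. norm (\<psi> (g \<omega>)))" using int by (rule integrable_norm)
    then have "integrable Q (\<lambda>\<omega>. exp (g \<omega> - s2 / 2))" by (simp add: \<psi>_def norm_mult)
    with 1 show ?thesis by simp
  qed
  have int: "integrable Q (\<lambda>\<omega>. exp (g \<omega> - s2 / 2))" using key[OF bounded_linear_zero] by simp
  have "distr Q borel (\<lambda>\<omega>. \<omega> + h) = distr (density Q (\<lambda>\<omega>. exp (g \<omega> - s2 / 2))) borel (\<lambda>\<omega>. \<omega>)"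
  proof (rule finite_measure_eqI_char_functional)
    show "finite_measure (distr Q borel (\<lambda>\<omega>. \<omega> + h))" by (rule finite_measure_distr) measurable
    have "finite_measure (density Q (\<lambda>\<omega>. exp (g \<omega> - s2 / 2)))"
      using int by (intro finite_measureI) (auto simp: emeasure_density integrable_iff_bounded cong: nn_integral_cong)
    then show "finite_measure (distr (density Q (\<lambda>\<omega>. exp (g \<omega> - s2 / 2))) borel (\<lambda>\<omega>. \<omega>))"
      by (rule finite_measure.finite_measure_distr) measurable
    fix l :: "'w \<Rightarrow> real" assume l: "bounded_linear l"
    note [measurable] = functional_borel[OF l]
    have "iexp (l (\<omega> + h)) = iexp (l h) * iexp (l \<omega>)" for \<omega>
      using l by (simp add: linear_simps exp_add[symmetric] algebra_simps)
    then have "(CLINT x|distr Q borel (\<lambda>\<omega>. \<omega> + h). iexp (l x)) = iexp (l h) * (CLINT \<omega>|Q. iexp (l \<omega>))"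
      by (subst integral_distr) auto
    also have "\<dots> = (CLINT x|distr (density Q (\<lambda>\<omega>. exp (g \<omega> - s2 / 2))) borel (\<lambda>\<omega>. \<omega>). iexp (l x))"
      by (subst integral_distr, measurable, subst integral_density) (auto simp: key[OF l] scaleR_conv_of_real)
    finally show "(CLINT x|distr Q borel (\<lambda>\<omega>. \<omega> + h). iexp (l x))
        = (CLINT x|distr (density Q (\<lambda>\<omega>. exp (g \<omega> - s2 / 2))) borel (\<lambda>\<omega>. \<omega>). iexp (l x))" .
  qed auto
  then show ?thesis by (simp add: s2_def)
qed

lemma cameron_martin_AE_shift:
  assumes star: "is_star P h g" and AE: "AE \<omega> in Q. R \<omega>"
  shows "AE \<omega> in Q. R (\<omega> + h)"
proof -
  have [measurable]: "g \<in> borel_measurable Q" by (rule is_starD(3)[OF star])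
  have [measurable]: "(\<lambda>\<omega>. \<omega>) \<in> measurable Q borel" "(\<lambda>\<omega>. \<omega> + h) \<in> measurable Q borel"
    by (rule borel_imp_Q_measurable, measurable)+
  have "AE \<omega> in P. R \<omega>" using AE by (simp add: AE_completion_iff)
  then obtain N where N: "\<And>\<omega>. \<omega> \<in> space P - N \<Longrightarrow> R \<omega>" "N \<in> null_sets P"
    by (rule AE_E3) (rule that)
  have NB [measurable]: "N \<in> sets borel" using N(2) sets_P by auto
  have "N \<in> null_sets Q" using N(2) by (rule null_sets_completionI)
  then have "AE \<omega> in Q. \<omega> \<notin> N" by (rule AE_not_in)
  let ?D = "distr (density Q (\<lambda>\<omega>. exp (g \<omega> - expectation (\<lambda>\<omega>. (g \<omega>)\<^sup>2) / 2))) borel (\<lambda>\<omega>. \<omega>)"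
  have "AE \<omega> in ?D. \<omega> \<notin> N"
    using \<open>AE \<omega> in Q. \<omega> \<notin> N\<close> by (subst AE_distr_iff) (auto simp: AE_density)
  then have "AE \<omega> in distr Q borel (\<lambda>\<omega>. \<omega> + h). \<omega> \<notin> N"
    unfolding cameron_martin[OF star] .
  then have "AE \<omega> in Q. \<omega> + h \<notin> N" by (subst (asm) AE_distr_iff) auto
  then show ?thesis by eventually_elim (use N(1) in auto)
qed

lemma cameron_martin_nn_integral:
  assumes star: "is_star P h g" and F: "F \<in> borel_measurable Q"
  shows "(\<integral>\<^sup>+\<omega>. F (\<omega> + h) \<partial>Q) = (\<integral>\<^sup>+\<omega>. F \<omega> * ennreal (exp (g \<omega> - expectation (\<lambda>\<omega>. (g \<omega>)\<^sup>2) / 2)) \<partial>Q)"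
proof -
  have [measurable]: "g \<in> borel_measurable Q" by (rule is_starD(3)[OF star])
  have [measurable]: "(\<lambda>\<omega>. \<omega>) \<in> measurable Q borel" "(\<lambda>\<omega>. \<omega> + h) \<in> measurable Q borel"
    by (rule borel_imp_Q_measurable, measurable)+
  obtain G where G: "G \<in> borel_measurable P" "AE \<omega> in P. F \<omega> = G \<omega>"
    using completion_ex_borel_measurable[OF F] by blast
  have [measurable]: "G \<in> borel_measurable borel" using G(1) by (simp add: measurable_cong_sets[OF sets_P refl])
  have AE: "AE \<omega> in Q. F \<omega> = G \<omega>" using G(2) by (rule AE_completion)
  have "(\<integral>\<^sup>+\<omega>. F (\<omega> + h) \<partial>Q) = (\<integral>\<^sup>+\<omega>. G (\<omega> + h) \<partial>Q)"
    using cameron_martin_AE_shift[OF star AE] by (intro nn_integral_cong_AE) auto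
  also have "\<dots> = (\<integral>\<^sup>+\<omega>. G \<omega> \<partial>distr Q borel (\<lambda>\<omega>. \<omega> + h))" by (simp add: nn_integral_distr)
  also have "\<dots> = (\<integral>\<^sup>+\<omega>. ennreal (exp (g \<omega> - expectation (\<lambda>\<omega>. (g \<omega>)\<^sup>2) / 2)) * G \<omega> \<partial>Q)"
    unfolding cameron_martin[OF star]
    by (simp add: nn_integral_distr nn_integral_density)
  also have "\<dots> = (\<integral>\<^sup>+\<omega>. F \<omega> * ennreal (exp (g \<omega> - expectation (\<lambda>\<omega>. (g \<omega>)\<^sup>2) / 2)) \<partial>Q)"
    using AE by (intro nn_integral_cong_AE) (auto simp: mult.commute)
  finally show ?thesis .
qed

text \<open>
  For a functional this is linearity and \<open>E (l g) = l h\<close>. A subsequence of the approximating functionals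
  converges almost surely, and it still does so along \<open>\<omega> + h\<close> because shifts preserve null sets.
\<close>

lemma gaussian_space_shift:
  assumes X: "X \<in> gaussian_space" and star: "is_star P h g"
  shows "AE \<omega> in Q. X (\<omega> + h) = X \<omega> + expectation (\<lambda>\<omega>. X \<omega> * g \<omega>)"
proof -
  obtain l where l: "\<And>n. bounded_linear (l n)" "msq_limit l X"
    using gaussian_spaceE[OF X] by metis
  have "\<exists>r::nat\<Rightarrow>nat. strict_mono r \<and> (AE \<omega> in Q. (\<lambda>n. (l (r n) \<omega> - X \<omega>)\<^sup>2) \<longlonglongrightarrow> 0)"
  proof (rule tendsto_L1_AE_subseq)
    show "integrable Q (\<lambda>\<omega>. (l n \<omega> - X \<omega>)\<^sup>2)" for n
      using l(2) square_integrable_diff[of Q "l n" X] by (auto simp: msq_limit_def square_integrable_def)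
    show "(\<lambda>n. \<integral>\<omega>. norm ((l n \<omega> - X \<omega>)\<^sup>2) \<partial>Q) \<longlonglongrightarrow> 0"
      using l(2) by (simp add: msq_limit_def)
  qed
  then obtain r :: "nat \<Rightarrow> nat" where r: "strict_mono r" "AE \<omega> in Q. (\<lambda>n. (l (r n) \<omega> - X \<omega>)\<^sup>2) \<longlonglongrightarrow> 0"
    by (elim exE conjE)
  have lim: "(\<lambda>n. l (r n) \<omega>) \<longlonglongrightarrow> X \<omega>" if "(\<lambda>n. (l (r n) \<omega> - X \<omega>)\<^sup>2) \<longlonglongrightarrow> 0" for \<omega>
  proof -
    have "(\<lambda>n. sqrt ((l (r n) \<omega> - X \<omega>)\<^sup>2)) \<longlonglongrightarrow> sqrt 0" using that by (rule tendsto_real_sqrt)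
    then show ?thesis by (simp add: tendsto_rabs_zero_iff LIM_zero_iff)
  qed
  have "(\<lambda>n. expectation (\<lambda>\<omega>. l n \<omega> * g \<omega>)) \<longlonglongrightarrow> expectation (\<lambda>\<omega>. X \<omega> * g \<omega>)"
    by (rule msq_limit_mult[OF l(2) is_starD(2)[OF star]])
  then have "(\<lambda>n. l n h) \<longlonglongrightarrow> expectation (\<lambda>\<omega>. X \<omega> * g \<omega>)"
    by (simp add: is_starD(4)[OF star l(1)])
  from LIMSEQ_subseq_LIMSEQ[OF this r(1)]
  have lh: "(\<lambda>n. l (r n) h) \<longlonglongrightarrow> expectation (\<lambda>\<omega>. X \<omega> * g \<omega>)" by (simp add: o_def)
  show ?thesis
    using r(2) cameron_martin_AE_shift[OF star r(2)]
  proof eventually_elim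
    case (elim \<omega>)
    have "(\<lambda>n. l (r n) \<omega> + l (r n) h) \<longlonglongrightarrow> X \<omega> + expectation (\<lambda>\<omega>. X \<omega> * g \<omega>)"
      by (intro tendsto_add lim[OF elim(1)] lh)
    moreover have "l (r n) (\<omega> + h) = l (r n) \<omega> + l (r n) h" for n
      using l(1)[of "r n"] by (simp add: linear_simps)
    ultimately show ?case using LIMSEQ_unique[OF lim[OF elim(2)]] by simp
  qed
qed

end

section \<open>Girsanov's theorem for step processes\<close>

context gaussian_measure
begin

definition star :: "'w \<Rightarrow> 'w \<Rightarrow> real" where
  "star h = (SOME g. is_star P h g)"

definition cm_inner :: "'w \<Rightarrow> 'w \<Rightarrow> real" where
  "cm_inner h k = expectation (\<lambda>\<omega>. star h \<omega> * star k \<omega>)"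

definition cm_weight :: "'w \<Rightarrow> 'w \<Rightarrow> real" where
  "cm_weight h \<omega> = exp (- star h \<omega> - cm_inner h h / 2)"

lemma is_star_star: "h \<in> cameron_martin_space P \<Longrightarrow> is_star P h (star h)"
  unfolding star_def cameron_martin_space_def mem_Collect_eq by (rule someI_ex[of "is_star P h"])

lemma star_measurable [measurable]: "h \<in> cameron_martin_space P \<Longrightarrow> star h \<in> borel_measurable Q"
  using is_star_star is_starD(3) by blast

lemma star_scale:
  assumes "h \<in> cameron_martin_space P"
  shows "a *\<^sub>R h \<in> cameron_martin_space P" "AE \<omega> in Q. star (a *\<^sub>R h) \<omega> = a * star h \<omega>"
proof -
  have "is_star P (a *\<^sub>R h + 0 *\<^sub>R h) (\<lambda>\<omega>. a * star h \<omega> + 0 * star h \<omega>)"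
    by (intro is_star_lincomb is_star_star assms)
  then have s: "is_star P (a *\<^sub>R h) (\<lambda>\<omega>. a * star h \<omega>)" by simp
  then show "a *\<^sub>R h \<in> cameron_martin_space P" unfolding cameron_martin_space_def by blast
  then show "AE \<omega> in Q. star (a *\<^sub>R h) \<omega> = a * star h \<omega>"
    using is_star_unique[OF is_star_star s] by blast
qed

lemma cm_inner_scale:
  assumes "h \<in> cameron_martin_space P" "k \<in> cameron_martin_space P"
  shows "cm_inner (a *\<^sub>R h) (b *\<^sub>R k) = a * b * cm_inner h k"
proof -
  note [measurable] = star_measurable[OF assms(1)] star_measurable[OF assms(2)]
    star_measurable[OF star_scale(1)[OF assms(1)]] star_measurable[OF star_scale(1)[OF assms(2)]]
  have "cm_inner (a *\<^sub>R h) (b *\<^sub>R k) = expectation (\<lambda>\<omega>. (a * b) * (star h \<omega> * star k \<omega>))"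
    unfolding cm_inner_def using star_scale(2)[OF assms(1), of a] star_scale(2)[OF assms(2), of b]
    by (intro integral_cong_AE) auto
  then show ?thesis by (simp add: cm_inner_def)
qed

lemma star_shift:
  assumes "h \<in> cameron_martin_space P" "k \<in> cameron_martin_space P"
  shows "AE \<omega> in Q. star h (\<omega> + k) = star h \<omega> + cm_inner h k"
  using gaussian_space_shift[OF is_starD(1)[OF is_star_star[OF assms(1)]] is_star_star[OF assms(2)]]
  by (simp add: cm_inner_def)

lemma cm_weight_shift:
  assumes "h \<in> cameron_martin_space P" "k \<in> cameron_martin_space P" "cm_inner h k = 0"
  shows "AE \<omega> in Q. cm_weight h (\<omega> + k) = cm_weight h \<omega>"
  using star_shift[OF assms(1,2)] by eventually_elim (simp add: cm_weight_def assms(3))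

lemma cm_weight_nn_integral:
  assumes h: "h \<in> cameron_martin_space P" and F: "F \<in> borel_measurable Q"
  shows "(\<integral>\<^sup>+\<omega>. F \<omega> * ennreal (cm_weight h \<omega>) \<partial>Q) = (\<integral>\<^sup>+\<omega>. F (\<omega> - h) \<partial>Q)"
proof -
  have "is_star P ((-1) *\<^sub>R h + 0 *\<^sub>R h) (\<lambda>\<omega>. (-1) * star h \<omega> + 0 * star h \<omega>)"
    by (intro is_star_lincomb is_star_star h)
  then have s: "is_star P (- h) (\<lambda>\<omega>. - star h \<omega>)" by simp
  show ?thesis
    using cameron_martin_nn_integral[OF s F] by (simp add: cm_weight_def cm_inner_def power2_eq_square)
qed

text \<open>
  Girsanov's theorem for step processes. The \<open>k\<close>-th increment of the shift is \<open>e k i\<close> where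
  \<open>i = I k \<omega>\<close>; it only takes countably many values, and by \<open>I_shift\<close> the indices chosen up to
  time \<open>m\<close> do not change when \<open>\<omega>\<close> is moved by an admissible \<open>m\<close>-th increment.
\<close>

context
  fixes e :: "nat \<Rightarrow> nat \<Rightarrow> 'w" and I :: "nat \<Rightarrow> 'w \<Rightarrow> nat" and V :: "nat \<Rightarrow> 'w set"
  assumes e_V: "\<And>m i. e m i \<in> V m"
    and V_cm: "\<And>m. V m \<subseteq> cameron_martin_space P"
    and V_scale: "\<And>m c a. c \<in> V m \<Longrightarrow> a *\<^sub>R c \<in> V m"
    and I_measurable [measurable]: "\<And>m. I m \<in> measurable Q (count_space UNIV)"
    and I_shift: "\<And>k m c. k \<le> m \<Longrightarrow> c \<in> V m \<Longrightarrow> AE \<omega> in Q. I k (\<omega> + c) = I k \<omega>"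
    and V_orth: "\<And>k m c d. k < m \<Longrightarrow> d \<in> V k \<Longrightarrow> c \<in> V m \<Longrightarrow> cm_inner d c = 0"
begin

definition girsanov_weight :: "real \<Rightarrow> nat \<Rightarrow> 'w \<Rightarrow> real" where
  "girsanov_weight a m \<omega> = (\<Prod>k<m. cm_weight (a *\<^sub>R e k (I k \<omega>)) \<omega>)"

lemma e_cm: "a *\<^sub>R e k i \<in> cameron_martin_space P"
  using e_V V_cm V_scale by blast

lemma e_measurable [measurable]: "(\<lambda>\<omega>. a *\<^sub>R e k (I k \<omega>)) \<in> measurable Q borel"
  by measurable

lemma cm_weight_measurable [measurable]: "(\<lambda>\<omega>. cm_weight (a *\<^sub>R e k (I k \<omega>)) \<omega>) \<in> borel_measurable Q"
proof (rule measurable_compose_countable[where g = "I k" and f = "\<lambda>i \<omega>. cm_weight (a *\<^sub>R e k i) \<omega>"])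
  note [measurable] = star_measurable[OF e_cm]
  show "(\<lambda>\<omega>. cm_weight (a *\<^sub>R e k i) \<omega>) \<in> borel_measurable Q" for i
    unfolding cm_weight_def by measurable
qed (rule I_measurable)

lemma girsanov_weight_measurable [measurable]: "girsanov_weight a m \<in> borel_measurable Q"
  unfolding girsanov_weight_def by measurable

lemma shift_measurable [measurable]: "(\<lambda>\<omega>. \<omega> + (\<Sum>k<m. a *\<^sub>R e k (I k \<omega>))) \<in> measurable Q borel"
proof (rule borel_measurable_add)
  show "(\<lambda>\<omega>. \<omega>) \<in> measurable Q borel"
    by (rule borel_imp_Q_measurable, measurable)
qed measurable

lemma indicator_index_measurable [measurable]: "(\<lambda>\<omega>. indicator {i} (I m \<omega>) :: ennreal) \<in> borel_measurable Q"
  by (rule measurable_compose[OF I_measurable]) simp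

lemma girsanov_weight_nonneg: "0 \<le> girsanov_weight a m \<omega>"
  unfolding girsanov_weight_def cm_weight_def by (intro prod_nonneg) auto

text \<open>
  Induction on the number of increments, peeling off the last one. On the event \<open>I m = i\<close> the last
  increment is the deterministic vector \<open>a e m i\<close>, to which the Cameron--Martin formula applies. That shift
  changes neither the previous increments and their indices, nor, by orthogonality, the previous weights, nor the
  event \<open>I m = i\<close> itself.
\<close>

lemma girsanov_step_process:
  assumes F [measurable]: "F \<in> borel_measurable borel"
  shows "(\<integral>\<^sup>+\<omega>. F (\<omega> + (\<Sum>k<m. a *\<^sub>R e k (I k \<omega>))) * ennreal (girsanov_weight a m \<omega>) \<partial>Q) = (\<integral>\<^sup>+\<omega>. F \<omega> \<partial>Q)"
proof (induction m)
  case 0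
  then show ?case by (simp add: girsanov_weight_def)
next
  case (Suc m)
  define S where "S \<omega> = (\<Sum>k<m. a *\<^sub>R e k (I k \<omega>))" for \<omega>
  define Z where "Z = girsanov_weight a m"
  have [measurable]: "(\<lambda>\<omega>. \<omega> + S \<omega>) \<in> measurable Q borel" "Z \<in> borel_measurable Q"
    unfolding S_def Z_def by measurable
  define H where "H i \<omega> = F (\<omega> + S \<omega> + a *\<^sub>R e m i) * ennreal (Z \<omega>) * indicator {i} (I m \<omega>)" for i \<omega>
  have [measurable]: "H i \<in> borel_measurable Q" for i unfolding H_def by measurable
  have shift: "(\<integral>\<^sup>+\<omega>. H i \<omega> * ennreal (cm_weight (a *\<^sub>R e m i) \<omega>) \<partial>Q)
      = (\<integral>\<^sup>+\<omega>. F (\<omega> + S \<omega>) * ennreal (Z \<omega>) * indicator {i} (I m \<omega>) \<partial>Q)" for i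
  proof -
    define c where "c = (-1) *\<^sub>R (a *\<^sub>R e m i)"
    have cV: "c \<in> V m" unfolding c_def by (intro V_scale e_V)
    have c_cm: "c \<in> cameron_martin_space P" using cV V_cm by blast
    have 1: "AE \<omega> in Q. \<forall>k\<le>m. I k (\<omega> + c) = I k \<omega>"
    proof (subst AE_all_countable, intro allI)
      show "AE \<omega> in Q. k \<le> m \<longrightarrow> I k (\<omega> + c) = I k \<omega>" for k
        using I_shift[OF _ cV, of k] by (cases "k \<le> m") simp_all
    qed
    have 2: "AE \<omega> in Q. \<forall>k i. k < m \<longrightarrow> cm_weight (a *\<^sub>R e k i) (\<omega> + c) = cm_weight (a *\<^sub>R e k i) \<omega>"
    proof (subst AE_all_countable, intro allI, subst AE_all_countable, intro allI)
      fix k i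
      show "AE \<omega> in Q. k < m \<longrightarrow> cm_weight (a *\<^sub>R e k i) (\<omega> + c) = cm_weight (a *\<^sub>R e k i) \<omega>"
      proof (cases "k < m")
        case True
        then have "cm_inner (a *\<^sub>R e k i) c = 0" by (rule V_orth) (use cV e_V V_scale in auto)
        from cm_weight_shift[OF e_cm c_cm this] show ?thesis by simp
      qed simp
    qed
    have "(\<integral>\<^sup>+\<omega>. H i \<omega> * ennreal (cm_weight (a *\<^sub>R e m i) \<omega>) \<partial>Q) = (\<integral>\<^sup>+\<omega>. H i (\<omega> + c) \<partial>Q)"
      using cm_weight_nn_integral[OF e_cm, of "H i" a m i] by (simp add: c_def)
    also have "\<dots> = (\<integral>\<^sup>+\<omega>. F (\<omega> + S \<omega>) * ennreal (Z \<omega>) * indicator {i} (I m \<omega>) \<partial>Q)"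
    proof (rule nn_integral_cong_AE)
      show "AE \<omega> in Q. H i (\<omega> + c) = F (\<omega> + S \<omega>) * ennreal (Z \<omega>) * indicator {i} (I m \<omega>)"
        using 1 2
      proof eventually_elim
        case (elim \<omega>)
        have "S (\<omega> + c) = S \<omega>" using elim(1) by (simp add: S_def)
        moreover have "Z (\<omega> + c) = Z \<omega>" using elim by (simp add: Z_def girsanov_weight_def)
        ultimately show ?case using elim(1) by (simp add: H_def c_def algebra_simps)
      qed
    qed
    finally show ?thesis .
  qed
  have split: "(\<integral>\<^sup>+\<omega>. f \<omega> \<partial>Q) = (\<Sum>i. \<integral>\<^sup>+\<omega>. f \<omega> * indicator {i} (I m \<omega>) \<partial>Q)"
    if [measurable]: "f \<in> borel_measurable Q" for f
  proof -
    have "f \<omega> = (\<Sum>i. f \<omega> * indicator {i} (I m \<omega>))" for \<omega>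
      using suminf_finite[of "{I m \<omega>}" "\<lambda>i. f \<omega> * indicator {i} (I m \<omega>)"] by simp
    then have "(\<integral>\<^sup>+\<omega>. f \<omega> \<partial>Q) = (\<integral>\<^sup>+\<omega>. (\<Sum>i. f \<omega> * indicator {i} (I m \<omega>)) \<partial>Q)" by simp
    also have "\<dots> = (\<Sum>i. \<integral>\<^sup>+\<omega>. f \<omega> * indicator {i} (I m \<omega>) \<partial>Q)" by (rule nn_integral_suminf) measurable
    finally show ?thesis .
  qed
  have "(\<integral>\<^sup>+\<omega>. F (\<omega> + (\<Sum>k<Suc m. a *\<^sub>R e k (I k \<omega>))) * ennreal (girsanov_weight a (Suc m) \<omega>) \<partial>Q)
      = (\<Sum>i. \<integral>\<^sup>+\<omega>. F (\<omega> + (\<Sum>k<Suc m. a *\<^sub>R e k (I k \<omega>))) * ennreal (girsanov_weight a (Suc m) \<omega>) * indicator {i} (I m \<omega>) \<partial>Q)"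
    by (rule split) measurable
  also have "\<dots> = (\<Sum>i. \<integral>\<^sup>+\<omega>. H i \<omega> * ennreal (cm_weight (a *\<^sub>R e m i) \<omega>) \<partial>Q)"
  proof (intro suminf_cong nn_integral_cong)
    fix i \<omega>
    have "0 \<le> Z \<omega>" "0 \<le> cm_weight (a *\<^sub>R e m i) \<omega>"
      unfolding Z_def by (rule girsanov_weight_nonneg) (simp add: cm_weight_def)
    then show "F (\<omega> + (\<Sum>k<Suc m. a *\<^sub>R e k (I k \<omega>))) * ennreal (girsanov_weight a (Suc m) \<omega>) * indicator {i} (I m \<omega>)
        = H i \<omega> * ennreal (cm_weight (a *\<^sub>R e m i) \<omega>)"
      by (cases "I m \<omega> = i")
         (auto simp: H_def S_def Z_def girsanov_weight_def ennreal_mult add.assoc mult_ac)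
  qed
  also have "\<dots> = (\<integral>\<^sup>+\<omega>. F (\<omega> + S \<omega>) * ennreal (Z \<omega>) \<partial>Q)"
    unfolding shift by (rule split[symmetric]) measurable
  also have "\<dots> = (\<integral>\<^sup>+\<omega>. F \<omega> \<partial>Q)" using Suc.IH by (simp add: S_def Z_def)
  finally show ?case .
qed

text \<open>
  The square of an exponential density is the density for the doubled shift, up to the exponential of the
  energy. This bounds its second moment.
\<close>

lemma girsanov_weight_double:
  "AE \<omega> in Q. (girsanov_weight 1 m \<omega>)\<^sup>2
     = girsanov_weight 2 m \<omega> * exp (\<Sum>k<m. cm_inner (e k (I k \<omega>)) (e k (I k \<omega>)))"
proof -
  have cm: "e k i \<in> cameron_martin_space P" for k i using e_cm[of 1] by simp
  have "AE \<omega> in Q. \<forall>k i. star (2 *\<^sub>R e k i) \<omega> = 2 * star (e k i) \<omega>"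
    by (simp only: AE_all_countable) (intro allI star_scale(2)[OF cm])
  then show ?thesis
  proof eventually_elim
    case (elim \<omega>)
    have "(cm_weight (e k i) \<omega>)\<^sup>2 = cm_weight (2 *\<^sub>R e k i) \<omega> * exp (cm_inner (e k i) (e k i))" for k i
    proof -
      have "cm_inner (2 *\<^sub>R e k i) (2 *\<^sub>R e k i) = 2 * 2 * cm_inner (e k i) (e k i)"
        by (rule cm_inner_scale[OF cm cm])
      then show ?thesis
        using elim by (simp add: cm_weight_def power2_eq_square exp_add[symmetric])
    qed
    then show ?case
      by (simp add: girsanov_weight_def exp_sum prod.distrib prod_power_distrib)
  qed
qed

text \<open>
  A shift of bounded energy changes the law of \<open>\<omega>\<close> little in total variation: the second moment
  of the Girsanov density \<open>Z\<close> is at most \<open>exp K\<close>, so that \<open>E \<bar>1 - Z\<bar>\<close> is small.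
\<close>

lemma step_shift_prob_le:
  assumes K: "AE \<omega> in Q. (\<Sum>k<m. cm_inner (e k (I k \<omega>)) (e k (I k \<omega>))) \<le> K"
    and B [measurable]: "B \<in> sets borel"
  shows "measure Q {\<omega>. \<omega> + (\<Sum>k<m. e k (I k \<omega>)) \<in> B} \<le> measure Q B + sqrt (exp K - 1)"
proof -
  have "(\<lambda>\<omega>. \<omega>) \<in> measurable Q borel"
    by (rule borel_imp_Q_measurable, measurable)
  from measurable_sets[OF this B] have BQ: "B \<in> sets Q" by simp
  define Z where "Z = girsanov_weight 1 m"
  have [measurable]: "Z \<in> borel_measurable Q" unfolding Z_def by measurable
  have Z0: "0 \<le> Z \<omega>" for \<omega> unfolding Z_def by (rule girsanov_weight_nonneg)
  have EZ: "(\<integral>\<^sup>+\<omega>. ennreal (Z \<omega>) \<partial>Q) = 1"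
    using girsanov_step_process[where F = "\<lambda>_. 1" and m = m and a = 1] by (simp add: Z_def base.emeasure_space_1[simplified])
  have EZ2: "(\<integral>\<^sup>+\<omega>. ennreal (girsanov_weight 2 m \<omega>) \<partial>Q) = 1"
    using girsanov_step_process[where F = "\<lambda>_. 1" and m = m and a = 2] by (simp add: base.emeasure_space_1[simplified])
  have mean_one: "integrable Q W \<and> expectation W = 1"
    if "(\<integral>\<^sup>+\<omega>. ennreal (W \<omega>) \<partial>Q) = 1" "\<And>\<omega>. 0 \<le> W \<omega>" "W \<in> borel_measurable Q" for W
  proof
    show W: "integrable Q W" using that by (intro integrableI_nonneg) auto
    show "expectation W = 1" using nn_integral_eq_integral[OF W] that by simp
  qed
  have Z_int: "integrable Q Z" "expectation Z = 1"
    using mean_one[OF EZ Z0] by simp_all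
  have W_int: "integrable Q (girsanov_weight 2 m)" "expectation (girsanov_weight 2 m) = 1"
    using mean_one[OF EZ2 girsanov_weight_nonneg] by simp_all
  have le: "AE \<omega> in Q. (Z \<omega>)\<^sup>2 \<le> exp K * girsanov_weight 2 m \<omega>"
    using girsanov_weight_double[of m] K
  proof eventually_elim
    case (elim \<omega>)
    then show ?case using girsanov_weight_nonneg[of 2 m \<omega>]
      by (simp add: Z_def mult.commute[of "exp K"] mult_left_mono)
  qed
  have Z2_int: "integrable Q (\<lambda>\<omega>. (Z \<omega>)\<^sup>2)"
  proof (rule Bochner_Integration.integrable_bound[OF integrable_mult_right[OF W_int(1), of "exp K"]])
    show "AE \<omega> in Q. norm ((Z \<omega>)\<^sup>2) \<le> norm (exp K * girsanov_weight 2 m \<omega>)"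
      using le by eventually_elim simp
  qed measurable
  have Z2: "expectation (\<lambda>\<omega>. (Z \<omega>)\<^sup>2) \<le> exp K"
    using integral_mono_AE[OF Z2_int _ le] W_int by simp
  have sqZ: "square_integrable Q Z" using Z2_int by (simp add: square_integrable_def)
  have sq1: "square_integrable Q (\<lambda>\<omega>. 1 - Z \<omega>)"
    by (rule square_integrable_diff[OF square_integrable_const sqZ])
  have "expectation (\<lambda>\<omega>. (1 - Z \<omega>)\<^sup>2) = expectation (\<lambda>\<omega>. 1 - 2 * Z \<omega> + (Z \<omega>)\<^sup>2)"
    by (intro Bochner_Integration.integral_cong) (auto simp: power2_diff)
  also have "\<dots> \<le> exp K - 1" using Z_int Z2_int Z2 prob_space by simp
  finally have var: "expectation (\<lambda>\<omega>. (1 - Z \<omega>)\<^sup>2) \<le> exp K - 1" .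
  have abs_int: "integrable Q (\<lambda>\<omega>. \<bar>1 - Z \<omega>\<bar>)"
    using square_integrable_imp_integrable[OF sq1] by simp
  have "expectation (\<lambda>\<omega>. \<bar>1 - Z \<omega>\<bar>) \<le> sqrt (exp K - 1)"
  proof (rule real_le_rsqrt)
    have "square_integrable Q (\<lambda>\<omega>. \<bar>1 - Z \<omega>\<bar>)" using sq1 by (auto simp: square_integrable_def)
    from Cauchy_Schwarz_integral[OF this square_integrable_const[of 1]] var
    show "(expectation (\<lambda>\<omega>. \<bar>1 - Z \<omega>\<bar>))\<^sup>2 \<le> exp K - 1" by simp
  qed
  note L1 = this
  have L0: "0 \<le> expectation (\<lambda>\<omega>. \<bar>1 - Z \<omega>\<bar>)" by simp
  have "ennreal (measure Q {\<omega>. \<omega> + (\<Sum>k<m. e k (I k \<omega>)) \<in> B})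
      = (\<integral>\<^sup>+\<omega>. indicator B (\<omega> + (\<Sum>k<m. 1 *\<^sub>R e k (I k \<omega>))) \<partial>Q)"
  proof -
    have "{\<omega>. \<omega> + (\<Sum>k<m. e k (I k \<omega>)) \<in> B} \<in> sets Q"
      using measurable_sets[OF shift_measurable[where a = 1 and m = m] B] by (simp add: vimage_def)
    then have "emeasure Q {\<omega>. \<omega> + (\<Sum>k<m. e k (I k \<omega>)) \<in> B}
        = (\<integral>\<^sup>+\<omega>. indicator {\<omega>. \<omega> + (\<Sum>k<m. e k (I k \<omega>)) \<in> B} \<omega> \<partial>Q)" by simp
    then show ?thesis by (simp add: emeasure_eq_measure indicator_def)
  qed
  also have "\<dots> \<le> (\<integral>\<^sup>+\<omega>. indicator B (\<omega> + (\<Sum>k<m. 1 *\<^sub>R e k (I k \<omega>))) * ennreal (girsanov_weight 1 m \<omega>) + ennreal \<bar>1 - Z \<omega>\<bar> \<partial>Q)"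
  proof (rule nn_integral_mono)
    fix \<omega>
    have "1 \<le> Z \<omega> + \<bar>1 - Z \<omega>\<bar>" by linarith
    then have "ennreal 1 \<le> ennreal (Z \<omega>) + ennreal \<bar>1 - Z \<omega>\<bar>"
      by (subst ennreal_plus[symmetric]) (auto intro: Z0 ennreal_leI simp del: ennreal_1)
    then show "indicator B (\<omega> + (\<Sum>k<m. 1 *\<^sub>R e k (I k \<omega>)))
      \<le> indicator B (\<omega> + (\<Sum>k<m. 1 *\<^sub>R e k (I k \<omega>))) * ennreal (girsanov_weight 1 m \<omega>) + ennreal \<bar>1 - Z \<omega>\<bar>"
      by (auto simp: Z_def indicator_def)
  qed
  also have "\<dots> = (\<integral>\<^sup>+\<omega>. indicator B (\<omega> + (\<Sum>k<m. 1 *\<^sub>R e k (I k \<omega>))) * ennreal (girsanov_weight 1 m \<omega>) \<partial>Q)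
      + (\<integral>\<^sup>+\<omega>. ennreal \<bar>1 - Z \<omega>\<bar> \<partial>Q)"
  proof (rule nn_integral_add)
    have "(\<lambda>\<omega>. indicator B (\<omega> + (\<Sum>k<m. 1 *\<^sub>R e k (I k \<omega>))) :: ennreal) \<in> borel_measurable Q"
      by (rule measurable_compose[OF shift_measurable]) measurable
    then show "(\<lambda>\<omega>. indicator B (\<omega> + (\<Sum>k<m. 1 *\<^sub>R e k (I k \<omega>))) * ennreal (girsanov_weight 1 m \<omega>)) \<in> borel_measurable Q"
      by measurable
  qed measurable
  also have "(\<integral>\<^sup>+\<omega>. indicator B (\<omega> + (\<Sum>k<m. 1 *\<^sub>R e k (I k \<omega>))) * ennreal (girsanov_weight 1 m \<omega>) \<partial>Q)
      = (\<integral>\<^sup>+\<omega>. indicator B \<omega> \<partial>Q)"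
    by (rule girsanov_step_process) measurable
  also have "\<dots> + (\<integral>\<^sup>+\<omega>. ennreal \<bar>1 - Z \<omega>\<bar> \<partial>Q)
      = ennreal (measure Q B) + ennreal (expectation (\<lambda>\<omega>. \<bar>1 - Z \<omega>\<bar>))"
    using BQ nn_integral_eq_integral[OF abs_int] by (simp add: emeasure_eq_measure)
  also have "\<dots> \<le> ennreal (measure Q B + sqrt (exp K - 1))"
    using L1 L0 by (simp add: ennreal_plus[symmetric] ennreal_leI del: ennreal_plus)
  finally have "ennreal (measure Q {\<omega>. \<omega> + (\<Sum>k<m. e k (I k \<omega>)) \<in> B}) \<le> ennreal (measure Q B + sqrt (exp K - 1))" .
  moreover have "0 \<le> measure Q B + sqrt (exp K - 1)"
    using L1 L0 measure_nonneg[of Q B] by linarith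
  ultimately show ?thesis by (simp only: ennreal_le_iff)
qed

end

end

section \<open>Continuity of translations in \<open>L\<^sup>p\<close>\<close>

lemma lborel_integrable_shift:
  fixes f :: "real \<Rightarrow> 'b::{banach,second_countable_topology}"
  shows "integrable lborel (\<lambda>x. f (x - \<eta>)) \<longleftrightarrow> integrable lborel f"
  using lborel_integrable_real_affine_iff[of 1 f "- \<eta>"] by (simp add: add.commute)

lemma lborel_integral_shift:
  fixes f :: "real \<Rightarrow> 'b::{banach,second_countable_topology}"
  shows "(\<integral>x. f (x - \<eta>) \<partial>lborel) = (\<integral>x. f x \<partial>lborel)"
  using lborel_integral_real_affine[of 1 f "- \<eta>"] by (simp add: add.commute)

lemma AE_lborel_shift:
  assumes "AE x in lborel. R x"
  shows "AE x in lborel. R (x - \<eta>)"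
proof -
  have "AE x in distr lborel borel ((+) (- \<eta>)). R x"
    using assms by (simp only: lborel_distr_plus)
  then have "AE x in lborel. R (- \<eta> + x)"
    by (rule AE_distrD[rotated]) simp
  then show ?thesis by simp
qed

text \<open>
  The positive part of \<open>1\<^sub>U - 1\<^sub>U(\<cdot> - \<eta>)\<close> tends to \<open>0\<close> pointwise, as \<open>U\<close> is open, and is dominated by
  \<open>1\<^sub>U\<close>. The negative part has the same integral by translation invariance.
\<close>

lemma translation_L1_open:
  fixes \<eta> :: "nat \<Rightarrow> real"
  assumes U: "open U" "emeasure lborel U < \<infinity>" and \<eta>: "\<eta> \<longlonglongrightarrow> 0"
  shows "(\<lambda>n. \<integral>x. \<bar>indicator U (x - \<eta> n) - indicator U x\<bar> \<partial>lborel) \<longlonglongrightarrow> (0 :: real)"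
proof -
  have [measurable]: "U \<in> sets borel" using U by simp
  define g where "g = (indicator U :: real \<Rightarrow> real)"
  have g: "integrable lborel g" using U unfolding g_def by (intro integrable_real_indicator) auto
  have gm [measurable]: "g \<in> borel_measurable borel" unfolding g_def by measurable
  have gs: "integrable lborel (\<lambda>x. g (x - c))" for c using g by (simp add: lborel_integrable_shift)
  define p where "p n x = max 0 (g x - g (x - \<eta> n))" for n x
  have pint: "integrable lborel (p n)" for n
    unfolding p_def using g gs by (intro integrable_max) auto
  have "(\<lambda>n. \<integral>x. p n x \<partial>lborel) \<longlonglongrightarrow> (\<integral>x. 0 \<partial>(lborel :: real measure))"
  proof (rule Bochner_Integration.integral_dominated_convergence[where w = g])
    show "AE x in lborel. (\<lambda>n. p n x) \<longlonglongrightarrow> 0"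
    proof (rule AE_I2)
      fix x
      show "(\<lambda>n. p n x) \<longlonglongrightarrow> 0"
      proof (cases "x \<in> U")
        case True
        have "(\<lambda>n. x - \<eta> n) \<longlonglongrightarrow> x - 0" by (intro tendsto_intros \<eta>)
        then have "\<forall>\<^sub>F n in sequentially. x - \<eta> n \<in> U"
          using topological_tendstoD[OF _ U(1)] True by simp
        then have "\<forall>\<^sub>F n in sequentially. p n x = 0"
          by eventually_elim (use True in \<open>simp add: p_def g_def\<close>)
        then show ?thesis by (rule tendsto_eventually)
      next
        case False
        then have "p n x = 0" for n by (simp add: p_def g_def)
        then show ?thesis by simp
      qed
    qed
    show "AE x in lborel. norm (p n x) \<le> g x" for n
      by (rule AE_I2) (auto simp: p_def g_def split: split_indicator)
  qed (use g pint in auto)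
  moreover have "(\<integral>x. \<bar>g (x - \<eta> n) - g x\<bar> \<partial>lborel) = 2 * (\<integral>x. p n x \<partial>lborel)" for n
  proof -
    have "(\<integral>x. \<bar>g (x - \<eta> n) - g x\<bar> \<partial>lborel) = (\<integral>x. 2 * p n x + (g (x - \<eta> n) - g x) \<partial>lborel)"
      by (intro Bochner_Integration.integral_cong) (auto simp: p_def max_def abs_if)
    then show ?thesis using pint[of n] g gs[of "\<eta> n"] lborel_integral_shift[of g "\<eta> n"] by simp
  qed
  ultimately show ?thesis by (auto simp: g_def intro!: tendsto_eq_intros)
qed

text \<open>Outer regularity of Lebesgue measure reduces the claim to open sets.\<close>

lemma translation_L1_indicator:
  fixes \<eta> :: "nat \<Rightarrow> real"
  assumes A [measurable]: "A \<in> sets borel" and fin: "emeasure lborel A < \<infinity>" and \<eta>: "\<eta> \<longlonglongrightarrow> 0"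
  shows "(\<lambda>n. \<integral>x. \<bar>indicator A (x - \<eta> n) - indicator A x\<bar> \<partial>lborel) \<longlonglongrightarrow> (0 :: real)"
proof (rule LIMSEQ_I)
  fix e :: real assume "e > 0"
  have "A \<in> sets lebesgue" using A by simp
  from sets_lebesgue_outer_open[OF this, of "e / 4"] \<open>e > 0\<close>
  obtain U where U: "open U" "A \<subseteq> U" "U - A \<in> lmeasurable" "emeasure lebesgue (U - A) < ennreal (e / 4)"
    by auto
  have [measurable]: "U \<in> sets borel" using U by simp
  have UA: "emeasure lborel (U - A) < ennreal (e / 4)" using U by (simp add: emeasure_completion)
  have "emeasure lborel U \<le> emeasure lborel A + emeasure lborel (U - A)"
    using U(2) emeasure_subadditive[of A lborel "U - A"] by (simp add: Un_absorb1)
  also have "\<dots> < \<infinity>" using fin order_less_trans[OF UA ennreal_less_top] by simp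
  finally have finU: "emeasure lborel U < \<infinity>" .
  let ?a = "indicator A :: real \<Rightarrow> real" and ?u = "indicator U :: real \<Rightarrow> real"
  have int: "integrable lborel ?a" "integrable lborel ?u"
    using fin finU by (auto intro!: integrable_real_indicator)
  then have ints: "integrable lborel (\<lambda>x. ?a (x - c))" "integrable lborel (\<lambda>x. ?u (x - c))" for c
    by (simp_all add: lborel_integrable_shift)
  define d where "d = (\<integral>x. \<bar>?a x - ?u x\<bar> \<partial>lborel)"
  have "d = (\<integral>x. indicator (U - A) x \<partial>lborel)"
    unfolding d_def using U(2) by (intro Bochner_Integration.integral_cong) (auto split: split_indicator)
  then have "d = enn2real (emeasure lborel (U - A))" by (simp add: measure_def)
  then have d: "d < e / 4"
    using UA \<open>e > 0\<close> by (cases "emeasure lborel (U - A)") (auto simp: ennreal_less_iff)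
  have ds: "(\<integral>x. \<bar>?a (x - c) - ?u (x - c)\<bar> \<partial>lborel) = d" for c
    unfolding d_def using lborel_integral_shift[of "\<lambda>x. \<bar>?a x - ?u x\<bar>" c] by simp
  obtain N where N: "\<And>n. n \<ge> N \<Longrightarrow> norm ((\<integral>x. \<bar>?u (x - \<eta> n) - ?u x\<bar> \<partial>lborel) - 0) < e / 4"
    using LIMSEQ_D[OF translation_L1_open[OF U(1) finU \<eta>], of "e / 4"] \<open>e > 0\<close> by auto
  have "norm ((\<integral>x. \<bar>?a (x - \<eta> n) - ?a x\<bar> \<partial>lborel) - 0) < e" if "n \<ge> N" for n
  proof -
    have "(\<integral>x. \<bar>?a (x - \<eta> n) - ?a x\<bar> \<partial>lborel)
        \<le> (\<integral>x. \<bar>?a (x - \<eta> n) - ?u (x - \<eta> n)\<bar> + \<bar>?u (x - \<eta> n) - ?u x\<bar> + \<bar>?a x - ?u x\<bar> \<partial>lborel)"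
      using int ints by (intro integral_mono) auto
    also have "\<dots> = d + (\<integral>x. \<bar>?u (x - \<eta> n) - ?u x\<bar> \<partial>lborel) + d"
      using int ints ds by (simp add: d_def)
    also have "\<dots> < e" using d N[OF that] by (simp only: real_norm_def diff_zero; linarith)
    finally show ?thesis by simp
  qed
  then show "\<exists>N. \<forall>n\<ge>N. norm ((\<integral>x. \<bar>?a (x - \<eta> n) - ?a x\<bar> \<partial>lborel) - 0) < e" by blast
qed

lemma translation_L1:
  fixes f :: "real \<Rightarrow> 'b::{banach,second_countable_topology}" and \<eta> :: "nat \<Rightarrow> real"
  assumes "integrable lborel f" and \<eta>: "\<eta> \<longlonglongrightarrow> 0"
  shows "(\<lambda>n. \<integral>x. norm (f (x - \<eta> n) - f x) \<partial>lborel) \<longlonglongrightarrow> 0"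
  using assms(1)
proof (induction rule: integrable_induct)
  case (base A c)
  have eq: "norm (indicator A (x - \<eta> n) *\<^sub>R c - indicator A x *\<^sub>R c)
      = norm c * \<bar>indicator A (x - \<eta> n) - indicator A x\<bar>" for x n
    by (auto split: split_indicator)
  have "(\<lambda>n. norm c * (\<integral>x. \<bar>indicator A (x - \<eta> n) - indicator A x\<bar> \<partial>lborel)) \<longlonglongrightarrow> 0"
    using translation_L1_indicator[OF _ _ \<eta>, of A] base by (auto intro!: tendsto_mult_right_zero)
  then show ?case unfolding eq by simp
next
  case (add f g)
  show ?case
  proof (rule Lim_null_comparison)
    show "(\<lambda>n. (\<integral>x. norm (f (x - \<eta> n) - f x) \<partial>lborel) + (\<integral>x. norm (g (x - \<eta> n) - g x) \<partial>lborel)) \<longlonglongrightarrow> 0"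
      using tendsto_add[OF add.IH(1) add.IH(2)] by simp
    have int: "integrable lborel (\<lambda>x. f (x - c))" "integrable lborel (\<lambda>x. g (x - c))" for c
      using add.hyps by (simp_all add: lborel_integrable_shift)
    have "(\<integral>x. norm (f (x - \<eta> n) + g (x - \<eta> n) - (f x + g x)) \<partial>lborel)
       \<le> (\<integral>x. norm (f (x - \<eta> n) - f x) + norm (g (x - \<eta> n) - g x) \<partial>lborel)" for n
      using add.hyps int by (intro integral_mono) (auto intro!: norm_diff_triangle_ineq)
    then have "(\<integral>x. norm (f (x - \<eta> n) + g (x - \<eta> n) - (f x + g x)) \<partial>lborel)
       \<le> (\<integral>x. norm (f (x - \<eta> n) - f x) \<partial>lborel) + (\<integral>x. norm (g (x - \<eta> n) - g x) \<partial>lborel)" for n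
      using add.hyps int by simp
    then show "\<forall>\<^sub>F n in sequentially. norm (\<integral>x. norm (f (x - \<eta> n) + g (x - \<eta> n) - (f x + g x)) \<partial>lborel)
       \<le> (\<integral>x. norm (f (x - \<eta> n) - f x) \<partial>lborel) + (\<integral>x. norm (g (x - \<eta> n) - g x) \<partial>lborel)"
      by simp
  qed
next
  case (lim f s)
  have s_int: "integrable lborel (s i)" for i using lim.hyps by auto
  have ints: "integrable lborel (\<lambda>x. f (x - c))" "integrable lborel (\<lambda>x. s i (x - c))" for c i
    using lim.hyps s_int by (simp_all add: lborel_integrable_shift)
  have "(\<lambda>i. \<integral>x. norm (s i x - f x) \<partial>lborel) \<longlonglongrightarrow> (\<integral>x. 0 \<partial>(lborel :: real measure))"
  proof (rule Bochner_Integration.integral_dominated_convergence[where w = "\<lambda>x. 3 * norm (f x)"])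
    show "AE x in lborel. (\<lambda>i. norm (s i x - f x)) \<longlonglongrightarrow> 0"
      using lim.hyps(2) by (intro AE_I2) (simp add: tendsto_norm_zero_iff LIM_zero_iff)
    show "AE x in lborel. norm (norm (s i x - f x)) \<le> 3 * norm (f x)" for i
    proof (rule AE_I2)
      fix x
      have "norm (s i x) \<le> 2 * norm (f x)" using lim.hyps(3) by simp
      then show "norm (norm (s i x - f x)) \<le> 3 * norm (f x)"
        using norm_triangle_ineq4[of "s i x" "f x"] by simp
    qed
  qed (use lim.hyps s_int in auto)
  then have approx: "(\<lambda>i. \<integral>x. norm (s i x - f x) \<partial>lborel) \<longlonglongrightarrow> 0" by simp
  show ?case
  proof (rule LIMSEQ_I)
    fix e :: real assume "e > 0"
    obtain i where i: "norm ((\<integral>x. norm (s i x - f x) \<partial>lborel) - 0) < e / 4"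
      using LIMSEQ_D[OF approx, of "e / 4"] \<open>e > 0\<close> by auto
    obtain N where N: "\<And>n. n \<ge> N \<Longrightarrow> norm ((\<integral>x. norm (s i (x - \<eta> n) - s i x) \<partial>lborel) - 0) < e / 4"
      using LIMSEQ_D[OF lim.IH[of i], of "e / 4"] \<open>e > 0\<close> by auto
    have "norm ((\<integral>x. norm (f (x - \<eta> n) - f x) \<partial>lborel) - 0) < e" if "n \<ge> N" for n
    proof -
      have "norm (a - b) \<le> norm (c - a) + norm (c - d) + norm (d - b)" for a b c d :: 'b
        using norm_triangle_ineq[of "a - c" "c - d + (d - b)"] norm_triangle_ineq[of "c - d" "d - b"]
        by (simp add: norm_minus_commute)
      then have "(\<integral>x. norm (f (x - \<eta> n) - f x) \<partial>lborel)
          \<le> (\<integral>x. norm (s i (x - \<eta> n) - f (x - \<eta> n)) + norm (s i (x - \<eta> n) - s i x) + norm (s i x - f x) \<partial>lborel)"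
        using s_int ints lim.hyps by (intro integral_mono) auto
      also have "\<dots> = (\<integral>x. norm (s i (x - \<eta> n) - f (x - \<eta> n)) \<partial>lborel)
          + (\<integral>x. norm (s i (x - \<eta> n) - s i x) \<partial>lborel) + (\<integral>x. norm (s i x - f x) \<partial>lborel)"
        using s_int ints lim.hyps by simp
      also have "(\<integral>x. norm (s i (x - \<eta> n) - f (x - \<eta> n)) \<partial>lborel) = (\<integral>x. norm (s i x - f x) \<partial>lborel)"
        by (rule lborel_integral_shift)
      finally have "(\<integral>x. norm (f (x - \<eta> n) - f x) \<partial>lborel) \<le> (\<integral>x. norm (s i x - f x) \<partial>lborel)
          + (\<integral>x. norm (s i (x - \<eta> n) - s i x) \<partial>lborel) + (\<integral>x. norm (s i x - f x) \<partial>lborel)" .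
      moreover have "0 \<le> (\<integral>x. norm (f (x - \<eta> n) - f x) \<partial>lborel)" by simp
      ultimately show ?thesis using i N[OF that] \<open>e > 0\<close> unfolding real_norm_def by linarith
    qed
    then show "\<exists>N. \<forall>n\<ge>N. norm ((\<integral>x. norm (f (x - \<eta> n) - f x) \<partial>lborel) - 0) < e" by blast
  qed
qed

lemma powr_triangle3:
  fixes a b c p :: real
  assumes "0 \<le> a" "0 \<le> b" "0 \<le> c" "0 < p"
  shows "(a + b + c) powr p \<le> 3 powr p * (a powr p + b powr p + c powr p)"
proof -
  define m where "m = max a (max b c)"
  have "(a + b + c) powr p \<le> (3 * m) powr p"
    using assms by (intro powr_mono2) (auto simp: m_def)
  also have "\<dots> = 3 powr p * m powr p" using assms by (simp add: powr_mult m_def)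
  also have "m powr p \<le> a powr p + b powr p + c powr p"
    by (auto simp: m_def max_def)
  finally show ?thesis by simp
qed

text \<open>
  After truncation at level \<open>M\<close> the function is bounded, where the \<open>L\<^sup>p\<close> distance is controlled by the
  \<open>L\<^sup>1\<close> distance; the truncation error is small in \<open>L\<^sup>p\<close>, uniformly under translation.
\<close>

lemma translation_Lp:
  fixes f :: "real \<Rightarrow> 'b::{banach,second_countable_topology}" and \<eta> :: "nat \<Rightarrow> real"
  assumes p: "1 \<le> p" and f: "f \<in> Lp_on p {0..1}" and \<eta>: "\<eta> \<longlonglongrightarrow> 0"
  shows "(\<lambda>n. \<integral>x. norm (f (x - \<eta> n) - f x) powr p \<partial>lborel) \<longlonglongrightarrow> 0"
    and "integrable lborel (\<lambda>x. norm (f (x - c) - f x) powr p)"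
proof -
  have fm [measurable]: "f \<in> borel_measurable borel" and fint: "integrable lborel (\<lambda>x. norm (f x) powr p)"
    and f0: "\<And>x. x \<notin> {0..1} \<Longrightarrow> f x = 0"
    using f by (auto simp: Lp_on_def)
  define g where "g M x = (if norm (f x) \<le> M then f x else 0)" for M x
  have gm [measurable]: "g M \<in> borel_measurable borel" for M unfolding g_def by measurable
  have dint: "integrable lborel (\<lambda>x. norm (f x - g M x) powr p)" for M
    by (rule Bochner_Integration.integrable_bound[OF fint]) (auto simp: g_def)
  have "(\<lambda>M. \<integral>x. norm (f x - g (real M) x) powr p \<partial>lborel) \<longlonglongrightarrow> (\<integral>x. 0 \<partial>(lborel :: real measure))"
  proof (rule Bochner_Integration.integral_dominated_convergence[OF _ _ fint])
    show "AE x in lborel. (\<lambda>M. norm (f x - g (real M) x) powr p) \<longlonglongrightarrow> 0"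
    proof (rule AE_I2)
      fix x
      have "\<forall>\<^sub>F M in sequentially. norm (f x - g (real M) x) powr p = 0"
        using eventually_ge_at_top[of "nat \<lceil>norm (f x)\<rceil>"]
        by eventually_elim (auto simp: g_def nat_ceiling_le_eq)
      then show "(\<lambda>M. norm (f x - g (real M) x) powr p) \<longlonglongrightarrow> 0" by (rule tendsto_eventually)
    qed
  qed (auto simp: g_def)
  then have approx: "(\<lambda>M. \<integral>x. norm (f x - g (real M) x) powr p \<partial>lborel) \<longlonglongrightarrow> 0" by simp
  have g_int: "integrable lborel (g M)" for M
  proof (rule Bochner_Integration.integrable_bound)
    show "integrable lborel (\<lambda>x. \<bar>M\<bar> * indicator {0..1::real} x)" by (intro integrable_mult_right integrable_real_indicator) auto
    show "AE x in lborel. norm (g M x) \<le> norm (\<bar>M\<bar> * indicator {0..1} x)"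
      using f0 by (intro AE_I2) (auto simp: g_def split: split_indicator)
  qed measurable
  have g_shift: "integrable lborel (\<lambda>x. norm (g M (x - c) - g M x))" for M c
    using g_int[of M] lborel_integrable_shift[of "g M" c] by (intro integrable_norm Bochner_Integration.integrable_diff) auto
  have gb: "norm (g M (x - c) - g M x) powr p \<le> (2 * M) powr (p - 1) * norm (g M (x - c) - g M x)"
    if "M \<ge> 0" for M x c
  proof -
    define y where "y = norm (g M (x - c) - g M x)"
    have "norm (g M z) \<le> M" for z using that by (simp add: g_def)
    then have y: "y \<le> 2 * M" unfolding y_def
      using norm_triangle_ineq4[of "g M (x - c)" "g M x"] by (smt (verit))
    have "y \<ge> 0" by (simp add: y_def)
    have "y powr p = y powr (p - 1) * y"
    proof (cases "y = 0")
      case False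
      have "y powr (p - 1) * y powr 1 = y powr (p - 1 + 1)"
        by (rule powr_add[symmetric])
      then show ?thesis unfolding powr_one[OF \<open>y \<ge> 0\<close>] by simp
    qed simp
    also have "\<dots> \<le> (2 * M) powr (p - 1) * y"
      using y \<open>y \<ge> 0\<close> p by (intro mult_right_mono powr_mono2) auto
    finally show ?thesis by (simp add: y_def)
  qed
  have gp_int: "integrable lborel (\<lambda>x. norm (g M (x - c) - g M x) powr p)" if "M \<ge> 0" for M c
  proof (rule Bochner_Integration.integrable_bound[OF integrable_mult_right[OF g_shift, of "(2 * M) powr (p - 1)" M c]])
    show "AE x in lborel. norm (norm (g M (x - c) - g M x) powr p)
        \<le> norm ((2 * M) powr (p - 1) * norm (g M (x - c) - g M x))"
      using gb[OF that, of _ c] by (intro AE_I2) simp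
  qed measurable
  have le: "norm (f (x - c) - f x) powr p \<le> 3 powr p * (norm (f (x - c) - g M (x - c)) powr p
      + norm (g M (x - c) - g M x) powr p + norm (f x - g M x) powr p)" for x c M
  proof -
    have "norm (f (x - c) - f x) \<le> norm (f (x - c) - g M (x - c)) + norm (g M (x - c) - g M x) + norm (f x - g M x)"
      using norm_triangle_ineq[of "f (x - c) - g M (x - c)" "g M (x - c) - g M x + (g M x - f x)"]
        norm_triangle_ineq[of "g M (x - c) - g M x" "g M x - f x"] by (simp add: norm_minus_commute)
    then have "norm (f (x - c) - f x) powr p
       \<le> (norm (f (x - c) - g M (x - c)) + norm (g M (x - c) - g M x) + norm (f x - g M x)) powr p"
      using p by (intro powr_mono2) auto
    also have "\<dots> \<le> 3 powr p * (norm (f (x - c) - g M (x - c)) powr p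
      + norm (g M (x - c) - g M x) powr p + norm (f x - g M x) powr p)"
      using p by (intro powr_triangle3) auto
    finally show ?thesis .
  qed
  have dints: "integrable lborel (\<lambda>x. norm (f (x - c) - g M (x - c)) powr p)" for c M
    using lborel_integrable_shift[of "\<lambda>x. norm (f x - g M x) powr p" c] dint by simp
  have rhs_int: "integrable lborel (\<lambda>x. 3 powr p * (norm (f (x - c) - g M (x - c)) powr p
      + norm (g M (x - c) - g M x) powr p + norm (f x - g M x) powr p))" if "M \<ge> 0" for M c
    using dints dint gp_int[OF that] by (intro integrable_mult_right Bochner_Integration.integrable_add) auto
  show fs_int: "integrable lborel (\<lambda>x. norm (f (x - c) - f x) powr p)" for c
  proof (rule Bochner_Integration.integrable_bound[OF rhs_int[of 0 c]])
    show "AE x in lborel. norm (norm (f (x - c) - f x) powr p) \<le> norm (3 powr p * (norm (f (x - c) - g 0 (x - c)) powr p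
      + norm (g 0 (x - c) - g 0 x) powr p + norm (f x - g 0 x) powr p))"
      using le[of _ c 0] by (intro AE_I2) (simp add: abs_of_nonneg)
  qed (simp, measurable)
  show "(\<lambda>n. \<integral>x. norm (f (x - \<eta> n) - f x) powr p \<partial>lborel) \<longlonglongrightarrow> 0"
  proof (rule LIMSEQ_I)
    fix e :: real assume "e > 0"
    define e' where "e' = e / (4 * 3 powr p)"
    have e': "e' > 0" using \<open>e > 0\<close> by (simp add: e'_def)
    obtain M :: nat where M: "norm ((\<integral>x. norm (f x - g (real M) x) powr p \<partial>lborel) - 0) < e'"
      using LIMSEQ_D[OF approx e'] by auto
    have "(\<lambda>n. \<integral>x. norm (g (real M) (x - \<eta> n) - g (real M) x) powr p \<partial>lborel) \<longlonglongrightarrow> 0"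
    proof (rule Lim_null_comparison)
      show "(\<lambda>n. (2 * real M) powr (p - 1) * (\<integral>x. norm (g (real M) (x - \<eta> n) - g (real M) x) \<partial>lborel)) \<longlonglongrightarrow> 0"
        by (rule tendsto_mult_right_zero[OF translation_L1[OF g_int \<eta>]])
      have "(\<integral>x. norm (g (real M) (x - \<eta> n) - g (real M) x) powr p \<partial>lborel)
          \<le> (\<integral>x. (2 * real M) powr (p - 1) * norm (g (real M) (x - \<eta> n) - g (real M) x) \<partial>lborel)" for n
        using gp_int[of "real M"] g_shift gb by (intro integral_mono integrable_mult_right) auto
      then show "\<forall>\<^sub>F n in sequentially. norm (\<integral>x. norm (g (real M) (x - \<eta> n) - g (real M) x) powr p \<partial>lborel)
        \<le> (2 * real M) powr (p - 1) * (\<integral>x. norm (g (real M) (x - \<eta> n) - g (real M) x) \<partial>lborel)"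
        by simp
    qed
    from LIMSEQ_D[OF this e']
    obtain N where N: "\<And>n. n \<ge> N \<Longrightarrow> norm ((\<integral>x. norm (g (real M) (x - \<eta> n) - g (real M) x) powr p \<partial>lborel) - 0) < e'"
      by auto
    have "norm ((\<integral>x. norm (f (x - \<eta> n) - f x) powr p \<partial>lborel) - 0) < e" if "n \<ge> N" for n
    proof -
      have "(\<integral>x. norm (f (x - \<eta> n) - f x) powr p \<partial>lborel) \<le> (\<integral>x. 3 powr p * (norm (f (x - \<eta> n) - g (real M) (x - \<eta> n)) powr p
      + norm (g (real M) (x - \<eta> n) - g (real M) x) powr p + norm (f x - g (real M) x) powr p) \<partial>lborel)"
        by (rule integral_mono[OF fs_int rhs_int le]) simp
      also have "\<dots> = 3 powr p * ((\<integral>x. norm (f (x - \<eta> n) - g (real M) (x - \<eta> n)) powr p \<partial>lborel)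
        + (\<integral>x. norm (g (real M) (x - \<eta> n) - g (real M) x) powr p \<partial>lborel) + (\<integral>x. norm (f x - g (real M) x) powr p \<partial>lborel))"
        using dints dint gp_int[of "real M"] by simp
      also have "(\<integral>x. norm (f (x - \<eta> n) - g (real M) (x - \<eta> n)) powr p \<partial>lborel) = (\<integral>x. norm (f x - g (real M) x) powr p \<partial>lborel)"
        by (rule lborel_integral_shift)
      also have "3 powr p * ((\<integral>x. norm (f x - g (real M) x) powr p \<partial>lborel)
        + (\<integral>x. norm (g (real M) (x - \<eta> n) - g (real M) x) powr p \<partial>lborel) + (\<integral>x. norm (f x - g (real M) x) powr p \<partial>lborel))
        \<le> 3 powr p * (3 * e')"
        using M N[OF that] by (intro mult_left_mono) auto
      also have "\<dots> < e" using \<open>e > 0\<close> by (simp add: e'_def field_simps)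
      finally show ?thesis by simp
    qed
    then show "\<exists>N. \<forall>n\<ge>N. norm ((\<integral>x. norm (f (x - \<eta> n) - f x) powr p \<partial>lborel) - 0) < e" by blast
  qed
qed

section \<open>Delay and restriction on \<open>L\<^sup>p([0,1], X)\<close>\<close>

lemma powr_add_le:
  fixes a b p :: real
  assumes "0 \<le> a" "0 \<le> b" "0 < p"
  shows "(a + b) powr p \<le> 3 powr p * (a powr p + b powr p)"
  using powr_triangle3[of a b 0 p] assms by simp

lemma Lp_on_add:
  assumes "0 < p" "f \<in> Lp_on p S" "g \<in> Lp_on p S"
  shows "(\<lambda>x. f x + g x) \<in> Lp_on p S"
proof -
  have [measurable]: "f \<in> borel_measurable borel" "g \<in> borel_measurable borel"
    using assms by (auto simp: Lp_on_def)
  have int: "integrable lborel (\<lambda>x. norm (f x) powr p)" "integrable lborel (\<lambda>x. norm (g x) powr p)"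
    using assms by (auto simp: Lp_on_def)
  have "integrable lborel (\<lambda>x. norm (f x + g x) powr p)"
  proof (rule Bochner_Integration.integrable_bound)
    show "integrable lborel (\<lambda>x. 3 powr p * (norm (f x) powr p + norm (g x) powr p))"
      by (intro integrable_mult_right Bochner_Integration.integrable_add int)
    have "norm (f x + g x) powr p \<le> 3 powr p * (norm (f x) powr p + norm (g x) powr p)" for x
    proof -
      have "norm (f x + g x) powr p \<le> (norm (f x) + norm (g x)) powr p"
        using assms(1) by (intro powr_mono2 norm_triangle_ineq) auto
      also have "\<dots> \<le> 3 powr p * (norm (f x) powr p + norm (g x) powr p)"
        using assms(1) by (intro powr_add_le) auto
      finally show ?thesis .
    qed
    then show "AE x in lborel. norm (norm (f x + g x) powr p) \<le> norm (3 powr p * (norm (f x) powr p + norm (g x) powr p))"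
      by (intro AE_I2) simp
  qed measurable
  then show ?thesis using assms by (auto simp: Lp_on_def)
qed

lemma Lp_on_scaleR:
  assumes "f \<in> Lp_on p S"
  shows "(\<lambda>x. c *\<^sub>R f x) \<in> Lp_on p S"
  using assms by (auto simp: Lp_on_def powr_mult)

locale Lp_unit_interval =
  fixes p :: real and rep :: "'e::banach \<Rightarrow> real \<Rightarrow> 'x::{banach,second_countable_topology}"
  assumes p_gt_1: "1 < p" and is_Lp: "is_Lp_space p {0..1} rep"
begin

lemma rep_Lp: "rep h \<in> Lp_on p {0..1}"
  and rep_surj: "f \<in> Lp_on p {0..1} \<Longrightarrow> \<exists>h. AE x in lborel. rep h x = f x"
  and rep_add: "AE x in lborel. rep (h + k) x = rep h x + rep k x"
  and rep_scaleR: "AE x in lborel. rep (c *\<^sub>R h) x = c *\<^sub>R rep h x"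
  and norm_rep: "norm h = Lp_norm lborel p (rep h)"
  using is_Lp by (auto simp: is_Lp_space_def)

lemma rep_measurable [measurable]: "rep h \<in> borel_measurable borel"
  and rep_integrable: "integrable lborel (\<lambda>x. norm (rep h x) powr p)"
  and rep_outside: "x \<notin> {0..1} \<Longrightarrow> rep h x = 0"
  using rep_Lp[of h] by (auto simp: Lp_on_def)

lemma rep_diff: "AE x in lborel. rep (h - k) x = rep h x - rep k x"
  using rep_add[of h "(-1) *\<^sub>R k"] rep_scaleR[of "-1" k] by eventually_elim simp

lemma rep_0: "AE x in lborel. rep 0 x = 0"
  using rep_scaleR[of 0 0] by eventually_elim simp

lemma norm_powr: "norm h powr p = (\<integral>x. norm (rep h x) powr p \<partial>lborel)"
proof -
  have "0 \<le> (\<integral>x. norm (rep h x) powr p \<partial>lborel)" by simp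
  then show ?thesis using p_gt_1 by (simp add: norm_rep Lp_norm_def powr_powr)
qed

lemma rep_eqI:
  assumes "AE x in lborel. rep h x = rep k x"
  shows "h = k"
proof -
  have "AE x in lborel. norm (rep (h - k) x) powr p = 0"
    using assms rep_diff[of h k] by eventually_elim simp
  then have "(\<integral>x. norm (rep (h - k) x) powr p \<partial>lborel) = 0"
    by (subst integral_cong_AE[of _ _ "\<lambda>_. 0"]) auto
  then have "norm (h - k) powr p = 0" by (simp add: norm_powr)
  then show ?thesis by simp
qed

text \<open>Elements of \<open>'e\<close> are determined by their representatives, hence the choice of a preimage.\<close>

definition cutoff :: "real set \<Rightarrow> real \<Rightarrow> 'e \<Rightarrow> 'e" where
  "cutoff S \<eta> h = (SOME k. AE x in lborel. rep k x = (if x \<in> S \<and> x \<in> {0..1} then rep h (x - \<eta>) else 0))"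

lemma rep_cutoff:
  assumes [measurable]: "S \<in> sets borel"
  shows "AE x in lborel. rep (cutoff S \<eta> h) x = (if x \<in> S \<and> x \<in> {0..1} then rep h (x - \<eta>) else 0)"
proof -
  have "(\<lambda>x. if x \<in> S \<and> x \<in> {0..1} then rep h (x - \<eta>) else 0) \<in> Lp_on p {0..1}"
    unfolding Lp_on_def mem_Collect_eq
  proof (intro conjI)
    have "integrable lborel (\<lambda>x. norm (rep h (x - \<eta>)) powr p)"
      using rep_integrable[of h] lborel_integrable_shift[of "\<lambda>x. norm (rep h x) powr p" \<eta>] by simp
    then show "integrable lborel (\<lambda>x. norm (if x \<in> S \<and> x \<in> {0..1} then rep h (x - \<eta>) else 0) powr p)"
      by (rule Bochner_Integration.integrable_bound) auto
  qed auto
  from rep_surj[OF this] show ?thesis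
    unfolding cutoff_def by (rule someI_ex)
qed

lemma cutoff_add: assumes [measurable]: "S \<in> sets borel" shows "cutoff S \<eta> (h + k) = cutoff S \<eta> h + cutoff S \<eta> k"
proof (rule rep_eqI)
  have "AE x in lborel. rep (h + k) (x - \<eta>) = rep h (x - \<eta>) + rep k (x - \<eta>)"
    using rep_add[of h k] by (rule AE_lborel_shift)
  then show "AE x in lborel. rep (cutoff S \<eta> (h + k)) x = rep (cutoff S \<eta> h + cutoff S \<eta> k) x"
    using rep_cutoff[OF assms, of \<eta> "h + k"] rep_cutoff[OF assms, of \<eta> h] rep_cutoff[OF assms, of \<eta> k]
      rep_add[of "cutoff S \<eta> h" "cutoff S \<eta> k"]
    by eventually_elim simp
qed

lemma cutoff_scaleR: assumes [measurable]: "S \<in> sets borel" shows "cutoff S \<eta> (c *\<^sub>R h) = c *\<^sub>R cutoff S \<eta> h"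
proof (rule rep_eqI)
  have "AE x in lborel. rep (c *\<^sub>R h) (x - \<eta>) = c *\<^sub>R rep h (x - \<eta>)"
    using rep_scaleR[of c h] by (rule AE_lborel_shift)
  then show "AE x in lborel. rep (cutoff S \<eta> (c *\<^sub>R h)) x = rep (c *\<^sub>R cutoff S \<eta> h) x"
    using rep_cutoff[OF assms, of \<eta> "c *\<^sub>R h"] rep_cutoff[OF assms, of \<eta> h] rep_scaleR[of c "cutoff S \<eta> h"]
    by eventually_elim simp
qed

lemma norm_cutoff_le: assumes [measurable]: "S \<in> sets borel" shows "norm (cutoff S \<eta> h) \<le> norm h"
proof -
  have int: "integrable lborel (\<lambda>x. norm (rep h (x - \<eta>)) powr p)"
    using rep_integrable[of h] lborel_integrable_shift[of "\<lambda>x. norm (rep h x) powr p" \<eta>] by simp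
  have "norm (cutoff S \<eta> h) powr p \<le> (\<integral>x. norm (rep h (x - \<eta>)) powr p \<partial>lborel)"
    unfolding norm_powr
  proof (rule integral_mono_AE[OF rep_integrable int])
    show "AE x in lborel. norm (rep (cutoff S \<eta> h) x) powr p \<le> norm (rep h (x - \<eta>)) powr p"
      using rep_cutoff[OF assms, of \<eta> h] by eventually_elim simp
  qed
  also have "\<dots> = norm h powr p"
    unfolding norm_powr by (rule lborel_integral_shift)
  finally have "norm (cutoff S \<eta> h) powr p \<le> norm h powr p" .
  then show ?thesis
    using powr_less_mono2[of p "norm h" "norm (cutoff S \<eta> h)"] p_gt_1 by (meson norm_ge_zero not_le less_trans zero_less_one)
qed

lemma bounded_linear_cutoff: "S \<in> sets borel \<Longrightarrow> bounded_linear (cutoff S \<eta>)"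
  by (rule bounded_linear_intro[where K = 1]) (auto simp: cutoff_add cutoff_scaleR norm_cutoff_le)

lemma cutoff_disjoint_union:
  assumes [measurable]: "S \<in> sets borel" "T \<in> sets borel" and "S \<inter> T = {}"
  shows "cutoff (S \<union> T) \<eta> h = cutoff S \<eta> h + cutoff T \<eta> h"
proof (rule rep_eqI)
  have "S \<union> T \<in> sets borel" by measurable
  from rep_cutoff[OF this, of \<eta> h]
  show "AE x in lborel. rep (cutoff (S \<union> T) \<eta> h) x = rep (cutoff S \<eta> h + cutoff T \<eta> h) x"
    using rep_cutoff[OF assms(1), of \<eta> h] rep_cutoff[OF assms(2), of \<eta> h] rep_add[of "cutoff S \<eta> h" "cutoff T \<eta> h"]
    by eventually_elim (use assms(3) in auto)
qed

lemma cutoff_empty: "cutoff {} \<eta> h = 0"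
proof (rule rep_eqI)
  show "AE x in lborel. rep (cutoff {} \<eta> h) x = rep 0 x"
    using rep_cutoff[OF sets.empty_sets, of \<eta> h] rep_0 by eventually_elim simp
qed

text \<open>The projection of \<open>E\<close> onto \<open>E\<^sub>s\<close>.\<close>

definition restr :: "real \<Rightarrow> 'e \<Rightarrow> 'e" where
  "restr s = cutoff {0..s} 0"

lemma rep_restr: "AE x in lborel. rep (restr s h) x = (if x \<in> {0..s} then rep h x else 0)"
proof -
  have "{0..s} \<in> sets borel" by simp
  from rep_cutoff[OF this, of 0 h] show ?thesis
    unfolding restr_def by eventually_elim (auto simp: rep_outside)
qed

lemma bounded_linear_restr: "bounded_linear (restr s)"
  unfolding restr_def by (rule bounded_linear_cutoff) simp

lemma norm_restr_le: "norm (restr s h) \<le> norm h"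
  unfolding restr_def by (rule norm_cutoff_le) simp

lemma restr_eqI:
  assumes "AE x in lborel. x \<in> {0..s} \<longrightarrow> rep h x = rep k x"
  shows "restr s h = restr s k"
proof (rule rep_eqI)
  show "AE x in lborel. rep (restr s h) x = rep (restr s k) x"
    using assms rep_restr[of s h] rep_restr[of s k] by eventually_elim auto
qed

lemma restr_restr: "s \<le> t \<Longrightarrow> restr s (restr t h) = restr s h"
proof (rule restr_eqI)
  assume "s \<le> t"
  then show "AE x in lborel. x \<in> {0..s} \<longrightarrow> rep (restr t h) x = rep h x"
    using rep_restr[of t h] by eventually_elim (use \<open>s \<le> t\<close> in auto)
qed

lemma restr_self: "AE x in lborel. x \<notin> {0..s} \<longrightarrow> rep h x = 0 \<Longrightarrow> restr s h = h"
proof (rule rep_eqI)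
  assume "AE x in lborel. x \<notin> {0..s} \<longrightarrow> rep h x = 0"
  then show "AE x in lborel. rep (restr s h) x = rep h x"
    using rep_restr[of s h] by eventually_elim auto
qed

lemma restr_eq_0_iff: "restr s h = 0 \<longleftrightarrow> (AE x in lborel. x \<in> {0..s} \<longrightarrow> rep h x = 0)"
proof
  assume "restr s h = 0"
  then have "AE x in lborel. rep (restr s h) x = 0" using rep_0 by simp
  then show "AE x in lborel. x \<in> {0..s} \<longrightarrow> rep h x = 0"
    using rep_restr[of s h] by eventually_elim auto
next
  assume *: "AE x in lborel. x \<in> {0..s} \<longrightarrow> rep h x = 0"
  show "restr s h = 0"
  proof (rule rep_eqI)
    show "AE x in lborel. rep (restr s h) x = rep 0 x"
      using * rep_restr[of s h] rep_0 by eventually_elim auto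
  qed
qed

text \<open>
  If a block is at most as long as the delay, it only depends on the argument before the block starts. This
  makes the discretised control predictable.
\<close>

lemma cutoff_restr:
  assumes [measurable]: "S \<in> sets borel" and S: "\<And>x. x \<in> S \<Longrightarrow> x \<le> s + \<eta>"
  shows "cutoff S \<eta> (restr s h) = cutoff S \<eta> h"
proof (rule rep_eqI)
  have "AE x in lborel. rep (restr s h) (x - \<eta>) = (if x - \<eta> \<in> {0..s} then rep h (x - \<eta>) else 0)"
    using rep_restr[of s h] by (rule AE_lborel_shift)
  then show "AE x in lborel. rep (cutoff S \<eta> (restr s h)) x = rep (cutoff S \<eta> h) x"
    using rep_cutoff[OF assms(1), of \<eta> h] rep_cutoff[OF assms(1), of \<eta> "restr s h"]
  proof eventually_elim
    case (elim x)
    then show ?case using S[of x] by (cases "x \<in> S") (auto simp: rep_outside)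
  qed
qed

text \<open>
  Up to time \<open>t\<close> the delayed element is a translate of \<open>h\<close>: before time \<open>\<eta> n\<close>, where it is cut off,
  the translate of \<open>h\<close> vanishes as well.
\<close>

lemma delay_tendsto:
  assumes \<eta>: "\<eta> \<longlonglongrightarrow> 0" "\<And>n. 0 \<le> \<eta> n" and t: "t \<le> 1"
  shows "(\<lambda>n. cutoff {\<eta> n<..t} (\<eta> n) h) \<longlonglongrightarrow> restr t h"
proof -
  have le: "norm (cutoff {\<eta> n<..t} (\<eta> n) h - restr t h) powr p \<le> (\<integral>x. norm (rep h (x - \<eta> n) - rep h x) powr p \<partial>lborel)" for n
    unfolding norm_powr
  proof (rule integral_mono_AE[OF rep_integrable translation_Lp(2)[OF less_imp_le[OF p_gt_1] rep_Lp[of h] \<eta>(1)]])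
    have S: "{\<eta> n<..t} \<in> sets borel" by simp
    have "AE x in lborel. x \<noteq> \<eta> n" by (rule AE_lborel_singleton)
    then show "AE x in lborel. norm (rep (cutoff {\<eta> n<..t} (\<eta> n) h - restr t h) x) powr p \<le> norm (rep h (x - \<eta> n) - rep h x) powr p"
      using rep_diff[of "cutoff {\<eta> n<..t} (\<eta> n) h" "restr t h"] rep_cutoff[OF S, of "\<eta> n" h] rep_restr[of t h]
    proof eventually_elim
      case (elim x)
      consider "x \<notin> {0..t}" | "x \<in> {0..t}" "x > \<eta> n" | "x \<in> {0..t}" "x < \<eta> n" using elim by fastforce
      then show ?case
      proof cases
        case 1
        then have "\<not> (x \<in> {\<eta> n<..t} \<and> x \<in> {0..1})" by auto
        then have "rep (cutoff {\<eta> n<..t} (\<eta> n) h - restr t h) x = 0"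
          using elim(2-4) 1 by (simp only: if_False diff_self)
        then show ?thesis by simp
      next
        case 2
        then show ?thesis using elim t by simp
      next
        case 3
        then have "rep h (x - \<eta> n) = 0" by (intro rep_outside) auto
        then show ?thesis using elim 3 by simp
      qed
    qed
  qed
  have "(\<lambda>n. norm (cutoff {\<eta> n<..t} (\<eta> n) h - restr t h) powr p) \<longlonglongrightarrow> 0"
    by (rule Lim_null_comparison[OF _ translation_Lp(1)[OF less_imp_le[OF p_gt_1] rep_Lp[of h] \<eta>(1)]]) (use le in auto)
  then have "(\<lambda>n. (norm (cutoff {\<eta> n<..t} (\<eta> n) h - restr t h) powr p) powr (1 / p)) \<longlonglongrightarrow> 0 powr (1 / p)"
    by (rule tendsto_powr') (use p_gt_1 in auto)
  then have "(\<lambda>n. norm (cutoff {\<eta> n<..t} (\<eta> n) h - restr t h)) \<longlonglongrightarrow> 0"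
    using p_gt_1 by (simp add: powr_powr)
  then show ?thesis by (simp add: tendsto_norm_zero_iff LIM_zero_iff)
qed

end

section \<open>Separately differentiable functions along the diagonal\<close>

text \<open>
  Let \<open>K\<close> be the closed set of points near which \<open>\<phi>\<close> is not Lipschitz with constant \<open>c\<close>. Off \<open>K\<close>
  the bound can be chained along intervals, up to the closure of a gap of \<open>K\<close> by continuity. If \<open>K\<close> were
  nonempty, Baire's theorem would give a member \<open>S\<close> of the cover containing all points of \<open>K\<close> near
  some \<open>x \<in> K\<close>. A short interval near \<open>x\<close> splits into a part between two points of \<open>K\<close>, hence of
  \<open>S\<close>, and two parts inside gaps of \<open>K\<close>; the bound holds on each of them, so that \<open>x \<notin> K\<close>.
\<close>

lemma lipschitz_by_countable_closed_cover:
  fixes \<phi> :: "real \<Rightarrow> real"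
  assumes cont: "continuous_on {0..1} \<phi>"
    and \<S>: "countable \<S>" "\<And>S. S \<in> \<S> \<Longrightarrow> closed S" "{0..1} \<subseteq> \<Union>\<S>"
    and lip: "\<And>S. S \<in> \<S> \<Longrightarrow> \<exists>d>0. \<forall>x\<in>S \<inter> {0..1}. \<forall>y\<in>S \<inter> {0..1}. \<bar>y - x\<bar> < d \<longrightarrow> \<bar>\<phi> y - \<phi> x\<bar> \<le> c * \<bar>y - x\<bar>"
  shows "\<bar>\<phi> 1 - \<phi> 0\<bar> \<le> c"
proof -
  define near where "near d x \<longleftrightarrow> (\<forall>a b. 0 \<le> a \<and> a \<le> b \<and> b \<le> 1 \<and> x - d < a \<and> b < x + d \<longrightarrow> \<bar>\<phi> b - \<phi> a\<bar> \<le> c * (b - a))" for d x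
  define K where "K = {x \<in> {0..1}. \<forall>d>0. \<not> near d x}"
  have near_mono: "near (d / 2) y" if "near d x" "\<bar>y - x\<bar> < d / 2" for d x y
    unfolding near_def
  proof (intro allI impI)
    fix a b assume ab: "0 \<le> a \<and> a \<le> b \<and> b \<le> 1 \<and> y - d / 2 < a \<and> b < y + d / 2"
    have "y - x < d / 2" "x - y < d / 2" using that(2) abs_ge_self[of "y - x"] abs_ge_minus_self[of "y - x"] by linarith+
    with ab have "x - d < a" "b < x + d" by linarith+
    with ab that(1) show "\<bar>\<phi> b - \<phi> a\<bar> \<le> c * (b - a)" unfolding near_def by simp
  qed
  have bolz: "\<bar>\<phi> v - \<phi> u\<bar> \<le> c * (v - u)"
    if uv: "u \<le> v" "0 \<le> u" "v \<le> 1" "\<And>x. u \<le> x \<Longrightarrow> x \<le> v \<Longrightarrow> x \<notin> K" for u v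
    using uv(1)
  proof -
    have "0 \<le> u \<and> v \<le> 1 \<longrightarrow> \<bar>\<phi> v - \<phi> u\<bar> \<le> c * (v - u)"
      using uv(1)
    proof (induction u v rule: Bolzano)
      case (trans a b e)
      then have "c * (b - a) + c * (e - b) = c * (e - a)" by (simp add: algebra_simps)
      with trans show ?case by auto
    next
      case (local x)
      then obtain d where d: "d > 0" "near d x"
        using uv(2,3) uv(4)[of x] unfolding K_def by auto
      have "0 \<le> a \<and> b \<le> 1 \<longrightarrow> \<bar>\<phi> b - \<phi> a\<bar> \<le> c * (b - a)" if "a \<le> x" "x \<le> b" "b - a < d" for a b
        using d(2) that unfolding near_def by auto
      then show ?case using d(1) by blast
    qed
    then show ?thesis using uv by simp
  qed
  have gap: "\<bar>\<phi> y - \<phi> x\<bar> \<le> c * (y - x)"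
    if xy: "x < y" "0 \<le> x" "y \<le> 1" "\<And>z. x < z \<Longrightarrow> z < y \<Longrightarrow> z \<notin> K" for x y
  proof -
    define m where "m = (y - x) / 2"
    have m: "0 < m" using xy by (simp add: m_def)
    have cl: "closure {0<..<m} = {0..m}" using m by simp
    define G where "G s = c * ((y - s) - (x + s)) - \<bar>\<phi> (y - s) - \<phi> (x + s)\<bar>" for s
    have 2: "2 * m = y - x" by (simp add: m_def)
    have ins: "(\<lambda>s. y - s) ` {0..m} \<subseteq> {0..1}" "(\<lambda>s. x + s) ` {0..m} \<subseteq> {0..1}"
      using xy 2 by (auto simp only: image_subset_iff atLeastAtMost_iff) 
    have "continuous_on {0..m} (\<lambda>s. \<phi> (y - s))" "continuous_on {0..m} (\<lambda>s. \<phi> (x + s))"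
      using ins by (auto intro!: continuous_on_compose2[OF cont] continuous_on_diff continuous_on_add)
    then have "continuous_on {0..m} G"
      unfolding G_def by (intro continuous_on_diff continuous_on_mult continuous_on_rabs continuous_on_add
          continuous_on_const continuous_on_id)
    moreover have "0 \<le> G s" if "s \<in> {0<..<m}" for s
    proof -
      have "x + s \<le> y - s" "0 \<le> x + s" "y - s \<le> 1" "x < x + s" "y - s < y"
        using xy that 2 by (simp_all only: greaterThanLessThan_iff) linarith+
      then show ?thesis
        unfolding G_def using bolz[of "x + s" "y - s"] xy(4) by force
    qed
    ultimately have "0 \<le> G 0"
      using continuous_ge_on_closure[of "{0<..<m}" G 0 0] m unfolding cl by auto
    then show ?thesis by (simp add: G_def)
  qed
  have "K = {}"
  proof (rule ccontr)
    assume "K \<noteq> {}"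
    have "closed K"
      unfolding closed_def open_dist
    proof (intro ballI)
      fix x assume "x \<in> - K"
      show "\<exists>e>0. \<forall>y. dist y x < e \<longrightarrow> y \<in> - K"
      proof (cases "x \<in> {0..1}")
        case True
        with \<open>x \<in> - K\<close> obtain d where d: "d > 0" "near d x" by (auto simp: K_def)
        have "y \<in> - K" if "dist y x < d / 2" for y
        proof -
          have "near (d / 2) y" using near_mono[OF d(2), of y] that by (simp add: dist_real_def)
          moreover have "d / 2 > 0" using d(1) by simp
          ultimately show ?thesis unfolding K_def by blast
        qed
        then show ?thesis using d(1) by (intro exI[of _ "d / 2"]) auto
      next
        case False
        then obtain e where "e > 0" "\<forall>y. dist y x < e \<longrightarrow> y \<in> - {0..1}"
          using open_dist[THEN iffD1, rule_format, of "- {0..1::real}" x] by (auto simp: open_Compl)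
        then show ?thesis by (intro exI[of _ e]) (auto simp: K_def)
      qed
    qed
    have "\<exists>S\<in>\<S>. \<not> K \<subseteq> closure (K - S)"
    proof (rule ccontr)
      assume neg: "\<not> (\<exists>S\<in>\<S>. \<not> K \<subseteq> closure (K - S))"
      have "K \<subseteq> closure (\<Inter>S\<in>\<S>. K - S)"
      proof (rule Baire[OF \<open>closed K\<close>])
        show "countable ((\<lambda>S. K - S) ` \<S>)" using \<S>(1) by simp
        fix T assume "T \<in> (\<lambda>S. K - S) ` \<S>"
        then obtain S where S: "S \<in> \<S>" "T = K - S" by blast
        have "openin (top_of_set K) (K \<inter> - S)" using \<S>(2)[OF S(1)] by (intro openin_open_Int) (simp add: open_Compl)
        moreover have "K \<subseteq> closure (K - S)" using neg S(1) by blast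
        ultimately show "openin (top_of_set K) T \<and> K \<subseteq> closure T"
          by (simp only: S(2) Diff_eq simp_thms)
      qed
      moreover have "(\<Inter>S\<in>\<S>. K - S) = {}"
      proof -
        obtain x where "x \<in> K" using \<open>K \<noteq> {}\<close> by blast
        then have "\<S> \<noteq> {}" using \<S>(3) by (auto simp: K_def)
        have sub: "K \<subseteq> \<Union>\<S>" using \<S>(3) by (auto simp: K_def)
        show ?thesis
        proof (rule equals0I)
          fix z assume z: "z \<in> (\<Inter>S\<in>\<S>. K - S)"
          then have "z \<in> K" using \<open>\<S> \<noteq> {}\<close> by blast
          then obtain S where "S \<in> \<S>" "z \<in> S" using sub by blast
          with z show False by blast
        qed
      qed
      ultimately show False using \<open>K \<noteq> {}\<close> by simp
    qed
    then obtain S where S: "S \<in> \<S>" and nsub: "\<not> K \<subseteq> closure (K - S)" by blast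
    then obtain x where x: "x \<in> K" "x \<notin> closure (K - S)" by blast
    obtain r where r: "r > 0" "\<And>z. z \<in> K \<Longrightarrow> dist z x < r \<Longrightarrow> z \<in> S"
    proof -
      obtain r where r: "r > 0" "\<forall>z\<in>K - S. \<not> dist z x < r"
        using x(2) unfolding closure_approachable by blast
      show thesis by (rule that[of r]) (use r in auto)
    qed
    obtain d where d: "d > 0" "\<And>a b. a \<in> S \<inter> {0..1} \<Longrightarrow> b \<in> S \<inter> {0..1} \<Longrightarrow> \<bar>b - a\<bar> < d \<Longrightarrow> \<bar>\<phi> b - \<phi> a\<bar> \<le> c * \<bar>b - a\<bar>"
      using lip[OF S] by blast
    define e where "e = min r (d / 2)"
    have e: "e > 0" "e \<le> r" "2 * e \<le> d" using r d by (auto simp: e_def)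
    have "near e x"
      unfolding near_def
    proof (intro allI impI)
      fix a b assume ab: "0 \<le> a \<and> a \<le> b \<and> b \<le> 1 \<and> x - e < a \<and> b < x + e"
      show "\<bar>\<phi> b - \<phi> a\<bar> \<le> c * (b - a)"
      proof (cases "K \<inter> {a..b} = {}")
        case True
        then show ?thesis using ab by (intro bolz) auto
      next
        case False
        have comp: "compact (K \<inter> {a..b})" using \<open>closed K\<close> by (intro closed_Int_compact) auto
        obtain l where l: "l \<in> K \<inter> {a..b}" "\<And>z. z \<in> K \<inter> {a..b} \<Longrightarrow> l \<le> z"
          using compact_attains_inf[OF comp False] by blast
        obtain u where u: "u \<in> K \<inter> {a..b}" "\<And>z. z \<in> K \<inter> {a..b} \<Longrightarrow> z \<le> u"
          using compact_attains_sup[OF comp False] by blast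
        have lu: "l \<le> u" using l(2)[OF u(1)] .
        have 1: "\<bar>\<phi> l - \<phi> a\<bar> \<le> c * (l - a)"
        proof (cases "l = a")
          case False
          show ?thesis
          proof (rule gap)
            show "z \<notin> K" if "a < z" "z < l" for z using l(2)[of z] l(1) that by force
          qed (use l(1) ab False in auto)
        qed simp
        have 2: "\<bar>\<phi> b - \<phi> u\<bar> \<le> c * (b - u)"
        proof (cases "u = b")
          case False
          show ?thesis
          proof (rule gap)
            show "z \<notin> K" if "u < z" "z < b" for z using u(2)[of z] u(1) that by force
          qed (use u(1) ab False in auto)
        qed simp
        have "l \<in> S \<inter> {0..1}" "u \<in> S \<inter> {0..1}"
          using l(1) u(1) ab e(2) r(2)[of l] r(2)[of u] by (auto simp: dist_real_def)
        moreover have "\<bar>u - l\<bar> < d" using l(1) u(1) ab e(3) by auto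
        ultimately have 3: "\<bar>\<phi> u - \<phi> l\<bar> \<le> c * (u - l)" using d(2)[of l u] lu by simp
        have "c * (l - a) + c * (u - l) + c * (b - u) = c * (b - a)" by (simp add: algebra_simps)
        with 1 2 3 show ?thesis by linarith
      qed
    qed
    then show False using x(1) e(1) by (auto simp: K_def)
  qed
  then show ?thesis using bolz[of 0 1] by simp
qed

text \<open>
  The chain rule along the diagonal would give derivative \<open>D \<theta> - D \<theta> = 0\<close>, but it is not available: \<open>F\<close> has partial
  derivatives, only at points of the diagonal, and these need not depend continuously on the point. Instead,
  for \<open>\<epsilon> > 0\<close> the interval is covered by countably many closed sets \<open>S m q\<close>, on which the two
  difference quotients on scales below \<open>1 / Suc m\<close> are within \<open>\<epsilon>\<close> of a fixed vector \<open>q\<close> and of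
  \<open>- q\<close>. For two nearby points \<open>x\<close>, \<open>y\<close> of the same set the detour through
  \<open>F y x\<close> shows \<open>\<parallel>F y y - F x x\<parallel> \<le> 2 \<epsilon> \<bar>y - x\<bar>\<close>, as the contributions of \<open>q\<close> cancel.
\<close>

theorem constant_on_diagonal:
  fixes F :: "real \<Rightarrow> real \<Rightarrow> 'u::{real_normed_vector,second_countable_topology}"
  assumes cont: "continuous_on ({0..1} \<times> {0..1}) (\<lambda>(\<theta>, s). F \<theta> s)"
    and der1: "\<And>\<theta>. \<theta> \<in> {0..1} \<Longrightarrow> ((\<lambda>\<theta>'. F \<theta>' \<theta>) has_vector_derivative D \<theta>) (at \<theta> within {0..1})"
    and der2: "\<And>\<theta>. \<theta> \<in> {0..1} \<Longrightarrow> ((\<lambda>s. F \<theta> s) has_vector_derivative (- D \<theta>)) (at \<theta> within {0..1})"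
  shows "F 1 1 = F 0 0"
proof -
  obtain Q :: "'u set" where Q: "countable Q" "\<And>X. open X \<Longrightarrow> X \<noteq> {} \<Longrightarrow> \<exists>d\<in>Q. d \<in> X"
    by (erule countable_dense_setE)
  define \<phi> where "\<phi> \<theta> = norm (F \<theta> \<theta> - F 0 0)" for \<theta>
  have contF: "continuous_on A (\<lambda>x. F (f x) (g x))"
    if "continuous_on A f" "continuous_on A g" "f ` A \<subseteq> {0..1}" "g ` A \<subseteq> {0..1}" for A :: "real set" and f g
    using continuous_on_compose2[OF cont, of A "\<lambda>x. (f x, g x)"] that
    by (auto intro: continuous_intros)
  have bound: "\<bar>\<phi> 1 - \<phi> 0\<bar> \<le> 2 * \<epsilon>" if "\<epsilon> > 0" for \<epsilon>
  proof -
    define S where "S m q = {\<theta> \<in> {0..1}. \<forall>s\<in>{0..1}. \<bar>s - \<theta>\<bar> < 1 / Suc m \<longrightarrow>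
        norm (F s \<theta> - F \<theta> \<theta> - (s - \<theta>) *\<^sub>R q) \<le> \<epsilon> * \<bar>s - \<theta>\<bar> \<and>
        norm (F \<theta> s - F \<theta> \<theta> + (s - \<theta>) *\<^sub>R q) \<le> \<epsilon> * \<bar>s - \<theta>\<bar>}" for m :: nat and q
    show ?thesis
    proof (rule lipschitz_by_countable_closed_cover[where \<S> = "(\<lambda>(m, q). S m q) ` (UNIV \<times> Q)"])
      show "continuous_on {0..1} \<phi>"
        unfolding \<phi>_def by (intro continuous_intros contF) auto
      show "countable ((\<lambda>(m, q). S m q) ` (UNIV \<times> Q))" using Q(1) by (intro countable_image countable_SIGMA) auto
      have "closed (S m q)" for m q
      proof -
        have "S m q = {0..1} \<inter> (\<Inter>s\<in>{0..1}. {\<theta> \<in> {0..1}. 1 / Suc m \<le> \<bar>s - \<theta>\<bar>}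
          \<union> {\<theta> \<in> {0..1}. norm (F s \<theta> - F \<theta> \<theta> - (s - \<theta>) *\<^sub>R q) \<le> \<epsilon> * \<bar>s - \<theta>\<bar>}
            \<inter> {\<theta> \<in> {0..1}. norm (F \<theta> s - F \<theta> \<theta> + (s - \<theta>) *\<^sub>R q) \<le> \<epsilon> * \<bar>s - \<theta>\<bar>})"
          (is "_ = _ \<inter> (\<Inter>s\<in>_. ?A s \<union> ?B s \<inter> ?C s)")
          unfolding S_def by (auto simp: not_less[symmetric])
        moreover have "closed (?A s \<union> ?B s \<inter> ?C s)" if "s \<in> {0..1}" for s
        proof (intro closed_Un closed_Int)
          show "closed (?A s)"
            by (intro continuous_on_closed_Collect_le continuous_intros) auto
          show "closed (?B s)" "closed (?C s)"
            by (intro continuous_on_closed_Collect_le continuous_on_norm continuous_on_add continuous_on_diff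
                  continuous_on_scaleR continuous_on_mult continuous_on_rabs continuous_on_const continuous_on_id
                  contF; use that in force)+
        qed
        ultimately show ?thesis by (simp add: closed_INT closed_Int)
      qed
      then show "closed T" if "T \<in> (\<lambda>(m, q). S m q) ` (UNIV \<times> Q)" for T using that by auto
      show "{0..1} \<subseteq> \<Union>((\<lambda>(m, q). S m q) ` (UNIV \<times> Q))"
      proof
        fix \<theta> :: real assume \<theta>: "\<theta> \<in> {0..1}"
        obtain q where q: "q \<in> Q" "norm (q - D \<theta>) < \<epsilon> / 2"
          using Q(2)[of "ball (D \<theta>) (\<epsilon> / 2)"] \<open>\<epsilon> > 0\<close> by (auto simp: dist_norm norm_minus_commute)
        obtain d1 where d1: "d1 > 0" "\<And>s. s \<in> {0..1} \<Longrightarrow> \<bar>s - \<theta>\<bar> < d1 \<Longrightarrow>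
            norm (F s \<theta> - F \<theta> \<theta> - (s - \<theta>) *\<^sub>R D \<theta>) \<le> \<epsilon> / 2 * \<bar>s - \<theta>\<bar>"
          using der1[OF \<theta>, unfolded has_vector_derivative_def has_derivative_within_alt, THEN conjunct2, rule_format, of "\<epsilon> / 2"]
            \<open>\<epsilon> > 0\<close> by auto
        obtain d2 where d2: "d2 > 0" "\<And>s. s \<in> {0..1} \<Longrightarrow> \<bar>s - \<theta>\<bar> < d2 \<Longrightarrow>
            norm (F \<theta> s - F \<theta> \<theta> - (s - \<theta>) *\<^sub>R (- D \<theta>)) \<le> \<epsilon> / 2 * \<bar>s - \<theta>\<bar>"
          using der2[OF \<theta>, unfolded has_vector_derivative_def has_derivative_within_alt, THEN conjunct2, rule_format, of "\<epsilon> / 2"]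
            \<open>\<epsilon> > 0\<close> by auto
        obtain m where m: "1 / real (Suc m) < min d1 d2"
          using nat_approx_posE[of "min d1 d2"] d1(1) d2(1) by auto
        have "\<theta> \<in> S m q"
          unfolding S_def
        proof (intro CollectI conjI \<theta> ballI impI)
          fix s :: real assume s: "s \<in> {0..1}" "\<bar>s - \<theta>\<bar> < 1 / Suc m"
          have qe: "norm ((s - \<theta>) *\<^sub>R (q - D \<theta>)) \<le> \<epsilon> / 2 * \<bar>s - \<theta>\<bar>"
            using mult_right_mono[OF less_imp_le[OF q(2)], of "\<bar>s - \<theta>\<bar>"] by (simp add: mult.commute)
          have "F s \<theta> - F \<theta> \<theta> - (s - \<theta>) *\<^sub>R q = (F s \<theta> - F \<theta> \<theta> - (s - \<theta>) *\<^sub>R D \<theta>) - (s - \<theta>) *\<^sub>R (q - D \<theta>)"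
            by (simp add: algebra_simps)
          then show "norm (F s \<theta> - F \<theta> \<theta> - (s - \<theta>) *\<^sub>R q) \<le> \<epsilon> * \<bar>s - \<theta>\<bar>"
            using norm_triangle_ineq4[of "F s \<theta> - F \<theta> \<theta> - (s - \<theta>) *\<^sub>R D \<theta>" "(s - \<theta>) *\<^sub>R (q - D \<theta>)"] qe d1(2)[OF s(1)] s(2) m
            by (simp only: min_less_iff_conj) linarith
          have "F \<theta> s - F \<theta> \<theta> + (s - \<theta>) *\<^sub>R q = (F \<theta> s - F \<theta> \<theta> - (s - \<theta>) *\<^sub>R (- D \<theta>)) + (s - \<theta>) *\<^sub>R (q - D \<theta>)"
            by (simp add: algebra_simps)
          then show "norm (F \<theta> s - F \<theta> \<theta> + (s - \<theta>) *\<^sub>R q) \<le> \<epsilon> * \<bar>s - \<theta>\<bar>"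
            using norm_triangle_ineq[of "F \<theta> s - F \<theta> \<theta> - (s - \<theta>) *\<^sub>R (- D \<theta>)" "(s - \<theta>) *\<^sub>R (q - D \<theta>)"] qe d2(2)[OF s(1)] s(2) m
            by (simp only: min_less_iff_conj) linarith
        qed
        then show "\<theta> \<in> \<Union>((\<lambda>(m, q). S m q) ` (UNIV \<times> Q))" using q(1) by auto
      qed
      fix T assume "T \<in> (\<lambda>(m, q). S m q) ` (UNIV \<times> Q)"
      then obtain m q where T: "T = S m q" by auto
      show "\<exists>d>0. \<forall>x\<in>T \<inter> {0..1}. \<forall>y\<in>T \<inter> {0..1}. \<bar>y - x\<bar> < d \<longrightarrow> \<bar>\<phi> y - \<phi> x\<bar> \<le> 2 * \<epsilon> * \<bar>y - x\<bar>"
      proof (intro exI[of _ "1 / Suc m"] conjI ballI impI)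
        fix x y assume x: "x \<in> T \<inter> {0..1}" and y: "y \<in> T \<inter> {0..1}" and xy: "\<bar>y - x\<bar> < 1 / Suc m"
        have 1: "norm (F y x - F x x - (y - x) *\<^sub>R q) \<le> \<epsilon> * \<bar>y - x\<bar>"
          using x y xy unfolding T S_def by auto
        have 2: "norm (F y x - F y y + (x - y) *\<^sub>R q) \<le> \<epsilon> * \<bar>y - x\<bar>"
          using x y xy unfolding T S_def by (auto simp: abs_minus_commute)
        have "F y y - F x x = (F y x - F x x - (y - x) *\<^sub>R q) - (F y x - F y y + (x - y) *\<^sub>R q)"
          by (simp add: algebra_simps)
        then have "norm (F y y - F x x) \<le> norm (F y x - F x x - (y - x) *\<^sub>R q) + norm (F y x - F y y + (x - y) *\<^sub>R q)"
          by (simp only: norm_triangle_ineq4)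
        with 1 2 have 3: "norm (F y y - F x x) \<le> 2 * \<epsilon> * \<bar>y - x\<bar>" by linarith
        have "\<bar>\<phi> y - \<phi> x\<bar> \<le> norm (F y y - F 0 0 - (F x x - F 0 0))"
          unfolding \<phi>_def by (rule norm_triangle_ineq3)
        then show "\<bar>\<phi> y - \<phi> x\<bar> \<le> 2 * \<epsilon> * \<bar>y - x\<bar>" using 3 by simp
      qed simp
    qed
  qed
  have "\<phi> 1 \<le> 0"
  proof (rule field_le_epsilon)
    fix e :: real assume "e > 0"
    then show "\<phi> 1 \<le> 0 + e" using bound[of "e / 2"] by (simp add: \<phi>_def)
  qed
  then show ?thesis by (simp add: \<phi>_def)
qed

section \<open>Picard iteration with parameters\<close>

text \<open>
  The integral over \<open>{0..\<theta>}\<close> is rescaled to the fixed interval \<open>{0..1}\<close>, which makes continuity in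
  \<open>(\<theta>, \<xi>)\<close> jointly a matter of continuous parameter dependence.
\<close>

fun picard :: "(real \<Rightarrow> 'e \<Rightarrow> 'm \<Rightarrow> 'e::banach) \<Rightarrow> nat \<Rightarrow> real \<Rightarrow> 'm \<Rightarrow> 'e" where
  "picard a 0 \<theta> \<xi> = 0"
| "picard a (Suc n) \<theta> \<xi> = \<theta> *\<^sub>R integral {0..1} (\<lambda>z. a (\<theta> * z) (picard a n (\<theta> * z) \<xi>) \<xi>)"

text \<open>The limit is written as a telescoping series to apply the Weierstrass criterion.\<close>

definition picard_limit :: "(real \<Rightarrow> 'e \<Rightarrow> 'm \<Rightarrow> 'e::banach) \<Rightarrow> real \<Rightarrow> 'm \<Rightarrow> 'e" where
  "picard_limit a \<theta> \<xi> = (\<Sum>n. picard a (Suc n) \<theta> \<xi> - picard a n \<theta> \<xi>)"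

text \<open>
  The two constants \<open>1 / 2\<close> keep the iterates inside the ball on which the field is controlled and make
  the iteration contract on the whole interval \<open>{0..1}\<close> at once.
\<close>

locale picard_field =
  fixes a :: "real \<Rightarrow> 'e \<Rightarrow> 'm::metric_space \<Rightarrow> 'e::banach" and G :: "'m set" and \<delta> :: real
  assumes \<delta>_pos: "0 < \<delta>"
    and bound: "\<And>\<theta> h \<xi>. \<theta> \<in> {0..1} \<Longrightarrow> h \<in> ball 0 \<delta> \<Longrightarrow> \<xi> \<in> G \<Longrightarrow> norm (a \<theta> h \<xi>) \<le> \<delta> / 2"
    and contract: "\<And>\<theta> h h' \<xi>. \<theta> \<in> {0..1} \<Longrightarrow> h \<in> ball 0 \<delta> \<Longrightarrow> h' \<in> ball 0 \<delta> \<Longrightarrow> \<xi> \<in> G \<Longrightarrow>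
          norm (a \<theta> h \<xi> - a \<theta> h' \<xi>) \<le> norm (h - h') / 2"
    and cont: "continuous_on ({0..1} \<times> ball 0 \<delta> \<times> G) (\<lambda>(\<theta>, h, \<xi>). a \<theta> h \<xi>)"
begin

lemma mult_unit: "\<theta> \<in> {0..1} \<Longrightarrow> z \<in> {0..1} \<Longrightarrow> \<theta> * z \<in> {0..1}" for \<theta> z :: real
  by (simp add: mult_le_one)

lemma continuous_on_field:
  assumes "continuous_on A f" "continuous_on A g" "continuous_on A k"
    and "\<And>x. x \<in> A \<Longrightarrow> f x \<in> {0..1}" "\<And>x. x \<in> A \<Longrightarrow> g x \<in> ball 0 \<delta>" "\<And>x. x \<in> A \<Longrightarrow> k x \<in> G"
  shows "continuous_on A (\<lambda>x. a (f x) (g x) (k x))"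
proof -
  have "continuous_on A (\<lambda>x. (f x, g x, k x))"
    using assms(1-3) by (intro continuous_on_Pair)
  from continuous_on_compose2[OF cont this] assms(4-6) show ?thesis by force
qed

lemma norm_scaled_integral_le:
  fixes f :: "real \<Rightarrow> 'e"
  assumes "\<theta> \<in> {0..1}" "continuous_on {0..1} f" "\<And>z. z \<in> {0..1} \<Longrightarrow> norm (f z) \<le> B"
  shows "norm (\<theta> *\<^sub>R integral {0..1} f) \<le> B"
proof -
  have B: "0 \<le> B" by (rule order_trans[OF norm_ge_zero assms(3)[of 0]]) simp
  have "norm (integral {0..1} f) \<le> B * (1 - 0)"
    using assms by (intro integral_bound) auto
  then have "norm (\<theta> *\<^sub>R integral {0..1} f) \<le> 1 * B"
    using assms(1) by (simp only: norm_scaleR) (intro mult_mono, auto)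
  then show ?thesis by simp
qed

lemma picard_invariant:
  "continuous_on ({0..1} \<times> G) (\<lambda>(\<theta>, \<xi>). picard a n \<theta> \<xi>) \<and>
   (\<forall>\<theta>\<in>{0..1}. \<forall>\<xi>\<in>G. norm (picard a n \<theta> \<xi>) \<le> \<delta> / 2)"
proof (induction n)
  case 0
  show ?case using \<delta>_pos by simp
next
  case (Suc n)
  have cont_n: "continuous_on ({0..1} \<times> G) (\<lambda>(\<theta>, \<xi>). picard a n \<theta> \<xi>)"
    and norm_n: "\<And>\<theta> \<xi>. \<theta> \<in> {0..1} \<Longrightarrow> \<xi> \<in> G \<Longrightarrow> norm (picard a n \<theta> \<xi>) \<le> \<delta> / 2"
    using Suc.IH by auto
  have in_ball: "picard a n \<theta> \<xi> \<in> ball 0 \<delta>" if "\<theta> \<in> {0..1}" "\<xi> \<in> G" for \<theta> \<xi>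
    using norm_n[OF that] \<delta>_pos by simp
  let ?f = "\<lambda>x z. a (fst x * z) (picard a n (fst x * z) (snd x)) (snd x)"
  have c: "continuous_on (({0..1::real} \<times> G) \<times> cbox 0 (1::real)) (\<lambda>(x, z). ?f x z)"
  proof -
    have k: "continuous_on (({0..1::real} \<times> G) \<times> cbox 0 (1::real)) (\<lambda>y. fst (fst y) * snd y)"
      "continuous_on (({0..1::real} \<times> G) \<times> cbox 0 (1::real)) (\<lambda>y. snd (fst y))"
      by (auto intro!: continuous_intros)
    have sub: "(\<lambda>y. (fst (fst y) * snd y, snd (fst y))) ` (({0..1::real} \<times> G) \<times> cbox 0 (1::real)) \<subseteq> {0..1} \<times> G"
      by (auto simp: mult_le_one)
    have k3: "continuous_on (({0..1::real} \<times> G) \<times> cbox 0 (1::real)) (\<lambda>y. picard a n (fst (fst y) * snd y) (snd (fst y)))"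
      using continuous_on_compose2[OF cont_n continuous_on_Pair[OF k] sub] by simp
    have "continuous_on (({0..1::real} \<times> G) \<times> cbox 0 (1::real)) (\<lambda>y. ?f (fst y) (snd y))"
    proof (rule continuous_on_field[OF k(1) k3 k(2)])
      fix y assume "y \<in> ({0..1::real} \<times> G) \<times> cbox 0 (1::real)"
      then have "(fst (fst y) * snd y, snd (fst y)) \<in> {0..1} \<times> G"
        using sub by blast
      then have "fst (fst y) * snd y \<in> {0..1}" "snd (fst y) \<in> G"
        by (simp_all only: mem_Times_iff fst_conv snd_conv)
      then show "fst (fst y) * snd y \<in> {0..1}" "snd (fst y) \<in> G"
        "picard a n (fst (fst y) * snd y) (snd (fst y)) \<in> ball 0 \<delta>"
        by (auto simp only: in_ball)
    qed
    then show ?thesis by (simp add: case_prod_unfold)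
  qed
  have "continuous_on ({0..1} \<times> G) (\<lambda>x. fst x *\<^sub>R integral (cbox 0 1) (?f x))"
    by (intro continuous_on_scaleR continuous_on_fst continuous_on_id integral_continuous_on_param c)
  then have 1: "continuous_on ({0..1} \<times> G) (\<lambda>(\<theta>, \<xi>). picard a (Suc n) \<theta> \<xi>)"
    by (simp add: case_prod_unfold)
  have 2: "norm (picard a (Suc n) \<theta> \<xi>) \<le> \<delta> / 2" if "\<theta> \<in> {0..1}" "\<xi> \<in> G" for \<theta> \<xi>
    unfolding picard.simps
  proof (rule norm_scaled_integral_le[OF that(1)])
    have "continuous_on {0..1} (\<lambda>z. ?f (\<theta>, \<xi>) z)"
      using continuous_on_compose2[OF c, of "{0..1}" "\<lambda>z. ((\<theta>, \<xi>), z)"] that by (force intro: continuous_intros)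
    then show "continuous_on {0..1} (\<lambda>z. a (\<theta> * z) (picard a n (\<theta> * z) \<xi>) \<xi>)" by simp
    show "norm (a (\<theta> * z) (picard a n (\<theta> * z) \<xi>) \<xi>) \<le> \<delta> / 2" if "z \<in> {0..1}" for z
      using mult_unit[OF \<open>\<theta> \<in> {0..1}\<close> that] \<open>\<xi> \<in> G\<close> by (intro bound in_ball)
  qed
  show ?case using 1 2 by blast
qed

lemma picard_continuous: "continuous_on ({0..1} \<times> G) (\<lambda>(\<theta>, \<xi>). picard a n \<theta> \<xi>)"
  and picard_norm: "\<theta> \<in> {0..1} \<Longrightarrow> \<xi> \<in> G \<Longrightarrow> norm (picard a n \<theta> \<xi>) \<le> \<delta> / 2"
  using picard_invariant[of n] by auto

lemma continuous_on_slice: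
  fixes f :: "real \<Rightarrow> 'm \<Rightarrow> 'e"
  assumes "continuous_on ({0..1} \<times> G) (\<lambda>(\<theta>, \<xi>). f \<theta> \<xi>)" "\<xi> \<in> G" "\<theta> \<in> {0..1}"
  shows "continuous_on {0..1} (\<lambda>z. f (\<theta> * z) \<xi>)"
proof -
  have "continuous_on {0..1} (\<lambda>z. (\<theta> * z, \<xi>))" by (intro continuous_intros)
  moreover have "(\<lambda>z. (\<theta> * z, \<xi>)) ` {0..1} \<subseteq> {0..1} \<times> G"
    using assms(2) mult_unit[OF assms(3)] by (simp add: image_subset_iff)
  ultimately show ?thesis
    using continuous_on_compose2[OF assms(1), of "{0..1}" "\<lambda>z. (\<theta> * z, \<xi>)"] by simp
qed

lemma field_along_continuous:
  fixes f :: "real \<Rightarrow> 'm \<Rightarrow> 'e"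
  assumes "continuous_on ({0..1} \<times> G) (\<lambda>(\<theta>, \<xi>). f \<theta> \<xi>)" "\<xi> \<in> G" "\<theta> \<in> {0..1}"
    and "\<And>z. z \<in> {0..1} \<Longrightarrow> norm (f z \<xi>) \<le> \<delta> / 2"
  shows "continuous_on {0..1} (\<lambda>z. a (\<theta> * z) (f (\<theta> * z) \<xi>) \<xi>)"
proof (rule continuous_on_field)
  show "continuous_on {0..1} (\<lambda>z. f (\<theta> * z) \<xi>)" by (rule continuous_on_slice[OF assms(1-3)])
  show "f (\<theta> * z) \<xi> \<in> ball 0 \<delta>" if "z \<in> {0..1}" for z
    using assms(4)[OF mult_unit[OF assms(3) that]] \<delta>_pos by simp
  show "continuous_on {0..1} (\<lambda>z. \<theta> * z)" "continuous_on {0..1} (\<lambda>z::real. \<xi>)"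
    by (auto intro!: continuous_intros)
qed (simp_all only: assms mult_unit)

lemma picard_step:
  assumes "\<xi> \<in> G" "\<theta> \<in> {0..1}"
  shows "norm (picard a (Suc n) \<theta> \<xi> - picard a n \<theta> \<xi>) \<le> \<delta> * (1 / 2) ^ Suc n"
  using assms(2)
proof (induction n arbitrary: \<theta>)
  case 0
  then show ?case using picard_norm[of \<theta> \<xi> "Suc 0"] assms(1) by simp
next
  case (Suc n)
  let ?f = "\<lambda>n z. a (\<theta> * z) (picard a n (\<theta> * z) \<xi>) \<xi>"
  have c: "continuous_on {0..1} (?f n)" for n
    by (rule field_along_continuous[OF picard_continuous assms(1) Suc.prems]) (use picard_norm assms(1) in auto)
  then have "picard a (Suc (Suc n)) \<theta> \<xi> - picard a (Suc n) \<theta> \<xi> = \<theta> *\<^sub>R integral {0..1} (\<lambda>z. ?f (Suc n) z - ?f n z)"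
    unfolding picard.simps(2)[of a "Suc n"] picard.simps(2)[of a n \<theta>] scaleR_diff_right[symmetric]
    by (subst integral_diff) (auto intro: integrable_continuous_real simp del: picard.simps)
  also have "norm \<dots> \<le> \<delta> * (1 / 2) ^ Suc (Suc n)"
  proof (rule norm_scaled_integral_le[OF Suc.prems])
    show "continuous_on {0..1} (\<lambda>z. ?f (Suc n) z - ?f n z)" by (intro continuous_on_diff c)
    fix z :: real assume z: "z \<in> {0..1}"
    have \<theta>z: "\<theta> * z \<in> {0..1}" by (rule mult_unit[OF Suc.prems z])
    have b: "picard a k (\<theta> * z) \<xi> \<in> ball 0 \<delta>" for k
      using picard_norm[OF \<theta>z assms(1), of k] \<delta>_pos by simp
    have "norm (?f (Suc n) z - ?f n z) \<le> norm (picard a (Suc n) (\<theta> * z) \<xi> - picard a n (\<theta> * z) \<xi>) / 2"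
      by (rule contract[OF \<theta>z b b assms(1)])
    also have "\<dots> \<le> \<delta> * (1 / 2) ^ Suc n / 2" using Suc.IH[OF \<theta>z] by (rule divide_right_mono) simp
    finally show "norm (?f (Suc n) z - ?f n z) \<le> \<delta> * (1 / 2) ^ Suc (Suc n)" by simp
  qed
  finally show ?case .
qed

lemma picard_uniform_limit:
  "uniform_limit ({0..1} \<times> G) (\<lambda>n (\<theta>, \<xi>). picard a n \<theta> \<xi>) (\<lambda>(\<theta>, \<xi>). picard_limit a \<theta> \<xi>) sequentially"
proof -
  have "uniform_limit ({0..1} \<times> G) (\<lambda>n x. \<Sum>i<n. picard a (Suc i) (fst x) (snd x) - picard a i (fst x) (snd x))
      (\<lambda>x. \<Sum>i. picard a (Suc i) (fst x) (snd x) - picard a i (fst x) (snd x)) sequentially"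
  proof (rule Weierstrass_m_test)
    show "norm (picard a (Suc n) (fst x) (snd x) - picard a n (fst x) (snd x)) \<le> \<delta> * (1 / 2) ^ Suc n"
      if "x \<in> {0..1} \<times> G" for n x
      using that by (intro picard_step) auto
    show "summable (\<lambda>n. \<delta> * (1 / 2) ^ Suc n)"
      by (intro summable_mult summable_Suc_iff[THEN iffD2] summable_geometric) simp
  qed
  moreover have "(\<Sum>i<n. picard a (Suc i) \<theta> \<xi> - picard a i \<theta> \<xi>) = picard a n \<theta> \<xi>" for n \<theta> \<xi>
    by (subst sum_lessThan_telescope) simp
  ultimately show ?thesis by (simp add: picard_limit_def case_prod_unfold)
qed

lemma picard_tendsto: "\<theta> \<in> {0..1} \<Longrightarrow> \<xi> \<in> G \<Longrightarrow> (\<lambda>n. picard a n \<theta> \<xi>) \<longlonglongrightarrow> picard_limit a \<theta> \<xi>"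
  using tendsto_uniform_limitI[OF picard_uniform_limit, of "(\<theta>, \<xi>)"] by simp

lemma picard_limit_continuous: "continuous_on ({0..1} \<times> G) (\<lambda>(\<theta>, \<xi>). picard_limit a \<theta> \<xi>)"
proof (rule uniform_limit_theorem[OF _ picard_uniform_limit])
  show "\<forall>\<^sub>F n in sequentially. continuous_on ({0..1} \<times> G) (\<lambda>(\<theta>, \<xi>). picard a n \<theta> \<xi>)"
    by (rule always_eventually) (intro allI picard_continuous)
qed simp

lemma picard_limit_norm:
  assumes "\<theta> \<in> {0..1}" "\<xi> \<in> G"
  shows "norm (picard_limit a \<theta> \<xi>) \<le> \<delta> / 2"
proof (rule Lim_norm_ubound[OF _ picard_tendsto[OF assms]])
  show "\<forall>\<^sub>F n in sequentially. norm (picard a n \<theta> \<xi>) \<le> \<delta> / 2"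
    by (intro always_eventually allI picard_norm assms)
qed simp

lemma picard_limit_integral:
  assumes \<xi>: "\<xi> \<in> G" and \<theta>: "\<theta> \<in> {0..1}"
  shows "picard_limit a \<theta> \<xi> = \<theta> *\<^sub>R integral {0..1} (\<lambda>z. a (\<theta> * z) (picard_limit a (\<theta> * z) \<xi>) \<xi>)" (is "_ = ?I")
proof (rule LIMSEQ_unique)
  show "(\<lambda>n. picard a (Suc n) \<theta> \<xi>) \<longlonglongrightarrow> picard_limit a \<theta> \<xi>"
    by (rule LIMSEQ_Suc[OF picard_tendsto[OF \<theta> \<xi>]])
  show "(\<lambda>n. picard a (Suc n) \<theta> \<xi>) \<longlonglongrightarrow> ?I"
  proof (rule LIMSEQ_I)
    fix e :: real assume "e > 0"
    obtain N where N: "\<And>n x. n \<ge> N \<Longrightarrow> x \<in> {0..1} \<times> G \<Longrightarrow>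
        dist (case x of (\<theta>, \<xi>) \<Rightarrow> picard a n \<theta> \<xi>) (case x of (\<theta>, \<xi>) \<Rightarrow> picard_limit a \<theta> \<xi>) < e"
      using uniform_limitD[OF picard_uniform_limit \<open>e > 0\<close>] unfolding eventually_sequentially by auto
    have "norm (picard a (Suc n) \<theta> \<xi> - ?I) < e" if "n \<ge> N" for n
    proof -
      let ?f = "\<lambda>z. a (\<theta> * z) (picard a n (\<theta> * z) \<xi>) \<xi>" and ?g = "\<lambda>z. a (\<theta> * z) (picard_limit a (\<theta> * z) \<xi>) \<xi>"
      have cf: "continuous_on {0..1} ?f"
        by (rule field_along_continuous[OF picard_continuous \<xi> \<theta>]) (use picard_norm \<xi> in auto)
      have cg: "continuous_on {0..1} ?g"
        by (rule field_along_continuous[OF picard_limit_continuous \<xi> \<theta>]) (use picard_limit_norm \<xi> in auto)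
      have "picard a (Suc n) \<theta> \<xi> - ?I = \<theta> *\<^sub>R integral {0..1} (\<lambda>z. ?f z - ?g z)"
        unfolding picard.simps(2) scaleR_diff_right[symmetric]
        using cf cg by (subst integral_diff) (auto intro: integrable_continuous_real)
      also have "norm \<dots> \<le> e / 2"
      proof (rule norm_scaled_integral_le[OF \<theta> continuous_on_diff[OF cf cg]])
        fix z :: real assume z: "z \<in> {0..1}"
        have \<theta>z: "\<theta> * z \<in> {0..1}" by (rule mult_unit[OF \<theta> z])
        have "picard a n (\<theta> * z) \<xi> \<in> ball 0 \<delta>" "picard_limit a (\<theta> * z) \<xi> \<in> ball 0 \<delta>"
          using picard_norm[OF \<theta>z \<xi>, of n] picard_limit_norm[OF \<theta>z \<xi>] \<delta>_pos by auto
        from contract[OF \<theta>z this \<xi>]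
        have "norm (?f z - ?g z) \<le> norm (picard a n (\<theta> * z) \<xi> - picard_limit a (\<theta> * z) \<xi>) / 2" .
        also have "\<dots> \<le> e / 2" using N[OF \<open>n \<ge> N\<close>, of "(\<theta> * z, \<xi>)"] \<theta>z \<xi> by (simp add: dist_norm)
        finally show "norm (?f z - ?g z) \<le> e / 2" .
      qed
      finally show ?thesis using \<open>e > 0\<close> by simp
    qed
    then show "\<exists>N. \<forall>n\<ge>N. norm (picard a (Suc n) \<theta> \<xi> - ?I) < e" by blast
  qed
qed

lemma picard_limit_0: "\<xi> \<in> G \<Longrightarrow> picard_limit a 0 \<xi> = 0"
  using picard_limit_integral[of \<xi> 0] by simp

lemma picard_limit_ode:
  assumes \<xi>: "\<xi> \<in> G" and \<theta>: "\<theta> \<in> {0..1}"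
  shows "((\<lambda>\<theta>. picard_limit a \<theta> \<xi>) has_vector_derivative a \<theta> (picard_limit a \<theta> \<xi>) \<xi>) (at \<theta> within {0..1})"
proof -
  define f where "f z = a z (picard_limit a z \<xi>) \<xi>" for z
  have f: "continuous_on {0..1} f"
  proof -
    have "continuous_on {0..1} (\<lambda>z. a (1 * z) (picard_limit a (1 * z) \<xi>) \<xi>)"
      by (rule field_along_continuous[OF picard_limit_continuous \<xi>]) (simp, rule picard_limit_norm[OF _ \<xi>])
    then show ?thesis by (simp only: f_def[abs_def] mult_1)
  qed
  have der: "((\<lambda>u. integral {0..u} f) has_vector_derivative f x) (at x within {0..1})" if "x \<in> {0..1}" for x
    by (rule integral_has_vector_derivative[OF f that])
  have eq: "picard_limit a t \<xi> = integral {0..t} f" if t: "t \<in> {0..1}" for t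
  proof -
    have "((\<lambda>z. t *\<^sub>R f (t * z)) has_integral (integral {0..t * 1} f - integral {0..t * 0} f)) {0..1}"
    proof (rule fundamental_theorem_of_calculus)
      fix z :: real assume z: "z \<in> {0..1}"
      have 1: "((\<lambda>z. t * z) has_vector_derivative t) (at z within {0..1})"
        by (auto intro!: derivative_eq_intros simp: has_real_derivative_iff_has_vector_derivative[symmetric])
      have 2: "((\<lambda>u. integral {0..u} f) has_vector_derivative f (t * z)) (at (t * z) within (\<lambda>z. t * z) ` {0..1})"
        using mult_unit[OF t] z by (intro has_vector_derivative_within_subset[OF der]) (auto simp only: image_subset_iff)
      have "((\<lambda>u. integral {0..u} f) \<circ> (\<lambda>z. t * z) has_vector_derivative (t *\<^sub>R f (t * z))) (at z within {0..1})"
        by (rule vector_diff_chain_within[OF 1 2])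
      then show "((\<lambda>z. integral {0..t * z} f) has_vector_derivative t *\<^sub>R f (t * z)) (at z within {0..1})"
        by (simp add: o_def)
    qed simp
    from integral_unique[OF this] have "t *\<^sub>R integral {0..1} (\<lambda>z. f (t * z)) = integral {0..t} f"
      by simp
    then show ?thesis by (subst picard_limit_integral[OF \<xi> t]) (simp only: f_def)
  qed
  show ?thesis
    using has_vector_derivative_transform[OF \<theta> eq der[OF \<theta>]] by (simp add: f_def)
qed

end

text \<open>
  Picard iteration is natural: a bounded linear map that intertwines two fields also intertwines the solutions.
  The parameters \<open>\<xi>\<close>, \<open>\<xi>'\<close> are fixed, so that only the fields at these parameters are compared.
\<close>

lemma picard_map:
  fixes \<xi> :: "'m::metric_space" and a :: "real \<Rightarrow> 'e::banach \<Rightarrow> 'm \<Rightarrow> 'e"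
  assumes "picard_field a G \<delta>" "\<xi> \<in> G" and L: "bounded_linear L"
    and inter: "\<And>\<theta> h. \<theta> \<in> {0..1} \<Longrightarrow> h \<in> ball 0 \<delta> \<Longrightarrow> L (a \<theta> h \<xi>) = b \<theta> (L h) \<xi>'"
    and \<theta>: "\<theta> \<in> {0..1}"
  shows "L (picard a n \<theta> \<xi>) = picard b n \<theta> \<xi>'"
  using \<theta>
proof (induction n arbitrary: \<theta>)
  case 0
  then show ?case using L by (simp add: linear_simps)
next
  case (Suc n)
  interpret picard_field a G \<delta> by fact
  let ?f = "\<lambda>z. a (\<theta> * z) (picard a n (\<theta> * z) \<xi>) \<xi>"
  have "continuous_on {0..1} ?f"
    by (rule field_along_continuous[OF picard_continuous \<open>\<xi> \<in> G\<close> Suc.prems]) (use picard_norm \<open>\<xi> \<in> G\<close> in auto)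
  then have "L (integral {0..1} ?f) = integral {0..1} (\<lambda>z. L (?f z))"
    using integral_linear[OF _ L, of ?f "{0..1}"] by (simp add: o_def integrable_continuous_real)
  also have "\<dots> = integral {0..1} (\<lambda>z. b (\<theta> * z) (picard b n (\<theta> * z) \<xi>') \<xi>')"
  proof (rule integral_cong)
    fix z :: real assume z: "z \<in> {0..1}"
    have \<theta>z: "\<theta> * z \<in> {0..1}" by (rule mult_unit[OF Suc.prems z])
    have "picard a n (\<theta> * z) \<xi> \<in> ball 0 \<delta>"
      using picard_norm[OF \<theta>z \<open>\<xi> \<in> G\<close>, of n] \<delta>_pos by simp
    then show "L (?f z) = b (\<theta> * z) (picard b n (\<theta> * z) \<xi>') \<xi>'"
      using inter[OF \<theta>z] Suc.IH[OF \<theta>z] by simp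
  qed
  finally show ?case using L by (simp add: linear_simps)
qed

lemma picard_limit_map:
  fixes \<xi> \<xi>' :: "'m::metric_space" and a b :: "real \<Rightarrow> 'e::banach \<Rightarrow> 'm \<Rightarrow> 'e"
  assumes a: "picard_field a G \<delta>" "\<xi> \<in> G" and b: "picard_field b G' \<delta>" "\<xi>' \<in> G'" and L: "bounded_linear L"
    and inter: "\<And>\<theta> h. \<theta> \<in> {0..1} \<Longrightarrow> h \<in> ball 0 \<delta> \<Longrightarrow> L (a \<theta> h \<xi>) = b \<theta> (L h) \<xi>'"
    and \<theta>: "\<theta> \<in> {0..1}"
  shows "L (picard_limit a \<theta> \<xi>) = picard_limit b \<theta> \<xi>'"
proof (rule LIMSEQ_unique)
  show "(\<lambda>n. L (picard a n \<theta> \<xi>)) \<longlonglongrightarrow> L (picard_limit a \<theta> \<xi>)"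
    by (rule bounded_linear.tendsto[OF L picard_field.picard_tendsto[OF a(1) \<theta> a(2)]])
  show "(\<lambda>n. L (picard a n \<theta> \<xi>)) \<longlonglongrightarrow> picard_limit b \<theta> \<xi>'"
    using picard_field.picard_tendsto[OF b(1) \<theta> b(2)]
      picard_map[where L = L and a = a and b = b and \<xi> = \<xi> and \<xi>' = \<xi>', OF a L inter \<theta>] by simp
qed

section \<open>Noise that is driven by elements of \<open>E\<close>\<close>

sublocale gaussian_noise \<subseteq> gaussian_measure P
  by unfold_locales (rule gaussian)

context gaussian_noise
begin

lemma Lp_norm_2_square: "(Lp_norm M 2 f)\<^sup>2 = (\<integral>x. (norm (f x))\<^sup>2 \<partial>M)"
proof -
  have "0 \<le> (\<integral>x. (norm (f x))\<^sup>2 \<partial>M)" by simp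
  moreover have "norm (f x) powr 2 = (norm (f x))\<^sup>2" for x by (simp add: powr_numeral)
  ultimately show ?thesis by (simp add: Lp_norm_def powr_half_sqrt)
qed

lemma inc_cm: "f \<in> Lp_on 2 UNIV \<Longrightarrow> inc f \<in> cameron_martin_space P"
  using inc_image by blast

lemma cm_inner_inc: "f \<in> Lp_on 2 UNIV \<Longrightarrow> cm_inner (inc f) (inc f) = (\<integral>x. (norm (f x))\<^sup>2 \<partial>lborel)"
  using arg_cong[OF inc_isometry, of f "\<lambda>x. x\<^sup>2"]
  unfolding cameron_martin_norm_def star_def[symmetric] Lp_norm_2_square
  by (simp add: cm_inner_def power2_eq_square)

lemma cm_inner_add:
  assumes h: "h \<in> cameron_martin_space P" and k: "k \<in> cameron_martin_space P"
  shows "cm_inner (h + k) (h + k) = cm_inner h h + 2 * cm_inner h k + cm_inner k k"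
proof -
  note sq = is_starD(2)[OF is_star_star[OF h]] is_starD(2)[OF is_star_star[OF k]]
  have "is_star P (1 *\<^sub>R h + 1 *\<^sub>R k) (\<lambda>\<omega>. 1 * star h \<omega> + 1 * star k \<omega>)"
    by (intro is_star_lincomb is_star_star h k)
  then have s: "is_star P (h + k) (\<lambda>\<omega>. star h \<omega> + star k \<omega>)" by simp
  then have hk: "h + k \<in> cameron_martin_space P" unfolding cameron_martin_space_def by auto
  note [measurable] = star_measurable[OF h] star_measurable[OF k] star_measurable[OF hk]
  have "AE \<omega> in Q. star (h + k) \<omega> = star h \<omega> + star k \<omega>"
    by (rule is_star_unique[OF is_star_star[OF hk] s])
  then have "cm_inner (h + k) (h + k) = expectation (\<lambda>\<omega>. (star h \<omega>)\<^sup>2 + 2 * (star h \<omega> * star k \<omega>) + (star k \<omega>)\<^sup>2)"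
    unfolding cm_inner_def
    by (intro integral_cong_AE) (auto simp: power2_eq_square algebra_simps)
  also have "\<dots> = cm_inner h h + 2 * cm_inner h k + cm_inner k k"
    using sq square_integrable_mult[OF sq] by (simp add: cm_inner_def square_integrable_def power2_eq_square)
  finally show ?thesis .
qed

text \<open>Polarisation of the isometry \<open>inc\<close>.\<close>

lemma cm_inner_disjoint:
  assumes f: "f \<in> Lp_on 2 UNIV" and g: "g \<in> Lp_on 2 UNIV" and disj: "AE x in lborel. f x = 0 \<or> g x = 0"
  shows "cm_inner (inc f) (inc g) = 0"
proof -
  have [measurable]: "f \<in> borel_measurable borel" "g \<in> borel_measurable borel"
    using f g by (auto simp: Lp_on_def)
  have int: "integrable lborel (\<lambda>x. (norm (f x))\<^sup>2)" "integrable lborel (\<lambda>x. (norm (g x))\<^sup>2)"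
    using f g by (auto simp: Lp_on_def powr_numeral)
  have fg: "(\<lambda>x. f x + g x) \<in> Lp_on 2 UNIV" by (rule Lp_on_add[OF _ f g]) simp
  have "cm_inner (inc f + inc g) (inc f + inc g) = (\<integral>x. (norm (f x + g x))\<^sup>2 \<partial>lborel)"
    using cm_inner_inc[OF fg] inc_add[OF f g] by simp
  also have "\<dots> = (\<integral>x. (norm (f x))\<^sup>2 + (norm (g x))\<^sup>2 \<partial>lborel)"
  proof (rule integral_cong_AE)
    show "AE x in lborel. (norm (f x + g x))\<^sup>2 = (norm (f x))\<^sup>2 + (norm (g x))\<^sup>2"
      using disj by eventually_elim auto
  qed measurable
  also have "\<dots> = cm_inner (inc f) (inc f) + cm_inner (inc g) (inc g)"
    using int by (simp add: cm_inner_inc f g)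
  finally show ?thesis using cm_inner_add[OF inc_cm[OF f] inc_cm[OF g]] by simp
qed

lemma inc_null:
  assumes f: "f \<in> Lp_on 2 UNIV" and 0: "AE x in lborel. f x = 0"
  shows "inc f = 0"
proof (rule functionals_separate_points)
  fix l :: "'w \<Rightarrow> real" assume l: "bounded_linear l"
  have [measurable]: "f \<in> borel_measurable borel" using f by (auto simp: Lp_on_def)
  note s = is_star_star[OF inc_cm[OF f]]
  have "AE x in lborel. (norm (f x))\<^sup>2 = 0" using 0 by eventually_elim simp
  then have "(\<integral>x. (norm (f x))\<^sup>2 \<partial>lborel) = 0"
    by (subst integral_cong_AE[of _ _ "\<lambda>_. 0"]) auto
  then have "expectation (\<lambda>\<omega>. star (inc f) \<omega> * star (inc f) \<omega>) = 0"
    using cm_inner_inc[OF f] by (simp add: cm_inner_def)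
  then have "expectation (\<lambda>\<omega>. (star (inc f) \<omega>)\<^sup>2) = 0" by (simp add: power2_eq_square)
  moreover have "(expectation (\<lambda>\<omega>. l \<omega> * star (inc f) \<omega>))\<^sup>2
      \<le> expectation (\<lambda>\<omega>. (l \<omega>)\<^sup>2) * expectation (\<lambda>\<omega>. (star (inc f) \<omega>)\<^sup>2)"
    by (rule Cauchy_Schwarz_integral[OF functional_law(1)[OF l] is_starD(2)[OF s]])
  ultimately have "expectation (\<lambda>\<omega>. l \<omega> * star (inc f) \<omega>) = 0" by simp
  then show "l (inc f) = 0" using is_starD(4)[OF s l] by simp
qed

lemma inc_cong_AE:
  assumes f: "f \<in> Lp_on 2 UNIV" and g: "g \<in> Lp_on 2 UNIV" and eq: "AE x in lborel. f x = g x"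
  shows "inc f = inc g"
proof -
  have g': "(\<lambda>x. (-1) *\<^sub>R g x) \<in> Lp_on 2 UNIV" by (rule Lp_on_scaleR[OF g])
  have fg: "(\<lambda>x. f x + (-1) *\<^sub>R g x) \<in> Lp_on 2 UNIV" by (rule Lp_on_add[OF _ f g']) simp
  have "inc (\<lambda>x. f x + (-1) *\<^sub>R g x) = 0"
  proof (rule inc_null[OF fg])
    show "AE x in lborel. f x + (-1) *\<^sub>R g x = 0" using eq by eventually_elim simp
  qed
  then show ?thesis using inc_add[OF f g'] inc_scaleR[OF g, of "-1"] by simp
qed

text \<open>
  A generator \<open>u = f\<^sup>*\<close> is moved by the shift by the inner product of \<open>f\<close> and \<open>g\<close>, which vanishes as their
  supports are disjoint.
\<close>

lemma noise_sigma_shift: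
  assumes B: "B \<in> sets (noise_sigma P inc S)"
    and g: "g \<in> Lp_on 2 UNIV" "AE x in lborel. x \<in> S \<longrightarrow> g x = 0"
  shows "AE \<omega> in Q. \<omega> + inc g \<in> B \<longleftrightarrow> \<omega> \<in> B"
proof -
  have "B \<in> sigma_sets UNIV {u -` B | f u B. f \<in> Lp_on 2 S \<and> is_star P (inc f) u \<and> B \<in> sets borel}"
    using B by (simp add: noise_sigma_def)
  then show ?thesis
  proof induction
    case (Basic a)
    then obtain f u C where a: "a = u -` C" "f \<in> Lp_on 2 S" "is_star P (inc f) u" by auto
    have f: "f \<in> Lp_on 2 UNIV" and f0: "\<And>x. x \<notin> S \<Longrightarrow> f x = 0" using a(2) by (auto simp: Lp_on_def)
    note u = is_starD[OF a(3)]
    have "cm_inner (inc f) (inc g) = 0"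
    proof (rule cm_inner_disjoint[OF f g(1)])
      show "AE x in lborel. f x = 0 \<or> g x = 0" using g(2) by eventually_elim (use f0 in auto)
    qed
    moreover have "expectation (\<lambda>\<omega>. u \<omega> * star (inc g) \<omega>) = cm_inner (inc f) (inc g)"
    proof -
      note [measurable] = star_measurable[OF inc_cm[OF g(1)]] star_measurable[OF inc_cm[OF f]] u(3)
      have "AE \<omega> in Q. u \<omega> = star (inc f) \<omega>"
        by (rule is_star_unique[OF a(3) is_star_star[OF inc_cm[OF f]]])
      then show ?thesis unfolding cm_inner_def by (intro integral_cong_AE) auto
    qed
    ultimately have "AE \<omega> in Q. u (\<omega> + inc g) = u \<omega>"
      using gaussian_space_shift[OF u(1) is_star_star[OF inc_cm[OF g(1)]]] by simp
    then show ?case by eventually_elim (simp add: a(1))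
  next
    case Empty
    then show ?case by simp
  next
    case (Compl a)
    from Compl.IH show ?case by eventually_elim simp
  next
    case (Union a)
    from Union.IH have "AE \<omega> in Q. \<forall>i. \<omega> + inc g \<in> a i \<longleftrightarrow> \<omega> \<in> a i" by (simp add: AE_all_countable)
    then show ?case by eventually_elim simp
  qed
qed

end

sublocale abstract_flow_system \<subseteq> Lp_unit_interval p rep
  using p_gt_2 E_is_Lp by unfold_locales auto

context abstract_flow_system
begin

definition noise :: "'e \<Rightarrow> real \<Rightarrow> 'h" where
  "noise h = (\<lambda>x. j (rep h x))"

definition shift :: "'e \<Rightarrow> 'w" where
  "shift h = inc (noise h)"

text \<open>
  On the unit interval \<open>x\<^sup>2 \<le> 1 + x\<^sup>p\<close> for \<open>x \<ge> 0\<close> and \<open>p \<ge> 2\<close>, which is cruder than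
  Jensen's inequality and explains the factor \<open>2\<close>: the right-hand side integrates to \<open>1 + \<parallel>h\<parallel>\<^sup>p\<close>.
\<close>

lemma noise_Lp: "noise h \<in> Lp_on 2 UNIV"
  and noise_L2_le: "norm h = 1 \<Longrightarrow> (\<integral>x. (norm (noise h x))\<^sup>2 \<partial>lborel) \<le> 2 * (onorm j)\<^sup>2"
proof -
  have [measurable]: "j \<in> borel_measurable borel"
    by (rule borel_measurable_continuous_onI[OF linear_continuous_on[OF j_inclusion(1)]])
  have le: "(norm (noise h x))\<^sup>2 \<le> (onorm j)\<^sup>2 * (indicator {0..1} x + norm (rep h x) powr p)" for x
  proof -
    have "norm (noise h x) \<le> onorm j * norm (rep h x)" unfolding noise_def by (rule onorm[OF j_inclusion(1)])
    then have "(norm (noise h x))\<^sup>2 \<le> (onorm j * norm (rep h x))\<^sup>2" by (rule power_mono) simp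
    also have "\<dots> = (onorm j)\<^sup>2 * (norm (rep h x))\<^sup>2" by (rule power_mult_distrib)
    also have "(norm (rep h x))\<^sup>2 \<le> indicator {0..1} x + norm (rep h x) powr p"
    proof (cases "x \<in> {0..1}")
      case True
      show ?thesis
      proof (cases "norm (rep h x) \<le> 1")
        case le1: True
        then have "(norm (rep h x))\<^sup>2 \<le> 1" by (simp add: power_le_one)
        moreover have "0 \<le> norm (rep h x) powr p" by simp
        ultimately show ?thesis using True by (simp add: add_increasing2)
      next
        case False
        then have "(norm (rep h x))\<^sup>2 = norm (rep h x) powr 2" by (simp add: powr_numeral)
        also have "\<dots> \<le> norm (rep h x) powr p" using False p_gt_2 by (intro powr_mono) auto
        finally have "(norm (rep h x))\<^sup>2 \<le> norm (rep h x) powr p" .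
        then show ?thesis by (rule order_trans) simp
      qed
    qed (simp add: rep_outside)
    finally show ?thesis by (simp add: mult_left_mono)
  qed
  have int: "integrable lborel (\<lambda>x. (onorm j)\<^sup>2 * (indicator {0..1} x + norm (rep h x) powr p))"
    using rep_integrable by (intro integrable_mult_right Bochner_Integration.integrable_add integrable_real_indicator) auto
  have m [measurable]: "noise h \<in> borel_measurable borel" unfolding noise_def by measurable
  have int2: "integrable lborel (\<lambda>x. (norm (noise h x))\<^sup>2)"
  proof (rule Bochner_Integration.integrable_bound[OF int])
    show "AE x in lborel. norm ((norm (noise h x))\<^sup>2) \<le> norm ((onorm j)\<^sup>2 * (indicator {0..1} x + norm (rep h x) powr p))"
      using le by (intro AE_I2) (simp add: order_trans[OF _ abs_ge_self])
  qed measurable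
  then show "noise h \<in> Lp_on 2 UNIV" by (simp add: Lp_on_def m powr_numeral)
  assume "norm h = 1"
  have "(\<integral>x. (norm (noise h x))\<^sup>2 \<partial>lborel) \<le> (\<integral>x. (onorm j)\<^sup>2 * (indicator {0..1} x + norm (rep h x) powr p) \<partial>lborel)"
    by (rule integral_mono[OF int2 int le])
  also have "\<dots> = (onorm j)\<^sup>2 * (1 + norm h powr p)"
    using rep_integrable by (simp add: norm_powr)
  also have "\<dots> = 2 * (onorm j)\<^sup>2" using \<open>norm h = 1\<close> by simp
  finally show "(\<integral>x. (norm (noise h x))\<^sup>2 \<partial>lborel) \<le> 2 * (onorm j)\<^sup>2" .
qed

lemma shift_cm: "shift h \<in> cameron_martin_space P"
  unfolding shift_def by (rule inc_cm[OF noise_Lp])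

lemma shift_add: "shift (h + k) = shift h + shift k"
proof -
  have "inc (noise (h + k)) = inc (\<lambda>x. noise h x + noise k x)"
  proof (rule inc_cong_AE)
    show "AE x in lborel. noise (h + k) x = noise h x + noise k x"
      using rep_add[of h k] by eventually_elim (simp add: noise_def linear_simps j_inclusion(1))
  qed (auto intro!: noise_Lp Lp_on_add)
  then show ?thesis by (simp add: shift_def inc_add noise_Lp)
qed

lemma shift_scaleR: "shift (c *\<^sub>R h) = c *\<^sub>R shift h"
proof -
  have "inc (noise (c *\<^sub>R h)) = inc (\<lambda>x. c *\<^sub>R noise h x)"
  proof (rule inc_cong_AE)
    show "AE x in lborel. noise (c *\<^sub>R h) x = c *\<^sub>R noise h x"
      using rep_scaleR[of c h] by eventually_elim (simp add: noise_def linear_simps j_inclusion(1))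
  qed (auto intro!: noise_Lp Lp_on_scaleR)
  then show ?thesis by (simp add: shift_def inc_scaleR noise_Lp)
qed

lemma shift_sum: "shift (\<Sum>k\<in>J. f k) = (\<Sum>k\<in>J. shift (f k))"
proof (induction J rule: infinite_finite_induct)
  case (insert x F)
  then show ?case by (simp add: shift_add)
qed (use shift_scaleR[of 0 0] in auto)

lemma shift_energy_le: "cm_inner (shift h) (shift h) \<le> 2 * (onorm j)\<^sup>2 * (norm h)\<^sup>2"
proof (cases "h = 0")
  case True
  have "cm_inner (0 *\<^sub>R shift 0) (0 *\<^sub>R shift 0) = 0" using cm_inner_scale[OF shift_cm shift_cm, of 0 0 0 0] by simp
  then show ?thesis using True shift_scaleR[of 0 0] by simp
next
  case False
  define k where "k = h /\<^sub>R norm h"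
  have k: "norm k = 1" "h = norm h *\<^sub>R k" using False by (auto simp: k_def)
  have "cm_inner (shift h) (shift h) = norm h * norm h * cm_inner (shift k) (shift k)"
    by (subst (1 2) k(2)) (simp only: shift_scaleR cm_inner_scale[OF shift_cm shift_cm])
  moreover have "cm_inner (shift k) (shift k) \<le> 2 * (onorm j)\<^sup>2"
    unfolding shift_def cm_inner_inc[OF noise_Lp] by (rule noise_L2_le[OF k(1)])
  from mult_left_mono[OF this, of "norm h * norm h"]
  have "norm h * norm h * cm_inner (shift k) (shift k) \<le> 2 * (onorm j)\<^sup>2 * (norm h)\<^sup>2"
    by (simp add: power2_eq_square mult_ac)
  ultimately show ?thesis by simp
qed

lemma shift_orth:
  assumes "AE x in lborel. rep h x = 0 \<or> rep k x = 0"
  shows "cm_inner (shift h) (shift k) = 0"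
  unfolding shift_def
proof (rule cm_inner_disjoint[OF noise_Lp noise_Lp])
  show "AE x in lborel. noise h x = 0 \<or> noise k x = 0"
    using assms by eventually_elim (auto simp: noise_def linear_simps j_inclusion(1))
qed

lemma past_shift:
  assumes B: "B \<in> sets (noise_sigma P inc {..s})" and h: "restr s h = 0"
  shows "AE \<omega> in Q. \<omega> + shift h \<in> B \<longleftrightarrow> \<omega> \<in> B"
  unfolding shift_def
proof (rule noise_sigma_shift[OF B noise_Lp])
  show "AE x in lborel. x \<in> {..s} \<longrightarrow> noise h x = 0"
    using h[unfolded restr_eq_0_iff]
  proof eventually_elim
    case (elim x)
    then show ?case using rep_outside[of x h] by (cases "0 \<le> x") (auto simp: noise_def linear_simps j_inclusion(1))
  qed
qed

lemma \<Xi>_shift: "AE \<omega> in Q. \<Xi> (\<omega> + shift h) = \<tau> h (\<Xi> \<omega>)"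
  using \<tau>_shift[of h] by (simp add: shift_def noise_def)

lemma AE_shift: "AE \<omega> in Q. R \<omega> \<Longrightarrow> AE \<omega> in Q. R (\<omega> + shift h)"
  by (rule cameron_martin_AE_shift[OF is_star_star[OF shift_cm]])

end

section \<open>Causality\<close>

lemma countable_dense_subset_exists:
  fixes S :: "'a::{metric_space,second_countable_topology} set"
  obtains T where "countable T" "T \<subseteq> S" "S \<subseteq> closure T"
proof -
  obtain B :: "'a set set" where B: "countable B" "topological_basis B"
    using ex_countable_basis by blast
  define pick where "pick b = (SOME x. x \<in> b \<inter> S)" for b
  have pick: "pick b \<in> b \<inter> S" if "b \<inter> S \<noteq> {}" for b
  proof -
    have "\<exists>x. x \<in> b \<inter> S" using that by blast
    then show ?thesis unfolding pick_def by (rule someI_ex)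
  qed
  show thesis
  proof (rule that)
    show "countable (pick ` {b \<in> B. b \<inter> S \<noteq> {}})" using B(1) by simp
    show "pick ` {b \<in> B. b \<inter> S \<noteq> {}} \<subseteq> S" using pick by auto
    show "S \<subseteq> closure (pick ` {b \<in> B. b \<inter> S \<noteq> {}})"
    proof
      fix x assume x: "x \<in> S"
      show "x \<in> closure (pick ` {b \<in> B. b \<inter> S \<noteq> {}})"
        unfolding closure_approachable
      proof (intro allI impI)
        fix e :: real assume "e > 0"
        then obtain b where b: "b \<in> B" "x \<in> b" "b \<subseteq> ball x e"
          using topological_basisE[OF B(2), of "ball x e" x] by auto
        then have ne: "b \<inter> S \<noteq> {}" using x by auto
        then have "pick b \<in> ball x e" using pick[OF ne] b(3) by auto
        then show "\<exists>y\<in>pick ` {b \<in> B. b \<inter> S \<noteq> {}}. dist y x < e"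
          using b(1) ne by (auto simp: dist_commute)
      qed
    qed
  qed
qed


lemma continuous_on_Alive: "continuous_on S f \<Longrightarrow> continuous_on S (\<lambda>x. Alive (f x))"
  unfolding continuous_on_def tendsto_iff by (simp add: dist_norm)

lemma Alive_state: "z \<noteq> Dead \<Longrightarrow> Alive (state z) = z"
  by (cases z) auto

lemma continuous_on_state:
  fixes f :: "'a::metric_space \<Rightarrow> 'b::real_normed_vector with_death"
  assumes "continuous_on S f" "\<And>x. x \<in> S \<Longrightarrow> f x \<noteq> Dead"
  shows "continuous_on S (\<lambda>x. state (f x))"
  unfolding continuous_on_iff
proof (intro ballI allI impI)
  fix x and e :: real assume x: "x \<in> S" and "e > 0"
  then obtain d where d: "d > 0" "\<And>y. y \<in> S \<Longrightarrow> dist y x < d \<Longrightarrow> dist (f y) (f x) < e"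
    using assms(1) unfolding continuous_on_iff by blast
  have "dist (state (f y)) (state (f x)) = dist (f y) (f x)" if "y \<in> S" for y
    using assms(2)[OF that] assms(2)[OF x] by (cases "f y"; cases "f x") (auto simp: dist_norm)
  then show "\<exists>d>0. \<forall>y\<in>S. dist y x < d \<longrightarrow> dist (state (f y)) (state (f x)) < e"
    using d by (intro exI[of _ d]) auto
qed

lemma locally_lipschitz_on_imp_continuous_on:
  assumes "locally_lipschitz_on X f"
  shows "continuous_on X f"
  unfolding continuous_on_eq_continuous_within
proof
  fix x assume x: "x \<in> X"
  then obtain V L where V: "open V" "x \<in> V" "L-lipschitz_on (V \<inter> X) f"
    using assms unfolding locally_lipschitz_on_def by blast
  have "continuous (at x within V \<inter> X) f"
    using lipschitz_on_continuous_on[OF V(3)] V(2) x by (auto simp: continuous_on_eq_continuous_within)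
  moreover have "at x within V \<inter> X = at x within X"
    by (rule at_within_nhd[OF V(2,1)]) auto
  ultimately show "continuous (at x within X) f" by simp
qed

context abstract_flow_system
begin

lemma \<tau>_tendsto:
  assumes "(f \<longlongrightarrow> h) F" "(g \<longlongrightarrow> \<xi>) F"
  shows "((\<lambda>x. \<tau> (f x) (g x)) \<longlongrightarrow> \<tau> h \<xi>) F"
proof -
  have "isCont (\<lambda>(h, \<xi>). \<tau> h \<xi>) (h, \<xi>)"
    using \<tau>_continuous by (simp add: continuous_on_eq_continuous_at)
  from isCont_tendsto_compose[OF this tendsto_Pair[OF assms]] show ?thesis by simp
qed

lemma \<tau>_commute: "\<tau> h (\<tau> k \<xi>) = \<tau> (k + h) \<xi>"
  by (simp add: \<tau>_add add.commute)

lemma flow_set_open: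
  assumes "0 \<le> t" "t \<le> 1"
  shows "open (survival \<Phi> t)"
proof -
  let ?D = "{(s, t, z, \<xi>). 0 \<le> s \<and> s \<le> t \<and> t \<le> 1} :: (real \<times> real \<times> 'u with_death \<times> 'm) set"
  obtain T where T: "open T" "{(s, t, z, \<xi>). 0 \<le> s \<and> s \<le> t \<and> t \<le> 1 \<and> \<Phi> s t z \<xi> \<noteq> Dead} = ?D \<inter> T"
    using alive_open unfolding openin_open by blast
  have "survival \<Phi> t = (\<lambda>x. (0, t, Alive (fst x), snd x)) -` T"
  proof -
    have "(0, t, Alive u, \<xi>) \<in> T \<longleftrightarrow> \<Phi> 0 t (Alive u) \<xi> \<noteq> Dead" for u \<xi>
    proof -
      have "(0, t, Alive u, \<xi>) \<in> {(s, t, z, \<xi>). 0 \<le> s \<and> s \<le> t \<and> t \<le> 1 \<and> \<Phi> s t z \<xi> \<noteq> Dead}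
          \<longleftrightarrow> (0, t, Alive u, \<xi>) \<in> ?D \<inter> T" using T(2) by simp
      then show ?thesis using assms by simp
    qed
    then show ?thesis by (auto simp: survival_def)
  qed
  moreover have "open ((\<lambda>x. (0::real, t, Alive (fst x :: 'u), snd x :: 'm)) -` T)"
    by (intro open_vimage T(1) continuous_on_Pair continuous_on_const continuous_on_Alive continuous_on_fst
          continuous_on_snd continuous_on_id)
  ultimately show ?thesis by simp
qed

lemma flow_continuous:
  assumes "0 \<le> t" "t \<le> 1"
  shows "continuous_on (survival \<Phi> t) (\<lambda>(u, \<xi>). \<Phi> 0 t (Alive u) \<xi>)"
proof -
  have c: "continuous_on (survival \<Phi> t) (\<lambda>x. (0::real, t, Alive (fst x), snd x))"
    by (intro continuous_on_Pair continuous_on_const continuous_on_Alive continuous_on_fst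
          continuous_on_snd continuous_on_id)
  have sub: "(\<lambda>x. (0::real, t, Alive (fst x), snd x)) ` survival \<Phi> t
      \<subseteq> {(s, t, z, \<xi>). 0 \<le> s \<and> s \<le> t \<and> t \<le> 1 \<and> \<Phi> s t z \<xi> \<noteq> Dead}"
    using assms by (auto simp: survival_def)
  show ?thesis
    using continuous_on_compose2[OF alive_continuous c sub] by (simp add: case_prod_unfold)
qed

lemma survival_antimono:
  assumes "0 \<le> s" "s \<le> t" "t \<le> 1" "(u, \<xi>) \<in> survival \<Phi> t"
  shows "(u, \<xi>) \<in> survival \<Phi> s"
proof (rule ccontr)
  assume "(u, \<xi>) \<notin> survival \<Phi> s"
  then have "\<Phi> 0 s (Alive u) \<xi> = Dead" by (simp add: survival_def)
  then have "\<Phi> 0 t (Alive u) \<xi> = Dead"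
    using flow[of 0 s t "Alive u" \<xi>] flow_Dead[of s t \<xi>] assms by simp
  then show False using assms(4) by (simp add: survival_def)
qed

lemma survival_iff_r: "t \<in> {0..1} \<Longrightarrow> (u, \<xi>) \<in> survival \<Phi> t \<longleftrightarrow> r t u \<xi> \<noteq> \<infinity>"
  using r_explosion by (simp add: survival_def)

lemma flow_future_shift:
  assumes "0 \<le> s" "s \<le> 1" "restr s k = 0"
  shows "\<Phi> 0 s z (\<tau> (h + k) \<xi>) = \<Phi> 0 s z (\<tau> h \<xi>)"
  using \<tau>_local[of 0 s k z "\<tau> h \<xi>"] assms by (simp add: restr_eq_0_iff \<tau>_commute)

lemma survival_future_shift:
  assumes "0 \<le> s" "s \<le> 1" "restr s k = 0"
  shows "(u, \<tau> (h + k) \<xi>) \<in> survival \<Phi> s \<longleftrightarrow> (u, \<tau> h \<xi>) \<in> survival \<Phi> s"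
  using flow_future_shift[OF assms] by (simp add: survival_def)

lemma A_continuous:
  assumes "0 < s" "s \<le> t" "t \<le> 1"
  shows "continuous_on (survival \<Phi> s) (\<lambda>(u, \<xi>). A t s u \<xi>)"
  by (rule locally_lipschitz_on_imp_continuous_on[OF A_lipschitz[OF assms]])

lemma r_finite_continuous:
  assumes "0 < s" "s \<le> 1"
  shows "continuous_on (survival \<Phi> s) (\<lambda>(u, \<xi>). r s u \<xi>)"
proof -
  have "continuous_on (survival \<Phi> s) (\<lambda>x. ennreal (case x of (u, \<xi>) \<Rightarrow> enn2real (r s u \<xi>)))"
    using assms by (intro continuous_on_ennreal locally_lipschitz_on_imp_continuous_on r_lipschitz) auto
  then show ?thesis
  proof (rule continuous_on_eq)
    fix x assume "x \<in> survival \<Phi> s"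
    then show "ennreal (case x of (u, \<xi>) \<Rightarrow> enn2real (r s u \<xi>)) = (case x of (u, \<xi>) \<Rightarrow> r s u \<xi>)"
      using assms survival_iff_r[of s "fst x" "snd x"] by (cases x) (simp add: less_top)
  qed
qed

text \<open>
  A quantity adapted to the past of time \<open>s\<close> does not notice a change of the noise after time \<open>s\<close>.
  For deterministic changes this holds almost surely; continuity in all arguments makes the exceptional
  null set independent of the initial condition and of the change.
\<close>

lemma AE_nonanticipating:
  fixes Y :: "'u \<Rightarrow> 'm \<Rightarrow> 'y::{second_countable_topology,t2_space}"
  assumes s: "0 < s" "s \<le> 1"
    and cont: "continuous_on (survival \<Phi> s) (\<lambda>(u, \<xi>). Y u \<xi>)"
    and adapted: "\<And>u. (\<lambda>\<omega>. Y u (\<Xi> \<omega>)) \<in> borel_measurable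
           (restrict_space (noise_sigma P inc {..s}) {\<omega>. (u, \<Xi> \<omega>) \<in> survival \<Phi> s})"
  shows "AE \<omega> in Q. \<forall>u h k. restr s k = 0 \<longrightarrow> (u, \<tau> h (\<Xi> \<omega>)) \<in> survival \<Phi> s \<longrightarrow>
           Y u (\<tau> (h + k) (\<Xi> \<omega>)) = Y u (\<tau> h (\<Xi> \<omega>))"
proof -
  have one: "AE \<omega> in Q. (u, \<Xi> \<omega>) \<in> survival \<Phi> s \<longrightarrow> Y u (\<tau> k (\<Xi> \<omega>)) = Y u (\<Xi> \<omega>)"
    if k: "restr s k = 0" for u k
  proof -
    obtain B :: "'y set set" where B: "countable B" "topological_basis B"
      using ex_countable_basis by blast
    define S where "S = {\<omega>. (u, \<Xi> \<omega>) \<in> survival \<Phi> s}"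
    have "\<exists>C\<in>sets (noise_sigma P inc {..s}). \<forall>\<omega>\<in>S. Y u (\<Xi> \<omega>) \<in> b \<longleftrightarrow> \<omega> \<in> C" if "b \<in> B" for b
    proof -
      have "b \<in> sets borel" using topological_basis_open[OF B(2) that] by simp
      from measurable_sets[OF adapted[of u] this]
      obtain C where C: "C \<in> sets (noise_sigma P inc {..s})"
          "(\<lambda>\<omega>. Y u (\<Xi> \<omega>)) -` b \<inter> space (restrict_space (noise_sigma P inc {..s}) S) = S \<inter> C"
        by (auto simp: sets_restrict_space S_def)
      have "space (noise_sigma P inc {..s}) = UNIV" by (simp add: noise_sigma_def space_measure_of_conv)
      then have "(\<lambda>\<omega>. Y u (\<Xi> \<omega>)) -` b \<inter> S = S \<inter> C" using C(2) by (simp add: space_restrict_space)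
      then show ?thesis using C(1) by blast
    qed
    then obtain C where C: "\<And>b. b \<in> B \<Longrightarrow> C b \<in> sets (noise_sigma P inc {..s})"
        "\<And>b \<omega>. b \<in> B \<Longrightarrow> \<omega> \<in> S \<Longrightarrow> Y u (\<Xi> \<omega>) \<in> b \<longleftrightarrow> \<omega> \<in> C b"
      by metis
    have "AE \<omega> in Q. \<forall>b\<in>B. \<omega> + shift k \<in> C b \<longleftrightarrow> \<omega> \<in> C b"
      using past_shift[OF C(1) k] by (subst AE_ball_countable[OF B(1)]) blast
    then show ?thesis
      using \<Xi>_shift[of k]
    proof eventually_elim
      case (elim \<omega>)
      show ?case
      proof
        assume sv: "(u, \<Xi> \<omega>) \<in> survival \<Phi> s"
        have "(u, \<tau> k (\<Xi> \<omega>)) \<in> survival \<Phi> s"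
          using survival_future_shift[of s k u 0 "\<Xi> \<omega>"] k s sv by (simp add: \<tau>_zero)
        then have "\<omega> \<in> S" "\<omega> + shift k \<in> S" using sv elim(2) by (auto simp: S_def)
        then have same: "Y u (\<tau> k (\<Xi> \<omega>)) \<in> b \<longleftrightarrow> Y u (\<Xi> \<omega>) \<in> b" if "b \<in> B" for b
          using C(2)[OF that, of \<omega>] C(2)[OF that, of "\<omega> + shift k"] elim(1) that elim(2) by simp
        show "Y u (\<tau> k (\<Xi> \<omega>)) = Y u (\<Xi> \<omega>)"
        proof (rule ccontr)
          assume "Y u (\<tau> k (\<Xi> \<omega>)) \<noteq> Y u (\<Xi> \<omega>)"
          from hausdorff[OF this]
          obtain U V where UV: "open U" "open V" "Y u (\<tau> k (\<Xi> \<omega>)) \<in> U" "Y u (\<Xi> \<omega>) \<in> V" "U \<inter> V = {}"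
            by (elim exE conjE)
          obtain b where "b \<in> B" "Y u (\<tau> k (\<Xi> \<omega>)) \<in> b" "b \<subseteq> U"
            by (rule topological_basisE[OF B(2) UV(1,3)])
          then show False using same UV(4,5) by blast
        qed
      qed
    qed
  qed
  have two: "AE \<omega> in Q. (u, \<tau> h (\<Xi> \<omega>)) \<in> survival \<Phi> s \<longrightarrow> Y u (\<tau> (h + k) (\<Xi> \<omega>)) = Y u (\<tau> h (\<Xi> \<omega>))"
    if k: "restr s k = 0" for u h k
    using AE_shift[OF one[OF k, of u], of h] \<Xi>_shift[of h]
    by eventually_elim (simp add: \<tau>_commute)
  define N where "N = {(u :: 'u, h :: 'e, k :: 'e). restr s k = 0}"
  obtain T where T: "countable T" "T \<subseteq> N" "N \<subseteq> closure T"
    by (rule countable_dense_subset_exists)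
  have "AE \<omega> in Q. \<forall>x\<in>T. (fst x, \<tau> (fst (snd x)) (\<Xi> \<omega>)) \<in> survival \<Phi> s \<longrightarrow>
      Y (fst x) (\<tau> (fst (snd x) + snd (snd x)) (\<Xi> \<omega>)) = Y (fst x) (\<tau> (fst (snd x)) (\<Xi> \<omega>))"
    unfolding AE_ball_countable[OF T(1)]
  proof
    fix x assume "x \<in> T"
    then have "restr s (snd (snd x)) = 0" using T(2) by (auto simp: N_def)
    then show "AE \<omega> in Q. (fst x, \<tau> (fst (snd x)) (\<Xi> \<omega>)) \<in> survival \<Phi> s \<longrightarrow>
      Y (fst x) (\<tau> (fst (snd x) + snd (snd x)) (\<Xi> \<omega>)) = Y (fst x) (\<tau> (fst (snd x)) (\<Xi> \<omega>))"
      by (rule two)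
  qed
  then show ?thesis
  proof eventually_elim
    case (elim \<omega>)
    show ?case
    proof (intro allI impI)
      fix u h k assume k: "restr s k = 0" and sv: "(u, \<tau> h (\<Xi> \<omega>)) \<in> survival \<Phi> s"
      then have sv': "(u, \<tau> (h + k) (\<Xi> \<omega>)) \<in> survival \<Phi> s" using survival_future_shift[of s k] s by simp
      have op: "open (survival \<Phi> s)" using flow_set_open s by simp
      have "(u, h, k) \<in> closure T" using T(3) k by (auto simp: N_def)
      then obtain x where x: "\<And>n. x n \<in> T" "x \<longlonglongrightarrow> (u, h, k)"
        unfolding closure_sequential by blast
      have l1: "(\<lambda>n. fst (x n)) \<longlonglongrightarrow> u" using tendsto_fst[OF x(2)] by simp
      have l2: "(\<lambda>n. fst (snd (x n))) \<longlonglongrightarrow> h" using tendsto_fst[OF tendsto_snd[OF x(2)]] by simp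
      have l3: "(\<lambda>n. snd (snd (x n))) \<longlonglongrightarrow> k" using tendsto_snd[OF tendsto_snd[OF x(2)]] by simp
      have isc: "isCont (\<lambda>(u, \<xi>). Y u \<xi>) y" if "y \<in> survival \<Phi> s" for y
        using cont op that by (simp add: continuous_on_eq_continuous_at)
      have p1: "(\<lambda>n. (fst (x n), \<tau> (fst (snd (x n))) (\<Xi> \<omega>))) \<longlonglongrightarrow> (u, \<tau> h (\<Xi> \<omega>))"
        by (intro tendsto_Pair l1 \<tau>_tendsto l2 tendsto_const)
      have p2: "(\<lambda>n. (fst (x n), \<tau> (fst (snd (x n)) + snd (snd (x n))) (\<Xi> \<omega>))) \<longlonglongrightarrow> (u, \<tau> (h + k) (\<Xi> \<omega>))"
        by (intro tendsto_Pair l1 \<tau>_tendsto tendsto_add l2 l3 tendsto_const)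
      have y1: "(\<lambda>n. Y (fst (x n)) (\<tau> (fst (snd (x n))) (\<Xi> \<omega>))) \<longlonglongrightarrow> Y u (\<tau> h (\<Xi> \<omega>))"
        using isCont_tendsto_compose[OF isc[OF sv] p1] by simp
      have y2: "(\<lambda>n. Y (fst (x n)) (\<tau> (fst (snd (x n)) + snd (snd (x n))) (\<Xi> \<omega>))) \<longlonglongrightarrow> Y u (\<tau> (h + k) (\<Xi> \<omega>))"
        using isCont_tendsto_compose[OF isc[OF sv'] p2] by simp
      have "\<forall>\<^sub>F n in sequentially. (fst (x n), \<tau> (fst (snd (x n))) (\<Xi> \<omega>)) \<in> survival \<Phi> s"
        by (rule topological_tendstoD[OF p1 op sv])
      then have "\<forall>\<^sub>F n in sequentially. Y (fst (x n)) (\<tau> (fst (snd (x n)) + snd (snd (x n))) (\<Xi> \<omega>))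
          = Y (fst (x n)) (\<tau> (fst (snd (x n))) (\<Xi> \<omega>))"
        by eventually_elim (use elim x(1) in blast)
      from tendsto_cong[OF this] y2
      have "(\<lambda>n. Y (fst (x n)) (\<tau> (fst (snd (x n))) (\<Xi> \<omega>))) \<longlonglongrightarrow> Y u (\<tau> (h + k) (\<Xi> \<omega>))" by simp
      then show "Y u (\<tau> (h + k) (\<Xi> \<omega>)) = Y u (\<tau> h (\<Xi> \<omega>))" using y1 by (rule LIMSEQ_unique)
    qed
  qed
qed

text \<open>
  The almost sure properties of configurations that are used afterwards. All initial points, all present shifts \<open>h\<close> and
  all future shifts \<open>k\<close> occur at once, so that what follows is deterministic.
\<close>

definition causal :: "real \<Rightarrow> real \<Rightarrow> 'm \<Rightarrow> bool" where
  "causal t s \<xi> \<longleftrightarrow> (\<forall>u h k. restr s k = 0 \<longrightarrow>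
     r s u (\<tau> (h + k) \<xi>) = r s u (\<tau> h \<xi>) \<and>
     ((u, \<tau> h \<xi>) \<in> survival \<Phi> s \<longrightarrow> A t s u (\<tau> (h + k) \<xi>) = A t s u (\<tau> h \<xi>)))"

lemma causal_\<tau>: "causal t s \<xi> \<Longrightarrow> causal t s (\<tau> k \<xi>)"
  unfolding causal_def by (simp add: \<tau>_commute add.assoc[symmetric])

lemma AE_causal:
  assumes st: "0 < s" "s \<le> t" "t \<le> 1"
  shows "AE \<omega> in Q. causal t s (\<Xi> \<omega>)"
proof -
  have s: "0 < s" "s \<le> 1" using st by auto
  obtain V :: "'u set" where V: "countable V" "\<And>X. open X \<Longrightarrow> X \<noteq> {} \<Longrightarrow> \<exists>d\<in>V. d \<in> X"
    by (erule countable_dense_setE)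
  have rAE: "AE \<omega> in Q. \<forall>u h k. restr s k = 0 \<longrightarrow> (u, \<tau> h (\<Xi> \<omega>)) \<in> survival \<Phi> s \<longrightarrow>
           r s u (\<tau> (h + k) (\<Xi> \<omega>)) = r s u (\<tau> h (\<Xi> \<omega>))"
    by (rule AE_nonanticipating[OF s r_finite_continuous[OF s] measurable_restrict_space1[OF r_adapted]])
       (use s in auto)
  have "AE \<omega> in Q. \<forall>v\<in>V. \<forall>u h k. restr s k = 0 \<longrightarrow> (u, \<tau> h (\<Xi> \<omega>)) \<in> survival \<Phi> s \<longrightarrow>
           blinfun_apply (A t s u (\<tau> (h + k) (\<Xi> \<omega>))) v = blinfun_apply (A t s u (\<tau> h (\<Xi> \<omega>))) v"
    unfolding AE_ball_countable[OF V(1)]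
  proof
    fix v
    have c: "continuous_on UNIV (\<lambda>T :: 'u \<Rightarrow>\<^sub>L 'e. blinfun_apply T v)"
      by (intro continuous_intros)
    show "AE \<omega> in Q. \<forall>u h k. restr s k = 0 \<longrightarrow> (u, \<tau> h (\<Xi> \<omega>)) \<in> survival \<Phi> s \<longrightarrow>
           blinfun_apply (A t s u (\<tau> (h + k) (\<Xi> \<omega>))) v = blinfun_apply (A t s u (\<tau> h (\<Xi> \<omega>))) v"
    proof (rule AE_nonanticipating[OF s])
      show "continuous_on (survival \<Phi> s) (\<lambda>(u, \<xi>). blinfun_apply (A t s u \<xi>) v)"
        using continuous_on_compose2[OF c A_continuous[OF st]] by (simp add: case_prod_unfold)
      show "(\<lambda>\<omega>. blinfun_apply (A t s u (\<Xi> \<omega>)) v) \<in> borel_measurable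
           (restrict_space (noise_sigma P inc {..s}) {\<omega>. (u, \<Xi> \<omega>) \<in> survival \<Phi> s})" for u
        by (rule measurable_compose[OF A_adapted[OF st] borel_measurable_continuous_onI[OF c]])
    qed
  qed
  then show ?thesis
    using rAE
  proof eventually_elim
    case (elim \<omega>)
    show ?case
      unfolding causal_def
    proof (intro allI impI conjI)
      fix u h k assume k: "restr s k = 0"
      show "r s u (\<tau> (h + k) (\<Xi> \<omega>)) = r s u (\<tau> h (\<Xi> \<omega>))"
      proof (cases "(u, \<tau> h (\<Xi> \<omega>)) \<in> survival \<Phi> s")
        case True
        then show ?thesis using elim(2) k by blast
      next
        case False
        then have "(u, \<tau> (h + k) (\<Xi> \<omega>)) \<notin> survival \<Phi> s" using survival_future_shift[of s k] k s by simp
        then show ?thesis using False s by (simp add: survival_iff_r)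
      qed
      assume sv: "(u, \<tau> h (\<Xi> \<omega>)) \<in> survival \<Phi> s"
      let ?S = "A t s u (\<tau> (h + k) (\<Xi> \<omega>))" and ?T = "A t s u (\<tau> h (\<Xi> \<omega>))"
      have cl: "closed {v. blinfun_apply ?S v = blinfun_apply ?T v}"
        by (intro closed_Collect_eq continuous_intros)
      have "open (- {v. blinfun_apply ?S v = blinfun_apply ?T v})" using cl by (simp add: open_Compl)
      have "- {v. blinfun_apply ?S v = blinfun_apply ?T v} = {}"
      proof (rule ccontr)
        assume "- {v. blinfun_apply ?S v = blinfun_apply ?T v} \<noteq> {}"
        from V(2)[OF \<open>open (- {v. blinfun_apply ?S v = blinfun_apply ?T v})\<close> this]
        obtain d where "d \<in> V" "blinfun_apply ?S d \<noteq> blinfun_apply ?T d" by auto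
        then show False using elim(1) k sv by blast
      qed
      then show "?S = ?T" by (intro blinfun_eqI) blast
    qed
  qed
qed

end

section \<open>Tame configurations\<close>

context abstract_flow_system
begin

text \<open>
  The configurations for which the control can be constructed. The bound on \<open>r\<close> ensures survival from all
  points near \<open>u\<^sub>0\<close> under all small shifts of the noise; the other two bounds are those of Picard's theorem. Quantifying
  over all \<open>u\<close> and \<open>h\<close> in fixed balls, with non-strict bounds, makes the set closed.
\<close>

definition tame :: "'u \<Rightarrow> real \<Rightarrow> real \<Rightarrow> real \<Rightarrow> real \<Rightarrow> 'm set" where
  "tame u\<^sub>0 \<delta> C t s = {\<xi>. \<forall>u h. norm (u - u\<^sub>0) < \<delta> \<longrightarrow> norm h < \<delta> \<longrightarrow>
     r s u (\<tau> h \<xi>) \<le> ennreal C \<and> norm (A t s u (\<tau> h \<xi>)) \<le> C \<and>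
     (\<forall>h'. norm h' < \<delta> \<longrightarrow> norm (A t s u (\<tau> h \<xi>) - A t s u (\<tau> h' \<xi>)) \<le> C * norm (h - h'))}"

lemma tame_survival:
  assumes "\<xi> \<in> tame u\<^sub>0 \<delta> C t s" "norm (u - u\<^sub>0) < \<delta>" "norm h < \<delta>" "s \<in> {0..1}"
  shows "(u, \<tau> h \<xi>) \<in> survival \<Phi> s"
proof -
  have "r s u (\<tau> h \<xi>) \<le> ennreal C" using assms by (auto simp: tame_def)
  then have "r s u (\<tau> h \<xi>) < \<infinity>" using ennreal_less_top le_less_trans by (metis infinity_ennreal_def)
  then show ?thesis using assms(4) by (simp add: survival_iff_r)
qed

text \<open>
  The bound on \<open>r\<close> is closed by lower semicontinuity; it keeps limit points inside the open set of survival,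
  where \<open>A\<close> is continuous.
\<close>

lemma closed_tame:
  assumes st: "0 < s" "s \<le> t" "t \<le> 1"
  shows "closed (tame u\<^sub>0 \<delta> C t s)"
  unfolding closed_sequential_limits
proof (intro allI impI)
  fix x \<xi> assume x: "(\<forall>n. x n \<in> tame u\<^sub>0 \<delta> C t s) \<and> x \<longlonglongrightarrow> \<xi>"
  have rs: "closed {(u, \<xi>). r s u \<xi> \<le> ennreal C}"
  proof -
    obtain T where T: "open T" "{(t, u, \<xi>). t \<in> {0..1} \<and> ennreal C < r t u \<xi>} = ({0..1} \<times> UNIV) \<inter> T"
      using r_lower_semicontinuous[of "ennreal C"] unfolding openin_open by blast
    have "(s, u, \<xi>) \<in> T \<longleftrightarrow> ennreal C < r s u \<xi>" for u \<xi>
    proof -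
      have "(s, u, \<xi>) \<in> {(t, u, \<xi>). t \<in> {0..1} \<and> ennreal C < r t u \<xi>} \<longleftrightarrow> (s, u, \<xi>) \<in> ({0..1} \<times> UNIV) \<inter> T"
        using T(2) by simp
      then show ?thesis using st by simp
    qed
    then have "{(u, \<xi>). r s u \<xi> \<le> ennreal C} = - ((\<lambda>x. (s, x)) -` T)" by auto
    moreover have "open ((\<lambda>x. (s, x)) -` T)" by (intro open_vimage T(1) continuous_intros)
    ultimately show ?thesis by (simp add: closed_def)
  qed
  have op: "open (survival \<Phi> s)" using flow_set_open st by simp
  have lim\<tau>: "(\<lambda>n. (u, \<tau> h (x n))) \<longlonglongrightarrow> (u, \<tau> h \<xi>)" for u h
    using x by (intro tendsto_Pair tendsto_const \<tau>_tendsto) auto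
  have r_le: "r s u (\<tau> h \<xi>) \<le> ennreal C" if "norm (u - u\<^sub>0) < \<delta>" "norm h < \<delta>" for u h
  proof -
    have "(u, \<tau> h (x n)) \<in> {(u, \<xi>). r s u \<xi> \<le> ennreal C}" for n
      using x that by (auto simp: tame_def)
    from closed_sequentially[OF rs this lim\<tau>] show ?thesis by simp
  qed
  have Alim: "(\<lambda>n. A t s u (\<tau> h (x n))) \<longlonglongrightarrow> A t s u (\<tau> h \<xi>)" if "norm (u - u\<^sub>0) < \<delta>" "norm h < \<delta>" for u h
  proof -
    have "r s u (\<tau> h \<xi>) < \<infinity>" using r_le[OF that] ennreal_less_top le_less_trans by (metis infinity_ennreal_def)
    then have "(u, \<tau> h \<xi>) \<in> survival \<Phi> s" using st by (simp add: survival_iff_r)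
    then have "isCont (\<lambda>(u, \<xi>). A t s u \<xi>) (u, \<tau> h \<xi>)"
      using A_continuous[OF st] op by (simp add: continuous_on_eq_continuous_at)
    from isCont_tendsto_compose[OF this lim\<tau>] show ?thesis by simp
  qed
  show "\<xi> \<in> tame u\<^sub>0 \<delta> C t s"
    unfolding tame_def
  proof (intro CollectI allI impI conjI)
    fix u :: 'u and h :: 'e assume uh: "norm (u - u\<^sub>0) < \<delta>" "norm h < \<delta>"
    show "r s u (\<tau> h \<xi>) \<le> ennreal C" by (rule r_le[OF uh])
    show "norm (A t s u (\<tau> h \<xi>)) \<le> C"
      by (rule Lim_norm_ubound[OF _ Alim[OF uh]]) (use x uh in \<open>auto simp: tame_def\<close>)
    fix h' :: 'e assume h': "norm h' < \<delta>"
    show "norm (A t s u (\<tau> h \<xi>) - A t s u (\<tau> h' \<xi>)) \<le> C * norm (h - h')"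
      by (rule Lim_norm_ubound[OF _ tendsto_diff[OF Alim[OF uh] Alim[OF uh(1) h']]])
         (use x uh h' in \<open>auto simp: tame_def\<close>)
  qed
qed

lemma A_restr:
  assumes "0 < s" "s \<le> q" "q \<le> t" "t \<le> 1" "(u, \<xi>) \<in> survival \<Phi> q"
  shows "restr s (blinfun_apply (A t q u \<xi>) v) = blinfun_apply (A t s u \<xi>) v"
proof -
  have sv: "(u, \<xi>) \<in> survival \<Phi> s" using survival_antimono[of s q u \<xi>] assms by simp
  have self: "restr s (blinfun_apply (A t s u \<xi>) v) = blinfun_apply (A t s u \<xi>) v"
    by (rule restr_self, rule A_range) (use assms sv in auto)
  show ?thesis
  proof (cases "s = q")
    case False
    have "restr s (blinfun_apply (A t q u \<xi>) v) = restr s (blinfun_apply (A t s u \<xi>) v)"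
      by (rule restr_eqI, rule A_restrict) (use assms False in auto)
    then show ?thesis using self by simp
  qed (use self in simp)
qed

text \<open>
  \<open>r\<close> increases in time, and the operators at the earlier time are restrictions of those at the later
  one, which does not increase norms.
\<close>

lemma tame_antimono:
  assumes sq: "0 < s" "s \<le> q" "q \<le> t" "t \<le> 1"
  shows "tame u\<^sub>0 \<delta> C t q \<subseteq> tame u\<^sub>0 \<delta> C t s"
proof
  fix \<xi> assume \<xi>: "\<xi> \<in> tame u\<^sub>0 \<delta> C t q"
  show "\<xi> \<in> tame u\<^sub>0 \<delta> C t s"
    unfolding tame_def
  proof (intro CollectI allI impI conjI)
    fix u :: 'u and h :: 'e assume uh: "norm (u - u\<^sub>0) < \<delta>" "norm h < \<delta>"
    have rq: "r q u (\<tau> h \<xi>) \<le> ennreal C" and Aq: "norm (A t q u (\<tau> h \<xi>)) \<le> C"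
      using \<xi> uh by (auto simp: tame_def)
    have sv: "(u, \<tau> h \<xi>) \<in> survival \<Phi> q" by (rule tame_survival[OF \<xi> uh]) (use sq in auto)
    have "r s u (\<tau> h \<xi>) \<le> r q u (\<tau> h \<xi>)"
      using r_mono[of u "\<tau> h \<xi>"] sq by (auto simp: mono_on_def)
    then show "r s u (\<tau> h \<xi>) \<le> ennreal C" using rq by simp
    show "norm (A t s u (\<tau> h \<xi>)) \<le> C"
    proof (rule norm_blinfun_bound)
      show "0 \<le> C" using Aq norm_ge_zero order_trans by blast
      fix v
      have "norm (blinfun_apply (A t s u (\<tau> h \<xi>)) v) \<le> norm (blinfun_apply (A t q u (\<tau> h \<xi>)) v)"
        unfolding A_restr[OF sq sv, symmetric] by (rule norm_restr_le)
      also have "\<dots> \<le> norm (A t q u (\<tau> h \<xi>)) * norm v" by (rule norm_blinfun)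
      also have "\<dots> \<le> C * norm v" using Aq by (rule mult_right_mono) simp
      finally show "norm (blinfun_apply (A t s u (\<tau> h \<xi>)) v) \<le> C * norm v" .
    qed
    fix h' :: 'e assume h': "norm h' < \<delta>"
    have sv': "(u, \<tau> h' \<xi>) \<in> survival \<Phi> q" by (rule tame_survival[OF \<xi> uh(1) h']) (use sq in auto)
    have Lq: "norm (A t q u (\<tau> h \<xi>) - A t q u (\<tau> h' \<xi>)) \<le> C * norm (h - h')"
      using \<xi> uh h' by (auto simp: tame_def)
    show "norm (A t s u (\<tau> h \<xi>) - A t s u (\<tau> h' \<xi>)) \<le> C * norm (h - h')"
    proof (rule norm_blinfun_bound)
      show "0 \<le> C * norm (h - h')" using Lq norm_ge_zero order_trans by blast
      fix v
      have "blinfun_apply (A t s u (\<tau> h \<xi>) - A t s u (\<tau> h' \<xi>)) v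
          = restr s (blinfun_apply (A t q u (\<tau> h \<xi>) - A t q u (\<tau> h' \<xi>)) v)"
        using A_restr[OF sq sv, of v] A_restr[OF sq sv', of v] bounded_linear_restr[of s]
        by (simp add: blinfun.diff_left linear_simps)
      then have "norm (blinfun_apply (A t s u (\<tau> h \<xi>) - A t s u (\<tau> h' \<xi>)) v)
          \<le> norm (blinfun_apply (A t q u (\<tau> h \<xi>) - A t q u (\<tau> h' \<xi>)) v)"
        using norm_restr_le by simp
      also have "\<dots> \<le> norm (A t q u (\<tau> h \<xi>) - A t q u (\<tau> h' \<xi>)) * norm v" by (rule norm_blinfun)
      also have "\<dots> \<le> C * norm (h - h') * norm v" using Lq by (rule mult_right_mono) simp
      finally show "norm (blinfun_apply (A t s u (\<tau> h \<xi>) - A t s u (\<tau> h' \<xi>)) v) \<le> C * norm (h - h') * norm v" .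
    qed
  qed
qed

lemma causal_A:
  assumes "causal t s \<xi>" "restr s k = 0" "(u, \<tau> h \<xi>) \<in> survival \<Phi> s"
  shows "A t s u (\<tau> (h + k) \<xi>) = A t s u (\<tau> h \<xi>)"
  using assms unfolding causal_def by blast

lemma causal_r:
  assumes "causal t s \<xi>" "restr s k = 0"
  shows "r s u (\<tau> (h + k) \<xi>) = r s u (\<tau> h \<xi>)"
  using assms unfolding causal_def by blast

lemma tame_\<tau>:
  assumes st: "0 < s" "s \<le> 1" and \<xi>: "\<xi> \<in> tame u\<^sub>0 \<delta> C t s" and c: "causal t s \<xi>" and k: "restr s k = 0"
  shows "\<tau> k \<xi> \<in> tame u\<^sub>0 \<delta> C t s"
  unfolding tame_def
proof (intro CollectI allI impI conjI)
  fix u :: 'u and h :: 'e assume uh: "norm (u - u\<^sub>0) < \<delta>" "norm h < \<delta>"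
  have eqA: "A t s u (\<tau> h (\<tau> k \<xi>)) = A t s u (\<tau> h \<xi>)" if "norm h < \<delta>" for h
    using causal_A[OF c k tame_survival[OF \<xi> uh(1) that]] st by (simp add: \<tau>_commute add.commute)
  show "r s u (\<tau> h (\<tau> k \<xi>)) \<le> ennreal C"
    using causal_r[OF c k, of u h] \<xi> uh by (simp add: \<tau>_commute add.commute tame_def)
  show "norm (A t s u (\<tau> h (\<tau> k \<xi>))) \<le> C" using \<xi> uh eqA by (simp add: tame_def)
  show "norm (A t s u (\<tau> h (\<tau> k \<xi>)) - A t s u (\<tau> h' (\<tau> k \<xi>))) \<le> C * norm (h - h')" if "norm h' < \<delta>" for h'
    using \<xi> uh eqA that by (simp add: tame_def)
qed

lemma tame_\<tau>_iff:
  assumes "0 < s" "s \<le> 1" "causal t s \<xi>" "restr s k = 0"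
  shows "\<tau> k \<xi> \<in> tame u\<^sub>0 \<delta> C t s \<longleftrightarrow> \<xi> \<in> tame u\<^sub>0 \<delta> C t s"
proof
  assume "\<tau> k \<xi> \<in> tame u\<^sub>0 \<delta> C t s"
  moreover have "restr s (- k) = 0"
    using assms(4) bounded_linear_restr[of s] by (simp add: linear_simps)
  ultimately have "\<tau> (- k) (\<tau> k \<xi>) \<in> tame u\<^sub>0 \<delta> C t s"
    using tame_\<tau>[OF assms(1,2) _ causal_\<tau>[OF assms(3)]] by blast
  then show "\<xi> \<in> tame u\<^sub>0 \<delta> C t s" by (simp add: \<tau>_commute \<tau>_zero)
qed (use tame_\<tau> assms in blast)

text \<open>
  Near \<open>(u\<^sub>0, \<xi>)\<close> the maps \<open>r t\<close> and \<open>A t t\<close> are Lipschitz, hence bounded, and \<open>h \<mapsto> \<tau> h \<xi>\<close> is Lipschitz near \<open>0\<close>.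
  All \<open>n\<close> beyond some \<open>N\<close> are included because the constants move in both directions with \<open>n\<close>.
\<close>

lemma survival_imp_tame:
  assumes t: "0 < t" "t \<le> 1" and sv: "(u\<^sub>0, \<xi>) \<in> survival \<Phi> t"
  shows "\<exists>N. \<forall>n\<ge>N. \<xi> \<in> tame u\<^sub>0 (1 / Suc n) (Suc n) t t"
proof -
  have tt: "0 < t" "t \<le> t" "t \<le> 1" "t \<in> {0<..1}" using t by auto
  obtain V1 L1 where V1: "open V1" "(u\<^sub>0, \<xi>) \<in> V1" "L1-lipschitz_on (V1 \<inter> survival \<Phi> t) (\<lambda>(u, \<xi>). A t t u \<xi>)"
    using A_lipschitz[OF tt(1-3)] sv unfolding locally_lipschitz_on_def by meson
  obtain V2 L2 where V2: "open V2" "(u\<^sub>0, \<xi>) \<in> V2" "L2-lipschitz_on (V2 \<inter> survival \<Phi> t) (\<lambda>(u, \<xi>). enn2real (r t u \<xi>))"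
    using r_lipschitz[OF tt(4)] sv unfolding locally_lipschitz_on_def by meson
  obtain V3 L3 where V3: "open V3" "(0 :: 'e) \<in> V3" "L3-lipschitz_on (V3 \<inter> UNIV) (\<lambda>h. \<tau> h \<xi>)"
    using \<tau>_lipschitz[of \<xi>] unfolding locally_lipschitz_on_def by blast
  have L: "0 \<le> L1" "0 \<le> L2" "0 \<le> L3"
    using V1(3) V2(3) V3(3) by (auto simp: lipschitz_on_def)
  define W where "W = V1 \<inter> V2 \<inter> survival \<Phi> t \<inter> ball (u\<^sub>0, \<xi>) 1"
  have "open W" unfolding W_def using V1 V2 flow_set_open t by (intro open_Int) auto
  moreover have "(u\<^sub>0, \<xi>) \<in> W" using V1 V2 sv by (simp add: W_def)
  ultimately obtain e where e: "e > 0" "ball (u\<^sub>0, \<xi>) e \<subseteq> W" by (auto simp: open_contains_ball)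
  have "isCont (\<lambda>h. \<tau> h \<xi>) 0"
    unfolding isCont_def by (rule \<tau>_tendsto) (auto intro: tendsto_ident_at)
  from this[unfolded continuous_at_eps_delta, rule_format, of "e / 2"] e(1)
  obtain d1 where d1: "d1 > 0" "\<And>h. norm h < d1 \<Longrightarrow> dist (\<tau> h \<xi>) \<xi> < e / 2"
    by (auto simp: \<tau>_zero)
  obtain d2 where d2: "d2 > 0" "ball 0 d2 \<subseteq> V3" using V3 by (auto simp: open_contains_ball)
  define d where "d = min (min d1 d2) (e / 2)"
  have d: "d > 0" "d \<le> d1" "d \<le> d2" "d \<le> e / 2" using d1 d2 e by (auto simp: d_def)
  define a where "a = norm (A t t u\<^sub>0 \<xi>) + L1"
  define b where "b = enn2real (r t u\<^sub>0 \<xi>) + L2"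
  have inW: "(u, \<tau> h \<xi>) \<in> W" if "norm (u - u\<^sub>0) < d" "norm h < d" for u h
  proof -
    have "dist (u, \<tau> h \<xi>) (u\<^sub>0, \<xi>) \<le> dist u u\<^sub>0 + dist (\<tau> h \<xi>) \<xi>"
      unfolding dist_prod_def fst_conv snd_conv by (rule sqrt_sum_squares_le_sum) simp_all
    also have "\<dots> < e" using that d d1(2)[of h] by (simp add: dist_norm)
    finally show ?thesis using e(2) by (auto simp: dist_commute)
  qed
  have near: "dist (u, \<tau> h \<xi>) (u\<^sub>0, \<xi>) \<le> 1" if "norm (u - u\<^sub>0) < d" "norm h < d" for u h
    using inW[OF that] by (auto simp: W_def dist_commute)
  have W0: "(u\<^sub>0, \<xi>) \<in> W" by fact
  have normA: "norm (A t t u (\<tau> h \<xi>)) \<le> a" if "norm (u - u\<^sub>0) < d" "norm h < d" for u h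
  proof -
    have "dist (A t t u (\<tau> h \<xi>)) (A t t u\<^sub>0 \<xi>) \<le> L1 * dist (u, \<tau> h \<xi>) (u\<^sub>0, \<xi>)"
      using lipschitz_onD[OF V1(3), of "(u, \<tau> h \<xi>)" "(u\<^sub>0, \<xi>)"] inW[OF that] W0 by (simp add: W_def)
    also have "\<dots> \<le> L1 * 1" using near[OF that] L by (intro mult_left_mono) auto
    finally show ?thesis
      using norm_triangle_sub[of "A t t u (\<tau> h \<xi>)" "A t t u\<^sub>0 \<xi>"] by (simp add: a_def dist_norm)
  qed
  have normr: "r t u (\<tau> h \<xi>) \<le> ennreal b" if "norm (u - u\<^sub>0) < d" "norm h < d" for u h
  proof -
    have "dist (enn2real (r t u (\<tau> h \<xi>))) (enn2real (r t u\<^sub>0 \<xi>)) \<le> L2 * dist (u, \<tau> h \<xi>) (u\<^sub>0, \<xi>)"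
      using lipschitz_onD[OF V2(3), of "(u, \<tau> h \<xi>)" "(u\<^sub>0, \<xi>)"] inW[OF that] W0 by (simp add: W_def)
    also have "\<dots> \<le> L2 * 1" using near[OF that] L by (intro mult_left_mono) auto
    finally have "enn2real (r t u (\<tau> h \<xi>)) \<le> b" by (simp add: b_def dist_real_def)
    moreover have "r t u (\<tau> h \<xi>) \<noteq> \<infinity>"
      using inW[OF that] t by (auto simp: W_def survival_iff_r)
    ultimately show ?thesis by (cases "r t u (\<tau> h \<xi>)") (auto intro: ennreal_leI)
  qed
  have lipA: "norm (A t t u (\<tau> h \<xi>) - A t t u (\<tau> h' \<xi>)) \<le> L1 * L3 * norm (h - h')"
    if "norm (u - u\<^sub>0) < d" "norm h < d" "norm h' < d" for u h h'
  proof -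
    have "norm (A t t u (\<tau> h \<xi>) - A t t u (\<tau> h' \<xi>)) \<le> L1 * dist (u, \<tau> h \<xi>) (u, \<tau> h' \<xi>)"
      using lipschitz_onD[OF V1(3), of "(u, \<tau> h \<xi>)" "(u, \<tau> h' \<xi>)"] inW[OF that(1,2)] inW[OF that(1,3)]
      by (simp add: W_def dist_norm)
    also have "\<dots> = L1 * dist (\<tau> h \<xi>) (\<tau> h' \<xi>)" by (simp add: dist_prod_def)
    also have "dist (\<tau> h \<xi>) (\<tau> h' \<xi>) \<le> L3 * dist h h'"
      using lipschitz_onD[OF V3(3), of h h'] that d d2(2) by (auto simp: subset_iff)
    finally show ?thesis using L by (simp add: dist_norm mult_left_mono mult.assoc)
  qed
  obtain N1 where N1: "1 / real (Suc N1) < d" using nat_approx_posE[OF d(1)] by blast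
  obtain N2 :: nat where N2: "max (max a b) (L1 * L3) \<le> real N2" using real_arch_simple by blast
  show ?thesis
  proof (intro exI[of _ "max N1 N2"] allI impI)
    fix n assume n: "max N1 N2 \<le> n"
    have "1 / real (Suc n) \<le> 1 / real (Suc N1)" using n by (intro divide_left_mono) auto
    then have dn: "1 / real (Suc n) \<le> d" using N1 by simp
    have cn: "a \<le> real (Suc n)" "b \<le> real (Suc n)" "L1 * L3 \<le> real (Suc n)" using n N2 by auto
    show "\<xi> \<in> tame u\<^sub>0 (1 / Suc n) (Suc n) t t"
      unfolding tame_def
    proof (intro CollectI allI impI conjI)
      fix u :: 'u and h :: 'e assume "norm (u - u\<^sub>0) < 1 / real (Suc n)" "norm h < 1 / real (Suc n)"
      then have uh: "norm (u - u\<^sub>0) < d" "norm h < d" using dn by linarith+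
      show "r t u (\<tau> h \<xi>) \<le> ennreal (real (Suc n))"
        using normr[OF uh] ennreal_leI[OF cn(2)] by (rule order_trans)
      show "norm (A t t u (\<tau> h \<xi>)) \<le> real (Suc n)" using normA[OF uh] cn(1) by (rule order_trans)
      fix h' :: 'e assume "norm h' < 1 / real (Suc n)"
      then have h': "norm h' < d" using dn by linarith
      show "norm (A t t u (\<tau> h \<xi>) - A t t u (\<tau> h' \<xi>)) \<le> real (Suc n) * norm (h - h')"
        using lipA[OF uh h'] mult_right_mono[OF cn(3), of "norm (h - h')"] by simp
    qed
  qed
qed

end

section \<open>The control\<close>

context abstract_flow_system
begin

lemma continuous_on_\<tau>:
  "continuous_on X f \<Longrightarrow> continuous_on X g \<Longrightarrow> continuous_on X (\<lambda>x. \<tau> (f x) (g x))"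
  using continuous_on_compose2[OF \<tau>_continuous, of X "\<lambda>x. (f x, g x)"] by (simp add: continuous_on_Pair)

text \<open>
  The direction of the noise that compensates an infinitesimal displacement of the initial condition in
  direction \<open>v\<close>, at the point \<open>u\<^sub>0 + \<theta> v\<close> and for the noise already shifted by \<open>h\<close>.
\<close>

definition velocity :: "real \<Rightarrow> real \<Rightarrow> 'u \<Rightarrow> 'u \<Rightarrow> real \<Rightarrow> 'e \<Rightarrow> 'm \<Rightarrow> 'e" where
  "velocity t s u\<^sub>0 v \<theta> h \<xi> = blinfun_apply (A t s (u\<^sub>0 + \<theta> *\<^sub>R v) (\<tau> h \<xi>)) v"

definition control :: "real \<Rightarrow> real \<Rightarrow> 'u \<Rightarrow> 'u \<Rightarrow> 'm \<Rightarrow> 'e" where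
  "control t s u\<^sub>0 v \<xi> = picard_limit (velocity t s u\<^sub>0 v) 1 \<xi>"

context
  fixes t :: real and u\<^sub>0 v :: 'u and \<delta> C \<kappa> :: real
  assumes t: "0 < t" "t \<le> 1"
    and \<kappa>: "0 < \<kappa>" "\<kappa> \<le> \<delta>" and v: "norm v < \<delta>" "C * norm v \<le> \<kappa> / 2" "C * norm v \<le> 1 / 2"
begin

lemma segment_near: "\<theta> \<in> {0..1} \<Longrightarrow> norm (u\<^sub>0 + \<theta> *\<^sub>R v - u\<^sub>0) < \<delta>"
  using mult_left_le_one_le[of "norm v" \<theta>] v(1) by simp

lemma velocity_survival:
  assumes "0 < s" "s \<le> t" "\<theta> \<in> {0..1}" "h \<in> ball 0 \<kappa>" "\<xi> \<in> tame u\<^sub>0 \<delta> C t s"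
  shows "(u\<^sub>0 + \<theta> *\<^sub>R v, \<tau> h \<xi>) \<in> survival \<Phi> s"
  by (rule tame_survival[OF assms(5) segment_near[OF assms(3)]]) (use assms t \<kappa> in auto)

lemma velocity_picard_field:
  assumes s: "0 < s" "s \<le> t"
  shows "picard_field (velocity t s u\<^sub>0 v) (tame u\<^sub>0 \<delta> C t s) \<kappa>"
proof
  fix \<theta> :: real and h :: 'e and \<xi> assume *: "\<theta> \<in> {0..1}" "h \<in> ball 0 \<kappa>" "\<xi> \<in> tame u\<^sub>0 \<delta> C t s"
  have "norm (velocity t s u\<^sub>0 v \<theta> h \<xi>) \<le> norm (A t s (u\<^sub>0 + \<theta> *\<^sub>R v) (\<tau> h \<xi>)) * norm v"
    unfolding velocity_def by (rule norm_blinfun)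
  also have "\<dots> \<le> C * norm v"
    using * segment_near[OF *(1)] \<kappa> by (intro mult_right_mono) (auto simp: tame_def)
  finally show "norm (velocity t s u\<^sub>0 v \<theta> h \<xi>) \<le> \<kappa> / 2" using v(2) by linarith
  fix h' :: 'e assume h': "h' \<in> ball 0 \<kappa>"
  have "norm (velocity t s u\<^sub>0 v \<theta> h \<xi> - velocity t s u\<^sub>0 v \<theta> h' \<xi>)
      \<le> norm (A t s (u\<^sub>0 + \<theta> *\<^sub>R v) (\<tau> h \<xi>) - A t s (u\<^sub>0 + \<theta> *\<^sub>R v) (\<tau> h' \<xi>)) * norm v"
    unfolding velocity_def blinfun.diff_left[symmetric] by (rule norm_blinfun)
  also have "\<dots> \<le> C * norm (h - h') * norm v"
    using * h' segment_near[OF *(1)] \<kappa> by (intro mult_right_mono) (auto simp: tame_def)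
  also have "\<dots> = C * norm v * norm (h - h')" by simp
  also have "\<dots> \<le> 1 / 2 * norm (h - h')" using v(3) by (rule mult_right_mono) simp
  finally show "norm (velocity t s u\<^sub>0 v \<theta> h \<xi> - velocity t s u\<^sub>0 v \<theta> h' \<xi>) \<le> norm (h - h') / 2" by simp
next
  let ?X = "{0..1} \<times> ball 0 \<kappa> \<times> tame u\<^sub>0 \<delta> C t s"
  have st: "0 < s" "s \<le> t" "t \<le> 1" using s t by auto
  have c: "continuous_on ?X (\<lambda>x. (u\<^sub>0 + fst x *\<^sub>R v, \<tau> (fst (snd x)) (snd (snd x))))"
    by (intro continuous_on_Pair continuous_on_\<tau> continuous_intros)
  have sub: "(\<lambda>x. (u\<^sub>0 + fst x *\<^sub>R v, \<tau> (fst (snd x)) (snd (snd x)))) ` ?X \<subseteq> survival \<Phi> s"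
    using velocity_survival[OF s] by auto
  have "continuous_on ?X (\<lambda>x. A t s (u\<^sub>0 + fst x *\<^sub>R v) (\<tau> (fst (snd x)) (snd (snd x))))"
    using continuous_on_compose2[OF A_continuous[OF st] c sub] by simp
  then have "continuous_on ?X (\<lambda>x. blinfun_apply (A t s (u\<^sub>0 + fst x *\<^sub>R v) (\<tau> (fst (snd x)) (snd (snd x)))) v)"
    by (intro continuous_intros)
  then show "continuous_on ?X (\<lambda>(\<theta>, h, \<xi>). velocity t s u\<^sub>0 v \<theta> h \<xi>)"
    by (simp add: velocity_def case_prod_unfold)
qed (rule \<kappa>(1))

lemma control_norm:
  "0 < s \<Longrightarrow> s \<le> t \<Longrightarrow> \<xi> \<in> tame u\<^sub>0 \<delta> C t s \<Longrightarrow> norm (control t s u\<^sub>0 v \<xi>) \<le> \<kappa> / 2"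
  unfolding control_def by (rule picard_field.picard_limit_norm[OF velocity_picard_field]) auto

lemma control_continuous:
  assumes "0 < s" "s \<le> t"
  shows "continuous_on (tame u\<^sub>0 \<delta> C t s) (control t s u\<^sub>0 v)"
proof -
  have "continuous_on (tame u\<^sub>0 \<delta> C t s) (\<lambda>\<xi>. (1 :: real, \<xi>))" by (intro continuous_intros)
  moreover have "(\<lambda>\<xi>. (1 :: real, \<xi>)) ` tame u\<^sub>0 \<delta> C t s \<subseteq> {0..1} \<times> tame u\<^sub>0 \<delta> C t s" by auto
  ultimately show ?thesis
    using continuous_on_compose2[OF picard_field.picard_limit_continuous[OF velocity_picard_field[OF assms]],
        of "tame u\<^sub>0 \<delta> C t s" "\<lambda>\<xi>. (1, \<xi>)"]
    by (simp add: control_def[abs_def])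
qed

text \<open>
  Restriction to \<open>{0..q}\<close> maps the field for time \<open>s\<close> to the field for time \<open>q\<close>: the operators are compatible with
  restriction, and by causality those at time \<open>q\<close> only see the restriction of \<open>h\<close>.
\<close>

lemma control_restr:
  assumes s: "0 < q" "q \<le> s" "s \<le> t" and \<xi>: "\<xi> \<in> tame u\<^sub>0 \<delta> C t s" and c: "causal t q \<xi>"
  shows "restr q (control t s u\<^sub>0 v \<xi>) = control t q u\<^sub>0 v \<xi>"
  unfolding control_def
proof (rule picard_limit_map)
  show "picard_field (velocity t s u\<^sub>0 v) (tame u\<^sub>0 \<delta> C t s) \<kappa>" by (rule velocity_picard_field) (use s in auto)
  show "picard_field (velocity t q u\<^sub>0 v) (tame u\<^sub>0 \<delta> C t q) \<kappa>" by (rule velocity_picard_field) (use s in auto)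
  show "\<xi> \<in> tame u\<^sub>0 \<delta> C t s" by fact
  show \<xi>q: "\<xi> \<in> tame u\<^sub>0 \<delta> C t q" using tame_antimono[of q s t u\<^sub>0 \<delta> C] s t \<xi> by auto
  show "bounded_linear (restr q)" by (rule bounded_linear_restr)
  fix \<theta> :: real and h :: 'e assume *: "\<theta> \<in> {0..1}" "h \<in> ball 0 \<kappa>"
  have sv: "(u\<^sub>0 + \<theta> *\<^sub>R v, \<tau> h \<xi>) \<in> survival \<Phi> s" by (rule velocity_survival) (use * s \<xi> in auto)
  have 1: "restr q (velocity t s u\<^sub>0 v \<theta> h \<xi>) = velocity t q u\<^sub>0 v \<theta> h \<xi>"
    unfolding velocity_def by (rule A_restr) (use s t sv in auto)
  have rb: "restr q h \<in> ball 0 \<kappa>" using norm_restr_le[of q h] * by (auto intro: le_less_trans)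
  have svq: "(u\<^sub>0 + \<theta> *\<^sub>R v, \<tau> (restr q h) \<xi>) \<in> survival \<Phi> q"
    by (rule velocity_survival[OF _ _ *(1) rb \<xi>q]) (use s in auto)
  have "restr q (h - restr q h) = 0"
    using bounded_linear_restr[of q] restr_restr[of q q h] by (simp add: linear_simps)
  from causal_A[OF c this svq] have 2: "velocity t q u\<^sub>0 v \<theta> h \<xi> = velocity t q u\<^sub>0 v \<theta> (restr q h) \<xi>"
    by (simp add: velocity_def)
  show "restr q (velocity t s u\<^sub>0 v \<theta> h \<xi>) = velocity t q u\<^sub>0 v \<theta> (restr q h) \<xi>"
    using 1 2 by simp
qed simp

text \<open>
  The control up to time \<open>s\<close> does not anticipate: by causality the fields for \<open>\<xi>\<close> and
  \<open>\<tau> k \<xi>\<close> coincide.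
\<close>

lemma control_\<tau>:
  assumes s: "0 < s" "s \<le> t" and \<xi>: "\<xi> \<in> tame u\<^sub>0 \<delta> C t s" and c: "causal t s \<xi>" and k: "restr s k = 0"
  shows "control t s u\<^sub>0 v (\<tau> k \<xi>) = control t s u\<^sub>0 v \<xi>"
proof -
  have "id (picard_limit (velocity t s u\<^sub>0 v) 1 \<xi>) = picard_limit (velocity t s u\<^sub>0 v) 1 (\<tau> k \<xi>)"
  proof (rule picard_limit_map)
    show "picard_field (velocity t s u\<^sub>0 v) (tame u\<^sub>0 \<delta> C t s) \<kappa>" by (rule velocity_picard_field[OF s])
    then show "picard_field (velocity t s u\<^sub>0 v) (tame u\<^sub>0 \<delta> C t s) \<kappa>" .
    show "\<xi> \<in> tame u\<^sub>0 \<delta> C t s" by fact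
    show "\<tau> k \<xi> \<in> tame u\<^sub>0 \<delta> C t s" by (rule tame_\<tau>[OF _ _ \<xi> c k]) (use s t in auto)
    show "bounded_linear (id :: 'e \<Rightarrow> 'e)" by (simp add: id_def)
    fix \<theta> :: real and h :: 'e assume *: "\<theta> \<in> {0..1}" "h \<in> ball 0 \<kappa>"
    have sv: "(u\<^sub>0 + \<theta> *\<^sub>R v, \<tau> h \<xi>) \<in> survival \<Phi> s" by (rule velocity_survival[OF s * \<xi>])
    show "id (velocity t s u\<^sub>0 v \<theta> h \<xi>) = velocity t s u\<^sub>0 v \<theta> (id h) (\<tau> k \<xi>)"
      using causal_A[OF c k sv] by (simp add: velocity_def \<tau>_commute add.commute)
  qed simp
  then show ?thesis by (simp add: control_def)
qed

text \<open>
  Along the controlled path the derivatives of the flow in the initial condition and in the noise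
  cancel, so the controlled flow started from \<open>u\<^sub>0 + v\<close> hits the flow started from \<open>u\<^sub>0\<close> at
  time \<open>t\<close>. As the control vanishes after time \<open>t\<close>, the two flows stay together afterwards.
\<close>

lemma control_couples:
  assumes \<xi>: "\<xi> \<in> tame u\<^sub>0 \<delta> C t t" and c: "causal t t \<xi>"
  shows "\<Phi> 0 1 (Alive (u\<^sub>0 + v)) (\<tau> (control t t u\<^sub>0 v \<xi>) \<xi>) = \<Phi> 0 1 (Alive u\<^sub>0) \<xi>"
proof -
  interpret F: picard_field "velocity t t u\<^sub>0 v" "tame u\<^sub>0 \<delta> C t t" \<kappa>
    by (rule velocity_picard_field) (use t in auto)
  define k where "k s = picard_limit (velocity t t u\<^sub>0 v) s \<xi>" for s
  define w where "w \<theta> = u\<^sub>0 + \<theta> *\<^sub>R v" for \<theta>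
  have kb: "k s \<in> ball 0 \<kappa>" if "s \<in> {0..1}" for s
    using F.picard_limit_norm[OF that \<xi>] \<kappa> by (simp add: k_def)
  have sv: "(w \<theta>, \<tau> (k s) \<xi>) \<in> survival \<Phi> t" if "\<theta> \<in> {0..1}" "s \<in> {0..1}" for \<theta> s
    unfolding w_def by (rule velocity_survival[OF _ _ that(1) kb[OF that(2)] \<xi>]) (use t in auto)
  have k_der: "(k has_vector_derivative velocity t t u\<^sub>0 v s (k s) \<xi>) (at s within {0..1})" if "s \<in> {0..1}" for s
    unfolding k_def by (rule F.picard_limit_ode[OF \<xi> that])
  have k_cont: "continuous_on {0..1} k"
    using F.continuous_on_slice[OF F.picard_limit_continuous \<xi>, of 1] by (simp add: k_def[abs_def])
  define F where "F \<theta> s = state (\<Phi> 0 t (Alive (w \<theta>)) (\<tau> (k s) \<xi>))" for \<theta> s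
  define D where "D \<theta> = frechet_derivative (\<lambda>u'. state (\<Phi> 0 t (Alive u') (\<tau> (k \<theta>) \<xi>))) (at (w \<theta>)) v" for \<theta>
  have "F 1 1 = F 0 0"
  proof (rule constant_on_diagonal[where F = F and D = D])
    show "continuous_on ({0..1} \<times> {0..1}) (\<lambda>(\<theta>, s). F \<theta> s)"
    proof -
      have c: "continuous_on ({0..1::real} \<times> {0..1::real}) (\<lambda>x. (w (fst x), \<tau> (k (snd x)) \<xi>))"
        unfolding w_def
        by (intro continuous_on_Pair continuous_on_\<tau> continuous_on_add continuous_on_scaleR continuous_on_fst
              continuous_on_const continuous_on_id continuous_on_compose2[OF k_cont continuous_on_snd]) auto
      have sub: "(\<lambda>x. (w (fst x), \<tau> (k (snd x)) \<xi>)) ` ({0..1} \<times> {0..1}) \<subseteq> survival \<Phi> t"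
        using sv by auto
      have "continuous_on ({0..1} \<times> {0..1}) (\<lambda>x. \<Phi> 0 t (Alive (w (fst x))) (\<tau> (k (snd x)) \<xi>))"
        using continuous_on_compose2[OF flow_continuous c sub] t by simp
      then have "continuous_on ({0..1} \<times> {0..1}) (\<lambda>x. state (\<Phi> 0 t (Alive (w (fst x))) (\<tau> (k (snd x)) \<xi>)))"
        by (rule continuous_on_state) (use sv in \<open>auto simp: survival_def\<close>)
      then show ?thesis by (simp add: F_def case_prod_unfold)
    qed
    fix \<theta> :: real assume \<theta>: "\<theta> \<in> {0..1}"
    have al: "\<Phi> 0 t (Alive (w \<theta>)) (\<tau> (k \<theta>) \<xi>) \<noteq> Dead" using sv[OF \<theta> \<theta>] by (simp add: survival_def)
    have w_der: "(w has_vector_derivative v) (at \<theta> within {0..1})"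
      unfolding w_def[abs_def] by (auto intro!: derivative_eq_intros)
    define l where "l u' = state (\<Phi> 0 t (Alive u') (\<tau> (k \<theta>) \<xi>))" for u'
    have "l differentiable (at (w \<theta>))"
      unfolding l_def[abs_def] by (rule alive_differentiable) (use al t in auto)
    then have "(l has_derivative frechet_derivative l (at (w \<theta>))) (at (w \<theta>))"
      by (simp only: frechet_derivative_works)
    then have l_der: "(l has_derivative frechet_derivative l (at (w \<theta>))) (at (w \<theta>) within w ` {0..1})"
      by (rule has_derivative_at_withinI)
    have "frechet_derivative l (at (w \<theta>)) v = D \<theta>" by (simp only: D_def l_def[abs_def])
    with vector_derivative_diff_chain_within[OF w_der l_der]
    have "(l \<circ> w has_vector_derivative D \<theta>) (at \<theta> within {0..1})" by (simp only:)
    moreover have "l \<circ> w = (\<lambda>\<theta>'. F \<theta>' \<theta>)" by (rule ext) (simp add: l_def F_def)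
    ultimately show "((\<lambda>\<theta>'. F \<theta>' \<theta>) has_vector_derivative D \<theta>) (at \<theta> within {0..1})"
      by (simp only:)
    define g where "g h = state (\<Phi> 0 t (Alive (w \<theta>)) (\<tau> h (\<tau> (k \<theta>) \<xi>)))" for h
    define f where "f s = k s - k \<theta>" for s
    have "((\<lambda>s. k s - k \<theta>) has_vector_derivative velocity t t u\<^sub>0 v \<theta> (k \<theta>) \<xi> - 0) (at \<theta> within {0..1})"
      by (rule has_vector_derivative_diff[OF k_der[OF \<theta>] has_vector_derivative_const])
    then have f_der: "(f has_vector_derivative velocity t t u\<^sub>0 v \<theta> (k \<theta>) \<xi>) (at \<theta> within {0..1})"
      by (simp add: f_def[abs_def])
    have "g differentiable (at 0)"
      unfolding g_def[abs_def] by (rule noise_differentiable) (use sv[OF \<theta> \<theta>] t in auto)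
    then have "(g has_derivative frechet_derivative g (at 0)) (at 0)"
      by (simp only: frechet_derivative_works)
    moreover have "f \<theta> = 0" by (simp add: f_def)
    ultimately have g_der: "(g has_derivative frechet_derivative g (at 0)) (at (f \<theta>) within f ` {0..1})"
      by (simp only:) (rule has_derivative_at_withinI)
    have "frechet_derivative g (at 0) (velocity t t u\<^sub>0 v \<theta> (k \<theta>) \<xi>) = - D \<theta>"
    proof -
      have "D \<theta> + frechet_derivative g (at 0) (velocity t t u\<^sub>0 v \<theta> (k \<theta>) \<xi>) = 0"
        unfolding D_def velocity_def g_def[abs_def] w_def[symmetric]
        by (rule A_compensates) (use sv[OF \<theta> \<theta>] t in auto)
      then show ?thesis by (simp add: add_eq_0_iff)
    qed
    with vector_derivative_diff_chain_within[OF f_der g_der]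
    have "(g \<circ> f has_vector_derivative - D \<theta>) (at \<theta> within {0..1})" by (simp only:)
    moreover have "g \<circ> f = F \<theta>"
      by (rule ext) (simp add: g_def f_def F_def \<tau>_commute)
    ultimately show "((\<lambda>s. F \<theta> s) has_vector_derivative (- D \<theta>)) (at \<theta> within {0..1})"
      by (simp only:)
  qed
  then have "\<Phi> 0 t (Alive (w 1)) (\<tau> (k 1) \<xi>) = \<Phi> 0 t (Alive (w 0)) (\<tau> (k 0) \<xi>)"
    using Alive_state[of "\<Phi> 0 t (Alive (w 1)) (\<tau> (k 1) \<xi>)"] Alive_state[of "\<Phi> 0 t (Alive (w 0)) (\<tau> (k 0) \<xi>)"]
      sv[of 1 1] sv[of 0 0]
    by (simp add: F_def survival_def)
  moreover have "k 0 = 0" unfolding k_def by (rule F.picard_limit_0[OF \<xi>])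
  moreover have k1: "k 1 = control t t u\<^sub>0 v \<xi>" by (simp add: k_def control_def)
  ultimately have hit: "\<Phi> 0 t (Alive (u\<^sub>0 + v)) (\<tau> (control t t u\<^sub>0 v \<xi>) \<xi>) = \<Phi> 0 t (Alive u\<^sub>0) \<xi>"
    by (simp add: w_def \<tau>_zero)
  have "restr t (control t t u\<^sub>0 v \<xi>) = control t t u\<^sub>0 v \<xi>"
    by (rule control_restr) (use t \<xi> c in auto)
  then have "AE x in lborel. rep (control t t u\<^sub>0 v \<xi>) x = (if x \<in> {0..t} then rep (control t t u\<^sub>0 v \<xi>) x else 0)"
    using rep_restr[of t "control t t u\<^sub>0 v \<xi>"] by simp
  moreover have "AE x in lborel. x \<noteq> t" by (rule AE_lborel_singleton)
  ultimately have "AE x in lborel. x \<in> {t..1} \<longrightarrow> rep (control t t u\<^sub>0 v \<xi>) x = 0"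
    by eventually_elim (auto split: if_splits)
  then have "\<Phi> t 1 z (\<tau> (control t t u\<^sub>0 v \<xi>) \<xi>) = \<Phi> t 1 z \<xi>" for z
    by (intro \<tau>_local) (use t in auto)
  then show ?thesis
    using flow[of 0 t 1 "Alive (u\<^sub>0 + v)" "\<tau> (control t t u\<^sub>0 v \<xi>) \<xi>"] flow[of 0 t 1 "Alive u\<^sub>0" \<xi>] hit t by simp
qed

end

end

section \<open>Discretisation of the control\<close>

context abstract_flow_system
begin

context
  fixes t :: real and u\<^sub>0 v :: 'u and \<delta> C \<kappa> :: real
  assumes t: "0 < t" "t \<le> 1"
    and \<kappa>: "0 < \<kappa>" "\<kappa> \<le> \<delta>" and v: "norm v < \<delta>" "C * norm v \<le> \<kappa> / 2" "C * norm v \<le> 1 / 2"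
begin

private abbreviation "ctrl s \<equiv> control t s u\<^sub>0 v"
private abbreviation "Tame s \<equiv> tame u\<^sub>0 \<delta> C t s"

private lemmas ctrl_norm = control_norm[OF t \<kappa> v]
private lemmas ctrl_restr = control_restr[OF t \<kappa> v]
private lemmas ctrl_\<tau> = control_\<tau>[OF t \<kappa> v]
private lemmas ctrl_continuous = control_continuous[OF t \<kappa> v]

definition mesh :: "nat \<Rightarrow> real" where
  "mesh N = t / real (Suc N)"

text \<open>
  The first grid point is \<open>mesh N\<close> rather than \<open>0\<close>: the controls exist at positive times, and the delayed
  control vanishes on the first interval anyway. The grid is constant from \<open>N\<close> on, where it has reached \<open>t\<close>.
\<close>

definition grid :: "nat \<Rightarrow> nat \<Rightarrow> real" where
  "grid N m = real (Suc (min m N)) * mesh N"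

lemma mesh_pos: "0 < mesh N" using t by (simp add: mesh_def)

lemma grid_last: "grid N N = t" by (simp add: grid_def mesh_def)

lemma grid_0: "grid N 0 = mesh N" by (simp add: grid_def)

lemma grid_mono: "k \<le> m \<Longrightarrow> grid N k \<le> grid N m"
  unfolding grid_def using mesh_pos[of N] by (intro mult_right_mono) auto

lemma grid_bounds: "0 < grid N m" "grid N m \<le> t"
proof -
  show "0 < grid N m" unfolding grid_def using mesh_pos by simp
  have "grid N m \<le> grid N (max m N)" by (rule grid_mono) simp
  then show "grid N m \<le> t" using grid_last[of N] by (simp add: grid_def)
qed

lemma grid_Suc_le: "grid N (Suc m) \<le> grid N m + mesh N"
proof -
  have "real (Suc (min (Suc m) N)) \<le> real (Suc (min m N)) + 1" by simp
  from mult_right_mono[OF this less_imp_le[OF mesh_pos[of N]]] show ?thesis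
    by (simp only: grid_def distrib_right mult_1)
qed

text \<open>On each interval of the grid the control that is used was determined one mesh size earlier.\<close>

definition block :: "nat \<Rightarrow> nat \<Rightarrow> 'e \<Rightarrow> 'e" where
  "block N m = cutoff {grid N m<..grid N (Suc m)} (mesh N)"

lemma rep_block: "AE x in lborel. rep (block N m h) x
    = (if x \<in> {grid N m<..grid N (Suc m)} \<and> x \<in> {0..1} then rep h (x - mesh N) else 0)"
  unfolding block_def by (rule rep_cutoff) simp

lemma restr_block_before: "s \<le> grid N m \<Longrightarrow> restr s (block N m h) = 0"
  unfolding restr_eq_0_iff using rep_block[of N m h] by eventually_elim auto

lemma restr_block_after: "grid N (Suc m) \<le> s \<Longrightarrow> restr s (block N m h) = block N m h"
proof (rule restr_self)
  assume s: "grid N (Suc m) \<le> s"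
  show "AE x in lborel. x \<notin> {0..s} \<longrightarrow> rep (block N m h) x = 0"
    using rep_block[of N m h] by eventually_elim (use s in auto)
qed

lemma block_restr: "block N m (restr (grid N m) h) = block N m h"
  unfolding block_def
proof (rule cutoff_restr)
  fix x assume "x \<in> {grid N m<..grid N (Suc m)}"
  then show "x \<le> grid N m + mesh N" using grid_Suc_le[of N m] by simp
qed simp

lemma sum_block: "(\<Sum>m<M. block N m h) = cutoff {mesh N<..grid N M} (mesh N) h"
proof (induction M)
  case 0
  then show ?case by (simp add: grid_0 cutoff_empty)
next
  case (Suc M)
  have "{mesh N<..grid N (Suc M)} = {mesh N<..grid N M} \<union> {grid N M<..grid N (Suc M)}"
    using grid_mono[of 0 M N] grid_mono[of M "Suc M" N] by (auto simp: grid_0)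
  then show ?case
    using Suc.IH cutoff_disjoint_union[of "{mesh N<..grid N M}" "{grid N M<..grid N (Suc M)}" "mesh N" h]
    by (simp add: block_def)
qed

text \<open>Shifts supported in different blocks are orthogonal, hence their energies add up.\<close>

lemma energy_sum:
  "(\<Sum>m<M. cm_inner (shift (block N m (h m))) (shift (block N m (h m))))
    = cm_inner (shift (\<Sum>m<M. block N m (h m))) (shift (\<Sum>m<M. block N m (h m)))"
proof (induction M)
  case 0
  then show ?case using cm_inner_scale[OF shift_cm shift_cm, of 0 0 0 0] shift_scaleR[of 0 0] by simp
next
  case (Suc M)
  let ?S = "\<Sum>m<M. block N m (h m)"
  have "restr (grid N M) ?S = (\<Sum>m<M. restr (grid N M) (block N m (h m)))"
    using bounded_linear_restr[of "grid N M"] by (simp add: linear_sum bounded_linear.linear)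
  also have "\<dots> = ?S" by (intro sum.cong refl restr_block_after grid_mono) simp
  finally have "AE x in lborel. rep ?S x = (if x \<in> {0..grid N M} then rep ?S x else 0)"
    using rep_restr[of "grid N M" ?S] by simp
  then have "AE x in lborel. rep ?S x = 0 \<or> rep (block N M (h M)) x = 0"
    using rep_block[of N M "h M"] by eventually_elim (auto split: if_splits)
  then have "cm_inner (shift ?S) (shift (block N M (h M))) = 0" by (rule shift_orth)
  then show ?case
    using Suc.IH cm_inner_add[OF shift_cm shift_cm, of ?S "block N M (h M)"] by (simp add: shift_add)
qed

text \<open>The sum of the \<open>N\<close> rounding errors has to be at most \<open>\<kappa> / 2\<close> and to vanish in the limit.\<close>

definition precision :: "nat \<Rightarrow> real" where
  "precision N = \<kappa> / (2 * real (Suc N) * real (Suc N))"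

lemma precision_pos: "0 < precision N" using \<kappa> by (simp add: precision_def)

lemma precision_le: "real N * precision N \<le> \<kappa> / (2 * real (Suc N))"
proof -
  have "real N * precision N \<le> real (Suc N) * precision N"
    using precision_pos[of N] by (intro mult_right_mono) auto
  also have "\<dots> = \<kappa> / (2 * real (Suc N))" by (simp add: precision_def)
  finally show ?thesis .
qed

lemma controlled_measurable:
  assumes B: "B \<in> sets borel"
  shows "{\<omega>. \<Xi> \<omega> \<in> Tame t \<and> \<tau> (ctrl t (\<Xi> \<omega>)) (\<Xi> \<omega>) \<in> B} \<in> sets Q"
proof -
  have T: "Tame t \<in> sets borel" using closed_tame[OF t(1) order_refl t(2)] by (rule borel_closed)
  define H where "H \<xi> = (if \<xi> \<in> Tame t then \<tau> (ctrl t \<xi>) \<xi> else \<xi>)" for \<xi>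
  have "H \<in> borel_measurable borel"
    unfolding H_def
    by (rule borel_measurable_continuous_on_if[OF T continuous_on_\<tau>[OF ctrl_continuous[OF t(1) order_refl] continuous_on_id] continuous_on_id])
  from measurable_sets[OF measurable_compose[OF \<Xi>_measurable this] B] measurable_sets[OF \<Xi>_measurable T]
  have "(\<lambda>\<omega>. H (\<Xi> \<omega>)) -` B \<inter> \<Xi> -` Tame t \<in> sets Q" by (intro sets.Int) simp_all
  also have "(\<lambda>\<omega>. H (\<Xi> \<omega>)) -` B \<inter> \<Xi> -` Tame t = {\<omega>. \<Xi> \<omega> \<in> Tame t \<and> \<tau> (ctrl t (\<Xi> \<omega>)) (\<Xi> \<omega>) \<in> B}"
    by (auto simp: H_def)
  finally show ?thesis .
qed

context
  fixes d :: "nat \<Rightarrow> 'e"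
  assumes d_dense: "\<And>x \<epsilon>. 0 < \<epsilon> \<Longrightarrow> \<exists>i. norm (x - d i) < \<epsilon>"
begin

text \<open>
  The index \<open>0\<close> stands for no control, which is the choice when the configuration is not tame; the other
  indices are those of the dense sequence, moved by one.
\<close>

definition index :: "nat \<Rightarrow> real \<Rightarrow> 'm \<Rightarrow> nat" where
  "index N s \<xi> = (if \<xi> \<in> Tame s then Suc (LEAST i. norm (ctrl s \<xi> - d i) < precision N) else 0)"

definition val :: "nat \<Rightarrow> 'e" where
  "val i = (case i of 0 \<Rightarrow> 0 | Suc i \<Rightarrow> d i)"

text \<open>
  Every block is chosen among countably many candidates, and the choice depends on the past of the block only,
  as required for Girsanov's theorem in the form above.
\<close>

definition approx :: "nat \<Rightarrow> 'm \<Rightarrow> 'e" where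
  "approx N \<xi> = (\<Sum>m<N. block N m (val (index N (grid N m) \<xi>)))"

definition causal_grid :: "'m \<Rightarrow> bool" where
  "causal_grid \<xi> \<longleftrightarrow> causal t t \<xi> \<and> (\<forall>N m. causal t (grid N m) \<xi>)"

lemma AE_causal_grid: "AE \<omega> in Q. causal_grid (\<Xi> \<omega>)"
  unfolding causal_grid_def
  by (intro AE_conjI AE_all_countable[THEN iffD2] allI AE_causal) (use t grid_bounds in auto)

lemma index_measurable:
  assumes s: "0 < s" "s \<le> t"
  shows "index N s \<in> measurable borel (count_space UNIV)"
proof -
  have T [measurable]: "Tame s \<in> sets borel" using closed_tame[OF s t(2)] by (rule borel_closed)
  define H where "H \<xi> = (if \<xi> \<in> Tame s then ctrl s \<xi> else 0)" for \<xi>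
  have [measurable]: "H \<in> borel_measurable borel"
    unfolding H_def by (rule borel_measurable_continuous_on_if[OF T ctrl_continuous[OF s] continuous_on_const])
  have eq: "index N s = (\<lambda>\<xi>. if \<xi> \<in> Tame s then Suc (LEAST i. norm (H \<xi> - d i) < precision N) else 0)"
    by (rule ext) (simp add: index_def H_def)
  show ?thesis unfolding eq by measurable
qed

lemma approx_measurable: "approx N \<in> borel_measurable borel"
  unfolding approx_def
proof (intro borel_measurable_sum)
  fix m
  show "(\<lambda>\<xi>. block N m (val (index N (grid N m) \<xi>))) \<in> borel_measurable borel"
    by (rule measurable_compose[OF index_measurable[OF grid_bounds]]) simp
qed

lemma index_\<tau>:
  assumes s: "0 < s" "s \<le> t" and c: "causal t s \<xi>" and k: "restr s k = 0"
  shows "index N s (\<tau> k \<xi>) = index N s \<xi>"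
  using tame_\<tau>_iff[OF s(1) _ c k, of u\<^sub>0 \<delta> C] ctrl_\<tau>[OF s _ c k] s t by (simp add: index_def)

lemma val_index: "\<xi> \<in> Tame s \<Longrightarrow> norm (val (index N s \<xi>) - ctrl s \<xi>) < precision N"
  using LeastI_ex[OF d_dense[OF precision_pos[of N], of "ctrl s \<xi>"]]
  by (simp add: index_def val_def norm_minus_commute)

text \<open>The approximation without rounding, which is compared with the delayed control.\<close>

definition ideal :: "nat \<Rightarrow> nat \<Rightarrow> 'm \<Rightarrow> 'e" where
  "ideal N M \<xi> = (\<Sum>m<M. if \<xi> \<in> Tame (grid N m) then block N m (ctrl (grid N m) \<xi>) else 0)"

lemma approx_ideal: "norm (approx N \<xi> - ideal N N \<xi>) \<le> \<kappa> / (2 * real (Suc N))"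
proof -
  have le: "norm (block N m (val (index N (grid N m) \<xi>)) - (if \<xi> \<in> Tame (grid N m) then block N m (ctrl (grid N m) \<xi>) else 0))
     \<le> precision N" for m
  proof (cases "\<xi> \<in> Tame (grid N m)")
    case True
    have lin: "bounded_linear (block N m)" unfolding block_def by (rule bounded_linear_cutoff) simp
    have "norm (block N m (val (index N (grid N m) \<xi>)) - block N m (ctrl (grid N m) \<xi>))
        = norm (block N m (val (index N (grid N m) \<xi>) - ctrl (grid N m) \<xi>))"
      using lin by (simp add: linear_simps)
    also have "\<dots> \<le> norm (val (index N (grid N m) \<xi>) - ctrl (grid N m) \<xi>)"
      unfolding block_def by (rule norm_cutoff_le) simp
    finally show ?thesis using val_index[OF True, of N] True by simp
  next
    case False
    have lin: "bounded_linear (block N m)" unfolding block_def by (rule bounded_linear_cutoff) simp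
    show ?thesis using False precision_pos[of N] lin by (simp add: index_def val_def linear_simps)
  qed
  have "norm (approx N \<xi> - ideal N N \<xi>) \<le> (\<Sum>m<N. precision N)"
    unfolding approx_def ideal_def sum_subtractf[symmetric] by (rule sum_norm_le) (rule le)
  also have "\<dots> = real N * precision N" by simp
  also have "\<dots> \<le> \<kappa> / (2 * real (Suc N))" by (rule precision_le)
  finally show ?thesis .
qed

text \<open>
  If \<open>\<xi>\<close> is tame until time \<open>s\<close>, all the pieces up to \<open>s\<close> are pieces of one and the same
  control, so they fit together.
\<close>

lemma ideal_tame:
  assumes c: "causal_grid \<xi>" and s: "s \<le> t" "\<xi> \<in> Tame s" and M: "\<And>m. m < M \<Longrightarrow> grid N m \<le> s"
  shows "ideal N M \<xi> = cutoff {mesh N<..grid N M} (mesh N) (ctrl s \<xi>)"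
proof -
  have "(if \<xi> \<in> Tame (grid N m) then block N m (ctrl (grid N m) \<xi>) else 0) = block N m (ctrl s \<xi>)" if m: "m < M" for m
  proof -
    have "\<xi> \<in> Tame (grid N m)"
      using tame_antimono[OF grid_bounds(1) M[OF m] s(1) t(2)] s(2) by blast
    moreover have "restr (grid N m) (ctrl s \<xi>) = ctrl (grid N m) \<xi>"
      by (rule ctrl_restr[OF grid_bounds(1) M[OF m] s]) (use c in \<open>simp add: causal_grid_def\<close>)
    ultimately show ?thesis using block_restr[of N m "ctrl s \<xi>"] by simp
  qed
  then show ?thesis unfolding ideal_def sum_block[symmetric] by (intro sum.cong) auto
qed

text \<open>
  At the last grid time at which \<open>\<xi>\<close> is tame the sum is a delayed control; later summands vanish.
\<close>

lemma ideal_norm: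
  assumes c: "causal_grid \<xi>"
  shows "norm (ideal N M \<xi>) \<le> \<kappa> / 2"
proof (induction M)
  case 0
  then show ?case using \<kappa> by (simp add: ideal_def)
next
  case (Suc M)
  show ?case
  proof (cases "\<xi> \<in> Tame (grid N M)")
    case True
    have "ideal N (Suc M) \<xi> = cutoff {mesh N<..grid N (Suc M)} (mesh N) (ctrl (grid N M) \<xi>)"
      by (rule ideal_tame[OF c grid_bounds(2) True]) (simp add: grid_mono)
    then have "norm (ideal N (Suc M) \<xi>) \<le> norm (ctrl (grid N M) \<xi>)" by (simp add: norm_cutoff_le)
    also have "\<dots> \<le> \<kappa> / 2" by (rule ctrl_norm[OF grid_bounds True])
    finally show ?thesis .
  next
    case False
    then show ?thesis using Suc.IH by (simp add: ideal_def)
  qed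
qed

lemma approx_norm:
  assumes "causal_grid \<xi>"
  shows "norm (approx N \<xi>) \<le> \<kappa>"
proof -
  have "\<kappa> / (2 * real (Suc N)) \<le> \<kappa> / 2"
    using \<kappa> by (intro divide_left_mono) auto
  then have "norm (approx N \<xi> - ideal N N \<xi>) \<le> \<kappa> / 2" using approx_ideal[of N \<xi>] by linarith
  moreover have "norm (approx N \<xi>) \<le> norm (ideal N N \<xi>) + norm (approx N \<xi> - ideal N N \<xi>)"
    using norm_triangle_sub by blast
  ultimately show ?thesis using ideal_norm[OF assms, of N N] by linarith
qed

lemma approx_tendsto:
  assumes c: "causal_grid \<xi>" and \<xi>: "\<xi> \<in> Tame t"
  shows "(\<lambda>N. approx N \<xi>) \<longlonglongrightarrow> ctrl t \<xi>"
proof -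
  have "mesh \<longlonglongrightarrow> 0"
    unfolding mesh_def[abs_def] by (rule LIMSEQ_Suc[OF lim_const_over_n])
  then have "(\<lambda>N. cutoff {mesh N<..t} (mesh N) (ctrl t \<xi>)) \<longlonglongrightarrow> restr t (ctrl t \<xi>)"
    by (rule delay_tendsto) (use mesh_pos t in \<open>auto intro: less_imp_le\<close>)
  moreover have "restr t (ctrl t \<xi>) = ctrl t \<xi>"
    by (rule ctrl_restr) (use t \<xi> c in \<open>auto simp: causal_grid_def\<close>)
  moreover have "ideal N N \<xi> = cutoff {mesh N<..t} (mesh N) (ctrl t \<xi>)" for N
    using ideal_tame[OF c order_refl \<xi> grid_bounds(2), of N N] by (simp add: grid_last)
  ultimately have 1: "(\<lambda>N. ideal N N \<xi>) \<longlonglongrightarrow> ctrl t \<xi>" by simp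
  have "(\<lambda>N. \<kappa> / 2 / real (Suc N)) \<longlonglongrightarrow> 0" by (rule LIMSEQ_Suc[OF lim_const_over_n])
  then have "(\<lambda>N. \<kappa> / (2 * real (Suc N))) \<longlonglongrightarrow> 0" by simp
  then have "(\<lambda>N. approx N \<xi> - ideal N N \<xi>) \<longlonglongrightarrow> 0"
    by (rule Lim_null_comparison[rotated]) (intro always_eventually allI approx_ideal)
  from tendsto_add[OF this 1] show ?thesis by simp
qed

text \<open>
  Girsanov's theorem for step processes, with \<open>V m\<close> the shifts supported in the \<open>m\<close>-th block. As it speaks of Borel
  sets of \<open>\<omega>\<close>, the event \<open>\<Xi> \<in> B\<close> is enlarged to a Borel set of the same probability.
\<close>

lemma approx_law_le:
  assumes B: "B \<in> sets borel"
  shows "measure Q {\<omega>. \<tau> (approx N (\<Xi> \<omega>)) (\<Xi> \<omega>) \<in> B}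
      \<le> measure Q {\<omega>. \<Xi> \<omega> \<in> B} + sqrt (exp (2 * (onorm j)\<^sup>2 * \<kappa>\<^sup>2) - 1)"
proof -
  note \<Xi>m = \<Xi>_measurable
  define e where "e m i = shift (block N m (val i))" for m i
  define I where "I m \<omega> = index N (grid N m) (\<Xi> \<omega>)" for m \<omega>
  define V where "V m = shift ` {k. restr (grid N m) k = 0 \<and> restr (grid N (Suc m)) k = k}" for m
  have eV: "e m i \<in> V m" for m i
    unfolding e_def V_def by (intro imageI CollectI conjI restr_block_before restr_block_after) simp_all
  have Vcm: "V m \<subseteq> cameron_martin_space P" for m unfolding V_def using shift_cm by blast
  have Vs: "a *\<^sub>R c \<in> V m" if "c \<in> V m" for m c a
  proof -
    obtain k where k: "c = shift k" "restr (grid N m) k = 0" "restr (grid N (Suc m)) k = k"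
      using \<open>c \<in> V m\<close> unfolding V_def by blast
    have "restr s (a *\<^sub>R k) = a *\<^sub>R restr s k" for s
      using bounded_linear_restr[of s] by (simp add: linear_simps)
    then show ?thesis unfolding V_def k(1) shift_scaleR[symmetric] using k by (intro imageI) simp
  qed
  have Im: "I m \<in> measurable Q (count_space UNIV)" for m
    unfolding I_def[abs_def] by (rule measurable_compose[OF \<Xi>m index_measurable[OF grid_bounds]])
  have Ishift: "AE \<omega> in Q. I k (\<omega> + c) = I k \<omega>" if km: "k \<le> m" and cV: "c \<in> V m" for k m c
  proof -
    obtain b where b: "c = shift b" "restr (grid N m) b = 0" using cV unfolding V_def by blast
    have "restr (grid N k) b = restr (grid N k) (restr (grid N m) b)"
      by (rule restr_restr[symmetric, OF grid_mono[OF km]])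
    then have bk: "restr (grid N k) b = 0"
      using b(2) bounded_linear_restr[of "grid N k"] by (simp add: linear_simps)
    show ?thesis
      using \<Xi>_shift[of b] AE_causal_grid
    proof eventually_elim
      case (elim \<omega>)
      then show ?case
        using index_\<tau>[OF grid_bounds _ bk, of "\<Xi> \<omega>"] by (simp add: I_def b(1) causal_grid_def)
    qed
  qed
  have orth: "cm_inner a c = 0" if km: "k < m" and aV: "a \<in> V k" and cV: "c \<in> V m" for k m a c
  proof -
    obtain a' where a': "a = shift a'" "restr (grid N (Suc k)) a' = a'" using aV unfolding V_def by blast
    obtain c' where c': "c = shift c'" "restr (grid N m) c' = 0" using cV unfolding V_def by blast
    have gm: "grid N (Suc k) \<le> grid N m" using km by (intro grid_mono) simp
    have "AE x in lborel. rep a' x = (if x \<in> {0..grid N (Suc k)} then rep a' x else 0)"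
      using rep_restr[of "grid N (Suc k)" a'] a'(2) by simp
    then show ?thesis
      unfolding a'(1) c'(1) using c'(2)[unfolded restr_eq_0_iff]
      by (intro shift_orth, eventually_elim) (use gm in \<open>auto split: if_splits\<close>)
  qed
  have sumE: "(\<Sum>m<N. e m (I m \<omega>)) = shift (approx N (\<Xi> \<omega>))" for \<omega>
    by (simp add: approx_def shift_sum e_def I_def)
  have energy: "AE \<omega> in Q. (\<Sum>m<N. cm_inner (e m (I m \<omega>)) (e m (I m \<omega>))) \<le> 2 * (onorm j)\<^sup>2 * \<kappa>\<^sup>2"
    using AE_causal_grid
  proof eventually_elim
    case (elim \<omega>)
    have "(\<Sum>m<N. cm_inner (e m (I m \<omega>)) (e m (I m \<omega>))) = cm_inner (shift (approx N (\<Xi> \<omega>))) (shift (approx N (\<Xi> \<omega>)))"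
      unfolding e_def I_def approx_def by (rule energy_sum)
    also have "\<dots> \<le> 2 * (onorm j)\<^sup>2 * (norm (approx N (\<Xi> \<omega>)))\<^sup>2" by (rule shift_energy_le)
    also have "\<dots> \<le> 2 * (onorm j)\<^sup>2 * \<kappa>\<^sup>2"
      using approx_norm[OF elim, of N] by (intro mult_left_mono power_mono) auto
    finally show ?case .
  qed
  have main: "measure Q {\<omega>. \<omega> + shift (approx N (\<Xi> \<omega>)) \<in> B'} \<le> measure Q B' + sqrt (exp (2 * (onorm j)\<^sup>2 * \<kappa>\<^sup>2) - 1)"
    if "B' \<in> sets borel" for B'
    using step_shift_prob_le[of e V I, OF eV Vcm Vs Im Ishift orth energy that] by (simp add: sumE)
  \<comment> \<open>Only countably many values of the control are involved, so one null set serves for all of them.\<close>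
  have AEsh: "AE \<omega> in Q. \<Xi> (\<omega> + shift (approx N (\<Xi> \<omega>))) = \<tau> (approx N (\<Xi> \<omega>)) (\<Xi> \<omega>)"
  proof -
    have "AE \<omega> in Q. \<forall>l :: nat list. \<Xi> (\<omega> + shift (\<Sum>m<N. block N m (val (l ! m)))) = \<tau> (\<Sum>m<N. block N m (val (l ! m))) (\<Xi> \<omega>)"
      unfolding AE_all_countable by (intro allI \<Xi>_shift)
    then show ?thesis
    proof eventually_elim
      case (elim \<omega>)
      have eq: "(\<Sum>m<N. block N m (val (map (\<lambda>m. index N (grid N m) (\<Xi> \<omega>)) [0..<N] ! m))) = approx N (\<Xi> \<omega>)"
        unfolding approx_def by (intro sum.cong) auto
      show ?case
        using elim[rule_format, of "map (\<lambda>m. index N (grid N m) (\<Xi> \<omega>)) [0..<N]"] by (simp only: eq)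
    qed
  qed
  have "{\<omega>. \<Xi> \<omega> \<in> B} \<in> sets Q" using measurable_sets[OF \<Xi>m B] by (simp add: vimage_def)
  then obtain B' where B': "{\<omega>. \<Xi> \<omega> \<in> B} \<subseteq> B'" "B' \<in> sets P"
      "B' - {\<omega>. \<Xi> \<omega> \<in> B} \<in> null_sets Q" "emeasure Q {\<omega>. \<Xi> \<omega> \<in> B} = emeasure P B'"
    by (rule completion_upper)
  have B'b: "B' \<in> sets borel" using B'(2) by (simp add: sets_P)
  have mB': "measure Q B' = measure Q {\<omega>. \<Xi> \<omega> \<in> B}"
    unfolding measure_completion[OF B'(2)] by (simp only: measure_def B'(4))
  have sQ: "{\<omega>. \<omega> + shift (approx N (\<Xi> \<omega>)) \<in> B'} \<in> sets Q"
  proof -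
    have "(\<lambda>\<omega>. \<omega> + (\<Sum>m<N. 1 *\<^sub>R e m (I m \<omega>))) \<in> measurable Q borel"
      by (rule shift_measurable[of e V I, OF eV Vcm Vs Im Ishift orth])
    from measurable_sets[OF this B'b] show ?thesis by (simp add: sumE vimage_def)
  qed
  have "measure Q {\<omega>. \<tau> (approx N (\<Xi> \<omega>)) (\<Xi> \<omega>) \<in> B} \<le> measure Q {\<omega>. \<omega> + shift (approx N (\<Xi> \<omega>)) \<in> B'}"
  proof (rule finite_measure_mono_AE[OF _ sQ])
    show "AE \<omega> in Q. \<omega> \<in> {\<omega>. \<tau> (approx N (\<Xi> \<omega>)) (\<Xi> \<omega>) \<in> B} \<longrightarrow> \<omega> \<in> {\<omega>. \<omega> + shift (approx N (\<Xi> \<omega>)) \<in> B'}"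
      using AEsh by eventually_elim (use B'(1) in auto)
  qed
  then show ?thesis using main[OF B'b] mB' by simp
qed

text \<open>
  The approximate controls converge almost surely on the tame configurations, and \<open>\<tau>\<close> is continuous, so that
  Fatou's lemma bounds the limit.
\<close>

lemma open_law_le:
  assumes B: "open B"
  shows "measure Q {\<omega>. \<Xi> \<omega> \<in> Tame t \<and> \<tau> (ctrl t (\<Xi> \<omega>)) (\<Xi> \<omega>) \<in> B}
      \<le> measure Q {\<omega>. \<Xi> \<omega> \<in> B} + sqrt (exp (2 * (onorm j)\<^sup>2 * \<kappa>\<^sup>2) - 1)" (is "measure Q ?A \<le> ?b")
proof -
  define b where "b = ?b"
  define E where "E N = {\<omega>. \<tau> (approx N (\<Xi> \<omega>)) (\<Xi> \<omega>) \<in> B}" for N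
  have E [measurable]: "E N \<in> sets Q" for N
  proof -
    have c: "continuous_on UNIV (\<lambda>x. \<tau> (fst x) (snd x))"
      using \<tau>_continuous by (simp only: case_prod_unfold)
    have "(\<lambda>\<xi>. \<tau> (approx N \<xi>) \<xi>) \<in> borel_measurable borel"
      by (rule borel_measurable_continuous_Pair[OF approx_measurable measurable_ident_sets[OF refl] c])
    from measurable_sets[OF measurable_compose[OF \<Xi>_measurable this], of B] B
    show ?thesis by (simp add: E_def vimage_def)
  qed
  have "(\<integral>\<^sup>+\<omega>. indicator ?A \<omega> \<partial>Q) \<le> (\<integral>\<^sup>+\<omega>. liminf (\<lambda>N. indicator (E N) \<omega>) \<partial>Q)"
  proof (rule nn_integral_mono_AE)
    show "AE \<omega> in Q. (indicator ?A \<omega> :: ennreal) \<le> liminf (\<lambda>N. indicator (E N) \<omega>)"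
      using AE_causal_grid
    proof eventually_elim
      case (elim \<omega>)
      show ?case
      proof (cases "\<omega> \<in> ?A")
        case True
        then have "(\<lambda>N. \<tau> (approx N (\<Xi> \<omega>)) (\<Xi> \<omega>)) \<longlonglongrightarrow> \<tau> (ctrl t (\<Xi> \<omega>)) (\<Xi> \<omega>)"
          by (intro \<tau>_tendsto approx_tendsto[OF elim] tendsto_const) simp
        from topological_tendstoD[OF this B] True
        have "\<forall>\<^sub>F N in sequentially. (1 :: ennreal) \<le> indicator (E N) \<omega>"
          by (auto simp: E_def elim!: eventually_mono)
        from Liminf_bounded[OF this] show ?thesis by (simp add: indicator_def)
      qed simp
    qed
  qed
  also have "\<dots> \<le> liminf (\<lambda>N. \<integral>\<^sup>+\<omega>. indicator (E N) \<omega> \<partial>Q)"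
    by (rule nn_integral_liminf) measurable
  also have "\<dots> \<le> ennreal b"
  proof (rule Liminf_le)
    show "\<forall>\<^sub>F N in sequentially. (\<integral>\<^sup>+\<omega>. indicator (E N) \<omega> \<partial>Q) \<le> ennreal b"
      using approx_law_le[OF borel_open[OF B]]
      by (intro always_eventually allI) (simp add: E_def[symmetric] b_def[symmetric] emeasure_eq_measure ennreal_leI)
  qed simp
  finally have "(\<integral>\<^sup>+\<omega>. indicator ?A \<omega> \<partial>Q) \<le> ennreal b" .
  moreover have "?A \<in> sets Q" by (rule controlled_measurable[OF borel_open[OF B]])
  moreover have "0 \<le> b" unfolding b_def by (intro add_nonneg_nonneg) auto
  ultimately have "measure Q ?A \<le> b" by (simp add: emeasure_eq_measure)
  then show ?thesis by (simp only: b_def)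
qed

end

end

end

section \<open>The strong Feller property\<close>

text \<open>The sum counts \<open>\<lfloor>n x\<rfloor>\<close> terms.\<close>

lemma floor_sum_bounds:
  assumes x: "0 \<le> x" "x \<le> 1" and n: "0 < n"
  shows "(\<Sum>k=1..n. of_bool (real k / real n \<le> x)) / real n \<le> x"
    and "x \<le> (\<Sum>k=1..n. of_bool (real k / real n \<le> x)) / real n + 1 / real n"
proof -
  have le: "real n * x \<le> real n" using x by (simp add: mult_left_le)
  define m where "m = nat \<lfloor>real n * x\<rfloor>"
  have m: "m \<le> n" using le by (simp add: m_def nat_le_iff floor_le_iff)
  have eq: "real k / real n \<le> x \<longleftrightarrow> k \<le> m" for k
  proof -
    have "real k / real n \<le> x \<longleftrightarrow> real k \<le> real n * x" using n by (simp add: field_simps)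
    also have "\<dots> \<longleftrightarrow> k \<le> m" using x by (simp add: m_def le_nat_iff le_floor_iff)
    finally show ?thesis .
  qed
  have "(\<Sum>k=1..n. of_bool (real k / real n \<le> x) :: real) = (\<Sum>k=1..m. 1)"
    unfolding eq by (rule sum.mono_neutral_cong_right) (use m in auto)
  then have "(\<Sum>k=1..n. of_bool (real k / real n \<le> x)) = real (nat \<lfloor>real n * x\<rfloor>)"
    by (simp add: m_def)
  moreover have "real (nat \<lfloor>real n * x\<rfloor>) \<le> real n * x" "real n * x \<le> real (nat \<lfloor>real n * x\<rfloor>) + 1"
    using x by (simp_all add: of_nat_nat)
  ultimately show "(\<Sum>k=1..n. of_bool (real k / real n \<le> x)) / real n \<le> x"
    "x \<le> (\<Sum>k=1..n. of_bool (real k / real n \<le> x)) / real n + 1 / real n"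
    using n by (simp_all add: field_simps)
qed

text \<open>
  The layer-cake formula in discrete form: up to \<open>1 / n\<close>, the expectation of
  a function with values in \<open>[0, 1]\<close> is the average of its tail probabilities at the levels \<open>k / n\<close>.
\<close>

lemma (in prob_space) expectation_le_of_tails:
  fixes f g :: "'a \<Rightarrow> real"
  assumes [measurable]: "f \<in> borel_measurable M" "g \<in> borel_measurable M"
    and f: "\<And>x. 0 \<le> f x" "\<And>x. f x \<le> 1" and g: "\<And>x. 0 \<le> g x" "\<And>x. g x \<le> 1"
    and tails: "\<And>a. prob {x \<in> space M. a \<le> f x} \<le> prob {x \<in> space M. a \<le> g x} + \<epsilon>"
  shows "expectation f \<le> expectation g + \<epsilon>"
proof -
  define S where "S h n x = (\<Sum>k=1..n. of_bool (real k / real n \<le> h x)) / real n" for h :: "'a \<Rightarrow> real" and n x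
  have S: "expectation (S h n) = (\<Sum>k=1..n. prob {x \<in> space M. real k / real n \<le> h x}) / real n"
    "integrable M (S h n)" if [measurable]: "h \<in> borel_measurable M" for h n
  proof -
    have eq: "of_bool (real k / real n \<le> h x) = (indicator {x \<in> space M. real k / real n \<le> h x} x :: real)"
      if "x \<in> space M" for k x using that by simp
    have int: "integrable M (indicator {x \<in> space M. real k / real n \<le> h x} :: 'a \<Rightarrow> real)" for k
      by (rule integrable_real_indicator) (simp_all add: emeasure_eq_measure)
    have "expectation (S h n) = (\<integral>x. (\<Sum>k=1..n. indicator {x \<in> space M. real k / real n \<le> h x} x) / real n \<partial>M)"
      unfolding S_def by (intro Bochner_Integration.integral_cong refl) (simp add: eq)
    also have "\<dots> = (\<Sum>k=1..n. prob {x \<in> space M. real k / real n \<le> h x}) / real n"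
      using int by (simp add: Bochner_Integration.integral_sum Int_def conj_commute)
    finally show "expectation (S h n) = (\<Sum>k=1..n. prob {x \<in> space M. real k / real n \<le> h x}) / real n" .
    have "integrable M (\<lambda>x. (\<Sum>k=1..n. indicator {x \<in> space M. real k / real n \<le> h x} x) / real n :: real)"
      using int by (intro integrable_divide_zero Bochner_Integration.integrable_sum) auto
    then show "integrable M (S h n)"
      unfolding S_def by (subst Bochner_Integration.integrable_cong[OF refl]) (simp_all add: eq)
  qed
  have int: "integrable M f" "integrable M g"
    using f g by (intro integrable_const_bound[where B=1] AE_I2; simp)+
  have "expectation f \<le> expectation g + \<epsilon> + 1 / real (Suc n)" for n
  proof -
    let ?n = "Suc n"
    have "expectation f \<le> expectation (\<lambda>x. S f ?n x + 1 / real ?n)"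
    proof (rule integral_mono[OF int(1) Bochner_Integration.integrable_add[OF S(2)[OF assms(1)]]])
      show "f x \<le> S f ?n x + 1 / real ?n" for x unfolding S_def by (rule floor_sum_bounds(2)[OF f]) simp
    qed simp
    also have "\<dots> = expectation (S f ?n) + 1 / real ?n" using S(2)[of f ?n] by (simp add: prob_space)
    also have "expectation (S f ?n) \<le> (\<Sum>k=1..?n. prob {x \<in> space M. real k / real ?n \<le> g x} + \<epsilon>) / real ?n"
      unfolding S(1)[OF assms(1)] by (intro divide_right_mono sum_mono tails) simp
    also have "\<dots> = expectation (S g ?n) + \<epsilon>"
      unfolding S(1)[OF assms(2)] by (simp only: sum.distrib add_divide_distrib) simp
    also have "expectation (S g ?n) \<le> expectation g"
    proof (rule integral_mono[OF S(2)[OF assms(2)] int(2)])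
      show "S g ?n x \<le> g x" for x unfolding S_def by (rule floor_sum_bounds(1)[OF g]) simp
    qed
    finally show ?thesis by simp
  qed
  moreover have "(\<lambda>n. expectation g + \<epsilon> + 1 / real (Suc n)) \<longlonglongrightarrow> expectation g + \<epsilon> + 0"
    by (intro tendsto_add tendsto_const LIMSEQ_Suc[OF lim_const_over_n])
  ultimately show ?thesis by (intro LIMSEQ_le_const) auto
qed

context abstract_flow_system
begin

text \<open>
  Open sets are enough, by outer regularity of the law of \<open>\<Xi>\<close> on the Polish space \<open>'m\<close>.
\<close>

lemma control_law_le:
  assumes t: "0 < t" "t \<le> 1"
    and \<kappa>: "0 < \<kappa>" "\<kappa> \<le> \<delta>" and v: "norm v < \<delta>" "C * norm v \<le> \<kappa> / 2" "C * norm v \<le> 1 / 2"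
    and B: "B \<in> sets borel"
  shows "measure Q {\<omega>. \<Xi> \<omega> \<in> tame u\<^sub>0 \<delta> C t t \<and> \<tau> (control t t u\<^sub>0 v (\<Xi> \<omega>)) (\<Xi> \<omega>) \<in> B}
      \<le> measure Q {\<omega>. \<Xi> \<omega> \<in> B} + sqrt (exp (2 * (onorm j)\<^sup>2 * \<kappa>\<^sup>2) - 1)"
proof (rule field_le_epsilon)
  fix e :: real assume e: "0 < e"
  obtain D :: "'e set" where D: "countable D" "\<And>X. open X \<Longrightarrow> X \<noteq> {} \<Longrightarrow> \<exists>d\<in>D. d \<in> X"
    by (erule countable_dense_setE)
  have dense: "\<exists>i. norm (x - from_nat_into D i) < \<epsilon>" if "0 < \<epsilon>" for x \<epsilon>
  proof -
    have "ball x \<epsilon> \<noteq> {}" using that by simp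
    then obtain d where "d \<in> D" "d \<in> ball x \<epsilon>" using D(2)[OF open_ball] by blast
    moreover obtain i where "from_nat_into D i = d" using from_nat_into_surj[OF D(1) \<open>d \<in> D\<close>] by blast
    ultimately show ?thesis by (intro exI[of _ i]) (simp add: dist_norm)
  qed
  define \<mu> where "\<mu> = distr Q borel \<Xi>"
  have em: "emeasure \<mu> X = ennreal (measure Q {\<omega>. \<Xi> \<omega> \<in> X})" if "X \<in> sets borel" for X
    using \<Xi>_measurable that by (simp add: \<mu>_def emeasure_distr emeasure_eq_measure vimage_def)
  have s\<mu>: "sets \<mu> = sets borel" by (simp add: \<mu>_def)
  have "emeasure \<mu> (space \<mu>) \<noteq> \<infinity>" by (simp add: \<mu>_def em[unfolded \<mu>_def])
  from outer_regular[OF s\<mu> this B]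
  have "(INF U\<in>{U. B \<subseteq> U \<and> open U}. emeasure \<mu> U) = ennreal (measure Q {\<omega>. \<Xi> \<omega> \<in> B})" using em[OF B] by simp
  also have "\<dots> < ennreal (measure Q {\<omega>. \<Xi> \<omega> \<in> B} + e)" using e by (intro ennreal_lessI) (auto intro: add_nonneg_pos)
  finally obtain U where U: "B \<subseteq> U" "open U" "emeasure \<mu> U < ennreal (measure Q {\<omega>. \<Xi> \<omega> \<in> B} + e)"
    unfolding INF_less_iff by auto
  have Ule: "measure Q {\<omega>. \<Xi> \<omega> \<in> U} \<le> measure Q {\<omega>. \<Xi> \<omega> \<in> B} + e"
    using U(3) unfolding em[OF borel_open[OF U(2)]] by (simp add: ennreal_less_iff del: ennreal_plus)
  have "measure Q {\<omega>. \<Xi> \<omega> \<in> tame u\<^sub>0 \<delta> C t t \<and> \<tau> (control t t u\<^sub>0 v (\<Xi> \<omega>)) (\<Xi> \<omega>) \<in> B}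
      \<le> measure Q {\<omega>. \<Xi> \<omega> \<in> tame u\<^sub>0 \<delta> C t t \<and> \<tau> (control t t u\<^sub>0 v (\<Xi> \<omega>)) (\<Xi> \<omega>) \<in> U}"
    using U(1) by (intro finite_measure_mono controlled_measurable[OF t \<kappa> v] borel_open U(2)) auto
  also have "\<dots> \<le> measure Q {\<omega>. \<Xi> \<omega> \<in> U} + sqrt (exp (2 * (onorm j)\<^sup>2 * \<kappa>\<^sup>2) - 1)"
    by (rule open_law_le[OF t \<kappa> v _ U(2), of "from_nat_into D"]) (rule dense)
  finally show "measure Q {\<omega>. \<Xi> \<omega> \<in> tame u\<^sub>0 \<delta> C t t \<and> \<tau> (control t t u\<^sub>0 v (\<Xi> \<omega>)) (\<Xi> \<omega>) \<in> B}
      \<le> measure Q {\<omega>. \<Xi> \<omega> \<in> B} + sqrt (exp (2 * (onorm j)\<^sup>2 * \<kappa>\<^sup>2) - 1) + e"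
    using Ule by linarith
qed

lemma flow_measurable: "(\<lambda>\<xi>. \<Phi> 0 1 (Alive u) \<xi>) \<in> borel_measurable borel"
proof -
  define S where "S = {\<xi>. (u, \<xi>) \<in> survival \<Phi> 1}"
  have "open ((\<lambda>\<xi>. (u, \<xi>)) -` survival \<Phi> 1)"
    by (intro open_vimage flow_set_open continuous_intros) simp_all
  then have S: "S \<in> sets borel" by (simp add: S_def vimage_def)
  have c: "continuous_on S (\<lambda>\<xi>. (u, \<xi>))" by (intro continuous_intros)
  have "continuous_on S (\<lambda>\<xi>. \<Phi> 0 1 (Alive u) \<xi>)"
    using continuous_on_compose2[OF flow_continuous[of 1] c] by (auto simp: S_def)
  from borel_measurable_continuous_on_if[OF S this continuous_on_const[of _ Dead]]
  have "(\<lambda>\<xi>. if \<xi> \<in> S then \<Phi> 0 1 (Alive u) \<xi> else Dead) \<in> borel_measurable borel" .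
  moreover have "(\<lambda>\<xi>. if \<xi> \<in> S then \<Phi> 0 1 (Alive u) \<xi> else Dead) = (\<lambda>\<xi>. \<Phi> 0 1 (Alive u) \<xi>)"
    by (rule ext) (simp add: S_def survival_def)
  ultimately show ?thesis by (simp only:)
qed

text \<open>
  On tame configurations \<open>\<Phi>\<^sub>1(u\<^sub>0, \<Xi>) = \<Phi>\<^sub>1(u\<^sub>0 + v, \<tau> h \<Xi>)\<close> for the control \<open>h\<close>, and the law of \<open>\<tau> h \<Xi>\<close> is
  dominated by that of \<open>\<Xi>\<close> up to a small error.
\<close>

lemma flow_law_le:
  assumes t: "0 < t" "t \<le> 1"
    and \<kappa>: "0 < \<kappa>" "\<kappa> \<le> \<delta>" and v: "norm v < \<delta>" "C * norm v \<le> \<kappa> / 2" "C * norm v \<le> 1 / 2"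
    and D: "D \<in> sets borel"
  shows "measure Q {\<omega>. \<Phi> 0 1 (Alive u\<^sub>0) (\<Xi> \<omega>) \<in> D}
      \<le> measure Q {\<omega>. \<Xi> \<omega> \<notin> tame u\<^sub>0 \<delta> C t t} + measure Q {\<omega>. \<Phi> 0 1 (Alive (u\<^sub>0 + v)) (\<Xi> \<omega>) \<in> D}
        + sqrt (exp (2 * (onorm j)\<^sup>2 * \<kappa>\<^sup>2) - 1)"
proof -
  define B where "B = {\<xi>. \<Phi> 0 1 (Alive (u\<^sub>0 + v)) \<xi> \<in> D}"
  have B: "B \<in> sets borel" using measurable_sets[OF flow_measurable D, of "u\<^sub>0 + v"] by (simp add: B_def vimage_def)
  define X where "X = {\<omega>. \<Xi> \<omega> \<notin> tame u\<^sub>0 \<delta> C t t}"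
  define Y where "Y = {\<omega>. \<Xi> \<omega> \<in> tame u\<^sub>0 \<delta> C t t \<and> \<tau> (control t t u\<^sub>0 v (\<Xi> \<omega>)) (\<Xi> \<omega>) \<in> B}"
  have "- tame u\<^sub>0 \<delta> C t t \<in> sets borel" using closed_tame[OF t(1) order_refl t(2)] by (intro borel_open) auto
  from measurable_sets[OF \<Xi>_measurable this] have X: "X \<in> sets Q" by (simp add: X_def vimage_def)
  have Y: "Y \<in> sets Q" unfolding Y_def by (rule controlled_measurable[OF t \<kappa> v B])
  have "measure Q {\<omega>. \<Phi> 0 1 (Alive u\<^sub>0) (\<Xi> \<omega>) \<in> D} \<le> measure Q (X \<union> Y)"
  proof (rule finite_measure_mono_AE)
    show "AE \<omega> in Q. \<omega> \<in> {\<omega>. \<Phi> 0 1 (Alive u\<^sub>0) (\<Xi> \<omega>) \<in> D} \<longrightarrow> \<omega> \<in> X \<union> Y"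
      using AE_causal[OF t(1) order_refl t(2)]
    proof eventually_elim
      case (elim \<omega>)
      show ?case
      proof (cases "\<Xi> \<omega> \<in> tame u\<^sub>0 \<delta> C t t")
        case True
        from control_couples[OF t \<kappa> v True elim] True show ?thesis by (simp add: Y_def B_def)
      qed (simp add: X_def)
    qed
    show "X \<union> Y \<in> sets Q" using X Y by simp
  qed
  also have "\<dots> \<le> measure Q X + measure Q Y" by (rule measure_Un_le[OF X Y])
  also have "measure Q Y \<le> measure Q {\<omega>. \<Xi> \<omega> \<in> B} + sqrt (exp (2 * (onorm j)\<^sup>2 * \<kappa>\<^sup>2) - 1)"
    unfolding Y_def by (rule control_law_le[OF t \<kappa> v B])
  finally show ?thesis by (simp add: X_def B_def)
qed

text \<open>
  At time \<open>0\<close> there is no explosion, and \<open>r\<close> is continuous in time, so the probability of explosion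
  before \<open>t\<close> tends to \<open>0\<close> as \<open>t \<rightarrow> 0\<close>. With \<open>t\<close> fixed, a surviving configuration is tame for all large
  \<open>n\<close>.
\<close>

lemma eventually_tame:
  assumes \<epsilon>: "0 < \<epsilon>"
  shows "\<exists>t n. 0 < t \<and> t \<le> 1 \<and> measure Q {\<omega>. \<Xi> \<omega> \<notin> tame u\<^sub>0 (1 / Suc n) (Suc n) t t} < \<epsilon>"
proof -
  have dead: "{\<omega>. (u\<^sub>0, \<Xi> \<omega>) \<notin> survival \<Phi> t} \<in> sets Q" if "0 \<le> t" "t \<le> 1" for t
  proof -
    have "open ((\<lambda>\<xi>. (u\<^sub>0, \<xi>)) -` survival \<Phi> t)"
      by (intro open_vimage flow_set_open that continuous_intros)
    then have "- (\<lambda>\<xi>. (u\<^sub>0, \<xi>)) -` survival \<Phi> t \<in> sets borel" by (intro borel_closed) (simp add: closed_Compl)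
    from measurable_sets[OF \<Xi>_measurable this] show ?thesis by (simp add: vimage_def Compl_eq)
  qed
  define N where "N m = {\<omega>. (u\<^sub>0, \<Xi> \<omega>) \<notin> survival \<Phi> (1 / Suc m)}" for m
  have "decseq N"
  proof (rule decseq_SucI, rule subsetI)
    fix m \<omega> assume "\<omega> \<in> N (Suc m)"
    moreover have "1 / real (Suc (Suc m)) \<le> 1 / real (Suc m)" by (simp add: frac_le)
    ultimately show "\<omega> \<in> N m"
      using survival_antimono[of "1 / real (Suc (Suc m))" "1 / real (Suc m)" u\<^sub>0 "\<Xi> \<omega>"] by (auto simp: N_def)
  qed
  moreover have "range N \<subseteq> sets Q" using dead by (auto simp: N_def)
  moreover have "(\<Inter>m. N m) = {}"
  proof -
    have "\<exists>m. \<omega> \<notin> N m" for \<omega>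
    proof -
      have "(\<lambda>m. r (1 / Suc m) u\<^sub>0 (\<Xi> \<omega>)) \<longlonglongrightarrow> r 0 u\<^sub>0 (\<Xi> \<omega>)"
      proof (rule continuous_on_tendsto_compose[OF r_continuous])
        show "(\<lambda>m. 1 / real (Suc m)) \<longlonglongrightarrow> 0" by (rule LIMSEQ_Suc[OF lim_const_over_n])
      qed auto
      from eventually_happens'[OF sequentially_bot order_tendstoD(2)[OF this r_0]]
      obtain m where "r (1 / Suc m) u\<^sub>0 (\<Xi> \<omega>) < \<infinity>" by (rule exE)
      then show ?thesis by (intro exI[of _ m]) (simp add: N_def survival_iff_r)
    qed
    then show ?thesis by auto
  qed
  ultimately have "(\<lambda>m. measure Q (N m)) \<longlonglongrightarrow> 0"
    using finite_Lim_measure_decseq[of N] by simp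
  then have "\<forall>\<^sub>F m in sequentially. measure Q (N m) < \<epsilon> / 2" by (rule order_tendstoD) (use \<epsilon> in simp)
  from eventually_happens'[OF sequentially_bot this]
  obtain m where m: "measure Q (N m) < \<epsilon> / 2" by (rule exE)
  define t where "t = 1 / real (Suc m)"
  have t: "0 < t" "t \<le> 1" by (auto simp: t_def)
  have tame: "{\<omega>. \<Xi> \<omega> \<notin> tame u\<^sub>0 \<delta> C t t} \<in> sets Q" for \<delta> C
  proof -
    have "- tame u\<^sub>0 \<delta> C t t \<in> sets borel" using closed_tame[OF t(1) order_refl t(2)] by (intro borel_open) auto
    from measurable_sets[OF \<Xi>_measurable this] show ?thesis by (simp add: vimage_def)
  qed
  have Nm: "N m \<in> sets Q" using dead[of t] t by (simp add: N_def t_def)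
  define D where "D n = (\<Union>k\<in>{n..}. {\<omega>. \<Xi> \<omega> \<notin> tame u\<^sub>0 (1 / Suc k) (Suc k) t t}) - N m" for n
  have "decseq D" unfolding D_def by (intro decseq_SucI Diff_mono UN_mono order_refl) auto
  moreover have D: "D n \<in> sets Q" for n
    unfolding D_def by (intro sets.Diff Nm sets.countable_UN'' countableI_type) (rule tame)
  moreover have "(\<Inter>n. D n) = {}"
  proof -
    have "\<exists>n. \<omega> \<notin> D n" for \<omega>
    proof (cases "\<omega> \<in> N m")
      case False
      then have "(u\<^sub>0, \<Xi> \<omega>) \<in> survival \<Phi> t" by (simp add: N_def t_def)
      from survival_imp_tame[OF t this] show ?thesis by (auto simp: D_def)
    qed (simp add: D_def)
    then show ?thesis by auto
  qed
  ultimately have "(\<lambda>n. measure Q (D n)) \<longlonglongrightarrow> 0"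
    using finite_Lim_measure_decseq[of D] by (simp add: image_subset_iff)
  then have "\<forall>\<^sub>F n in sequentially. measure Q (D n) < \<epsilon> / 2" by (rule order_tendstoD) (use \<epsilon> in simp)
  from eventually_happens'[OF sequentially_bot this]
  obtain n where n: "measure Q (D n) < \<epsilon> / 2" by (rule exE)
  have "measure Q {\<omega>. \<Xi> \<omega> \<notin> tame u\<^sub>0 (1 / Suc n) (Suc n) t t} \<le> measure Q (N m \<union> D n)"
    by (intro finite_measure_mono sets.Un Nm D) (auto simp: D_def)
  also have "\<dots> \<le> measure Q (N m) + measure Q (D n)" by (rule measure_Un_le[OF Nm D])
  finally have "measure Q {\<omega>. \<Xi> \<omega> \<notin> tame u\<^sub>0 (1 / Suc n) (Suc n) t t} < \<epsilon>" using m n by linarith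
  then show ?thesis using t by (intro exI conjI)
qed

text \<open>
  The parameters are chosen in the order \<open>t\<close>, \<open>n\<close>, \<open>\<kappa>\<close>, \<open>\<eta>\<close>: first the probability of not being tame, then the Girsanov
  error, and only then the size of \<open>v\<close>, which has to be small compared with \<open>\<kappa>\<close>.
\<close>

lemma flow_law_semicontinuous:
  assumes \<epsilon>: "0 < \<epsilon>"
  shows "\<exists>\<eta>>0. \<forall>v D. norm v < \<eta> \<longrightarrow> D \<in> sets borel \<longrightarrow>
    measure Q {\<omega>. \<Phi> 0 1 (Alive u\<^sub>0) (\<Xi> \<omega>) \<in> D} \<le> measure Q {\<omega>. \<Phi> 0 1 (Alive (u\<^sub>0 + v)) (\<Xi> \<omega>) \<in> D} + \<epsilon>"
proof -
  have "0 < \<epsilon> / 2" using \<epsilon> by simp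
  from eventually_tame[OF this, of u\<^sub>0] obtain t n where t: "0 < t" "t \<le> 1"
    and n: "measure Q {\<omega>. \<Xi> \<omega> \<notin> tame u\<^sub>0 (1 / Suc n) (Suc n) t t} < \<epsilon> / 2"
    by (elim exE conjE)
  have "((\<lambda>\<kappa>. sqrt (exp (2 * (onorm j)\<^sup>2 * \<kappa>\<^sup>2) - 1)) \<longlongrightarrow> sqrt (exp (2 * (onorm j)\<^sup>2 * 0\<^sup>2) - 1)) (at_right (0::real))"
    by (intro tendsto_intros)
  then have "((\<lambda>\<kappa>. sqrt (exp (2 * (onorm j)\<^sup>2 * \<kappa>\<^sup>2) - 1)) \<longlongrightarrow> 0) (at_right (0::real))" by simp
  then have small: "\<forall>\<^sub>F \<kappa> in at_right 0. sqrt (exp (2 * (onorm j)\<^sup>2 * \<kappa>\<^sup>2) - 1) < \<epsilon> / 2"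
    by (rule order_tendstoD) (use \<epsilon> in simp)
  have near: "\<forall>\<^sub>F \<kappa> in at_right 0. \<kappa> \<in> {0<..<1 / real (Suc n)}"
    by (rule eventually_at_right_real) simp
  define G where "G \<kappa> \<longleftrightarrow> sqrt (exp (2 * (onorm j)\<^sup>2 * \<kappa>\<^sup>2) - 1) < \<epsilon> / 2 \<and> \<kappa> \<in> {0<..<1 / real (Suc n)}" for \<kappa>
  have G: "\<forall>\<^sub>F \<kappa> in at_right 0. G \<kappa>" unfolding G_def by (rule eventually_conj[OF small near])
  have "\<exists>\<kappa>. G \<kappa>" by (rule eventually_happens'[OF trivial_limit_at_right_real G])
  then obtain \<kappa> where "G \<kappa>" by (rule exE)
  then have \<kappa>: "sqrt (exp (2 * (onorm j)\<^sup>2 * \<kappa>\<^sup>2) - 1) < \<epsilon> / 2" "0 < \<kappa>" "\<kappa> < 1 / real (Suc n)"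
    unfolding G_def greaterThanLessThan_iff by simp_all
  define \<eta> where "\<eta> = \<kappa> / (2 * real (Suc n))"
  have "1 / real (Suc n) \<le> 1" by simp
  then have \<kappa>1: "\<kappa> < 1" using \<kappa>(3) by linarith
  have \<eta>: "0 < \<eta>" "\<eta> < 1 / real (Suc n)" "real (Suc n) * \<eta> = \<kappa> / 2"
  proof -
    show "0 < \<eta>" using \<kappa> by (simp add: \<eta>_def)
    show e: "real (Suc n) * \<eta> = \<kappa> / 2" by (simp add: \<eta>_def del: of_nat_Suc)
    show "\<eta> < 1 / real (Suc n)" using e \<kappa>1 by (simp add: pos_less_divide_eq mult.commute del: of_nat_Suc)
  qed
  show ?thesis
  proof (intro exI[of _ \<eta>] conjI allI impI)
    show "0 < \<eta>" by (rule \<eta>(1))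
    fix v :: 'u and D :: "'u with_death set"
    assume v: "norm v < \<eta>" and D: "D \<in> sets borel"
    have "real (Suc n) * norm v \<le> real (Suc n) * \<eta>" using v by (intro mult_left_mono) auto
    then have Cv: "real (Suc n) * norm v \<le> \<kappa> / 2" by (simp only: \<eta>(3))
    have Cv': "real (Suc n) * norm v \<le> 1 / 2" using Cv \<kappa>1 by linarith
    from flow_law_le[OF t \<kappa>(2) less_imp_le[OF \<kappa>(3)] less_trans[OF v \<eta>(2)] Cv Cv' D, of u\<^sub>0] n \<kappa>(1)
    show "measure Q {\<omega>. \<Phi> 0 1 (Alive u\<^sub>0) (\<Xi> \<omega>) \<in> D} \<le> measure Q {\<omega>. \<Phi> 0 1 (Alive (u\<^sub>0 + v)) (\<Xi> \<omega>) \<in> D} + \<epsilon>"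
      by linarith
  qed
qed

text \<open>
  The estimate for sets is uniform, so it passes to functions rescaled to take values in \<open>[0, 1]\<close>. One
  inequality suffices, since it can be applied to \<open>\<Psi>\<close> and to \<open>- \<Psi>\<close>.
\<close>

lemma markov_operator_semicontinuous:
  assumes \<Psi>: "\<Psi> \<in> borel_measurable borel" and M: "0 < M" "\<And>z. \<bar>\<Psi> z\<bar> \<le> M" and \<epsilon>: "0 < \<epsilon>"
  shows "\<exists>\<eta>>0. \<forall>v. norm v < \<eta> \<longrightarrow>
    markov_operator P \<Xi> \<Phi> \<Psi> (Alive u\<^sub>0) \<le> markov_operator P \<Xi> \<Phi> \<Psi> (Alive (u\<^sub>0 + v)) + \<epsilon>"
proof -
  have "0 < \<epsilon> / (2 * M)" using \<epsilon> M by simp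
  from flow_law_semicontinuous[OF this, of u\<^sub>0]
  obtain \<eta> where \<eta>: "0 < \<eta>" "\<forall>v D. norm v < \<eta> \<longrightarrow> D \<in> sets borel \<longrightarrow>
    measure Q {\<omega>. \<Phi> 0 1 (Alive u\<^sub>0) (\<Xi> \<omega>) \<in> D} \<le> measure Q {\<omega>. \<Phi> 0 1 (Alive (u\<^sub>0 + v)) (\<Xi> \<omega>) \<in> D} + \<epsilon> / (2 * M)"
    by (elim exE conjE)
  define f where "f u \<omega> = (\<Psi> (\<Phi> 0 1 (Alive u) (\<Xi> \<omega>)) + M) / (2 * M)" for u \<omega>
  have m: "(\<lambda>\<omega>. \<Psi> (\<Phi> 0 1 (Alive u) (\<Xi> \<omega>))) \<in> borel_measurable Q" for u
    by (rule measurable_compose[OF measurable_compose[OF \<Xi>_measurable flow_measurable] \<Psi>])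
  have fm: "f u \<in> borel_measurable Q" for u unfolding f_def[abs_def] using m[of u] by measurable
  have f01: "0 \<le> f u \<omega>" "f u \<omega> \<le> 1" for u \<omega>
    using M(1) M(2)[of "\<Phi> 0 1 (Alive u) (\<Xi> \<omega>)"] by (auto simp: f_def field_simps abs_le_iff)
  have int: "integrable Q (\<lambda>\<omega>. \<Psi> (\<Phi> 0 1 (Alive u) (\<Xi> \<omega>)))" for u
    using M m by (intro integrable_const_bound[where B=M] AE_I2) auto
  have ef: "(\<integral>\<omega>. f u \<omega> \<partial>Q) = (markov_operator P \<Xi> \<Phi> \<Psi> (Alive u) + M) / (2 * M)" for u
    unfolding f_def markov_operator_def using int[of u] by (simp add: prob_space)
  show ?thesis
  proof (intro exI[of _ \<eta>] conjI allI impI)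
    show "0 < \<eta>" by (rule \<eta>(1))
    fix v :: 'u assume v: "norm v < \<eta>"
    have tails: "measure Q {\<omega> \<in> space Q. a \<le> f u\<^sub>0 \<omega>} \<le> measure Q {\<omega> \<in> space Q. a \<le> f (u\<^sub>0 + v) \<omega>} + \<epsilon> / (2 * M)" for a
    proof -
      have "{z. a \<le> (\<Psi> z + M) / (2 * M)} \<in> sets borel" using \<Psi> by measurable
      from \<eta>(2)[rule_format, OF v this] show ?thesis by (simp add: f_def)
    qed
    have "integral\<^sup>L Q (f u\<^sub>0) \<le> integral\<^sup>L Q (f (u\<^sub>0 + v)) + \<epsilon> / (2 * M)"
      by (rule expectation_le_of_tails[OF fm fm f01 f01 tails])
    then have "(markov_operator P \<Xi> \<Phi> \<Psi> (Alive u\<^sub>0) + M) / (2 * M)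
        \<le> (markov_operator P \<Xi> \<Phi> \<Psi> (Alive (u\<^sub>0 + v)) + M + \<epsilon>) / (2 * M)"
      by (simp only: ef add_divide_distrib)
    then show "markov_operator P \<Xi> \<Phi> \<Psi> (Alive u\<^sub>0) \<le> markov_operator P \<Xi> \<Phi> \<Psi> (Alive (u\<^sub>0 + v)) + \<epsilon>"
      using M(1) by (simp add: divide_le_cancel)
  qed
qed

lemma strong_feller:
  assumes \<Psi>: "\<Psi> \<in> borel_measurable borel" "bounded (range \<Psi>)"
  shows "continuous_on UNIV (markov_operator P \<Xi> \<Phi> \<Psi>)"
  unfolding continuous_on_iff
proof (intro ballI allI impI)
  fix z :: "'u with_death" and \<epsilon> :: real assume \<epsilon>: "0 < \<epsilon>"
  have alive_far: "1 \<le> dist (Alive u) (Dead :: 'u with_death)" for u :: 'u by simp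
  show "\<exists>d>0. \<forall>z'\<in>UNIV. dist z' z < d \<longrightarrow> dist (markov_operator P \<Xi> \<Phi> \<Psi> z') (markov_operator P \<Xi> \<Phi> \<Psi> z) < \<epsilon>"
  proof (cases z)
    case Dead
    have iso: "z' = z" if "dist z' z < 1" for z'
      using that alive_far Dead by (cases z') (auto simp: not_less)
    show ?thesis
    proof (intro exI[of _ 1] conjI ballI impI)
      fix z' assume "dist z' z < 1"
      then have "z' = z" by (rule iso)
      then show "dist (markov_operator P \<Xi> \<Phi> \<Psi> z') (markov_operator P \<Xi> \<Phi> \<Psi> z) < \<epsilon>" using \<epsilon> by simp
    qed simp
  next
    case (Alive u\<^sub>0)
    obtain M where M: "0 < M" "\<And>z. \<bar>\<Psi> z\<bar> \<le> M"
      using \<Psi>(2) unfolding bounded_pos by auto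
    have M': "\<bar>- \<Psi> z\<bar> \<le> M" for z using M(2)[of z] by simp
    have \<Psi>': "(\<lambda>z. - \<Psi> z) \<in> borel_measurable borel" using \<Psi>(1) by measurable
    have neg: "markov_operator P \<Xi> \<Phi> (\<lambda>z. - \<Psi> z) y = - markov_operator P \<Xi> \<Phi> \<Psi> y" for y
      by (simp add: markov_operator_def)
    have \<epsilon>2: "0 < \<epsilon> / 2" using \<epsilon> by simp
    from markov_operator_semicontinuous[OF \<Psi>(1) M \<epsilon>2, of u\<^sub>0]
    obtain \<eta>1 where 1: "0 < \<eta>1" "\<forall>v. norm v < \<eta>1 \<longrightarrow>
        markov_operator P \<Xi> \<Phi> \<Psi> (Alive u\<^sub>0) \<le> markov_operator P \<Xi> \<Phi> \<Psi> (Alive (u\<^sub>0 + v)) + \<epsilon> / 2"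
      by (elim exE conjE)
    from markov_operator_semicontinuous[OF \<Psi>' M(1) M' \<epsilon>2, of u\<^sub>0]
    obtain \<eta>2 where 2: "0 < \<eta>2" "\<forall>v. norm v < \<eta>2 \<longrightarrow>
        markov_operator P \<Xi> \<Phi> (\<lambda>z. - \<Psi> z) (Alive u\<^sub>0) \<le> markov_operator P \<Xi> \<Phi> (\<lambda>z. - \<Psi> z) (Alive (u\<^sub>0 + v)) + \<epsilon> / 2"
      by (elim exE conjE)
    show ?thesis
    proof (intro exI[of _ "min 1 (min \<eta>1 \<eta>2)"] conjI ballI impI)
      show "0 < min 1 (min \<eta>1 \<eta>2)" using 1 2 by simp
      fix z' assume d: "dist z' z < min 1 (min \<eta>1 \<eta>2)"
      then obtain u where u: "z' = Alive u"
        using alive_far[of u\<^sub>0] Alive by (cases z') (auto simp: dist_commute)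
      define v where "v = u - u\<^sub>0"
      have "norm v < \<eta>1" "norm v < \<eta>2" "u = u\<^sub>0 + v" using d u Alive by (auto simp: v_def)
      with 1(2)[rule_format, of v] 2(2)[rule_format, of v]
      show "dist (markov_operator P \<Xi> \<Phi> \<Psi> z') (markov_operator P \<Xi> \<Phi> \<Psi> z) < \<epsilon>"
        using u Alive \<epsilon> by (simp add: neg dist_real_def abs_le_iff)
    qed
  qed
qed

end

theorem theorem3p2:
  fixes P :: "'w::{banach,second_countable_topology} measure"
    and inc :: "(real \<Rightarrow> 'h::{real_inner,banach,second_countable_topology}) \<Rightarrow> 'w"
    and j :: "'x::{banach,second_countable_topology} \<Rightarrow> 'h"
    and p :: real
    and rep :: "'e::{banach,second_countable_topology} \<Rightarrow> real \<Rightarrow> 'x"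
    and \<Xi> :: "'w \<Rightarrow> 'm::polish_space"
    and \<Phi> :: "real \<Rightarrow> real \<Rightarrow> 'u::{banach,second_countable_topology} with_death \<Rightarrow> 'm \<Rightarrow> 'u with_death"
    and r :: "real \<Rightarrow> 'u \<Rightarrow> 'm \<Rightarrow> ennreal"
    and \<tau> :: "'e \<Rightarrow> 'm \<Rightarrow> 'm"
    and A :: "real \<Rightarrow> real \<Rightarrow> 'u \<Rightarrow> 'm \<Rightarrow> 'u \<Rightarrow>\<^sub>L 'e"
  assumes "abstract_flow_system P inc j p rep \<Xi> \<Phi> r \<tau> A"
  shows "\<forall>\<Psi> :: 'u with_death \<Rightarrow> real. \<Psi> \<in> borel_measurable borel \<and> bounded (range \<Psi>) \<longrightarrow>
           continuous_on UNIV (markov_operator P \<Xi> \<Phi> \<Psi>)"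
proof (intro allI impI)
  interpret abstract_flow_system P inc j p rep \<Xi> \<Phi> r \<tau> A by (rule assms)
  fix \<Psi> :: "'u with_death \<Rightarrow> real"
  assume "\<Psi> \<in> borel_measurable borel \<and> bounded (range \<Psi>)"
  then show "continuous_on UNIV (markov_operator P \<Xi> \<Phi> \<Psi>)" by (intro strong_feller) auto
qed

end
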